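(* Let $G$ be a connected and compact metric graph. For every edge $\mathsf e\in E(G)$ let $1<p_{\mathsf e}<\infty$ and let $\gamma_{\mathsf e}:\mathbb R\to\mathbb R$ be a continuous and strictly increasing function with $\gamma_{\mathsf e}(\mathbb R)=\mathbb R$ and $\gamma_{\mathsf e}(0)=0$. Let $f\in L^1_{loc}([0,+\infty);L^1(G))$ and $\omega\in L^1_{loc}([0,+\infty);L^1(V(G)))$. Then, for every $v_0\in L^1(G)$ and every $T>0$, there exists a unique mild solution on $[0,T]$ of the abstract Cauchy problem in $X=L^1(G)\times L^1(V(G))$ $$W'(t)+\mathcal A(W(t))\ni(f(t),\omega(t)),\quad t\in(0,T),\qquad W(0)=(v_0,0).$$
   Context: A compact metric graph $G$ has finite vertex set $V(G)$ and finite edge set $E(G)$; each edge $\mathsf e$ is identified with an ordered pair $(\mathsf i_{\mathsf e},\mathsf f_{\mathsf e})$ of vertices (initial, terminal), has a length $\ell_{\mathsf e}\in(0,\infty)$, and is parametrized by $[0,\ell_{\mathsf e}]$ with $\mathsf i_{\mathsf e}$ corresponding to $0$ and $\mathsf f_{\mathsf e}$ to $\ell_{\mathsf e}$. Standing assumption: there are no loops and no two different edges joining the same two vertices. A function $u$ on $G$ is a collection of functions $[u]_{\mathsf e}$ on $(0,\ell_{\mathsf e})$; $\int_G u\,dx:=\sum_{\mathsf e}\int_0^{\ell_{\mathsf e}}[u]_{\mathsf e}\,dx$; $L^1(G)$ is the set of $u$ with all $[u]_{\mathsf e}\in L^1(0,\ell_{\mathsf e})$, with norm $\int_G|u|$.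 $L^1(V(G))$ is the space of functions $V(G)\to\mathbb R$ with the norm $\sum_{\mathsf v}|\omega_{\mathsf v}|$, where $\omega_{\mathsf v}=\omega(\mathsf v)$. $X$ carries the sum of the two norms. $L^1_{loc}([0,+\infty);Y)$ is the set of $h:(0,\infty)\to Y$ with $h\in L^1(0,T;Y)$ for all $T>0$. For $\overline p=(p_{\mathsf e})$, $\mathcal W^{1,\overline p}(G)$ is the space of functions $u$ on $G$ with $[u]_{\mathsf e}\in W^{1,p_{\mathsf e}}(0,\ell_{\mathsf e})$ for all $\mathsf e$ (taken continuous on $[0,\ell_{\mathsf e}]$) whose endpoint values agree at each vertex $\mathsf v$ for all edges incident to $\mathsf v$; the common value is $u(\mathsf v)$. Write $v=\overline\gamma(u)$ if $[v]_{\mathsf e}=\gamma_{\mathsf e}([u]_{\mathsf e})$ for all $\mathsf e$. The operator $\mathcal A\subset X\times X$: $((v,0),(\tilde v,\omega))\in\mathcal A$ iff there exists $u\in\mathcal W^{1,\overline p}(G)$ with $v=\overline\gamma(u)$ a.e. in $G$ and $$\sum_{\mathsf e\in E(G)}\int_0^{\ell_{\mathsf e}}|[u]_{\mathsf e}'|^{p_{\mathsf e}-2}[u]_{\mathsf e}'[\varphi]_{\mathsf e}'\,dx=\int_G\tilde v\varphi\,dx+\sum_{\mathsf v\in V(G)}\omega_{\mathsf v}\varphi(\mathsf v)\quad\forall\varphi\in\mathcal W^{1,\overline p}(G)$$ (elements of the domain have second component $0$). Mild solution: for an operator $A$ on a Banach space $X$, $F\in L^1(0,T;X)$ and $W_0\in\overline{D(A)}$,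 a function $W\in C([0,T];X)$ is a mild solution of $W'+A(W)\ni F$, $W(0)=W_0$, on $[0,T]$ if $W(0)=W_0$ and for every $\epsilon>0$ there are a partition $0=t_0<t_1<\dots<t_N=T$, elements $F_1,\dots,F_N\in X$ and $W_1,\dots,W_N\in X$ with $t_i-t_{i-1}<\epsilon$ for all $i$, $\sum_{i=1}^N\int_{t_{i-1}}^{t_i}\|F(t)-F_i\|\,dt<\epsilon$, $\frac{W_i-W_{i-1}}{t_i-t_{i-1}}+A W_i\ni F_i$ for $i=1,\dots,N$, and $\sup_{t\in[0,T]}\|W(t)-W_\epsilon(t)\|<\epsilon$, where $W_\epsilon(0)=W_0$ and $W_\epsilon(t)=W_i$ for $t\in(t_{i-1},t_i]$. *)

theory Defs
  imports "HOL-Analysis.Analysis"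
begin

section \<open>Separable metric spaces are second countable\<close>

lemma countable_dense_imp_second_countable:
  fixes D :: "'a::metric_space set"
  assumes "countable D" and dense: "\<And>x e. e > 0 \<Longrightarrow> \<exists>d\<in>D. dist d x < e"
  shows "\<exists>B::'a set set. countable B \<and> open = generate_topology B"
proof -
  let ?B = "(\<lambda>(d, n). ball d (1 / real (Suc n))) ` (D \<times> UNIV)"
  have "topological_basis ?B"
  proof (rule topological_basisI)
    show "open b" if "b \<in> ?B" for b using that by auto
    fix U and x :: 'a assume "open U" "x \<in> U"
    then obtain e where e: "e > 0" "ball x e \<subseteq> U" by (meson openE)
    obtain n where n: "1 / real (Suc n) < e / 2"
      using nat_approx_posE[of "e / 2"] e(1) by auto
    obtain d where d: "d \<in> D" "dist d x < 1 / real (Suc n)"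
      using dense[of "1 / real (Suc n)" x] by auto
    have "ball d (1 / real (Suc n)) \<subseteq> ball x e"
    proof
      fix y assume "y \<in> ball d (1 / real (Suc n))"
      then have "dist d y < 1 / real (Suc n)" by simp
      then show "y \<in> ball x e"
        using d(2) n dist_triangle[of x y d] by (simp add: dist_commute)
    qed
    then show "\<exists>b\<in>?B. x \<in> b \<and> b \<subseteq> U"
      using d e(2) by (intro bexI[of _ "ball d (1 / real (Suc n))"]) auto
  qed
  moreover have "countable ?B" using assms(1) by simp
  ultimately show ?thesis using topological_basis_imp_subbasis by blast
qed


section \<open>The Banach space of integrable functions on the real line modulo equality almost everywhere\<close>

quotient_type L1R = "real \<Rightarrow> real" /
  partial: "\<lambda>f g. integrable lborel f \<and> integrable lborel g \<and> (AE x in lborel. f x = g x)"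
proof (rule part_equivpI)
  show "\<exists>f. integrable lborel f \<and> integrable lborel f \<and> (AE x in lborel. f x = (f x :: real))"
    by (intro exI[of _ "\<lambda>_. 0"]) simp
qed (auto simp: symp_def transp_def elim: eventually_mono eventually_elim2)

lemma integrable_rep_L1R [simp]: "integrable lborel (rep_L1R u)"
  using Quotient3_rep_reflp[OF Quotient3_L1R] by blast

lemma rep_abs_L1R: "integrable lborel f \<Longrightarrow> AE x in lborel. rep_L1R (abs_L1R f) x = f x"
  using Quotient3_rep_abs[OF Quotient3_L1R, of f] by simp

lemma abs_rep_L1R [simp]: "abs_L1R (rep_L1R u) = u"
  by (rule Quotient3_abs_rep[OF Quotient3_L1R])

lemma abs_L1R_eqI:
  "integrable lborel f \<Longrightarrow> integrable lborel g \<Longrightarrow> AE x in lborel. f x = g x \<Longrightarrow> abs_L1R f = abs_L1R g"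
  using Quotient3_rel_abs[OF Quotient3_L1R] by blast

instantiation L1R :: real_normed_vector
begin

lift_definition zero_L1R :: L1R is "\<lambda>_. 0" by simp
lift_definition uminus_L1R :: "L1R \<Rightarrow> L1R" is "\<lambda>f x. - f x" by (auto elim: eventually_mono)
lift_definition plus_L1R :: "L1R \<Rightarrow> L1R \<Rightarrow> L1R" is "\<lambda>f g x. f x + g x"
  by (auto elim: eventually_elim2)
lift_definition minus_L1R :: "L1R \<Rightarrow> L1R \<Rightarrow> L1R" is "\<lambda>f g x. f x - g x"
  by (auto elim: eventually_elim2)
lift_definition scaleR_L1R :: "real \<Rightarrow> L1R \<Rightarrow> L1R" is "\<lambda>c f x. c * f x"
  by (auto elim: eventually_mono)
lift_definition norm_L1R :: "L1R \<Rightarrow> real" is "\<lambda>f. LBINT x. \<bar>f x\<bar>"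
  by (rule integral_cong_AE) (auto elim: eventually_mono)

definition dist_L1R :: "L1R \<Rightarrow> L1R \<Rightarrow> real" where "dist_L1R u v = norm (u - v)"
definition sgn_L1R :: "L1R \<Rightarrow> L1R" where "sgn_L1R u = scaleR (inverse (norm u)) u"
definition uniformity_L1R :: "(L1R \<times> L1R) filter" where
  "uniformity_L1R = (INF e\<in>{0<..}. principal {(x, y). dist x y < e})"
definition open_L1R :: "L1R set \<Rightarrow> bool" where
  "open_L1R U = (\<forall>x\<in>U. \<forall>\<^sub>F (x', y) in uniformity. x' = x \<longrightarrow> y \<in> U)"

instance
proof
  fix a b c :: L1R and r s :: real
  show "a + b + c = a + (b + c)" by transfer (auto simp: add.assoc)
  show "a + b = b + a" by transfer (auto simp: add.commute)
  show "0 + a = a" by transfer auto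
  show "- a + a = 0" by transfer auto
  show "a - b = a + - b" by transfer auto
  show "r *\<^sub>R (a + b) = r *\<^sub>R a + r *\<^sub>R b" by transfer (auto simp: algebra_simps)
  show "(r + s) *\<^sub>R a = r *\<^sub>R a + s *\<^sub>R a" by transfer (auto simp: algebra_simps)
  show "r *\<^sub>R s *\<^sub>R a = (r * s) *\<^sub>R a" by transfer (auto simp: mult.assoc)
  show "1 *\<^sub>R a = a" by transfer auto
  show "dist a b = norm (a - b)" by (rule dist_L1R_def)
  show "sgn a = scaleR (inverse (norm a)) a" by (rule sgn_L1R_def)
  show "uniformity = (INF e\<in>{0<..}. principal {(x, y :: L1R). dist x y < e})"
    by (rule uniformity_L1R_def)
  show "open U = (\<forall>x\<in>U. \<forall>\<^sub>F (x', y) in uniformity. x' = x \<longrightarrow> y \<in> U)" for U :: "L1R set"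
    by (rule open_L1R_def)
  show "(norm a = 0) = (a = 0)"
  proof (transfer, goal_cases)
    case (1 f)
    then show ?case by (subst integral_nonneg_eq_0_iff_AE) auto
  qed
  show "norm (a + b) \<le> norm a + norm b"
  proof (transfer, goal_cases)
    case (1 f g)
    then have "(LBINT x. \<bar>f x + g x\<bar>) \<le> (LBINT x. \<bar>f x\<bar> + \<bar>g x\<bar>)"
      by (intro integral_mono) auto
    with 1 show ?case by simp
  qed
  show "norm (r *\<^sub>R a) = \<bar>r\<bar> * norm a" by transfer (simp add: abs_mult)
qed

end

lemma norm_rep_L1R: "norm u = (LBINT x. \<bar>rep_L1R u x\<bar>)"
  unfolding norm_L1R_def by simp

lemma dist_abs_L1R:
  assumes "integrable lborel f" "integrable lborel g"
  shows "dist (abs_L1R f) (abs_L1R g) = (LBINT x. \<bar>f x - g x\<bar>)"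
proof -
  have "abs_L1R f - abs_L1R g = abs_L1R (\<lambda>x. f x - g x)"
    using assms by (intro minus_L1R.abs_eq) auto
  then show ?thesis
    using assms by (simp add: dist_norm norm_L1R.abs_eq)
qed

lemma tendsto_abs_L1R:
  fixes w :: "real \<Rightarrow> real"
  assumes "\<And>i. integrable lborel (s i)" "integrable lborel f" "integrable lborel w"
    and "AE x in lborel. (\<lambda>i. s i x) \<longlonglongrightarrow> f x" and "\<And>i. AE x in lborel. \<bar>s i x\<bar> \<le> w x"
  shows "(\<lambda>i. abs_L1R (s i)) \<longlonglongrightarrow> abs_L1R f"
proof -
  have "(\<lambda>i. LBINT x. \<bar>s i x - f x\<bar>) \<longlonglongrightarrow> (LBINT x::real. 0)"
  proof (rule integral_dominated_convergence[where w = "\<lambda>x. w x + \<bar>f x\<bar>"])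
    show "AE x in lborel. (\<lambda>i. \<bar>s i x - f x\<bar>) \<longlonglongrightarrow> 0"
      using assms(4) by eventually_elim (simp add: tendsto_rabs_zero_iff LIM_zero)
    show "AE x in lborel. norm \<bar>s i x - f x\<bar> \<le> w x + \<bar>f x\<bar>" for i
      using assms(5)[of i] by eventually_elim auto
  qed (use assms in auto)
  then show ?thesis
    using assms by (simp add: tendsto_dist_iff[of _ "abs_L1R f"] dist_abs_L1R)
qed

instance L1R :: banach
proof
  fix X :: "nat \<Rightarrow> L1R" assume X: "Cauchy X"
  have "\<exists>N. \<forall>m\<ge>N. \<forall>n\<ge>N. norm (X m - X n) < (1/2) ^ k" for k :: nat
    using CauchyD[OF X, of "(1/2) ^ k"] by auto
  then obtain N where N: "\<And>k m n. m \<ge> N k \<Longrightarrow> n \<ge> N k \<Longrightarrow> norm (X m - X n) < (1/2) ^ k"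
    by metis
  define r where "r k = (\<Sum>i\<le>k. Suc (N i))" for k
  have r: "strict_mono r" by (rule strict_mono_Suc_iff[THEN iffD2]) (simp add: r_def)
  have rN: "N k \<le> r k" for k
  proof -
    have "Suc (N k) \<le> r k" unfolding r_def by (rule member_le_sum) auto
    then show ?thesis by simp
  qed
  define d where "d k = rep_L1R (X (r (Suc k)) - X (r k))" for k
  have d_int [measurable, simp]: "integrable lborel (d k)" for k by (simp add: d_def)
  have d_norm: "(LBINT x. \<bar>d k x\<bar>) < (1/2) ^ k" for k
    using N[OF order_trans[OF rN[of k]] rN[of k], of "r (Suc k)"] strict_monoD[OF r, of k "Suc k"]
    by (simp add: d_def norm_rep_L1R)
  have sm: "summable (\<lambda>k. LBINT x. \<bar>d k x\<bar>)"
    by (rule summable_comparison_test'[OF summable_geometric[of "1/2"]])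
      (use d_norm in \<open>auto intro: less_imp_le\<close>)
  have AE_sm: "AE x in lborel. summable (\<lambda>k. norm (d k x))"
  proof -
    have "(\<integral>\<^sup>+x. (\<Sum>k. ennreal (norm (d k x))) \<partial>lborel) = (\<Sum>k. \<integral>\<^sup>+x. ennreal (norm (d k x)) \<partial>lborel)"
      by (rule nn_integral_suminf) measurable
    also have "\<dots> = (\<Sum>k. ennreal (LBINT x. \<bar>d k x\<bar>))"
      by (simp add: nn_integral_eq_integral)
    also have "\<dots> \<noteq> \<infinity>" using sm by (simp add: ennreal_suminf_neq_top)
    finally have "AE x in lborel. (\<Sum>k. ennreal (norm (d k x))) \<noteq> \<infinity>"
      by (intro nn_integral_PInf_AE) auto
    then show ?thesis by eventually_elim (rule summable_suminf_not_top, auto)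
  qed
  define g where "g x = (\<Sum>k. d k x)" for x
  define w where "w x = (\<Sum>k. \<bar>d k x\<bar>)" for x
  have g_int: "integrable lborel g"
    unfolding g_def by (rule integrable_suminf) (use AE_sm sm in auto)
  have w_int: "integrable lborel w"
    unfolding w_def by (rule integrable_suminf) (use AE_sm sm in auto)
  have "(\<lambda>n. abs_L1R (\<lambda>x. \<Sum>k<n. d k x)) \<longlonglongrightarrow> abs_L1R g"
  proof (rule tendsto_abs_L1R[OF _ g_int w_int])
    show "AE x in lborel. (\<lambda>i. \<Sum>k<i. d k x) \<longlonglongrightarrow> g x"
      using AE_sm unfolding g_def
      by eventually_elim (rule summable_LIMSEQ[OF summable_norm_cancel])
    show "AE x in lborel. \<bar>\<Sum>k<i. d k x\<bar> \<le> w x" for i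
      using AE_sm
    proof eventually_elim
      case (elim x)
      have "\<bar>\<Sum>k<i. d k x\<bar> \<le> (\<Sum>k<i. \<bar>d k x\<bar>)" by (rule sum_abs)
      also have "\<dots> \<le> w x" unfolding w_def using elim by (intro sum_le_suminf) auto
      finally show ?case .
    qed
  qed simp
  moreover have "abs_L1R (\<lambda>x. \<Sum>k<n. d k x) = X (r n) - X (r 0)" for n
  proof (induction n)
    case 0
    show ?case by (simp add: zero_L1R_def)
  next
    case (Suc n)
    have "abs_L1R (\<lambda>x. \<Sum>k<Suc n. d k x) = abs_L1R (\<lambda>x. \<Sum>k<n. d k x) + abs_L1R (d n)"
      by (subst plus_L1R.abs_eq) auto
    also have "abs_L1R (d n) = X (r (Suc n)) - X (r n)" by (simp add: d_def)
    finally show ?case using Suc by simp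
  qed
  ultimately have "(\<lambda>n. X (r n) - X (r 0) + X (r 0)) \<longlonglongrightarrow> abs_L1R g + X (r 0)"
    by (intro tendsto_add) auto
  then have "(X \<circ> r) \<longlonglongrightarrow> abs_L1R g + X (r 0)" by (simp add: o_def)
  then show "convergent X"
    using Cauchy_converges_subseq[OF X r] by (auto simp: convergent_def)
qed

definition step_L1R :: "(rat \<times> rat \<times> rat) list \<Rightarrow> real \<Rightarrow> real" where
  "step_L1R cs x = (\<Sum>(q, a, b)\<leftarrow>cs. of_rat q * indicator {of_rat a..of_rat b} x)"

lemma step_L1R_simps [simp]:
  "step_L1R [] x = 0"
  "step_L1R ((q, a, b) # cs) x = of_rat q * indicator {of_rat a..of_rat b} x + step_L1R cs x"
  "step_L1R (cs @ ds) x = step_L1R cs x + step_L1R ds x"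
  by (simp_all add: step_L1R_def)

lemma integrable_step_L1R [simp]: "integrable lborel (step_L1R cs)"
proof (induction cs)
  case Nil
  then show ?case by (simp add: step_L1R_def)
next
  case (Cons c cs)
  obtain q a b where c: "c = (q, a, b)" by (cases c)
  have "step_L1R (c # cs) = (\<lambda>x. of_rat q * indicator {of_rat a..of_rat b} x + step_L1R cs x)"
    by (auto simp: c)
  then show ?case
    using Cons
    by (auto intro!: Bochner_Integration.integrable_add integrable_mult_right integrable_real_indicator
        simp: emeasure_lborel_Icc_eq)
qed

lemma plus_abs_L1R:
  "integrable lborel f \<Longrightarrow> integrable lborel g \<Longrightarrow>
    abs_L1R f + abs_L1R g = abs_L1R (\<lambda>x. f x + g x)"
  by (rule plus_L1R.abs_eq) auto

lemma rat_approx_above: "\<exists>q. \<forall>k::nat. (c::real) < of_rat (q k) \<and> of_rat (q k) < c + 1 / real (Suc k)"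
  by (rule choice, rule allI, rule of_rat_dense) simp

lemma rat_approx_below: "\<exists>q. \<forall>k::nat. (c::real) - 1 / real (Suc k) < of_rat (q k) \<and> of_rat (q k) < c"
  by (rule choice, rule allI, rule of_rat_dense) simp

lemma step_L1R_dense:
  fixes f :: "real \<Rightarrow> real"
  assumes "integrable lborel f"
  shows "abs_L1R f \<in> closure (range (\<lambda>cs. abs_L1R (step_L1R cs)))" (is "_ \<in> ?C")
proof -
  have C_lim: "l \<in> ?C" if "\<And>i. y i \<in> ?C" "y \<longlonglongrightarrow> l" for y l
    using closed_sequentially[OF closed_closure] that by blast
  have C_add: "u + v \<in> ?C" if uv: "u \<in> ?C" "v \<in> ?C" for u v
  proof -
    obtain a where a: "\<And>n::nat. a n \<in> range (\<lambda>cs. abs_L1R (step_L1R cs))" "a \<longlonglongrightarrow> u"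
      using uv(1)[unfolded closure_sequential] by blast
    obtain b where b: "\<And>n::nat. b n \<in> range (\<lambda>cs. abs_L1R (step_L1R cs))" "b \<longlonglongrightarrow> v"
      using uv(2)[unfolded closure_sequential] by blast
    have "a n + b n \<in> range (\<lambda>cs. abs_L1R (step_L1R cs))" for n
    proof -
      obtain cs ds where cd: "a n = abs_L1R (step_L1R cs)" "b n = abs_L1R (step_L1R ds)"
        using a(1) b(1) by blast
      have "a n + b n = abs_L1R (\<lambda>x. step_L1R cs x + step_L1R ds x)"
        unfolding cd by (rule plus_abs_L1R) simp_all
      also have "(\<lambda>x. step_L1R cs x + step_L1R ds x) = step_L1R (cs @ ds)" by auto
      finally show ?thesis by blast
    qed
    then show ?thesis
      using tendsto_add[OF a(2) b(2)] unfolding closure_sequential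
      by (intro exI[of _ "\<lambda>n. a n + b n"]) simp
  qed
  have int_Icc [simp]: "integrable lborel (\<lambda>x. c * indicator {a..b} x)" for a b c :: real
    by (intro integrable_mult_right integrable_real_indicator) (auto simp: emeasure_lborel_Icc_eq)
  have Icc_mem: "abs_L1R (\<lambda>x. c * indicator {a..b} x) \<in> ?C" for a b c
  proof -
    obtain q where q: "\<And>k::nat. c < of_rat (q k) \<and> of_rat (q k) < c + 1 / real (Suc k)"
      using rat_approx_above[of c] by blast
    obtain \<alpha> where \<alpha>: "\<And>k::nat. a - 1 / real (Suc k) < of_rat (\<alpha> k) \<and> of_rat (\<alpha> k) < a"
      using rat_approx_below[of a] by blast
    obtain \<beta> where \<beta>: "\<And>k::nat. b < of_rat (\<beta> k) \<and> of_rat (\<beta> k) < b + 1 / real (Suc k)"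
      using rat_approx_above[of b] by blast
    have inv: "(\<lambda>k. 1 / real (Suc k)) \<longlonglongrightarrow> 0" by (rule LIMSEQ_Suc[OF lim_1_over_n])
    have lq: "(\<lambda>k. of_rat (q k) :: real) \<longlonglongrightarrow> c"
      by (rule tendsto_sandwich[OF _ _ tendsto_const[of c] tendsto_add[OF tendsto_const[of c] inv, simplified]])
        (use q in \<open>auto intro!: always_eventually less_imp_le\<close>)
    have la: "(\<lambda>k. of_rat (\<alpha> k) :: real) \<longlonglongrightarrow> a"
      by (rule tendsto_sandwich[OF _ _ tendsto_diff[OF tendsto_const[of a] inv, simplified] tendsto_const[of a]])
        (use \<alpha> in \<open>auto intro!: always_eventually less_imp_le\<close>)
    have lb: "(\<lambda>k. of_rat (\<beta> k) :: real) \<longlonglongrightarrow> b"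
      by (rule tendsto_sandwich[OF _ _ tendsto_const[of b] tendsto_add[OF tendsto_const[of b] inv, simplified]])
        (use \<beta> in \<open>auto intro!: always_eventually less_imp_le\<close>)
    have ind: "(\<lambda>k. indicator {of_rat (\<alpha> k)..of_rat (\<beta> k)} x :: real) \<longlonglongrightarrow> indicator {a..b} x" for x
    proof (rule tendsto_eventually)
      consider "x < a" | "b < x" | "a \<le> x" "x \<le> b" by linarith
      then show "\<forall>\<^sub>F k in sequentially. indicator {of_rat (\<alpha> k)..of_rat (\<beta> k)} x = (indicator {a..b} x :: real)"
      proof cases
        case 1
        show ?thesis using order_tendstoD(1)[OF la 1] by eventually_elim (use 1 in auto)
      next
        case 2
        show ?thesis using order_tendstoD(2)[OF lb 2] by eventually_elim (use 2 in auto)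
      next
        case 3
        show ?thesis using \<alpha> \<beta> 3
          by (intro always_eventually allI) (auto simp: indicator_def dest: less_imp_le intro: order_trans)
      qed
    qed
    have "(\<lambda>k. abs_L1R (step_L1R [(q k, \<alpha> k, \<beta> k)])) \<longlonglongrightarrow> abs_L1R (\<lambda>x. c * indicator {a..b} x)"
    proof (rule tendsto_abs_L1R[where w = "\<lambda>x. (\<bar>c\<bar> + 1) * indicator {a - 1..b + 1} x"])
      show "AE x in lborel. (\<lambda>i. step_L1R [(q i, \<alpha> i, \<beta> i)] x) \<longlonglongrightarrow> c * indicator {a..b} x"
        using tendsto_mult[OF lq ind] by simp
      have "\<bar>step_L1R [(q i, \<alpha> i, \<beta> i)] x\<bar> \<le> (\<bar>c\<bar> + 1) * indicator {a - 1..b + 1} x" for i x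
      proof -
        have "1 / real (Suc i) \<le> 1" by simp
        then have "\<bar>of_rat (q i)\<bar> \<le> \<bar>c\<bar> + 1" "a - 1 \<le> of_rat (\<alpha> i)" "of_rat (\<beta> i) \<le> b + 1"
          using q[of i] \<alpha>[of i] \<beta>[of i] by linarith+
        then show ?thesis by (auto simp: indicator_def abs_mult)
      qed
      then show "AE x in lborel. \<bar>step_L1R [(q i, \<alpha> i, \<beta> i)] x\<bar> \<le> (\<bar>c\<bar> + 1) * indicator {a - 1..b + 1} x" for i
        by simp
    qed (simp_all only: int_Icc integrable_step_L1R)
    then show ?thesis
      by (rule C_lim[OF closure_subset[THEN subsetD, OF rangeI]])
  qed
  have int_Int: "integrable lborel (\<lambda>x. r * indicator (B \<inter> {- real n..real n}) x)"
    if "B \<in> sets borel" for r :: real and B n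
    using that by (intro integrable_mult_right integrable_real_indicator)
      (auto intro: le_less_trans[OF emeasure_mono[of _ "{- real n..real n}"]] simp: emeasure_lborel_Icc_eq)
  have bounded_set: "abs_L1R (\<lambda>x. c * indicator (A \<inter> {- real n..real n}) x) \<in> ?C"
    if "A \<in> sets borel" for A c n
    using that
  proof (induction arbitrary: c rule: borel_set_induct)
    case empty
    show ?case using Icc_mem[of 0 0 0] by simp
  next
    case (interval a b)
    show ?case using Icc_mem[of c "max a (- real n)" "min b (real n)"] by (simp add: Int_atLeastAtMost)
  next
    case (compl A)
    have "abs_L1R (\<lambda>x. c * indicator {- real n..real n} x + (- c) * indicator (A \<inter> {- real n..real n}) x) \<in> ?C"
      using C_add[OF Icc_mem[of c "- real n" "real n"] compl(2)[of "- c"]]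
      by (simp only: plus_abs_L1R int_Icc int_Int[OF compl(1)])
    also have "(\<lambda>x. c * indicator {- real n..real n} x + (- c) * indicator (A \<inter> {- real n..real n}) x)
        = (\<lambda>x. c * indicator (- A \<inter> {- real n..real n}) x)"
      by (auto simp: indicator_def)
    finally show ?case .
  next
    case (union F)
    have partial: "abs_L1R (\<lambda>x. \<Sum>i<k. c * indicator (F i \<inter> {- real n..real n}) x) \<in> ?C" for k
    proof (induction k)
      case 0
      show ?case using Icc_mem[of 0 0 0] by simp
    next
      case (Suc k)
      have "integrable lborel (\<lambda>x. \<Sum>i<k. c * indicator (F i \<inter> {- real n..real n}) x)"
        by (intro Bochner_Integration.integrable_sum int_Int union(2))
      then show ?case using C_add[OF Suc union(3)[of c k]]
        by (simp only: plus_abs_L1R int_Int union(2) sum.lessThan_Suc)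
    qed
    show ?case
    proof (rule C_lim[OF partial tendsto_abs_L1R[where w = "\<lambda>x. \<bar>c\<bar> * indicator {- real n..real n} x"]])
      have disj: "(F i \<inter> {- real n..real n}) \<inter> (F j \<inter> {- real n..real n}) = {}" if "i \<noteq> j" for i j
        using union(1) that by (auto simp: disjoint_family_on_def)
      have "(\<lambda>i. c * indicator (F i \<inter> {- real n..real n}) x) sums
          (c * indicator (\<Union>i. F i \<inter> {- real n..real n}) x)" for x
        by (intro sums_mult indicator_sums disj)
      moreover have "(\<Union>i. F i \<inter> {- real n..real n}) = (\<Union>i. F i) \<inter> {- real n..real n}" by blast
      ultimately have "(\<lambda>i. c * indicator (F i \<inter> {- real n..real n}) x) sums
          (c * indicator ((\<Union>i. F i) \<inter> {- real n..real n}) x)" for x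
        by simp
      then show "AE x in lborel. (\<lambda>k. \<Sum>i<k. c * indicator (F i \<inter> {- real n..real n}) x)
          \<longlonglongrightarrow> c * indicator ((\<Union>i. F i) \<inter> {- real n..real n}) x"
        by (simp add: sums_def)
      have "\<bar>\<Sum>i<k. c * indicator (F i \<inter> {- real n..real n}) x\<bar> \<le> \<bar>c\<bar> * indicator {- real n..real n} x" for k x
      proof -
        have "(\<Sum>i<k. indicator (F i \<inter> {- real n..real n}) x) = (indicator (\<Union>i<k. F i \<inter> {- real n..real n}) x :: real)"
          using disj by (intro indicator_UN_disjoint[symmetric]) (auto simp: disjoint_family_on_def)
        then show ?thesis
          by (simp add: sum_distrib_left[symmetric] abs_mult) (auto simp: indicator_def)
      qed
      then show "AE x in lborel. \<bar>\<Sum>i<k. c * indicator (F i \<inter> {- real n..real n}) x\<bar>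
          \<le> \<bar>c\<bar> * indicator {- real n..real n} x" for k
        by simp
      show "integrable lborel (\<lambda>x. \<Sum>i<k. c * indicator (F i \<inter> {- real n..real n}) x)" for k
        by (intro Bochner_Integration.integrable_sum int_Int union(2))
      show "integrable lborel (\<lambda>x. c * indicator ((\<Union>i. F i) \<inter> {- real n..real n}) x)"
        by (rule int_Int) (use union(2) in auto)
      show "integrable lborel (\<lambda>x. \<bar>c\<bar> * indicator {- real n..real n} x)"
        by (rule int_Icc)
    qed
  qed
  show ?thesis
    using assms
  proof (induction rule: integrable_induct)
    case (base A c)
    have A: "A \<in> sets borel" using base by simp
    have A_int: "integrable lborel (\<lambda>x. r * indicator (A \<inter> B) x)" if "B \<in> sets borel" for r :: real and B
      using base that by (intro integrable_mult_right integrable_real_indicator)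
        (auto intro: le_less_trans[OF emeasure_mono[of _ A]])
    have "(\<lambda>n. c * indicator (A \<inter> {- real n..real n}) x) \<longlonglongrightarrow> indicator A x *\<^sub>R c" for x :: real
    proof (rule tendsto_eventually)
      obtain n where n: "\<bar>x\<bar> \<le> real n" using real_arch_simple by blast
      show "\<forall>\<^sub>F n in sequentially. c * indicator (A \<inter> {- real n..real n}) x = indicator A x *\<^sub>R c"
        using eventually_ge_at_top[of n] by eventually_elim (use n in \<open>auto simp: indicator_def\<close>)
    qed
    moreover have "\<bar>c * indicator (A \<inter> {- real n..real n}) x\<bar> \<le> \<bar>c\<bar> * indicator A x" for n :: nat and x
      by (auto simp: indicator_def)
    ultimately have "(\<lambda>n. abs_L1R (\<lambda>x. c * indicator (A \<inter> {- real n..real n}) x))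
        \<longlonglongrightarrow> abs_L1R (\<lambda>x. indicator A x *\<^sub>R c)"
      using A_int[of "{- real n..real n}" for n] A_int[of UNIV c] A_int[of UNIV "\<bar>c\<bar>"]
      by (intro tendsto_abs_L1R[where w = "\<lambda>x. \<bar>c\<bar> * indicator A x"]) (simp_all add: mult.commute)
    then show ?case by (rule C_lim[OF bounded_set[OF A]])
  next
    case (add f g)
    then show ?case using C_add[of "abs_L1R f" "abs_L1R g"] by (simp add: plus_abs_L1R)
  next
    case (lim f s)
    have "(\<lambda>i. abs_L1R (s i)) \<longlonglongrightarrow> abs_L1R f"
      by (rule tendsto_abs_L1R[where w = "\<lambda>x. 2 * \<bar>f x\<bar>"]) (use lim in auto)
    then show ?case by (rule C_lim[rotated]) (rule lim.IH)
  qed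
qed

instance L1R :: second_countable_topology
proof
  show "\<exists>B::L1R set set. countable B \<and> open = generate_topology B"
  proof (rule countable_dense_imp_second_countable)
    show "countable (range (\<lambda>cs. abs_L1R (step_L1R cs)))" by simp
    fix u :: L1R and e :: real assume "e > 0"
    then show "\<exists>d\<in>range (\<lambda>cs. abs_L1R (step_L1R cs)). dist d u < e"
      using step_L1R_dense[OF integrable_rep_L1R[of u]] by (simp add: closure_approachable)
  qed
qed


section \<open>Finite families and pairs with the sum of the norms\<close>

text \<open>The library norms on \<open>'a ^ 'i\<close> and \<open>'a \<times> 'b\<close> are Euclidean combinations of the
  component norms; here the component norms are added.\<close>

typedef (overloaded) ('i, 'a) l1_family = "UNIV :: ('i \<Rightarrow> 'a) set"
  morphisms component Family by simp

setup_lifting type_definition_l1_family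

instantiation l1_family :: (finite, real_normed_vector) real_normed_vector
begin

lift_definition zero_l1_family :: "('a, 'b) l1_family" is "\<lambda>_. 0" .
lift_definition uminus_l1_family :: "('a, 'b) l1_family \<Rightarrow> ('a, 'b) l1_family" is "\<lambda>u i. - u i" .
lift_definition plus_l1_family :: "('a, 'b) l1_family \<Rightarrow> ('a, 'b) l1_family \<Rightarrow> ('a, 'b) l1_family"
  is "\<lambda>u v i. u i + v i" .
lift_definition minus_l1_family :: "('a, 'b) l1_family \<Rightarrow> ('a, 'b) l1_family \<Rightarrow> ('a, 'b) l1_family"
  is "\<lambda>u v i. u i - v i" .
lift_definition scaleR_l1_family :: "real \<Rightarrow> ('a, 'b) l1_family \<Rightarrow> ('a, 'b) l1_family"
  is "\<lambda>c u i. c *\<^sub>R u i" .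
lift_definition norm_l1_family :: "('a, 'b) l1_family \<Rightarrow> real" is "\<lambda>u. \<Sum>i\<in>UNIV. norm (u i)" .

definition dist_l1_family :: "('a, 'b) l1_family \<Rightarrow> ('a, 'b) l1_family \<Rightarrow> real" where
  "dist_l1_family u v = norm (u - v)"
definition sgn_l1_family :: "('a, 'b) l1_family \<Rightarrow> ('a, 'b) l1_family" where
  "sgn_l1_family u = scaleR (inverse (norm u)) u"
definition uniformity_l1_family :: "(('a, 'b) l1_family \<times> ('a, 'b) l1_family) filter" where
  "uniformity_l1_family = (INF e\<in>{0<..}. principal {(x, y). dist x y < e})"
definition open_l1_family :: "('a, 'b) l1_family set \<Rightarrow> bool" where
  "open_l1_family U = (\<forall>x\<in>U. \<forall>\<^sub>F (x', y) in uniformity. x' = x \<longrightarrow> y \<in> U)"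

instance
proof
  fix a b c :: "('a, 'b) l1_family" and r s :: real
  show "a + b + c = a + (b + c)" by transfer (auto simp: add.assoc)
  show "a + b = b + a" by transfer (auto simp: add.commute)
  show "0 + a = a" by transfer auto
  show "- a + a = 0" by transfer auto
  show "a - b = a + - b" by transfer auto
  show "r *\<^sub>R (a + b) = r *\<^sub>R a + r *\<^sub>R b" by transfer (auto simp: algebra_simps)
  show "(r + s) *\<^sub>R a = r *\<^sub>R a + s *\<^sub>R a" by transfer (auto simp: algebra_simps)
  show "r *\<^sub>R s *\<^sub>R a = (r * s) *\<^sub>R a" by transfer auto
  show "1 *\<^sub>R a = a" by transfer auto
  show "dist a b = norm (a - b)" by (rule dist_l1_family_def)
  show "sgn a = scaleR (inverse (norm a)) a" by (rule sgn_l1_family_def)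
  show "uniformity = (INF e\<in>{0<..}. principal {(x, y :: ('a, 'b) l1_family). dist x y < e})"
    by (rule uniformity_l1_family_def)
  show "open U = (\<forall>x\<in>U. \<forall>\<^sub>F (x', y) in uniformity. x' = x \<longrightarrow> y \<in> U)" for U :: "('a, 'b) l1_family set"
    by (rule open_l1_family_def)
  show "(norm a = 0) = (a = 0)" by transfer (auto simp: sum_nonneg_eq_0_iff)
  show "norm (a + b) \<le> norm a + norm b"
    by transfer (simp add: sum.distrib[symmetric] sum_mono norm_triangle_ineq)
  show "norm (r *\<^sub>R a) = \<bar>r\<bar> * norm a" by transfer (simp add: sum_distrib_left)
qed

end

lemma dist_l1_family: "dist u v = (\<Sum>i\<in>UNIV. dist (component u i) (component v i))"
  by (simp add: dist_norm norm_l1_family.rep_eq minus_l1_family.rep_eq)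

lemma component_Family [simp]: "component (Family f) = f"
  by (simp add: Family_inverse)

instance l1_family :: (finite, banach) banach
proof
  fix X :: "nat \<Rightarrow> ('a, 'b) l1_family" assume X: "Cauchy X"
  have "Cauchy (\<lambda>n. component (X n) i)" for i
  proof (rule metric_CauchyI)
    fix e :: real assume "e > 0"
    then obtain M where M: "\<And>m n. m \<ge> M \<Longrightarrow> n \<ge> M \<Longrightarrow> dist (X m) (X n) < e"
      using metric_CauchyD[OF X] by blast
    have "dist (component (X m) i) (component (X n) i) \<le> dist (X m) (X n)" for m n
      unfolding dist_l1_family by (rule member_le_sum) auto
    then show "\<exists>M. \<forall>m\<ge>M. \<forall>n\<ge>M. dist (component (X m) i) (component (X n) i) < e"
      using M by (meson le_less_trans)
  qed
  then have "\<exists>l. (\<lambda>n. component (X n) i) \<longlonglongrightarrow> l" for i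
    by (simp add: Cauchy_convergent_iff convergent_def)
  then obtain l where l: "\<And>i. (\<lambda>n. component (X n) i) \<longlonglongrightarrow> l i"
    by metis
  have "(\<lambda>n. dist (X n) (Family l)) \<longlonglongrightarrow> (\<Sum>i\<in>(UNIV::'a set). 0)"
    unfolding dist_l1_family component_Family
    by (intro tendsto_sum) (use l in \<open>simp add: tendsto_dist_iff[symmetric]\<close>)
  then have "X \<longlonglongrightarrow> Family l" by (simp add: tendsto_dist_iff[of X])
  then show "convergent X" by (auto simp: convergent_def)
qed

instance l1_family :: (finite, "{real_normed_vector, second_countable_topology}") second_countable_topology
proof
  obtain D :: "'b set" where D: "countable D" "\<And>X. open X \<Longrightarrow> X \<noteq> {} \<Longrightarrow> \<exists>d\<in>D. d \<in> X"
    using countable_dense_setE by blast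
  show "\<exists>B::('a, 'b) l1_family set set. countable B \<and> open = generate_topology B"
  proof (rule countable_dense_imp_second_countable)
    show "countable (Family ` (\<Pi>\<^sub>E i\<in>(UNIV::'a set). D))"
      by (intro countable_image countable_PiE D) auto
    fix u :: "('a, 'b) l1_family" and e :: real assume e: "e > 0"
    have "\<exists>d\<in>D. d \<in> ball (component u i) (e / CARD('a))" for i
      using e by (intro D) (simp_all add: not_le zero_less_card_finite)
    then obtain d where d: "\<And>i. d i \<in> D" "\<And>i. dist (d i) (component u i) < e / CARD('a)"
      by (metis mem_ball dist_commute)
    have "dist (Family d) u < (\<Sum>i\<in>(UNIV::'a set). e / CARD('a))"
      unfolding dist_l1_family component_Family by (rule sum_strict_mono) (use d in auto)
    then show "\<exists>v\<in>Family ` (\<Pi>\<^sub>E i\<in>(UNIV::'a set). D). dist v u < e"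
      using d(1) by (intro bexI[of _ "Family d"]) auto
  qed
qed

typedef (overloaded) ('a, 'b) l1_prod = "UNIV :: ('a \<times> 'b) set"
  morphisms parts Parts by simp

setup_lifting type_definition_l1_prod

lift_definition l1_Pair :: "'a \<Rightarrow> 'b \<Rightarrow> ('a, 'b) l1_prod" is Pair .
lift_definition l1_fst :: "('a, 'b) l1_prod \<Rightarrow> 'a" is fst .
lift_definition l1_snd :: "('a, 'b) l1_prod \<Rightarrow> 'b" is snd .

lemma l1_prod_simps [simp]:
  "l1_fst (l1_Pair a b) = a" "l1_snd (l1_Pair a b) = b" "l1_Pair (l1_fst z) (l1_snd z) = z"
  by (transfer, simp)+

instantiation l1_prod :: (real_normed_vector, real_normed_vector) real_normed_vector
begin

lift_definition zero_l1_prod :: "('a, 'b) l1_prod" is "(0, 0)" .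
lift_definition uminus_l1_prod :: "('a, 'b) l1_prod \<Rightarrow> ('a, 'b) l1_prod"
  is "\<lambda>z. (- fst z, - snd z)" .
lift_definition plus_l1_prod :: "('a, 'b) l1_prod \<Rightarrow> ('a, 'b) l1_prod \<Rightarrow> ('a, 'b) l1_prod"
  is "\<lambda>z z'. (fst z + fst z', snd z + snd z')" .
lift_definition minus_l1_prod :: "('a, 'b) l1_prod \<Rightarrow> ('a, 'b) l1_prod \<Rightarrow> ('a, 'b) l1_prod"
  is "\<lambda>z z'. (fst z - fst z', snd z - snd z')" .
lift_definition scaleR_l1_prod :: "real \<Rightarrow> ('a, 'b) l1_prod \<Rightarrow> ('a, 'b) l1_prod"
  is "\<lambda>c z. (c *\<^sub>R fst z, c *\<^sub>R snd z)" .
lift_definition norm_l1_prod :: "('a, 'b) l1_prod \<Rightarrow> real" is "\<lambda>z. norm (fst z) + norm (snd z)" .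

definition dist_l1_prod :: "('a, 'b) l1_prod \<Rightarrow> ('a, 'b) l1_prod \<Rightarrow> real" where
  "dist_l1_prod u v = norm (u - v)"
definition sgn_l1_prod :: "('a, 'b) l1_prod \<Rightarrow> ('a, 'b) l1_prod" where
  "sgn_l1_prod u = scaleR (inverse (norm u)) u"
definition uniformity_l1_prod :: "(('a, 'b) l1_prod \<times> ('a, 'b) l1_prod) filter" where
  "uniformity_l1_prod = (INF e\<in>{0<..}. principal {(x, y). dist x y < e})"
definition open_l1_prod :: "('a, 'b) l1_prod set \<Rightarrow> bool" where
  "open_l1_prod U = (\<forall>x\<in>U. \<forall>\<^sub>F (x', y) in uniformity. x' = x \<longrightarrow> y \<in> U)"

instance
proof
  fix a b c :: "('a, 'b) l1_prod" and r s :: real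
  show "a + b + c = a + (b + c)" by transfer (auto simp: add.assoc)
  show "a + b = b + a" by transfer (auto simp: add.commute)
  show "0 + a = a" by transfer auto
  show "- a + a = 0" by transfer auto
  show "a - b = a + - b" by transfer auto
  show "r *\<^sub>R (a + b) = r *\<^sub>R a + r *\<^sub>R b" by transfer (auto simp: algebra_simps)
  show "(r + s) *\<^sub>R a = r *\<^sub>R a + s *\<^sub>R a" by transfer (auto simp: algebra_simps)
  show "r *\<^sub>R s *\<^sub>R a = (r * s) *\<^sub>R a" by transfer auto
  show "1 *\<^sub>R a = a" by transfer auto
  show "dist a b = norm (a - b)" by (rule dist_l1_prod_def)
  show "sgn a = scaleR (inverse (norm a)) a" by (rule sgn_l1_prod_def)
  show "uniformity = (INF e\<in>{0<..}. principal {(x, y :: ('a, 'b) l1_prod). dist x y < e})"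
    by (rule uniformity_l1_prod_def)
  show "open U = (\<forall>x\<in>U. \<forall>\<^sub>F (x', y) in uniformity. x' = x \<longrightarrow> y \<in> U)" for U :: "('a, 'b) l1_prod set"
    by (rule open_l1_prod_def)
  show "(norm a = 0) = (a = 0)" by transfer (auto simp: add_nonneg_eq_0_iff)
  show "norm (a + b) \<le> norm a + norm b"
    by transfer (smt (verit) fst_conv snd_conv norm_triangle_ineq)
  show "norm (r *\<^sub>R a) = \<bar>r\<bar> * norm a" by transfer (simp add: distrib_left)
qed

end

lemma dist_l1_prod: "dist u v = dist (l1_fst u) (l1_fst v) + dist (l1_snd u) (l1_snd v)"
  unfolding dist_norm by transfer simp

instance l1_prod :: (banach, banach) banach
proof
  fix X :: "nat \<Rightarrow> ('a, 'b) l1_prod" assume X: "Cauchy X"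
  have "Cauchy (\<lambda>n. l1_fst (X n))" "Cauchy (\<lambda>n. l1_snd (X n))"
    using X unfolding Cauchy_def dist_l1_prod
    by (meson add_increasing2 add_increasing le_less_trans order_refl zero_le_dist)+
  then obtain a b where "(\<lambda>n. l1_fst (X n)) \<longlonglongrightarrow> a" "(\<lambda>n. l1_snd (X n)) \<longlonglongrightarrow> b"
    unfolding Cauchy_convergent_iff convergent_def by blast
  then have "(\<lambda>n. dist (X n) (l1_Pair a b)) \<longlonglongrightarrow> 0 + 0"
    unfolding dist_l1_prod l1_prod_simps by (intro tendsto_add) (simp_all add: tendsto_dist_iff[symmetric])
  then have "X \<longlonglongrightarrow> l1_Pair a b" by (simp add: tendsto_dist_iff[of X])
  then show "convergent X" by (auto simp: convergent_def)
qed

instance l1_prod :: ("{real_normed_vector, second_countable_topology}",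
    "{real_normed_vector, second_countable_topology}") second_countable_topology
proof
  obtain D :: "'a set" where D: "countable D" "\<And>X. open X \<Longrightarrow> X \<noteq> {} \<Longrightarrow> \<exists>d\<in>D. d \<in> X"
    using countable_dense_setE by blast
  obtain E :: "'b set" where E: "countable E" "\<And>X. open X \<Longrightarrow> X \<noteq> {} \<Longrightarrow> \<exists>d\<in>E. d \<in> X"
    using countable_dense_setE by blast
  show "\<exists>B::('a, 'b) l1_prod set set. countable B \<and> open = generate_topology B"
  proof (rule countable_dense_imp_second_countable)
    show "countable ((\<lambda>(a, b). l1_Pair a b) ` (D \<times> E))" using D E by simp
    fix u :: "('a, 'b) l1_prod" and e :: real assume e: "e > 0"
    obtain a where a: "a \<in> D" "dist a (l1_fst u) < e / 2"
      using D(2)[of "ball (l1_fst u) (e / 2)"] e by (auto simp: dist_commute)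
    obtain b where b: "b \<in> E" "dist b (l1_snd u) < e / 2"
      using E(2)[of "ball (l1_snd u) (e / 2)"] e by (auto simp: dist_commute)
    have "dist (l1_Pair a b) u < e" using a b by (simp add: dist_l1_prod)
    then show "\<exists>v\<in>(\<lambda>(a, b). l1_Pair a b) ` (D \<times> E). dist v u < e"
      using a b by auto
  qed
qed

section \<open>Mild solutions of abstract Cauchy problems\<close>

text \<open>Throughout, the Banach space is a closed subspace \<open>X\<close> of the ambient type. Time
  functions are measurable with respect to Lebesgue (not only Borel) sets.\<close>

definition L1_on :: "real \<Rightarrow> 'x::{banach, second_countable_topology} set \<Rightarrow> (real \<Rightarrow> 'x) \<Rightarrow> bool" where
  "L1_on T X h \<longleftrightarrow> (\<forall>t\<in>{0<..<T}. h t \<in> X) \<and> set_integrable lebesgue {0<..<T} h"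

definition L1_loc :: "'x::{banach, second_countable_topology} set \<Rightarrow> (real \<Rightarrow> 'x) \<Rightarrow> bool" where
  "L1_loc X h \<longleftrightarrow> (\<forall>T>0. L1_on T X h)"

text \<open>\<open>(w, z) \<in> A\<close> means \<open>z \<in> A w\<close>, so the domain of the operator \<open>A\<close> is \<open>Domain A\<close>.\<close>

definition mild_solution ::
  "'x::{banach, second_countable_topology} set \<Rightarrow> ('x \<times> 'x) set \<Rightarrow> (real \<Rightarrow> 'x) \<Rightarrow> 'x \<Rightarrow> real
    \<Rightarrow> (real \<Rightarrow> 'x) \<Rightarrow> bool" where
  "mild_solution X A F W0 T W \<longleftrightarrow>
    L1_on T X F \<and> W0 \<in> closure (Domain A) \<and>
    continuous_on {0..T} W \<and> W ` {0..T} \<subseteq> X \<and> W 0 = W0 \<and>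
    (\<forall>\<epsilon>>0. \<exists>(N::nat) (t::nat \<Rightarrow> real) (Fd::nat \<Rightarrow> 'x) (Wd::nat \<Rightarrow> 'x) (W\<epsilon>::real \<Rightarrow> 'x).
      t 0 = 0 \<and> t N = T \<and>
      (\<forall>i\<in>{1..N}. t (i - 1) < t i \<and> t i - t (i - 1) < \<epsilon> \<and> Fd i \<in> X \<and> Wd i \<in> X) \<and>
      (\<Sum>i=1..N. LINT s:{t (i - 1)..t i}|lebesgue. norm (F s - Fd i)) < \<epsilon> \<and>
      Wd 0 = W0 \<and>
      (\<forall>i\<in>{1..N}. (Wd i, Fd i - (Wd i - Wd (i - 1)) /\<^sub>R (t i - t (i - 1))) \<in> A) \<and>
      W\<epsilon> 0 = W0 \<and> (\<forall>i\<in>{1..N}. \<forall>s\<in>{t (i - 1)<..t i}. W\<epsilon> s = Wd i) \<and>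
      (SUP s\<in>{0..T}. norm (W s - W\<epsilon> s)) < \<epsilon>)"


section \<open>Metric graphs\<close>

text \<open>The vertex set is the finite type \<open>'v\<close>. An edge is the ordered pair of its initial and its
  terminal vertex.\<close>

record 'v metric_graph =
  edges :: "('v \<times> 'v) set"
  len :: "'v \<times> 'v \<Rightarrow> real"

definition compact_metric_graph :: "'v::finite metric_graph \<Rightarrow> bool" where
  "compact_metric_graph G \<longleftrightarrow>
    (\<forall>(a, b)\<in>edges G. a \<noteq> b \<and> (b, a) \<notin> edges G) \<and> (\<forall>e\<in>edges G. 0 < len G e)"

definition connected_graph :: "'v::finite metric_graph \<Rightarrow> bool" where
  "connected_graph G \<longleftrightarrow> (\<forall>a b. (a, b) \<in> (edges G \<union> (edges G)\<inverse>)\<^sup>*)"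

text \<open>\<open>L\<^sup>1(G)\<close> consists of the families, indexed by all pairs of vertices, that vanish off the edges
  of \<open>G\<close> and whose component at an edge \<open>e\<close> vanishes almost everywhere outside
  \<open>(0, \<ell>\<^sub>e)\<close>; extension by zero identifies \<open>L\<^sup>1(0, \<ell>\<^sub>e)\<close> with these components.\<close>

type_synonym 'v edge_fun = "('v \<times> 'v, L1R) l1_family"
type_synonym 'v vertex_fun = "('v, real) l1_family"
type_synonym 'v state = "('v edge_fun, 'v vertex_fun) l1_prod"

definition L1_edges :: "'v::finite metric_graph \<Rightarrow> 'v edge_fun set" where
  "L1_edges G = {u. (\<forall>e. e \<notin> edges G \<longrightarrow> component u e = 0) \<and>
    (\<forall>e\<in>edges G. AE x in lborel. x \<notin> {0<..<len G e} \<longrightarrow> rep_L1R (component u e) x = 0)}"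

definition state_space :: "'v::finite metric_graph \<Rightarrow> 'v state set" where
  "state_space G = {W. l1_fst W \<in> L1_edges G}"


section \<open>Sobolev functions\<close>

definition in_Lp :: "real \<Rightarrow> real \<Rightarrow> (real \<Rightarrow> real) \<Rightarrow> bool" where
  "in_Lp p l u \<longleftrightarrow> set_borel_measurable lborel {0<..<l} u \<and>
    set_integrable lborel {0<..<l} (\<lambda>x. \<bar>u x\<bar> powr p)"

text \<open>Continuously differentiable functions with compact support in \<open>(0, l)\<close>.\<close>

definition test_function :: "real \<Rightarrow> (real \<Rightarrow> real) \<Rightarrow> bool" where
  "test_function l \<psi> \<longleftrightarrow> (\<forall>x. \<psi> differentiable at x) \<and> continuous_on UNIV (deriv \<psi>) \<and>
    closure {x. \<psi> x \<noteq> 0} \<subseteq> {0<..<l}"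

definition has_weak_deriv :: "real \<Rightarrow> real \<Rightarrow> (real \<Rightarrow> real) \<Rightarrow> (real \<Rightarrow> real) \<Rightarrow> bool" where
  "has_weak_deriv p l u g \<longleftrightarrow> in_Lp p l g \<and>
    (\<forall>\<psi>. test_function l \<psi> \<longrightarrow>
      (LBINT x:{0<..<l}. u x * deriv \<psi> x) = - (LBINT x:{0<..<l}. g x * \<psi> x))"

definition W1p :: "real \<Rightarrow> real \<Rightarrow> (real \<Rightarrow> real) \<Rightarrow> bool" where
  "W1p p l u \<longleftrightarrow> in_Lp p l u \<and> (\<exists>g. has_weak_deriv p l u g)"

text \<open>Unique almost everywhere on \<open>(0, l)\<close>.\<close>

definition weak_deriv :: "real \<Rightarrow> real \<Rightarrow> (real \<Rightarrow> real) \<Rightarrow> real \<Rightarrow> real" where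
  "weak_deriv p l u = (SOME g. has_weak_deriv p l u g)"

definition has_vertex_value ::
  "'v::finite metric_graph \<Rightarrow> ('v \<times> 'v \<Rightarrow> real \<Rightarrow> real) \<Rightarrow> 'v \<Rightarrow> real \<Rightarrow> bool" where
  "has_vertex_value G u v c \<longleftrightarrow>
    (\<forall>e\<in>edges G. (fst e = v \<longrightarrow> u e 0 = c) \<and> (snd e = v \<longrightarrow> u e (len G e) = c))"

text \<open>A function on \<open>G\<close> has no value at a vertex without incident edges. In a connected graph
  such a vertex occurs only if the graph is a single point; the value is then taken to be 0.\<close>

definition vertex_value ::
  "'v::finite metric_graph \<Rightarrow> ('v \<times> 'v \<Rightarrow> real \<Rightarrow> real) \<Rightarrow> 'v \<Rightarrow> real" where
  "vertex_value G u v =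
    (if \<exists>e\<in>edges G. fst e = v \<or> snd e = v then THE c. has_vertex_value G u v c else 0)"

definition W1p_graph ::
  "'v::finite metric_graph \<Rightarrow> ('v \<times> 'v \<Rightarrow> real) \<Rightarrow> ('v \<times> 'v \<Rightarrow> real \<Rightarrow> real) set" where
  "W1p_graph G p = {u.
    (\<forall>e\<in>edges G. W1p (p e) (len G e) (u e) \<and> continuous_on {0..len G e} (u e)) \<and>
    (\<forall>v. \<exists>c. has_vertex_value G u v c)}"


section \<open>The operator with nonhomogeneous Kirchhoff conditions\<close>

text \<open>Where \<open>u'\<close> vanishes, \<open>\<bar>u'\<bar>\<^sup>p\<^sup>-\<^sup>2 u'\<close> is 0 also for \<open>p < 2\<close>, in agreement with
  \<^term>\<open>\<bar>0::real\<bar> powr (p - 2) * 0\<close>.\<close>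

definition graph_operator ::
  "'v::finite metric_graph \<Rightarrow> ('v \<times> 'v \<Rightarrow> real) \<Rightarrow> ('v \<times> 'v \<Rightarrow> real \<Rightarrow> real)
    \<Rightarrow> ('v state \<times> 'v state) set" where
  "graph_operator G p \<gamma> = {(V, Z). V \<in> state_space G \<and> Z \<in> state_space G \<and> l1_snd V = 0 \<and>
    (\<exists>u\<in>W1p_graph G p.
      (\<forall>e\<in>edges G. AE x in lborel. x \<in> {0<..<len G e} \<longrightarrow>
        rep_L1R (component (l1_fst V) e) x = \<gamma> e (u e x)) \<and>
      (\<forall>\<phi>\<in>W1p_graph G p.
        (\<Sum>e\<in>edges G. LBINT x:{0<..<len G e}.
          \<bar>weak_deriv (p e) (len G e) (u e) x\<bar> powr (p e - 2) * weak_deriv (p e) (len G e) (u e) x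
            * weak_deriv (p e) (len G e) (\<phi> e) x) =
        (\<Sum>e\<in>edges G. LBINT x:{0<..<len G e}. rep_L1R (component (l1_fst Z) e) x * \<phi> e x) +
        (\<Sum>v\<in>UNIV. component (l1_snd Z) v * vertex_value G \<phi> v)))}"

end

theory Submission
  imports Defs
begin

text \<open>The existence and uniqueness of mild solutions hold for every accretive operator that satisfies
  the range condition and whose domain is dense at the initial value. Two implicit Euler schemes with
  states \<open>W\<^sub>i\<close> and \<open>V\<^sub>j\<close> satisfy a recursion in \<open>(i, j)\<close> for \<open>\<bar>W\<^sub>i - V\<^sub>j\<bar>\<close>, and an explicit supersolution of
  this recursion (Kobayashi's estimate) shows that all schemes with small steps are uniformly close.

  Accretivity of the graph operator follows by testing the difference of two equations with
  \<open>arctan (n (u\<^sub>1 - u\<^sub>2))\<close> and letting \<open>n\<close> tend to infinity. The resolvent equation is the Euler--Lagrange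
  equation of a strictly convex coercive functional; a minimizing sequence has derivatives that are
  Cauchy in \<open>L\<^sup>1\<close>, because its convexity gap tends to zero. The domain is dense because the resolvents
  converge to \<open>\<gamma> w\<close> whenever \<open>w\<close> is a polynomial on each edge that vanishes at the vertices.\<close>

section \<open>Discretizations of accretive evolution equations\<close>

text \<open>Three features of the problem shape the argument. The right-hand side is only integrable
  in time, so the estimate for two schemes is run with a Lipschitz function in its place. States in
  the domain have vertex part 0, so the domain can be dense only in
  \<open>L^1(G) \<times> {0}\<close>; the vertex data act through the Kirchhoff balance alone, and
  the sign in the accretivity test must be that of \<open>u1 - u2\<close>, which has values at the
  vertices, not that of the difference of the densities. Finally, no growth is assumed of the
  functions \<gamma>: their surjectivity makes the primitives superlinear, which together with the
  p-energy and connectedness bounds minimizing sequences uniformly. Strong \<open>L^1\<close>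
  convergence of derivatives replaces weak compactness in Sobolev spaces, and subgradient
  inequalities replace differentiability of the functional. Calculus with weak derivatives runs
  through the integral representation of \<open>u\<close> by its derivative, because the weak
  derivative is a choice determined only almost everywhere.\<close>

definition accretive :: "('x::real_normed_vector \<times> 'x) set \<Rightarrow> bool" where
  "accretive A \<longleftrightarrow> (\<forall>w z w' z' r. (w, z) \<in> A \<longrightarrow> (w', z') \<in> A \<longrightarrow> 0 < r \<longrightarrow>
     norm (w - w') \<le> norm (w - w' + r *\<^sub>R (z - z')))"

lemma accretiveD:
  "accretive A \<Longrightarrow> (w, z) \<in> A \<Longrightarrow> (w', z') \<in> A \<Longrightarrow> 0 < r \<Longrightarrow>
    norm (w - w') \<le> norm (w - w' + r *\<^sub>R (z - z'))"
  unfolding accretive_def by blast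

definition implicit_scheme ::
  "('x::real_normed_vector \<times> 'x) set \<Rightarrow> nat \<Rightarrow> (nat \<Rightarrow> real) \<Rightarrow> (nat \<Rightarrow> 'x) \<Rightarrow> (nat \<Rightarrow> 'x) \<Rightarrow> bool" where
  "implicit_scheme A N t F W \<longleftrightarrow> t 0 = 0 \<and>
    (\<forall>i<N. t i < t (Suc i) \<and> (W (Suc i), F (Suc i) - (W (Suc i) - W i) /\<^sub>R (t (Suc i) - t i)) \<in> A)"

text \<open>With the weight \<open>r = \<delta> \<sigma> / (\<delta> + \<sigma>)\<close> in
  accretivity, multiplication by \<open>\<delta> + \<sigma>\<close> turns both difference quotients
  into increments, and \<open>W (Suc i)\<close> and \<open>V (Suc j)\<close> are traded for their
  predecessors.\<close>

lemma implicit_scheme_recursion: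
  assumes A: "accretive A" and W: "implicit_scheme A N t F W" and V: "implicit_scheme A M s G V"
    and "i < N" "j < M"
  defines "\<delta> \<equiv> t (Suc i) - t i" and "\<sigma> \<equiv> s (Suc j) - s j"
  shows "(\<delta> + \<sigma>) * norm (W (Suc i) - V (Suc j)) \<le>
    \<sigma> * norm (W i - V (Suc j)) + \<delta> * norm (W (Suc i) - V j) + \<delta> * \<sigma> * norm (F (Suc i) - G (Suc j))"
proof -
  have pos: "0 < \<delta>" "0 < \<sigma>"
    using W V assms(4,5) unfolding implicit_scheme_def \<delta>_def \<sigma>_def by auto
  define r where "r = \<delta> * \<sigma> / (\<delta> + \<sigma>)"
  define z where "z = F (Suc i) - (W (Suc i) - W i) /\<^sub>R \<delta>"
  define y where "y = G (Suc j) - (V (Suc j) - V j) /\<^sub>R \<sigma>"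
  have lam: "0 < r" using pos by (simp add: r_def)
  have "(W (Suc i), z) \<in> A" "(V (Suc j), y) \<in> A"
    using W V assms(4,5) unfolding implicit_scheme_def z_def y_def \<delta>_def \<sigma>_def by auto
  then have *: "norm (W (Suc i) - V (Suc j)) \<le> norm (W (Suc i) - V (Suc j) + r *\<^sub>R (z - y))"
    using accretiveD[OF A] lam by blast
  have z': "\<delta> *\<^sub>R z = \<delta> *\<^sub>R F (Suc i) - (W (Suc i) - W i)" and y': "\<sigma> *\<^sub>R y = \<sigma> *\<^sub>R G (Suc j) - (V (Suc j) - V j)"
    using pos by (simp_all add: z_def y_def algebra_simps)
  have l: "(\<delta> + \<sigma>) * r = \<delta> * \<sigma>" using pos by (simp add: r_def)
  have "(\<delta> + \<sigma>) *\<^sub>R (W (Suc i) - V (Suc j) + r *\<^sub>R (z - y))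
      = (\<delta> + \<sigma>) *\<^sub>R (W (Suc i) - V (Suc j)) + \<sigma> *\<^sub>R (\<delta> *\<^sub>R z) - \<delta> *\<^sub>R (\<sigma> *\<^sub>R y)"
    using l by (simp add: scaleR_right_diff_distrib scaleR_add_right mult.commute)
  also have "\<dots> = \<sigma> *\<^sub>R (W i - V (Suc j)) + \<delta> *\<^sub>R (W (Suc i) - V j) + (\<delta> * \<sigma>) *\<^sub>R (F (Suc i) - G (Suc j))"
    unfolding z' y' by (simp add: algebra_simps)
  finally have eq: "(\<delta> + \<sigma>) *\<^sub>R (W (Suc i) - V (Suc j) + r *\<^sub>R (z - y)) = \<dots>" .
  have "(\<delta> + \<sigma>) * norm (W (Suc i) - V (Suc j)) \<le> (\<delta> + \<sigma>) * norm (W (Suc i) - V (Suc j) + r *\<^sub>R (z - y))"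
    using * pos by simp
  also have "\<dots> = norm ((\<delta> + \<sigma>) *\<^sub>R (W (Suc i) - V (Suc j) + r *\<^sub>R (z - y)))"
    using pos by simp
  also have "\<dots> \<le> norm (\<sigma> *\<^sub>R (W i - V (Suc j))) + norm (\<delta> *\<^sub>R (W (Suc i) - V j))
      + norm ((\<delta> * \<sigma>) *\<^sub>R (F (Suc i) - G (Suc j)))"
    unfolding eq by (meson norm_triangle_ineq norm_triangle_le add_mono order_refl)
  finally show ?thesis using pos by simp
qed

text \<open>The pair \<open>(u, v)\<close> is a stationary solution for the right-hand side
  \<open>v\<close>, so each step adds at most its length times the distance of the data. This bounds
  the two-parameter array on its axes \<open>i = 0\<close> and \<open>j = 0\<close>.\<close>

lemma implicit_scheme_distance:
  assumes A: "accretive A" and W: "implicit_scheme A N t F W" and uv: "(u, v) \<in> A" and "i \<le> N"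
  shows "norm (W i - u) \<le> norm (W 0 - u) + (\<Sum>k<i. (t (Suc k) - t k) * norm (F (Suc k) - v))"
  using \<open>i \<le> N\<close>
proof (induction i)
  case (Suc i)
  let ?\<delta> = "t (Suc i) - t i"
  have pos: "0 < ?\<delta>" and mem: "(W (Suc i), F (Suc i) - (W (Suc i) - W i) /\<^sub>R ?\<delta>) \<in> A"
    using W Suc.prems unfolding implicit_scheme_def by auto
  have "norm (W (Suc i) - u) \<le>
      norm (W (Suc i) - u + ?\<delta> *\<^sub>R (F (Suc i) - (W (Suc i) - W i) /\<^sub>R ?\<delta> - v))"
    by (rule accretiveD[OF A mem uv pos])
  also have "W (Suc i) - u + ?\<delta> *\<^sub>R (F (Suc i) - (W (Suc i) - W i) /\<^sub>R ?\<delta> - v)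
      = (W i - u) + ?\<delta> *\<^sub>R (F (Suc i) - v)"
    using pos by (simp add: scaleR_right_diff_distrib)
  also have "norm \<dots> \<le> norm (W i - u) + ?\<delta> * norm (F (Suc i) - v)"
    using pos by (intro order_trans[OF norm_triangle_ineq]) simp
  finally show ?case using Suc by simp
qed simp

text \<open>The term \<open>\<epsilon> * (t + s)\<close> absorbs the squares of the step sizes in the two-parameter recursion.\<close>

definition time_gap :: "real \<Rightarrow> real \<Rightarrow> real \<Rightarrow> real" where
  "time_gap \<epsilon> t s = sqrt ((t - s)\<^sup>2 + \<epsilon> * (t + s))"

lemma time_gap_ge:
  assumes "0 \<le> \<epsilon>" "0 \<le> t" "0 \<le> s" shows "\<bar>t - s\<bar> \<le> time_gap \<epsilon> t s"
  unfolding time_gap_def using assms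
  by (intro real_le_rsqrt) (simp add: mult_nonneg_nonneg)

text \<open>By convexity of the square it suffices to average the squares of \<open>?a\<close> and
  \<open>?b\<close> with weights \<sigma> and \<delta>. In that average the terms linear in
  \<open>t - s\<close> cancel, the shifts leave the excess
  \<open>\<sigma> \<delta> (\<delta> + \<sigma>)\<close>, and the drop
  \<open>2 \<epsilon> \<sigma> \<delta>\<close> of the linear term outweighs it.\<close>

lemma time_gap_supersolution:
  assumes "0 < \<delta>" "\<delta> \<le> \<epsilon>" "0 < \<sigma>" "\<sigma> \<le> \<epsilon>" "0 \<le> t - \<delta>" "0 \<le> s - \<sigma>"
  shows "\<sigma> * time_gap \<epsilon> (t - \<delta>) s + \<delta> * time_gap \<epsilon> t (s - \<sigma>) \<le> (\<delta> + \<sigma>) * time_gap \<epsilon> t s"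
proof (rule power2_le_imp_le)
  let ?a = "time_gap \<epsilon> (t - \<delta>) s" and ?b = "time_gap \<epsilon> t (s - \<sigma>)" and ?d = "time_gap \<epsilon> t s"
  have sq: "?a\<^sup>2 = (t - \<delta> - s)\<^sup>2 + \<epsilon> * (t - \<delta> + s)" "?b\<^sup>2 = (t - (s - \<sigma>))\<^sup>2 + \<epsilon> * (t + (s - \<sigma>))"
    "?d\<^sup>2 = (t - s)\<^sup>2 + \<epsilon> * (t + s)"
    unfolding time_gap_def using assms by (auto intro!: real_sqrt_pow2 add_nonneg_nonneg mult_nonneg_nonneg)
  have "(\<sigma> * ?a + \<delta> * ?b)\<^sup>2 = (\<delta> + \<sigma>) * (\<sigma> * ?a\<^sup>2 + \<delta> * ?b\<^sup>2) - \<sigma> * \<delta> * (?a - ?b)\<^sup>2"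
    by (simp add: power2_eq_square algebra_simps)
  also have "\<dots> \<le> (\<delta> + \<sigma>) * (\<sigma> * ?a\<^sup>2 + \<delta> * ?b\<^sup>2)"
    using assms by simp
  also have "\<sigma> * ?a\<^sup>2 + \<delta> * ?b\<^sup>2 = (\<delta> + \<sigma>) * ?d\<^sup>2 - \<sigma> * \<delta> * (\<epsilon> - \<delta>) - \<sigma> * \<delta> * (\<epsilon> - \<sigma>)"
    unfolding sq by (simp add: power2_eq_square algebra_simps)
  also have "(\<delta> + \<sigma>) * \<dots> \<le> (\<delta> + \<sigma>) * ((\<delta> + \<sigma>) * ?d\<^sup>2)"
  proof -
    have "0 \<le> \<sigma> * \<delta> * (\<epsilon> - \<delta>)" "0 \<le> \<sigma> * \<delta> * (\<epsilon> - \<sigma>)" using assms by simp_all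
    then show ?thesis using assms by (intro mult_left_mono) linarith+
  qed
  finally show "(\<sigma> * ?a + \<delta> * ?b)\<^sup>2 \<le> ((\<delta> + \<sigma>) * ?d)\<^sup>2"
    by (simp add: power2_eq_square mult_ac)
  show "0 \<le> (\<delta> + \<sigma>) * ?d" using assms unfolding time_gap_def by simp
qed

text \<open>A discrete maximum principle: the value at \<open>(Suc i, Suc j)\<close> depends with
  positive weights on its two predecessors, so an ordering on the axes propagates to the whole
  array.\<close>

lemma recursion_comparison:
  fixes a B :: "nat \<Rightarrow> nat \<Rightarrow> real"
  assumes "\<And>i j. i < N \<Longrightarrow> j < M \<Longrightarrow> 0 < \<delta> i \<and> 0 < \<sigma> j"
    and "\<And>i j. i < N \<Longrightarrow> j < M \<Longrightarrow>
      (\<delta> i + \<sigma> j) * a (Suc i) (Suc j) \<le> \<sigma> j * a i (Suc j) + \<delta> i * a (Suc i) j + r i j"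
    and "\<And>i j. i < N \<Longrightarrow> j < M \<Longrightarrow>
      (\<delta> i + \<sigma> j) * B (Suc i) (Suc j) \<ge> \<sigma> j * B i (Suc j) + \<delta> i * B (Suc i) j + r i j"
    and "\<And>i. i \<le> N \<Longrightarrow> a i 0 \<le> B i 0" and "\<And>j. j \<le> M \<Longrightarrow> a 0 j \<le> B 0 j"
    and "i \<le> N" "j \<le> M"
  shows "a i j \<le> B i j"
  using assms(6,7)
proof (induction i arbitrary: j)
  case 0
  then show ?case using assms(5) by simp
next
  case (Suc i)
  show ?case using Suc.prems
  proof (induction j)
    case 0
    then show ?case using assms(4) by simp
  next
    case (Suc j)
    have lt: "i < N" "j < M" using Suc.prems by auto
    have a1: "a i (Suc j) \<le> B i (Suc j)" using Suc.prems Suc.IH by (simp add: \<open>\<And>j. _ \<Longrightarrow> _ \<Longrightarrow> a i j \<le> B i j\<close>)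
    have a2: "a (Suc i) j \<le> B (Suc i) j" using Suc by simp
    have p: "0 < \<delta> i" "0 < \<sigma> j" using assms(1)[OF lt] by auto
    have "(\<delta> i + \<sigma> j) * a (Suc i) (Suc j) \<le> (\<delta> i + \<sigma> j) * B (Suc i) (Suc j)"
      using assms(2)[OF lt] assms(3)[OF lt] mult_left_mono[OF a1, of "\<sigma> j"] mult_left_mono[OF a2, of "\<delta> i"] p
      by linarith
    then show ?case using p by (simp add: mult_le_cancel_left_pos)
  qed
qed

lemma implicit_scheme_nonneg:
  assumes "implicit_scheme A N t F W" "i \<le> N" shows "0 \<le> t i"
  using assms(2)
proof (induction i)
  case (Suc i)
  then show ?case using assms(1) unfolding implicit_scheme_def by (force dest: spec[of _ i])
qed (use assms(1) in \<open>simp add: implicit_scheme_def\<close>)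

lemma sum_time_steps: "(\<Sum>k<i. t (Suc k) - t k) = t i - (t 0 :: real)"
  by (induction i) auto

text \<open>Kobayashi's estimate. The Lipschitz function \<open>h\<close> stands for the right-hand
  side common to both schemes; the deviations of \<open>F\<close> and \<open>G\<close> from it enter
  only through sums weighted by the time steps, which suits data that are merely integrable in
  time.\<close>

lemma implicit_scheme_estimate:
  fixes h :: "real \<Rightarrow> 'x::real_normed_vector"
  assumes A: "accretive A" and W: "implicit_scheme A N t F W" and V: "implicit_scheme A M s G V"
    and uv: "(u, v) \<in> A"
    and eps: "\<And>i. i < N \<Longrightarrow> t (Suc i) - t i \<le> \<epsilon>" "\<And>j. j < M \<Longrightarrow> s (Suc j) - s j \<le> \<epsilon>" "0 \<le> \<epsilon>"
    and L: "0 \<le> L" "\<And>x y. norm (h x - h y) \<le> L * \<bar>x - y\<bar>"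
    and K: "\<And>i. i < N \<Longrightarrow> norm (h (t (Suc i))) \<le> K" "\<And>j. j < M \<Longrightarrow> norm (h (s (Suc j))) \<le> K" "0 \<le> K"
    and ij: "i \<le> N" "j \<le> M"
  shows "norm (W i - V j) \<le> norm (W 0 - u) + norm (V 0 - u) + (K + norm v) * time_gap \<epsilon> (t i) (s j)
    + (\<Sum>k<i. (t (Suc k) - t k) * norm (F (Suc k) - h (t (Suc k))))
    + (\<Sum>k<j. (s (Suc k) - s k) * norm (G (Suc k) - h (s (Suc k))))
    + L * t i * (time_gap \<epsilon> (t i) (s j) + \<epsilon>)"
proof -
  define \<alpha> where "\<alpha> k = norm (F (Suc k) - h (t (Suc k)))" for k
  define \<beta> where "\<beta> k = norm (G (Suc k) - h (s (Suc k)))" for k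
  define P where "P i = (\<Sum>k<i. (t (Suc k) - t k) * \<alpha> k)" for i
  define Q where "Q j = (\<Sum>k<j. (s (Suc k) - s k) * \<beta> k)" for j
  define \<kappa> where "\<kappa> = norm (W 0 - u) + norm (V 0 - u)"
  define D where "D i j = time_gap \<epsilon> (t i) (s j)" for i j
  define C where "C = K + norm v"
  \<comment> \<open>Each term of the supersolution answers one contribution: \<open>C * D\<close>
    dominates the axes, \<open>P\<close> and \<open>Q\<close> grow by exactly the errors of the data
    in one step, and in the last term the factor \<open>t i\<close> grows by the step
    \<open>\<delta>\<close>, which makes room for the Lipschitz source
    \<open>\<delta> \<sigma> L (D i (Suc j) + \<epsilon>)\<close>.\<close>
  define B where "B i j = \<kappa> + C * D i j + P i + Q j + L * t i * (D i j + \<epsilon>)" for i j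
  have C0: "0 \<le> C" using K(3) by (simp add: C_def)
  have t0: "t 0 = 0" "s 0 = 0" using W V by (simp_all add: implicit_scheme_def)
  have tn: "0 \<le> t i" if "i \<le> N" for i using implicit_scheme_nonneg[OF W that] .
  have sn: "0 \<le> s j" if "j \<le> M" for j using implicit_scheme_nonneg[OF V that] .
  have tp: "t i < t (Suc i)" if "i < N" for i using W that by (simp add: implicit_scheme_def)
  have sp: "s j < s (Suc j)" if "j < M" for j using V that by (simp add: implicit_scheme_def)
  have Dge: "\<bar>t i - s j\<bar> \<le> D i j" if "i \<le> N" "j \<le> M" for i j
    unfolding D_def using time_gap_ge[OF eps(3) tn[OF that(1)] sn[OF that(2)]] .
  have P0: "0 \<le> P i" if "i \<le> N" for i
    unfolding P_def \<alpha>_def using that tp by (intro sum_nonneg) (simp add: less_imp_le)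
  have Q0: "0 \<le> Q j" if "j \<le> M" for j
    unfolding Q_def \<beta>_def using that sp by (intro sum_nonneg) (simp add: less_imp_le)
  have "norm (W i - V j) \<le> B i j"
  proof (rule recursion_comparison[where N = N and M = M and \<delta> = "\<lambda>i. t (Suc i) - t i"
        and \<sigma> = "\<lambda>j. s (Suc j) - s j" and a = "\<lambda>i j. norm (W i - V j)"
        and r = "\<lambda>i j. (t (Suc i) - t i) * (s (Suc j) - s j) * norm (F (Suc i) - G (Suc j))"])
    show "0 < t (Suc i) - t i \<and> 0 < s (Suc j) - s j" if "i < N" "j < M" for i j
      using tp sp that by simp
    show "(t (Suc i) - t i + (s (Suc j) - s j)) * norm (W (Suc i) - V (Suc j))
        \<le> (s (Suc j) - s j) * norm (W i - V (Suc j)) + (t (Suc i) - t i) * norm (W (Suc i) - V j) +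
          (t (Suc i) - t i) * (s (Suc j) - s j) * norm (F (Suc i) - G (Suc j))" if "i < N" "j < M" for i j
      by (rule implicit_scheme_recursion[OF A W V that])
    show "norm (W i - V 0) \<le> B i 0" if i: "i \<le> N" for i
    proof -
      have "norm (W i - u) \<le> norm (W 0 - u) + (\<Sum>k<i. (t (Suc k) - t k) * norm (F (Suc k) - v))"
        by (rule implicit_scheme_distance[OF A W uv i])
      also have "(\<Sum>k<i. (t (Suc k) - t k) * norm (F (Suc k) - v))
          \<le> (\<Sum>k<i. (t (Suc k) - t k) * \<alpha> k + C * (t (Suc k) - t k))"
      proof (rule sum_mono)
        fix k assume "k \<in> {..<i}"
        then have k: "k < N" using i by simp
        have "norm (F (Suc k) - v) \<le> \<alpha> k + norm (h (t (Suc k))) + norm v"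
          unfolding \<alpha>_def
          using norm_triangle_ineq[of "F (Suc k) - h (t (Suc k))" "h (t (Suc k)) - v"]
            norm_triangle_ineq4[of "h (t (Suc k))" v] by simp
        also have "\<dots> \<le> \<alpha> k + C" using K(1)[OF k] by (simp add: C_def)
        finally show "(t (Suc k) - t k) * norm (F (Suc k) - v) \<le> (t (Suc k) - t k) * \<alpha> k + C * (t (Suc k) - t k)"
          using tp[OF k] mult_left_mono[of "norm (F (Suc k) - v)" "\<alpha> k + C" "t (Suc k) - t k"]
          by (simp add: algebra_simps)
      qed
      also have "\<dots> = P i + C * t i"
        unfolding P_def sum.distrib sum_distrib_left[symmetric] sum_time_steps t0 by simp
      finally have "norm (W i - V 0) \<le> \<kappa> + P i + C * t i"
        using norm_triangle_ineq4[of "W i - u" "V 0 - u"] by (simp add: \<kappa>_def)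
      moreover have "t i \<le> D i 0" using Dge[OF i, of 0] t0 tn[OF i] by simp
      then have "C * t i \<le> C * D i 0" using C0 by (rule mult_left_mono)
      moreover have "0 \<le> L * t i * (D i 0 + \<epsilon>)"
        using L(1) tn[OF i] \<open>t i \<le> D i 0\<close> eps(3) by (intro mult_nonneg_nonneg) auto
      ultimately show ?thesis by (simp add: B_def Q_def)
    qed
    show "norm (W 0 - V j) \<le> B 0 j" if j: "j \<le> M" for j
    proof -
      have "norm (V j - u) \<le> norm (V 0 - u) + (\<Sum>k<j. (s (Suc k) - s k) * norm (G (Suc k) - v))"
        by (rule implicit_scheme_distance[OF A V uv j])
      also have "(\<Sum>k<j. (s (Suc k) - s k) * norm (G (Suc k) - v))
          \<le> (\<Sum>k<j. (s (Suc k) - s k) * \<beta> k + C * (s (Suc k) - s k))"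
      proof (rule sum_mono)
        fix k assume "k \<in> {..<j}"
        then have k: "k < M" using j by simp
        have "norm (G (Suc k) - v) \<le> \<beta> k + norm (h (s (Suc k))) + norm v"
          unfolding \<beta>_def
          using norm_triangle_ineq[of "G (Suc k) - h (s (Suc k))" "h (s (Suc k)) - v"]
            norm_triangle_ineq4[of "h (s (Suc k))" v] by simp
        also have "\<dots> \<le> \<beta> k + C" using K(2)[OF k] by (simp add: C_def)
        finally show "(s (Suc k) - s k) * norm (G (Suc k) - v) \<le> (s (Suc k) - s k) * \<beta> k + C * (s (Suc k) - s k)"
          using sp[OF k] mult_left_mono[of "norm (G (Suc k) - v)" "\<beta> k + C" "s (Suc k) - s k"]
          by (simp add: algebra_simps)
      qed
      also have "\<dots> = Q j + C * s j"
        unfolding Q_def sum.distrib sum_distrib_left[symmetric] sum_time_steps t0 by simp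
      finally have "norm (W 0 - V j) \<le> \<kappa> + Q j + C * s j"
        using norm_triangle_ineq4[of "W 0 - u" "V j - u"] by (simp add: \<kappa>_def)
      moreover have "s j \<le> D 0 j" using Dge[of 0 j] j t0 sn[OF j] by simp
      then have "C * s j \<le> C * D 0 j" using C0 by (rule mult_left_mono)
      ultimately show ?thesis by (simp add: B_def P_def t0)
    qed
    fix i j assume i: "i < N" and j: "j < M"
    let ?\<delta> = "t (Suc i) - t i" and ?\<sigma> = "s (Suc j) - s j"
    have p: "0 < ?\<delta>" "0 < ?\<sigma>" using tp[OF i] sp[OF j] by auto
    have DD: "?\<sigma> * D i (Suc j) + ?\<delta> * D (Suc i) j \<le> (?\<delta> + ?\<sigma>) * D (Suc i) (Suc j)"
      unfolding D_def
      using time_gap_supersolution[of ?\<delta> \<epsilon> ?\<sigma> "t (Suc i)" "s (Suc j)"] p eps(1)[OF i] eps(2)[OF j] tn[of i] sn[of j] i j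
      by simp
    \<comment> \<open>The gap is taken at \<open>(i, Suc j)\<close>, at the cost of one step
      \<open>\<epsilon>\<close>, because this is the entry that the recursion multiplies by
      \<open>\<sigma> t i\<close> and that combines with the source term into
      \<open>\<sigma> t (Suc i)\<close>.\<close>
    have FG: "norm (F (Suc i) - G (Suc j)) \<le> \<alpha> i + \<beta> j + L * (D i (Suc j) + \<epsilon>)"
    proof -
      have "norm (F (Suc i) - G (Suc j)) \<le> \<alpha> i + norm (h (t (Suc i)) - h (s (Suc j))) + \<beta> j"
        unfolding \<alpha>_def \<beta>_def
        using norm_triangle_ineq[of "F (Suc i) - h (t (Suc i))" "h (t (Suc i)) - h (s (Suc j))"]
          norm_triangle_ineq4[of "F (Suc i) - h (s (Suc j))" "G (Suc j) - h (s (Suc j))"] by simp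
      also have "norm (h (t (Suc i)) - h (s (Suc j))) \<le> L * \<bar>t (Suc i) - s (Suc j)\<bar>" by (rule L)
      also have "L * \<bar>t (Suc i) - s (Suc j)\<bar> \<le> L * (D i (Suc j) + \<epsilon>)"
        using Dge[of i "Suc j"] i j p eps(1)[OF i] by (intro mult_left_mono L(1)) auto
      finally show ?thesis by simp
    qed
    have "?\<delta> * ?\<sigma> * norm (F (Suc i) - G (Suc j)) \<le> ?\<delta> * ?\<sigma> * (\<alpha> i + \<beta> j + L * (D i (Suc j) + \<epsilon>))"
      using FG p by (intro mult_left_mono) auto
    moreover have "C * (?\<sigma> * D i (Suc j) + ?\<delta> * D (Suc i) j) \<le> C * ((?\<delta> + ?\<sigma>) * D (Suc i) (Suc j))"
      by (rule mult_left_mono[OF DD C0])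
    moreover have "(L * t (Suc i)) * (?\<sigma> * D i (Suc j) + ?\<delta> * D (Suc i) j) \<le> (L * t (Suc i)) * ((?\<delta> + ?\<sigma>) * D (Suc i) (Suc j))"
      using L(1) tn[of "Suc i"] i by (intro mult_left_mono[OF DD]) auto
    moreover have pq: "P (Suc i) = P i + ?\<delta> * \<alpha> i" "Q (Suc j) = Q j + ?\<sigma> * \<beta> j" by (simp_all add: P_def Q_def)
    ultimately show "?\<sigma> * B i (Suc j) + ?\<delta> * B (Suc i) j + ?\<delta> * ?\<sigma> * norm (F (Suc i) - G (Suc j))
        \<le> (?\<delta> + ?\<sigma>) * B (Suc i) (Suc j)"
      unfolding B_def pq by (simp add: algebra_simps)
  qed (use ij in auto)
  then show ?thesis
    by (simp add: B_def \<kappa>_def D_def C_def P_def Q_def \<alpha>_def \<beta>_def)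
qed

section \<open>Lipschitz functions are dense in the integrable functions\<close>

lemma set_integrable_lebesgue_singleton:
  fixes F :: "real \<Rightarrow> 'x::{banach, second_countable_topology}"
  shows "integrable lebesgue (\<lambda>x. indicator {a} x *\<^sub>R F x)"
proof -
  have "integrable lebesgue (\<lambda>x. indicator {a} x *\<^sub>R F a)"
    by (intro integrable_scaleR_left integrable_real_indicator) auto
  moreover have "(\<lambda>x. indicator {a} x *\<^sub>R F x) = (\<lambda>x. indicator {a} x *\<^sub>R F a)"
    by (auto simp: indicator_def)
  ultimately show ?thesis by simp
qed

text \<open>\<open>L1_on\<close> concerns the open interval, whereas the error sums of the schemes
  integrate over closed ones; arbitrary values at the two endpoints do no harm.\<close>

lemma set_integrable_closed_interval:
  fixes F :: "real \<Rightarrow> 'x::{banach, second_countable_topology}"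
  assumes "set_integrable lebesgue {a<..<b} F" "a < b"
  shows "set_integrable lebesgue {a..b} F"
proof -
  have "(\<lambda>x. indicator {a..b} x *\<^sub>R F x) =
      (\<lambda>x. indicator {a<..<b} x *\<^sub>R F x + indicator {a} x *\<^sub>R F x + indicator {b} x *\<^sub>R F x)"
    using assms(2) by (auto simp: indicator_def fun_eq_iff)
  then show ?thesis
    using assms(1) unfolding set_integrable_def
    by (auto intro!: Bochner_Integration.integrable_add set_integrable_lebesgue_singleton)
qed

lemma lipschitz_imp_continuous:
  fixes h :: "real \<Rightarrow> 'x::real_normed_vector"
  assumes "0 \<le> L" "\<And>x y. norm (h x - h y) \<le> L * \<bar>x - y\<bar>"
  shows "continuous_on S h"
  by (rule lipschitz_on_continuous_on[of L]) (use assms in \<open>auto simp: lipschitz_on_def dist_norm\<close>)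

lemma continuous_imp_set_integrable_lebesgue:
  fixes h :: "real \<Rightarrow> 'x::{banach, second_countable_topology}"
  assumes "continuous_on {a..b} h"
  shows "set_integrable lebesgue {a..b} h"
  unfolding set_integrable_def
  by (rule integrable_completion[THEN iffD2, OF _ borel_integrable_compact[OF _ assms]])
     (use borel_integrable_compact[OF _ assms] in \<open>auto dest: borel_measurable_integrable\<close>)

text \<open>Outer regularity replaces \<open>A\<close> by an open set \<open>U\<close>, and the
  truncated multiples of the distance to the complement of \<open>U\<close> increase to its
  indicator.\<close>

lemma lipschitz_approx_indicator:
  assumes A: "A \<in> sets lebesgue" and e: "0 < e"
  shows "\<exists>g L. 0 \<le> L \<and> (\<forall>x y. \<bar>g x - g y\<bar> \<le> L * \<bar>x - y\<bar>) \<and>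
    (LINT s:{a..b}|lebesgue. \<bar>indicator A s - g s :: real\<bar>) < e"
proof -
  obtain U where U: "open U" "A \<subseteq> U" "U - A \<in> lmeasurable" "emeasure lebesgue (U - A) < ennreal (e / 2)"
    using sets_lebesgue_outer_open[OF A, of "e / 2"] e by auto
  \<comment> \<open>The distance to the empty set is 0 by convention, so \<open>U = UNIV\<close>
    needs its own case.\<close>
  define g where "g n x = (if U = UNIV then 1 else min 1 (real n * infdist x (- U)))" for n :: nat and x :: real
  have lip: "\<bar>g n x - g n y\<bar> \<le> real n * \<bar>x - y\<bar>" for n x y
  proof -
    have "\<bar>real n * infdist x (- U) - real n * infdist y (- U)\<bar> \<le> real n * \<bar>x - y\<bar>"
      using infdist_triangle_abs[of x "- U" y]
      by (simp add: right_diff_distrib[symmetric] abs_mult dist_real_def mult_left_mono)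
    then show ?thesis by (auto simp: g_def)
  qed
  have g01: "0 \<le> g n x" "g n x \<le> 1" for n x by (auto simp: g_def infdist_nonneg)
  have bnd: "\<bar>indicator B x - g n x\<bar> \<le> 1" for B n x
    using g01[of n x] by (auto simp: indicator_def)
  have lim: "(\<lambda>n. g n x) \<longlonglongrightarrow> indicator U x" for x
  proof (cases "U = UNIV")
    case False
    show ?thesis
    proof (cases "x \<in> U")
      case True
      have "infdist x (- U) > 0"
        using True False U(1) infdist_pos_not_in_closed[of "- U" x] by (auto simp: closed_Compl)
      then obtain m :: nat where m: "1 / infdist x (- U) < real m" using reals_Archimedean2 by blast
      have "\<forall>\<^sub>F n in sequentially. g n x = 1"
        using eventually_ge_at_top[of m]
      proof eventually_elim
        case (elim n)
        have "1 < real m * infdist x (- U)" using m \<open>infdist x (- U) > 0\<close> by (simp add: field_simps)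
        also have "\<dots> \<le> real n * infdist x (- U)" using elim by (intro mult_right_mono) (auto simp: infdist_nonneg)
        finally show ?case by (simp add: g_def False)
      qed
      then show ?thesis using True by (simp add: tendsto_eventually)
    next
      case False
      then show ?thesis using \<open>U \<noteq> UNIV\<close> by (simp add: g_def infdist_zero)
    qed
  qed (simp add: g_def)
  have [measurable]: "A \<in> sets lebesgue" "U \<in> sets lebesgue" using A U(1) by auto
  have gc: "continuous_on UNIV (g n)" for n
    by (rule lipschitz_imp_continuous[of "real n"]) (use lip in auto)
  have gm [measurable]: "g n \<in> borel_measurable lebesgue" for n
    using borel_measurable_continuous_onI[OF gc[of n]] by (simp add: measurable_completion)
  have Ii: "integrable lebesgue (\<lambda>x. indicator {a..b} x :: real)"
    by (intro integrable_real_indicator) (auto simp: emeasure_lborel_Icc_eq)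
  have bi: "set_integrable lebesgue {a..b} f" if [measurable]: "f \<in> borel_measurable lebesgue" and "\<And>x. \<bar>f x\<bar> \<le> 1" for f :: "real \<Rightarrow> real"
    unfolding set_integrable_def
  proof (rule Bochner_Integration.integrable_bound[OF Ii])
    show "(\<lambda>x. indicator {a..b} x *\<^sub>R f x) \<in> borel_measurable lebesgue"
      using that(1) by (intro borel_measurable_scaleR borel_measurable_indicator) auto
  qed (use that(2) in \<open>auto simp: indicator_def\<close>)
  have "(\<lambda>n. LINT s:{a..b}|lebesgue. \<bar>indicator U s - g n s\<bar>) \<longlonglongrightarrow> (LINT s:{a..b}|lebesgue. (0::real))"
    unfolding set_lebesgue_integral_def
  proof (rule integral_dominated_convergence[where w = "\<lambda>x. indicator {a..b} x"])
    show "AE x in lebesgue. (\<lambda>n. indicator {a..b} x *\<^sub>R \<bar>indicator U x - g n x\<bar>) \<longlonglongrightarrow> indicator {a..b} x *\<^sub>R (0::real)"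
    proof (rule AE_I2)
      fix x
      have "(\<lambda>n. \<bar>indicator U x - g n x\<bar>) \<longlonglongrightarrow> \<bar>indicator U x - indicator U x\<bar>"
        by (intro tendsto_intros lim)
      then show "(\<lambda>n. indicator {a..b} x *\<^sub>R \<bar>indicator U x - g n x\<bar>) \<longlonglongrightarrow> indicator {a..b} x *\<^sub>R (0::real)"
        by (intro tendsto_scaleR tendsto_const) simp
    qed
    show "AE x in lebesgue. norm (indicator {a..b} x *\<^sub>R \<bar>indicator U x - g n x\<bar>) \<le> indicator {a..b} x" for n
    proof (rule AE_I2)
      fix x show "norm (indicator {a..b} x *\<^sub>R \<bar>indicator U x - g n x\<bar>) \<le> indicator {a..b} x"
        using g01[of n x] by (auto simp: indicator_def)
    qed
  qed (use Ii in auto)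
  then have "(\<lambda>n. LINT s:{a..b}|lebesgue. \<bar>indicator U s - g n s\<bar>) \<longlonglongrightarrow> 0" by (simp add: set_lebesgue_integral_def)
  then obtain n where n: "(LINT s:{a..b}|lebesgue. \<bar>indicator U s - g n s\<bar>) < e / 2"
    using order_tendstoD(2)[of _ 0 sequentially "e / 2"] e by (auto simp: eventually_sequentially)
  have iUA: "integrable lebesgue (\<lambda>x. indicator (U - A) x :: real)"
    using U(3) by (intro integrable_real_indicator) (auto simp: fmeasurable_def)
  have UA: "(LINT s:{a..b}|lebesgue. indicator (U - A) s) \<le> (LINT s|lebesgue. indicator (U - A) s :: real)"
    unfolding set_lebesgue_integral_def
  proof (rule Bochner_Integration.integral_mono[OF _ iUA])
    show "integrable lebesgue (\<lambda>s. indicator {a..b} s *\<^sub>R (indicator (U - A) s :: real))"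
      by (rule integrable_mult_indicator[OF _ iUA]) auto
  qed (auto simp: indicator_def)
  have "emeasure lebesgue (U - A) = ennreal (measure lebesgue (U - A))"
    using U(4) by (intro emeasure_eq_ennreal_measure) auto
  then have "measure lebesgue (U - A) < e / 2"
    using U(4) e by (metis ennreal_less_iff measure_nonneg)
  then have UA2: "(LINT s:{a..b}|lebesgue. indicator (U - A) s :: real) < e / 2"
    using UA U(3) by simp
  have "(LINT s:{a..b}|lebesgue. \<bar>indicator A s - g n s\<bar>) \<le>
      (LINT s:{a..b}|lebesgue. indicator (U - A) s + \<bar>indicator U s - g n s\<bar>)"
  proof (rule set_integral_mono)
    show "set_integrable lebesgue {a..b} (\<lambda>s. \<bar>indicator A s - g n s\<bar>)"
      by (intro bi) (auto simp: bnd)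
    show "set_integrable lebesgue {a..b} (\<lambda>s. indicator (U - A) s + \<bar>indicator U s - g n s\<bar>)"
      by (intro set_integral_add bi) (auto simp: bnd)
  qed (use U(2) in \<open>auto simp: indicator_def\<close>)
  also have "\<dots> = (LINT s:{a..b}|lebesgue. indicator (U - A) s) + (LINT s:{a..b}|lebesgue. \<bar>indicator U s - g n s\<bar>)"
    by (intro set_integral_add(2) bi) (auto simp: bnd)
  also have "\<dots> < e" using n UA2 by simp
  finally show ?thesis using lip by (intro exI[of _ "g n"] exI[of _ "real n"]) auto
qed

text \<open>The error is measured on a bounded interval because \<open>h\<close> is Lipschitz on the
  whole line and need not be integrable on it.\<close>

lemma lipschitz_dense:
  fixes F :: "real \<Rightarrow> 'x::{banach, second_countable_topology}"
  assumes "integrable lebesgue F" "0 < e"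
  shows "\<exists>h L. 0 \<le> L \<and> (\<forall>x y. norm (h x - h y) \<le> L * \<bar>x - y\<bar>) \<and>
    (LINT s:{a..b}|lebesgue. norm (F s - h s)) < e"
  using assms
proof (induction arbitrary: e rule: integrable_induct)
  case (base A c)
  \<comment> \<open>Adding 1 to the norm covers \<open>c = 0\<close>.\<close>
  have "0 < e / (norm c + 1)" using base by (simp add: add_nonneg_pos)
  from lipschitz_approx_indicator[OF base(1) this, of a b]
  obtain g L where g: "0 \<le> L" "\<And>x y. \<bar>g x - g y\<bar> \<le> L * \<bar>x - y\<bar>"
    "(LINT s:{a..b}|lebesgue. \<bar>indicator A s - g s :: real\<bar>) < e / (norm c + 1)" by blast
  have eq: "norm (indicator A s *\<^sub>R c - g s *\<^sub>R c) = norm c * \<bar>indicator A s - g s\<bar>" for s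
    by (metis mult.commute norm_scaleR scaleR_left_diff_distrib)
  have "(LINT s:{a..b}|lebesgue. norm (indicator A s *\<^sub>R c - g s *\<^sub>R c))
      = norm c * (LINT s:{a..b}|lebesgue. \<bar>indicator A s - g s\<bar>)"
    unfolding eq by simp
  also have "\<dots> \<le> norm c * (e / (norm c + 1))" using g(3) by (intro mult_left_mono) auto
  also have "\<dots> < e" using base(3) by (simp add: pos_divide_less_eq add_nonneg_pos distrib_left)
  finally have "(LINT s:{a..b}|lebesgue. norm (indicator A s *\<^sub>R c - g s *\<^sub>R c)) < e" .
  moreover have "norm (g x *\<^sub>R c - g y *\<^sub>R c) \<le> (L * norm c) * \<bar>x - y\<bar>" for x y
    using mult_right_mono[OF g(2)[of x y], of "norm c"]
    by (simp add: scaleR_left_diff_distrib[symmetric] mult_ac)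
  ultimately show ?case using g(1)
    by (intro exI[of _ "\<lambda>s. g s *\<^sub>R c"] exI[of _ "L * norm c"]) auto
next
  case (add F G)
  from add(3)[of "e / 2"] add(4)[of "e / 2"] add(5) obtain h L k K where
    h: "0 \<le> L" "\<And>x y. norm (h x - h y) \<le> L * \<bar>x - y\<bar>" "(LINT s:{a..b}|lebesgue. norm (F s - h s)) < e / 2" and
    k: "0 \<le> K" "\<And>x y. norm (k x - k y) \<le> K * \<bar>x - y\<bar>" "(LINT s:{a..b}|lebesgue. norm (G s - k s)) < e / 2"
    by (auto simp: half_gt_zero_iff)
  have si: "set_integrable lebesgue {a..b} F" "set_integrable lebesgue {a..b} G"
    using add(1,2) unfolding set_integrable_def by (auto intro!: integrable_mult_indicator)
  have sh: "set_integrable lebesgue {a..b} h" "set_integrable lebesgue {a..b} k"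
    by (auto intro!: continuous_imp_set_integrable_lebesgue lipschitz_imp_continuous[OF h(1,2)] lipschitz_imp_continuous[OF k(1,2)])
  have "(LINT s:{a..b}|lebesgue. norm (F s + G s - (h s + k s))) \<le>
     (LINT s:{a..b}|lebesgue. norm (F s - h s) + norm (G s - k s))"
    by (intro set_integral_mono set_integral_add(1) set_integral_diff(1) set_integrable_norm si sh)
      (metis add_diff_add norm_triangle_ineq)
  also have "\<dots> = (LINT s:{a..b}|lebesgue. norm (F s - h s)) + (LINT s:{a..b}|lebesgue. norm (G s - k s))"
    by (intro set_integral_add(2) set_integral_diff(1) set_integrable_norm si sh)
  also have "\<dots> < e" using h k by simp
  finally have "(LINT s:{a..b}|lebesgue. norm (F s + G s - (h s + k s))) < e" .
  moreover have "norm (h x + k x - (h y + k y)) \<le> (L + K) * \<bar>x - y\<bar>" for x y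
    using norm_triangle_ineq[of "h x - h y" "k x - k y"] h(2)[of x y] k(2)[of x y]
    by (simp add: algebra_simps)
  ultimately show ?case using h(1) k(1)
    by (intro exI[of _ "\<lambda>s. h s + k s"] exI[of _ "L + K"]) auto
next
  case (lim F S)
  have si: "set_integrable lebesgue {a..b} F" "set_integrable lebesgue {a..b} (S i)" for i
    using lim(1,4) unfolding set_integrable_def by (auto intro!: integrable_mult_indicator)
  have "(\<lambda>i. LINT s:{a..b}|lebesgue. norm (F s - S i s)) \<longlonglongrightarrow> (LINT s:{a..b}|lebesgue. (0::real))"
    unfolding set_lebesgue_integral_def
  proof (rule integral_dominated_convergence[where w = "\<lambda>x. 3 * norm (F x)"])
    show "AE x in lebesgue. (\<lambda>i. indicator {a..b} x *\<^sub>R norm (F x - S i x)) \<longlonglongrightarrow> indicator {a..b} x *\<^sub>R (0::real)"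
    proof (rule AE_I2)
      fix x
      have "(\<lambda>i. norm (F x - S i x)) \<longlonglongrightarrow> norm (F x - F x)"
        by (intro tendsto_intros) (use lim(2) in auto)
      then show "(\<lambda>i. indicator {a..b} x *\<^sub>R norm (F x - S i x)) \<longlonglongrightarrow> indicator {a..b} x *\<^sub>R (0::real)"
        by (intro tendsto_scaleR tendsto_const) simp
    qed
    show "AE x in lebesgue. norm (indicator {a..b} x *\<^sub>R norm (F x - S i x)) \<le> 3 * norm (F x)" for i
    proof (rule AE_I2)
      fix x show "norm (indicator {a..b} x *\<^sub>R norm (F x - S i x)) \<le> 3 * norm (F x)"
        using norm_triangle_ineq4[of "F x" "S i x"] lim(3)[of x i] by (auto simp: indicator_def)
    qed
    show "(\<lambda>x. indicator {a..b} x *\<^sub>R norm (F x - S i x)) \<in> borel_measurable lebesgue" for i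
      using lim(1,4)
      by (intro borel_measurable_scaleR borel_measurable_indicator borel_measurable_norm borel_measurable_diff) auto
  qed (use lim(4) in auto)
  then have "(\<lambda>i. LINT s:{a..b}|lebesgue. norm (F s - S i s)) \<longlonglongrightarrow> 0" by (simp add: set_lebesgue_integral_def)
  then obtain i where i: "(LINT s:{a..b}|lebesgue. norm (F s - S i s)) < e / 2"
    using order_tendstoD(2)[of _ 0 sequentially "e / 2"] lim(6) by (auto simp: eventually_sequentially)
  from lim(5)[of "e / 2" i] lim(6) obtain h L where
    h: "0 \<le> L" "\<And>x y. norm (h x - h y) \<le> L * \<bar>x - y\<bar>" "(LINT s:{a..b}|lebesgue. norm (S i s - h s)) < e / 2"
    by auto
  have sh: "set_integrable lebesgue {a..b} h"
    by (auto intro!: continuous_imp_set_integrable_lebesgue lipschitz_imp_continuous[OF h(1,2)])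
  have "(LINT s:{a..b}|lebesgue. norm (F s - h s)) \<le>
     (LINT s:{a..b}|lebesgue. norm (F s - S i s) + norm (S i s - h s))"
    by (intro set_integral_mono set_integral_add(1) set_integral_diff(1) set_integrable_norm si sh)
      (metis diff_add_cancel add_diff_eq norm_triangle_ineq)
  also have "\<dots> = (LINT s:{a..b}|lebesgue. norm (F s - S i s)) + (LINT s:{a..b}|lebesgue. norm (S i s - h s))"
    by (intro set_integral_add(2) set_integral_diff(1) set_integrable_norm si sh)
  also have "\<dots> < e" using h i by simp
  finally show ?case using h(1,2) by blast
qed

section \<open>Mild solutions for accretive operators\<close>

lemma sum_set_integral_steps:
  fixes \<phi> :: "real \<Rightarrow> real"
  assumes "set_integrable lebesgue {t 0..t N} \<phi>" "\<And>i. i < N \<Longrightarrow> t i \<le> t (Suc i)"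
  shows "(\<Sum>i<N. LINT s:{t i..t (Suc i)}|lebesgue. \<phi> s) = (LINT s:{t 0..t N}|lebesgue. \<phi> s)"
  using assms
proof (induction N)
  case 0
  have "(LINT s:{t 0..t 0}|lebesgue. \<phi> s) = integral {t 0..t 0} \<phi>"
    using 0 by (intro set_lebesgue_integral_eq_integral(2)) auto
  then show ?case by simp
next
  case (Suc N)
  note st = Suc.prems(2)
  have mono: "t 0 \<le> t n" if "n \<le> N" for n
    using that
  proof (induction n)
    case (Suc n)
    then show ?case using st[of n] by simp
  qed simp
  have le: "t 0 \<le> t N" "t N \<le> t (Suc N)" using mono[of N] Suc.prems(2) by auto
  have si: "set_integrable lebesgue {t 0..t N} \<phi>" "set_integrable lebesgue {t N..t (Suc N)} \<phi>"
    using le by (auto intro: set_integrable_subset[OF Suc.prems(1)])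
  have "integral {t 0..t N} \<phi> + integral {t N..t (Suc N)} \<phi> = integral {t 0..t (Suc N)} \<phi>"
    using le set_lebesgue_integral_eq_integral(1)[OF Suc.prems(1)]
    by (intro Henstock_Kurzweil_Integration.integral_combine)
  then show ?case
    using Suc si by (simp add: set_lebesgue_integral_eq_integral(2))
qed

text \<open>The part of the discretization in \<open>mild_solution\<close> on which the estimates
  depend, with steps counted from 0. Membership in \<open>X\<close> and the step function are kept
  apart.\<close>

definition discretization ::
  "('x::{banach, second_countable_topology} \<times> 'x) set \<Rightarrow> (real \<Rightarrow> 'x) \<Rightarrow> 'x \<Rightarrow> real \<Rightarrow> real
    \<Rightarrow> nat \<Rightarrow> (nat \<Rightarrow> real) \<Rightarrow> (nat \<Rightarrow> 'x) \<Rightarrow> (nat \<Rightarrow> 'x) \<Rightarrow> bool" where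
  "discretization A F W0 T \<epsilon> N t Fd Wd \<longleftrightarrow> implicit_scheme A N t Fd Wd \<and> t N = T \<and> Wd 0 = W0 \<and>
    (\<forall>i<N. t (Suc i) - t i < \<epsilon>) \<and>
    (\<Sum>i<N. LINT s:{t i..t (Suc i)}|lebesgue. norm (F s - Fd (Suc i))) < \<epsilon>"

lemma discretization_mono:
  "discretization A F W0 T \<epsilon> N t Fd Wd \<Longrightarrow> \<epsilon> \<le> \<epsilon>' \<Longrightarrow> discretization A F W0 T \<epsilon>' N t Fd Wd"
  unfolding discretization_def by (auto intro: less_le_trans)

lemma discretization_step_bounds:
  assumes "discretization A F W0 T \<epsilon> N t Fd Wd" "i \<le> N"
  shows "0 \<le> t i" "t i \<le> T"
proof -
  have sch: "implicit_scheme A N t Fd Wd" "t N = T" using assms(1) by (auto simp: discretization_def)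
  show "0 \<le> t i" by (rule implicit_scheme_nonneg[OF sch(1) assms(2)])
  have "i \<le> n \<Longrightarrow> n \<le> N \<Longrightarrow> t i \<le> t n" for n
  proof (induction n)
    case (Suc n)
    then have "t n < t (Suc n)" using sch(1) by (simp add: implicit_scheme_def)
    then show ?case using Suc by (auto simp: le_Suc_eq)
  qed simp
  then show "t i \<le> T" using assms(2) sch(2) by auto
qed

text \<open>The values \<open>Fd (Suc k)\<close> and \<open>h (t (Suc k))\<close> are compared
  through \<open>F s\<close>, integrated over the step. This costs the discretization error of
  \<open>F\<close>, the \<open>L^1\<close> distance of \<open>F\<close> and \<open>h\<close>, and
  the oscillation \<open>L \<epsilon>\<close> of \<open>h\<close> on a step.\<close>

lemma discretization_error:
  assumes d: "discretization A F W0 T \<epsilon> N t Fd Wd" and F: "set_integrable lebesgue {0..T} F"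
    and h: "0 \<le> L" "\<And>x y. norm (h x - h y) \<le> L * \<bar>x - y\<bar>" and "i \<le> N" and "0 \<le> T" "0 \<le> \<epsilon>"
  shows "(\<Sum>k<i. (t (Suc k) - t k) * norm (Fd (Suc k) - h (t (Suc k))))
    \<le> \<epsilon> + (LINT s:{0..T}|lebesgue. norm (F s - h s)) + L * \<epsilon> * T"
proof -
  have sch: "implicit_scheme A N t Fd Wd" "t N = T" "t 0 = 0" "\<And>k. k < N \<Longrightarrow> t k < t (Suc k)"
    "\<And>k. k < N \<Longrightarrow> t (Suc k) - t k < \<epsilon>"
    using d by (auto simp: discretization_def implicit_scheme_def)
  have hi: "set_integrable lebesgue {a..b} h" for a b
    by (auto intro!: continuous_imp_set_integrable_lebesgue lipschitz_imp_continuous[OF h])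
  have ci: "set_integrable lebesgue {a..b} (\<lambda>_. c)" for a b :: real and c :: 'a
    by (auto intro!: continuous_imp_set_integrable_lebesgue)
  have sub: "{t k..t (Suc k)} \<subseteq> {0..T}" if "k < N" for k
    using discretization_step_bounds[OF d, of k] discretization_step_bounds[OF d, of "Suc k"] that by auto
  have Fi: "set_integrable lebesgue {t k..t (Suc k)} F" if "k < N" for k
    by (rule set_integrable_subset[OF F _ sub[OF that]]) auto
  have "(\<Sum>k<i. (t (Suc k) - t k) * norm (Fd (Suc k) - h (t (Suc k))))
     \<le> (\<Sum>k<N. (t (Suc k) - t k) * norm (Fd (Suc k) - h (t (Suc k))))"
    using \<open>i \<le> N\<close> sch(4) by (intro sum_mono2) (auto simp: less_imp_le)
  also have "\<dots> \<le> (\<Sum>k<N. (LINT s:{t k..t (Suc k)}|lebesgue. norm (F s - Fd (Suc k)))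
      + (LINT s:{t k..t (Suc k)}|lebesgue. norm (F s - h s)) + L * \<epsilon> * (t (Suc k) - t k))"
  proof (rule sum_mono)
    fix k assume "k \<in> {..<N}"
    then have k: "k < N" by simp
    let ?I = "{t k..t (Suc k)}"
    have vol: "(LINT s:?I|lebesgue. (c::real)) = (t (Suc k) - t k) * c" for c
      using sch(4)[OF k] by (simp add: set_lebesgue_integral_def less_imp_le)
    have "(t (Suc k) - t k) * norm (Fd (Suc k) - h (t (Suc k)))
        = (LINT s:?I|lebesgue. norm (Fd (Suc k) - h (t (Suc k))))" by (simp add: vol)
    also have "\<dots> \<le> (LINT s:?I|lebesgue. norm (F s - Fd (Suc k)) + norm (F s - h s) + L * \<epsilon>)"
    proof (rule set_integral_mono)
      show "set_integrable lebesgue ?I (\<lambda>s. norm (Fd (Suc k) - h (t (Suc k))))"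
        by (auto intro!: continuous_imp_set_integrable_lebesgue)
      show "set_integrable lebesgue ?I (\<lambda>s. norm (F s - Fd (Suc k)) + norm (F s - h s) + L * \<epsilon>)"
        by (intro set_integral_add(1) set_integrable_norm set_integral_diff(1) Fi[OF k] hi ci
            continuous_imp_set_integrable_lebesgue) auto
      fix s assume s: "s \<in> ?I"
      have "norm (h s - h (t (Suc k))) \<le> L * \<epsilon>"
        using sch(5)[OF k] s by (intro order_trans[OF h(2)] mult_left_mono h(1)) auto
      moreover have "norm (Fd (Suc k) - h (t (Suc k))) \<le> norm (F s - h s) + norm (F s - Fd (Suc k)) + norm (h s - h (t (Suc k)))"
        using norm_triangle_ineq[of "(F s - h s) - (F s - Fd (Suc k))" "h s - h (t (Suc k))"]
          norm_triangle_ineq4[of "F s - h s" "F s - Fd (Suc k)"] by simp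
      ultimately show "norm (Fd (Suc k) - h (t (Suc k))) \<le> norm (F s - Fd (Suc k)) + norm (F s - h s) + L * \<epsilon>"
        by simp
    qed
    also have "\<dots> = (LINT s:?I|lebesgue. norm (F s - Fd (Suc k)) + norm (F s - h s)) + (LINT s:?I|lebesgue. L * \<epsilon>)"
      by (intro set_integral_add set_integrable_norm set_integral_diff(1) Fi[OF k] hi ci
            continuous_imp_set_integrable_lebesgue) auto
    also have "(LINT s:?I|lebesgue. norm (F s - Fd (Suc k)) + norm (F s - h s)) =
       (LINT s:?I|lebesgue. norm (F s - Fd (Suc k))) + (LINT s:?I|lebesgue. norm (F s - h s))"
      by (intro set_integral_add set_integrable_norm set_integral_diff(1) Fi[OF k] hi ci)
    finally show "(t (Suc k) - t k) * norm (Fd (Suc k) - h (t (Suc k))) \<le>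
        (LINT s:?I|lebesgue. norm (F s - Fd (Suc k))) + (LINT s:?I|lebesgue. norm (F s - h s)) + L * \<epsilon> * (t (Suc k) - t k)"
      by (simp add: vol mult_ac)
  qed
  also have "\<dots> = (\<Sum>k<N. (LINT s:{t k..t (Suc k)}|lebesgue. norm (F s - Fd (Suc k))))
      + (\<Sum>k<N. LINT s:{t k..t (Suc k)}|lebesgue. norm (F s - h s)) + L * \<epsilon> * (t N - t 0)"
    by (simp add: sum.distrib sum_distrib_left[symmetric] sum_time_steps)
  also have "(\<Sum>k<N. LINT s:{t k..t (Suc k)}|lebesgue. norm (F s - h s)) = (LINT s:{t 0..t N}|lebesgue. norm (F s - h s))"
    using sch by (intro sum_set_integral_steps set_integrable_norm set_integral_diff(1) hi) (auto simp: F less_imp_le)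
  finally show ?thesis using d by (simp add: sch discretization_def)
qed

text \<open>One modulus serves uniqueness, convergence of the schemes and continuity of the limit.
  The tolerance \<open>3 * \<delta>\<close> covers two times at distance \<delta>, each within
  \<delta> of its node.\<close>

lemma discretization_modulus:
  fixes F :: "real \<Rightarrow> 'x::{banach, second_countable_topology}"
  assumes A: "accretive A" and F: "set_integrable lebesgue {0..T} F" and W0: "W0 \<in> closure (Domain A)"
    and T: "0 < T" and \<eta>: "0 < \<eta>"
  obtains \<delta> where "0 < \<delta>"
    "\<And>N t Fd Wd M s Gd Vd i j. discretization A F W0 T \<delta> N t Fd Wd \<Longrightarrow> discretization A F W0 T \<delta> M s Gd Vd \<Longrightarrow>
      i \<le> N \<Longrightarrow> j \<le> M \<Longrightarrow> \<bar>t i - s j\<bar> \<le> 3 * \<delta> \<Longrightarrow> norm (Wd i - Vd j) \<le> \<eta>"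
proof -
  obtain u v where uv: "(u, v) \<in> A" "norm (W0 - u) < \<eta> / 8"
    using W0 \<eta> unfolding closure_approachable
    by (metis Domain.cases dist_commute dist_norm divide_pos_pos zero_less_numeral)
  have "integrable lebesgue (\<lambda>x. indicator {0..T} x *\<^sub>R F x)" using F by (simp add: set_integrable_def)
  from lipschitz_dense[OF this, of "\<eta> / 8" 0 T] \<eta> obtain h L where
    h: "0 \<le> L" "\<And>x y. norm (h x - h y) \<le> L * \<bar>x - y\<bar>"
    and "(LINT s:{0..T}|lebesgue. norm (indicator {0..T} s *\<^sub>R F s - h s)) < \<eta> / 8"
    by auto
  moreover have "(LINT s:{0..T}|lebesgue. norm (indicator {0..T} s *\<^sub>R F s - h s)) = (LINT s:{0..T}|lebesgue. norm (F s - h s))"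
    by (intro set_lebesgue_integral_cong) auto
  ultimately have hF: "(LINT s:{0..T}|lebesgue. norm (F s - h s)) < \<eta> / 8" by simp
  define K where "K = norm (h 0) + L * T"
  have K: "norm (h x) \<le> K" if "0 \<le> x" "x \<le> T" for x
    using h(2)[of x 0] norm_triangle_sub[of "h x" "h 0"] that mult_left_mono[of x T L] h(1) by (auto simp: K_def)
  have K0: "0 \<le> K" using K[of 0] T norm_ge_zero[of "h 0"] by linarith
  \<comment> \<open>\<open>G \<delta>\<close> bounds the time gap when
    \<open>|t - s| \<le> 3 \<delta>\<close> and \<open>t + s \<le> 2 T\<close>. The pair
    \<open>(u, v)\<close> and the function \<open>h\<close>, hence \<open>L\<close> and
    \<open>K\<close>, are fixed before \<delta>; therefore the total bound \<open>E \<delta>\<close>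
    tends to \<open>4 \<eta> / 8\<close> as \<delta> tends to 0.\<close>
  define G where "G \<delta> = sqrt (9 * \<delta>\<^sup>2 + 2 * T * \<delta>)" for \<delta>
  define E where "E \<delta> = 2 * (\<eta> / 8) + (K + norm v) * G \<delta> + 2 * (\<delta> + \<eta> / 8 + L * \<delta> * T) + L * T * (G \<delta> + \<delta>)" for \<delta>
  have "(E \<longlongrightarrow> 2 * (\<eta> / 8) + (K + norm v) * sqrt (9 * 0\<^sup>2 + 2 * T * 0)
      + 2 * (0 + \<eta> / 8 + L * 0 * T) + L * T * (sqrt (9 * 0\<^sup>2 + 2 * T * 0) + 0)) (at_right 0)"
    unfolding E_def G_def by (intro tendsto_intros)
  then have "\<forall>\<^sub>F \<delta> in at_right 0. E \<delta> < \<eta>"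
    by (rule order_tendstoD) (use \<eta> in simp)
  then obtain \<delta>0 where "0 < \<delta>0" and "\<And>\<delta>. 0 < \<delta> \<Longrightarrow> \<delta> < \<delta>0 \<Longrightarrow> E \<delta> < \<eta>"
    by (auto simp: eventually_at_right_field)
  then obtain \<delta> where \<delta>: "0 < \<delta>" "E \<delta> < \<eta>" using dense by blast
  show thesis
  proof (rule that[OF \<delta>(1)])
    fix N t Fd Wd M s Gd Vd i j
    assume dW: "discretization A F W0 T \<delta> N t Fd Wd" and dV: "discretization A F W0 T \<delta> M s Gd Vd"
      and ij: "i \<le> N" "j \<le> M" and close: "\<bar>t i - s j\<bar> \<le> 3 * \<delta>"
    have sW: "implicit_scheme A N t Fd Wd" and sV: "implicit_scheme A M s Gd Vd"
      and st: "\<And>i. i < N \<Longrightarrow> t (Suc i) - t i \<le> \<delta>" "\<And>j. j < M \<Longrightarrow> s (Suc j) - s j \<le> \<delta>"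
      and W00: "Wd 0 = W0" "Vd 0 = W0"
      using dW dV by (auto simp: discretization_def less_imp_le)
    note bW = discretization_step_bounds[OF dW] and bV = discretization_step_bounds[OF dV]
    have "norm (Wd i - Vd j) \<le> norm (Wd 0 - u) + norm (Vd 0 - u) + (K + norm v) * time_gap \<delta> (t i) (s j)
      + (\<Sum>k<i. (t (Suc k) - t k) * norm (Fd (Suc k) - h (t (Suc k))))
      + (\<Sum>k<j. (s (Suc k) - s k) * norm (Gd (Suc k) - h (s (Suc k))))
      + L * t i * (time_gap \<delta> (t i) (s j) + \<delta>)"
      by (rule implicit_scheme_estimate[OF A sW sV uv(1) st _ h K K K0 ij])
        (use \<delta>(1) bW bV in auto)
    also have "\<dots> \<le> E \<delta>"
    proof -
      have "(t i - s j)\<^sup>2 \<le> (3 * \<delta>)\<^sup>2" using close \<delta>(1) by (intro abs_le_square_iff[THEN iffD1]) simp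
      moreover have "\<delta> * (t i + s j) \<le> \<delta> * (T + T)" using bW[OF ij(1)] bV[OF ij(2)] \<delta>(1) by (intro mult_left_mono) auto
      ultimately have g: "time_gap \<delta> (t i) (s j) \<le> G \<delta>"
        unfolding time_gap_def G_def by (intro real_sqrt_le_mono) (simp add: power2_eq_square algebra_simps)
      have g0: "0 \<le> time_gap \<delta> (t i) (s j)"
        using bW[OF ij(1)] bV[OF ij(2)] \<delta>(1) by (simp add: time_gap_def)
      have "(K + norm v) * time_gap \<delta> (t i) (s j) \<le> (K + norm v) * G \<delta>"
        using g K0 by (intro mult_left_mono) auto
      moreover have "L * t i * (time_gap \<delta> (t i) (s j) + \<delta>) \<le> L * T * (G \<delta> + \<delta>)"
        using g g0 \<delta>(1) h(1) bW[OF ij(1)] by (intro mult_mono mult_left_mono) auto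
      moreover have "w + w + a + s1 + s2 + b \<le> 2 * q + a' + 2 * (x + q + z) + b'"
        if "a \<le> a'" "b \<le> b'" "s1 \<le> x + I + z" "s2 \<le> x + I + z" "w < q" "I < q" for w a s1 s2 b a' b' x I z q :: real
        using that by simp
      moreover note discretization_error[OF dW F h ij(1) less_imp_le[OF T] less_imp_le[OF \<delta>(1)]]
        discretization_error[OF dV F h ij(2) less_imp_le[OF T] less_imp_le[OF \<delta>(1)]]
      ultimately show ?thesis using uv(2) hF unfolding E_def W00 by presburger
    qed
    finally show "norm (Wd i - Vd j) \<le> \<eta>" using \<delta>(2) by simp
  qed
qed

section \<open>Step functions of a scheme\<close>

definition step_interpolant :: "nat \<Rightarrow> (nat \<Rightarrow> real) \<Rightarrow> (nat \<Rightarrow> 'x) \<Rightarrow> (real \<Rightarrow> 'x) \<Rightarrow> bool" where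
  "step_interpolant N t Wd w \<longleftrightarrow> w 0 = Wd 0 \<and> (\<forall>i\<in>{1..N}. \<forall>s\<in>{t (i - 1)<..t i}. w s = Wd i)"

text \<open>The node is the right end of the step containing \<open>x\<close>. The steps are open on
  the left, so time 0 lies in none of them and belongs to node 0.\<close>

lemma step_interpolant_value:
  assumes d: "discretization A F W0 T \<epsilon> N t Fd Wd" and w: "step_interpolant N t Wd w" and x: "x \<in> {0..T}" "0 \<le> \<epsilon>"
  shows "\<exists>i\<le>N. w x = Wd i \<and> \<bar>x - t i\<bar> \<le> \<epsilon>"
proof (cases "x = 0")
  case True
  then show ?thesis using d w x by (intro exI[of _ 0]) (auto simp: step_interpolant_def discretization_def implicit_scheme_def)
next
  case False
  define i where "i = (LEAST i. x \<le> t i)"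
  have tN: "x \<le> t N" using d x by (simp add: discretization_def)
  have i: "x \<le> t i" "i \<le> N" unfolding i_def using tN by (auto intro: LeastI Least_le)
  have "i \<noteq> 0" using i(1) False x d by (cases "i = 0") (auto simp: discretization_def implicit_scheme_def)
  then obtain j where j: "i = Suc j" by (cases i) auto
  have "t j < x" using not_less_Least[of j "\<lambda>i. x \<le> t i"] j by (simp add: i_def not_le)
  then have "w x = Wd i" using w i j unfolding step_interpolant_def by (metis atLeastAtMost_iff diff_Suc_1 greaterThanAtMost_iff le_add1 plus_1_eq_Suc)
  moreover have "t (Suc j) - t j < \<epsilon>" using d i j by (simp add: discretization_def)
  ultimately show ?thesis using i j \<open>t j < x\<close> by (intro exI[of _ i]) auto
qed

lemma step_interpolant_exists:
  assumes d: "implicit_scheme A N t F Wd"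
  shows "\<exists>w. step_interpolant N t Wd w"
proof -
  define w where "w x = Wd (LEAST i. x \<le> t i)" for x
  have mono: "i \<le> j \<Longrightarrow> j \<le> N \<Longrightarrow> t i \<le> t j" for i j
  proof (induction j)
    case (Suc j)
    then have "t j < t (Suc j)" using d by (simp add: implicit_scheme_def)
    then show ?case using Suc by (auto simp: le_Suc_eq)
  qed simp
  have "w s = Wd i" if "i \<in> {1..N}" "s \<in> {t (i - 1)<..t i}" for i s
  proof -
    have "(LEAST i. s \<le> t i) = i"
    proof (rule Least_equality)
      fix k assume k: "s \<le> t k"
      show "i \<le> k"
      proof (rule ccontr)
        assume "\<not> i \<le> k"
        then have "t k \<le> t (i - 1)" using that by (intro mono) auto
        then show False using k that by auto
      qed
    qed (use that in auto)
    then show ?thesis by (simp add: w_def)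
  qed
  moreover have "w 0 = Wd 0"
  proof -
    have "(LEAST i. 0 \<le> t i) = 0" using d by (intro Least_equality) (auto simp: implicit_scheme_def)
    then show ?thesis by (simp add: w_def)
  qed
  ultimately show ?thesis unfolding step_interpolant_def by blast
qed

lemma mild_solution_iff:
  "mild_solution X A F W0 T W \<longleftrightarrow>
    L1_on T X F \<and> W0 \<in> closure (Domain A) \<and> continuous_on {0..T} W \<and> W ` {0..T} \<subseteq> X \<and> W 0 = W0 \<and>
    (\<forall>\<epsilon>>0. \<exists>N t Fd Wd w. discretization A F W0 T \<epsilon> N t Fd Wd \<and>
      (\<forall>i\<in>{1..N}. Fd i \<in> X \<and> Wd i \<in> X) \<and> step_interpolant N t Wd w \<and>
      (SUP s\<in>{0..T}. norm (W s - w s)) < \<epsilon>)"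
proof -
  have all: "(\<forall>i\<in>{1..N}. P (i - 1) i) \<longleftrightarrow> (\<forall>i<N. P i (Suc i))" for P and N :: nat
    by (metis (no_types, lifting) One_nat_def Suc_leI Suc_le_D atLeastAtMost_iff diff_Suc_1 le_add1 less_eq_Suc_le plus_1_eq_Suc)
  have sum: "(\<Sum>i=1..N. P (i - 1) i) = (\<Sum>i<N. P i (Suc i))" for P :: "nat \<Rightarrow> nat \<Rightarrow> real" and N
    by (simp add: sum.atLeast1_atMost_eq)
  have "(t 0 = 0 \<and> t N = T \<and>
      (\<forall>i\<in>{1..N}. t (i - 1) < t i \<and> t i - t (i - 1) < \<epsilon> \<and> Fd i \<in> X \<and> Wd i \<in> X) \<and>
      (\<Sum>i=1..N. LINT s:{t (i - 1)..t i}|lebesgue. norm (F s - Fd i)) < \<epsilon> \<and>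
      Wd 0 = W0 \<and>
      (\<forall>i\<in>{1..N}. (Wd i, Fd i - (Wd i - Wd (i - 1)) /\<^sub>R (t i - t (i - 1))) \<in> A) \<and>
      w 0 = W0 \<and> (\<forall>i\<in>{1..N}. \<forall>s\<in>{t (i - 1)<..t i}. w s = Wd i) \<and> Q) \<longleftrightarrow>
    (discretization A F W0 T \<epsilon> N t Fd Wd \<and> (\<forall>i\<in>{1..N}. Fd i \<in> X \<and> Wd i \<in> X) \<and> step_interpolant N t Wd w \<and> Q)"
    for \<epsilon> N t Fd Wd w Q
    unfolding discretization_def implicit_scheme_def step_interpolant_def
    using all[of N "\<lambda>k i. t k < t i"] all[of N "\<lambda>k i. t i - t k < \<epsilon>"]
      all[of N "\<lambda>k i. (Wd i, Fd i - (Wd i - Wd k) /\<^sub>R (t i - t k)) \<in> A"]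
      sum[of "\<lambda>k i. LINT s:{t k..t i}|lebesgue. norm (F s - Fd i)" N]
    by (auto simp: ball_conj_distrib)
  then show ?thesis unfolding mild_solution_def by presburger
qed

text \<open>If every deviation exceeded the mean deviation by a fixed amount, integration would give
  a contradiction. A value of \<open>F\<close> at an interior point, unlike an average, lies in
  \<open>X\<close> directly by the assumption on \<open>F\<close>.\<close>

lemma integral_average_point:
  fixes F :: "real \<Rightarrow> 'x::{banach, second_countable_topology}"
  assumes F: "set_integrable lebesgue {a..b} F" and ab: "a < b" and e: "0 < e"
  shows "\<exists>\<tau>\<in>{a<..<b}. (b - a) * norm (F \<tau> - c) \<le> (LINT s:{a..b}|lebesgue. norm (F s - c)) + e"
proof (rule ccontr)
  define I where "I = (LINT s:{a..b}|lebesgue. norm (F s - c))"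
  assume "\<not> ?thesis"
  then have *: "I + e \<le> (b - a) * norm (F s - c)" if "s \<in> {a<..<b}" for s
    using that by (force simp: I_def)
  have ci: "set_integrable lebesgue {x..y} (\<lambda>_. k)" for x y :: real and k :: 'x
    by (auto intro!: continuous_imp_set_integrable_lebesgue)
  have i1: "set_integrable lebesgue {a..b} (\<lambda>s. norm (F s - c))"
    by (intro set_integrable_norm set_integral_diff(1) F ci)
  have i2: "set_integrable lebesgue {a<..<b} (\<lambda>s. norm (F s - c))"
    by (rule set_integrable_subset[OF i1]) auto
  have eq: "(LINT s:{a<..<b}|lebesgue. norm (F s - c)) = I"
    unfolding I_def set_lebesgue_integral_eq_integral(2)[OF i1] set_lebesgue_integral_eq_integral(2)[OF i2]
    by (rule integral_open_interval_real[symmetric])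
  have i3: "set_integrable lebesgue {a<..<b} (\<lambda>s. I + e)"
    by (rule set_integrable_subset[of _ "{a..b}"]) (auto intro!: continuous_imp_set_integrable_lebesgue)
  have "(b - a) * (I + e) = (LINT s:{a<..<b}|lebesgue. I + e)"
    using ab by (simp add: set_lebesgue_integral_def)
  also have "\<dots> \<le> (LINT s:{a<..<b}|lebesgue. (b - a) * norm (F s - c))"
    using i2 * i3 by (intro set_integral_mono) auto
  also have "\<dots> = (b - a) * I" using eq by simp
  finally show False using ab e by (simp add: mult_le_cancel_left_pos)
qed

lemma discretization_exists:
  fixes F :: "real \<Rightarrow> 'x::{banach, second_countable_topology}"
  assumes X: "subspace X" and AX: "A \<subseteq> X \<times> X"
    and range: "\<And>x r. x \<in> X \<Longrightarrow> 0 < r \<Longrightarrow> \<exists>w z. (w, z) \<in> A \<and> w + r *\<^sub>R z = x"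
    and F: "set_integrable lebesgue {0..T} F" "\<And>t. t \<in> {0<..<T} \<Longrightarrow> F t \<in> X"
    and W0: "W0 \<in> X" and T: "0 < T" and \<epsilon>: "0 < \<epsilon>"
  shows "\<exists>N t Fd Wd. discretization A F W0 T \<epsilon> N t Fd Wd \<and> (\<forall>i\<in>{1..N}. Fd i \<in> X \<and> Wd i \<in> X)"
proof -
  \<comment> \<open>The final error is below \<open>5 e\<close>: twice the \<open>L^1\<close>
    distance of \<open>F\<close> and \<open>h\<close>, twice the oscillation \<open>L d T\<close> of
    \<open>h\<close>, and one \<open>e\<close> from the choice of the points \<tau>.\<close>
  define e where "e = \<epsilon> / 8"
  have e: "0 < e" using \<epsilon> by (simp add: e_def)
  have "integrable lebesgue (\<lambda>x. indicator {0..T} x *\<^sub>R F x)" using F by (simp add: set_integrable_def)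
  from lipschitz_dense[OF this e, of 0 T] obtain h L where
    h: "0 \<le> L" "\<And>x y. norm (h x - h y) \<le> L * \<bar>x - y\<bar>"
    and "(LINT s:{0..T}|lebesgue. norm (indicator {0..T} s *\<^sub>R F s - h s)) < e"
    by auto
  moreover have "(LINT s:{0..T}|lebesgue. norm (indicator {0..T} s *\<^sub>R F s - h s)) = (LINT s:{0..T}|lebesgue. norm (F s - h s))"
    by (intro set_lebesgue_integral_cong) auto
  ultimately have hF: "(LINT s:{0..T}|lebesgue. norm (F s - h s)) < e" by simp
  have hi: "set_integrable lebesgue {a..b} h" for a b
    by (auto intro!: continuous_imp_set_integrable_lebesgue lipschitz_imp_continuous[OF h])
  have ci: "set_integrable lebesgue {a..b} (\<lambda>_. c)" for a b :: real and c :: 'x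
    by (auto intro!: continuous_imp_set_integrable_lebesgue)
  have cr: "set_integrable lebesgue {a..b} (\<lambda>_. c)" for a b c :: real
    by (auto intro!: continuous_imp_set_integrable_lebesgue)
  \<comment> \<open>The two summands force a step \<open>d = T / N\<close> below \<epsilon> and the
    oscillation \<open>L d T\<close> below \<open>e\<close>.\<close>
  obtain N :: nat where N: "T / \<epsilon> + L * T * T / e < real N" using reals_Archimedean2 by blast
  have "0 \<le> T / \<epsilon>" "0 \<le> L * T * T / e" using T \<epsilon> e h(1) by auto
  then have N1: "T / \<epsilon> < real N" "L * T * T / e < real N" "0 < real N" using N T \<epsilon> by linarith+
  define d where "d = T / real N"
  have d: "0 < d" "d < \<epsilon>" "L * d * T \<le> e" "real N * d = T"
    using N1 T \<epsilon> e by (auto simp: d_def field_simps)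
  define t where "t k = real k * d" for k
  have td: "t (Suc k) - t k = d" for k by (simp add: t_def algebra_simps)
  have t: "t 0 = 0" "t N = T" "t k < t (Suc k)" for k
    using d by (auto simp: t_def)
  have tm: "t k \<le> t j" if "k \<le> j" for k j using that d by (simp add: t_def)
  have sub: "{t k..t (Suc k)} \<subseteq> {0..T}" if "k < N" for k
    using tm[of 0 k] tm[of "Suc k" N] that t by auto
  have Fi: "set_integrable lebesgue {t k..t (Suc k)} F" if "k < N" for k
    by (rule set_integrable_subset[OF F(1) _ sub[OF that]]) auto
  have "\<exists>\<tau>\<in>{t k<..<t (Suc k)}. d * norm (F \<tau> - h (t (Suc k))) \<le>
      (LINT s:{t k..t (Suc k)}|lebesgue. norm (F s - h (t (Suc k)))) + e / real N" if "k < N" for k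
    using integral_average_point[OF Fi[OF that] t(3), of "e / real N" "h (t (Suc k))"] e N1(3) by (simp add: td)
  then obtain \<tau> where \<tau>: "\<And>k. k < N \<Longrightarrow> \<tau> k \<in> {t k<..<t (Suc k)}"
    "\<And>k. k < N \<Longrightarrow> d * norm (F (\<tau> k) - h (t (Suc k))) \<le>
      (LINT s:{t k..t (Suc k)}|lebesgue. norm (F s - h (t (Suc k)))) + e / real N" by metis
  define Fd where "Fd i = F (\<tau> (i - 1))" for i
  have FdX: "Fd (Suc k) \<in> X" if "k < N" for k
    using \<tau>(1)[OF that] sub[OF that] F(2)[of "\<tau> k"] by (auto simp: Fd_def)
  define Wd where "Wd = rec_nat W0 (\<lambda>i w. SOME w'. (w', Fd (Suc i) - (w' - w) /\<^sub>R d) \<in> A)"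
  have Wd0: "Wd 0 = W0" by (simp add: Wd_def)
  have step: "Wd (Suc i) \<in> X \<and> (Wd (Suc i), Fd (Suc i) - (Wd (Suc i) - Wd i) /\<^sub>R d) \<in> A"
    if "Wd i \<in> X" "i < N" for i
  proof -
    \<comment> \<open>An implicit Euler step is a resolvent equation: \<open>w + d z\<close> has to
      equal \<open>Wd i + d F\<close>, which the range condition solves for any positive
      \<open>d\<close>.\<close>
    have "Wd i + d *\<^sub>R Fd (Suc i) \<in> X" using that FdX X by (intro subspace_add subspace_scale)
    from range[OF this d(1)] obtain w z where wz: "(w, z) \<in> A" "w + d *\<^sub>R z = Wd i + d *\<^sub>R Fd (Suc i)" by blast
    have "d *\<^sub>R z = d *\<^sub>R (Fd (Suc i) - (w - Wd i) /\<^sub>R d)"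
      using wz(2) d(1) by (simp add: algebra_simps)
    then have "z = Fd (Suc i) - (w - Wd i) /\<^sub>R d" using d(1) by (simp only: scaleR_cancel_left) auto
    then have ex: "\<exists>w'. (w', Fd (Suc i) - (w' - Wd i) /\<^sub>R d) \<in> A" using wz(1) by blast
    have WdS: "Wd (Suc i) = (SOME w'. (w', Fd (Suc i) - (w' - Wd i) /\<^sub>R d) \<in> A)"
      by (simp add: Wd_def)
    have "(Wd (Suc i), Fd (Suc i) - (Wd (Suc i) - Wd i) /\<^sub>R d) \<in> A"
      using someI_ex[OF ex] unfolding WdS .
    then show ?thesis using AX by auto
  qed
  have WX: "i \<le> N \<Longrightarrow> Wd i \<in> X" for i
    by (induction i) (use Wd0 W0 step in auto)
  have err: "(LINT s:{t k..t (Suc k)}|lebesgue. norm (F s - Fd (Suc k))) \<le>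
      2 * (LINT s:{t k..t (Suc k)}|lebesgue. norm (F s - h s)) + 2 * L * d * d + e / real N" if k: "k < N" for k
  proof -
    let ?I = "{t k..t (Suc k)}"
    let ?c = "h (t (Suc k))"
    have vol: "(LINT s:?I|lebesgue. (c::real)) = d * c" for c
      using t(3)[of k] td[of k] by (simp add: set_lebesgue_integral_def less_imp_le)
    have "(LINT s:?I|lebesgue. norm (F s - Fd (Suc k))) \<le> (LINT s:?I|lebesgue. norm (F s - ?c) + norm (Fd (Suc k) - ?c))"
      using norm_triangle_ineq4[of "F s - ?c" "Fd (Suc k) - ?c" for s]
      by (intro set_integral_mono set_integral_add(1) set_integrable_norm set_integral_diff(1) Fi[OF k] ci) auto
    also have "\<dots> = (LINT s:?I|lebesgue. norm (F s - ?c)) + (LINT s:?I|lebesgue. norm (Fd (Suc k) - ?c))"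
      by (intro set_integral_add set_integrable_norm set_integral_diff(1) Fi[OF k] ci)
    \<comment> \<open>The choice of \<tau> bounds the second integral, whose integrand is constant,
      by the first one up to \<open>e / N\<close>.\<close>
    also have "\<dots> \<le> 2 * (LINT s:?I|lebesgue. norm (F s - ?c)) + e / real N"
      using \<tau>(2)[OF k] by (simp add: vol Fd_def)
    also have "(LINT s:?I|lebesgue. norm (F s - ?c)) \<le> (LINT s:?I|lebesgue. norm (F s - h s) + L * d)"
    proof (intro set_integral_mono set_integral_add(1) set_integrable_norm set_integral_diff(1) Fi[OF k] ci cr hi)
      fix s assume s: "s \<in> ?I"
      have "norm (h s - ?c) \<le> L * d"
        using s td[of k] by (intro order_trans[OF h(2)] mult_left_mono h(1)) auto
      then show "norm (F s - ?c) \<le> norm (F s - h s) + L * d"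
        using norm_triangle_ineq[of "F s - h s" "h s - ?c"] by simp
    qed
    also have "\<dots> = (LINT s:?I|lebesgue. norm (F s - h s)) + L * d * d"
      using vol[of "L * d"] by (subst set_integral_add) (auto intro!: set_integrable_norm set_integral_diff(1) Fi[OF k] cr hi simp: mult_ac)
    finally show ?thesis by simp
  qed
  have "(\<Sum>k<N. LINT s:{t k..t (Suc k)}|lebesgue. norm (F s - Fd (Suc k))) \<le>
     (\<Sum>k<N. 2 * (LINT s:{t k..t (Suc k)}|lebesgue. norm (F s - h s)) + 2 * L * d * d + e / real N)"
    by (intro sum_mono err) auto
  also have "\<dots> = 2 * (\<Sum>k<N. LINT s:{t k..t (Suc k)}|lebesgue. norm (F s - h s)) + 2 * (L * d * (real N * d)) + e"
    using N1(3) by (simp add: sum.distrib sum_distrib_left[symmetric] algebra_simps)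
  also have "(\<Sum>k<N. LINT s:{t k..t (Suc k)}|lebesgue. norm (F s - h s)) = (LINT s:{t 0..t N}|lebesgue. norm (F s - h s))"
    using t less_imp_le[OF t(3)] by (intro sum_set_integral_steps set_integrable_norm set_integral_diff(1) hi) (auto simp: F)
  also have "2 * (LINT s:{t 0..t N}|lebesgue. norm (F s - h s)) + 2 * (L * d * (real N * d)) + e < \<epsilon>"
    using hF d(3,4) t(1,2) e by (simp add: e_def)
  finally have "discretization A F W0 T \<epsilon> N t Fd Wd"
    unfolding discretization_def implicit_scheme_def td
    using t d Wd0 step WX by auto
  moreover have "Fd i \<in> X \<and> Wd i \<in> X" if "i \<in> {1..N}" for i
    using that FdX[of "i - 1"] WX[of i] by auto
  ultimately show ?thesis by blast
qed

text \<open>A real supremum bounds its members only if the set is bounded above. Here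
  \<open>W\<close> is bounded on the compact interval and the step function takes finitely many
  values.\<close>

lemma step_interpolant_dist_le_Sup:
  fixes W :: "real \<Rightarrow> 'x::{banach, second_countable_topology}"
  assumes d: "discretization A F W0 T \<epsilon> N t Fd Wd" and w: "step_interpolant N t Wd w"
    and W: "continuous_on {0..T} W" and x: "x \<in> {0..T}" and "0 \<le> \<epsilon>"
  shows "norm (W x - w x) \<le> (SUP s\<in>{0..T}. norm (W s - w s))"
proof (rule cSUP_upper[OF x])
  have "bounded (W ` {0..T})" using W by (intro compact_imp_bounded compact_continuous_image) auto
  then obtain B where B: "\<And>s. s \<in> {0..T} \<Longrightarrow> norm (W s) \<le> B" unfolding bounded_iff by blast
  show "bdd_above ((\<lambda>s. norm (W s - w s)) ` {0..T})"
  proof (rule bdd_aboveI2)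
    fix s assume s: "s \<in> {0..T}"
    obtain i where "i \<le> N" "w s = Wd i" using step_interpolant_value[OF d w s \<open>0 \<le> \<epsilon>\<close>] by blast
    then have "norm (w s) \<le> (\<Sum>i\<le>N. norm (Wd i))" by (auto intro: member_le_sum)
    then show "norm (W s - w s) \<le> B + (\<Sum>i\<le>N. norm (Wd i))"
      using B[OF s] norm_triangle_ineq4[of "W s" "w s"] by linarith
  qed
qed

section \<open>Uniqueness and existence of mild solutions\<close>

theorem mild_solution_unique:
  assumes A: "accretive A" and T: "0 < T"
    and W: "mild_solution X A F W0 T W" and V: "mild_solution X A F W0 T V" and x: "x \<in> {0..T}"
  shows "W x = V x"
proof -
  have "norm (W x - V x) \<le> 0"
  proof (rule field_le_epsilon)
    fix e :: real assume e: "0 < e"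
    have F: "set_integrable lebesgue {0..T} F" "W0 \<in> closure (Domain A)" and cont: "continuous_on {0..T} W" "continuous_on {0..T} V"
      using W V T by (auto simp: mild_solution_iff L1_on_def intro: set_integrable_closed_interval)
    obtain \<delta> where \<delta>: "0 < \<delta>"
      "\<And>N t Fd Wd M s Gd Vd i j. discretization A F W0 T \<delta> N t Fd Wd \<Longrightarrow> discretization A F W0 T \<delta> M s Gd Vd \<Longrightarrow>
        i \<le> N \<Longrightarrow> j \<le> M \<Longrightarrow> \<bar>t i - s j\<bar> \<le> 3 * \<delta> \<Longrightarrow> norm (Wd i - Vd j) \<le> e / 3"
      using discretization_modulus[OF A F T, of "e / 3"] e by (metis divide_pos_pos zero_less_numeral)
    define \<epsilon> where "\<epsilon> = min \<delta> (e / 3)"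
    have \<epsilon>: "0 < \<epsilon>" "\<epsilon> \<le> \<delta>" "\<epsilon> \<le> e / 3" using \<delta>(1) e by (auto simp: \<epsilon>_def)
    obtain N t Fd Wd w where w: "discretization A F W0 T \<epsilon> N t Fd Wd" "step_interpolant N t Wd w"
      "(SUP s\<in>{0..T}. norm (W s - w s)) < \<epsilon>" using W \<epsilon>(1) unfolding mild_solution_iff by blast
    obtain M s Gd Vd v where v: "discretization A F W0 T \<epsilon> M s Gd Vd" "step_interpolant M s Vd v"
      "(SUP s\<in>{0..T}. norm (V s - v s)) < \<epsilon>" using V \<epsilon>(1) unfolding mild_solution_iff by blast
    obtain i where i: "i \<le> N" "w x = Wd i" "\<bar>x - t i\<bar> \<le> \<epsilon>"
      using step_interpolant_value[OF w(1,2) x] \<epsilon>(1) by auto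
    obtain j where j: "j \<le> M" "v x = Vd j" "\<bar>x - s j\<bar> \<le> \<epsilon>"
      using step_interpolant_value[OF v(1,2) x] \<epsilon>(1) by auto
    have "norm (Wd i - Vd j) \<le> e / 3"
      by (rule \<delta>(2)[OF discretization_mono[OF w(1) \<epsilon>(2)] discretization_mono[OF v(1) \<epsilon>(2)] i(1) j(1)])
        (use i(3) j(3) \<epsilon> in linarith)
    moreover have "norm (W x - w x) < \<epsilon>" "norm (V x - v x) < \<epsilon>"
      using step_interpolant_dist_le_Sup[OF w(1,2) cont(1) x] step_interpolant_dist_le_Sup[OF v(1,2) cont(2) x] w(3) v(3) \<epsilon>(1)
      by linarith+
    ultimately show "norm (W x - V x) \<le> 0 + e"
      using norm_triangle_ineq[of "(W x - w x) - (V x - v x)" "w x - v x"] norm_triangle_ineq4[of "W x - w x" "V x - v x"] i(2) j(2) \<epsilon>(3)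
      by simp
  qed
  then show ?thesis by simp
qed

theorem mild_solution_exists:
  fixes F :: "real \<Rightarrow> 'x::{banach, second_countable_topology}"
  assumes X: "subspace X" "closed X" and A: "accretive A" and AX: "A \<subseteq> X \<times> X"
    and range: "\<And>x r. x \<in> X \<Longrightarrow> 0 < r \<Longrightarrow> \<exists>w z. (w, z) \<in> A \<and> w + r *\<^sub>R z = x"
    and F: "L1_on T X F" and W0: "W0 \<in> X" "W0 \<in> closure (Domain A)" and T: "0 < T"
  shows "\<exists>W. mild_solution X A F W0 T W"
proof -
  have Fi: "set_integrable lebesgue {0..T} F"
    using F T by (auto simp: L1_on_def intro: set_integrable_closed_interval)
  have "\<exists>N t Fd Wd w. discretization A F W0 T (1 / real (Suc n)) N t Fd Wd \<and>
      (\<forall>i\<in>{1..N}. Fd i \<in> X \<and> Wd i \<in> X) \<and> step_interpolant N t Wd w" for n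
  proof -
    have "F s \<in> X" if "s \<in> {0<..<T}" for s using F that by (simp add: L1_on_def)
    from discretization_exists[OF X(1) AX range Fi this W0(1) T, of "1 / real (Suc n)"]
    obtain N t Fd Wd where d: "discretization A F W0 T (1 / real (Suc n)) N t Fd Wd"
      "\<forall>i\<in>{1..N}. Fd i \<in> X \<and> Wd i \<in> X" by auto
    then obtain w where "step_interpolant N t Wd w"
      using step_interpolant_exists unfolding discretization_def by blast
    then show ?thesis using d by blast
  qed
  then obtain N t Fd Wd w where
    d: "\<And>n. discretization A F W0 T (1 / real (Suc n)) (N n) (t n) (Fd n) (Wd n)" and
    dX: "\<And>n. \<forall>i\<in>{1..N n}. Fd n i \<in> X \<and> Wd n i \<in> X" and
    w: "\<And>n. step_interpolant (N n) (t n) (Wd n) (w n)" by metis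
  have Wd0: "Wd n 0 = W0" for n using d[of n] by (simp add: discretization_def)
  have wX: "w n x \<in> X" if x: "x \<in> {0..T}" for n x
  proof -
    obtain i where "i \<le> N n" "w n x = Wd n i" using step_interpolant_value[OF d[of n] w[of n] x] by auto
    then show ?thesis using dX[of n] W0(1) Wd0[of n] by (cases i) auto
  qed
  \<comment> \<open>With \<open>x = y\<close> this is the uniform Cauchy property of the step
    functions; with \<open>n = m\<close> it is an approximate equicontinuity.\<close>
  have mod: "\<exists>\<delta>>0. \<forall>n m x y. 1 / real (Suc n) \<le> \<delta> \<longrightarrow> 1 / real (Suc m) \<le> \<delta> \<longrightarrow> x \<in> {0..T} \<longrightarrow> y \<in> {0..T} \<longrightarrow>
      \<bar>x - y\<bar> \<le> \<delta> \<longrightarrow> norm (w n x - w m y) \<le> \<eta>" if \<eta>: "0 < \<eta>" for \<eta>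
  proof -
    obtain \<delta> where \<delta>: "0 < \<delta>"
      "\<And>N t Fd Wd M s Gd Vd i j. discretization A F W0 T \<delta> N t Fd Wd \<Longrightarrow> discretization A F W0 T \<delta> M s Gd Vd \<Longrightarrow>
        i \<le> N \<Longrightarrow> j \<le> M \<Longrightarrow> \<bar>t i - s j\<bar> \<le> 3 * \<delta> \<Longrightarrow> norm (Wd i - Vd j) \<le> \<eta>"
      using discretization_modulus[OF A Fi W0(2) T \<eta>] by metis
    have "norm (w n x - w m y) \<le> \<eta>" if *: "1 / real (Suc n) \<le> \<delta>" "1 / real (Suc m) \<le> \<delta>" "x \<in> {0..T}" "y \<in> {0..T}"
      "\<bar>x - y\<bar> \<le> \<delta>" for n m x y
    proof -
      obtain i where i: "i \<le> N n" "w n x = Wd n i" "\<bar>x - t n i\<bar> \<le> \<delta>"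
        using step_interpolant_value[OF discretization_mono[OF d *(1)] w *(3)] \<delta>(1) by auto
      obtain j where j: "j \<le> N m" "w m y = Wd m j" "\<bar>y - t m j\<bar> \<le> \<delta>"
        using step_interpolant_value[OF discretization_mono[OF d *(2)] w *(4)] \<delta>(1) by auto
      show ?thesis unfolding i(2) j(2)
        by (rule \<delta>(2)[OF discretization_mono[OF d *(1)] discretization_mono[OF d *(2)] i(1) j(1)])
          (use i(3) j(3) *(5) in linarith)
    qed
    then show ?thesis using \<delta>(1) by blast
  qed
  have mod': "\<exists>\<delta>>0. \<forall>n m x. 1 / real (Suc n) \<le> \<delta> \<longrightarrow> 1 / real (Suc m) \<le> \<delta> \<longrightarrow> x \<in> {0..T} \<longrightarrow>
      norm (w n x - w m x) \<le> \<eta>" if \<eta>: "0 < \<eta>" for \<eta>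
  proof -
    obtain \<delta> where "0 < \<delta>" and \<delta>: "\<forall>n m x y. 1 / real (Suc n) \<le> \<delta> \<longrightarrow> 1 / real (Suc m) \<le> \<delta> \<longrightarrow> x \<in> {0..T} \<longrightarrow> y \<in> {0..T} \<longrightarrow>
      \<bar>x - y\<bar> \<le> \<delta> \<longrightarrow> norm (w n x - w m y) \<le> \<eta>"
      using mod[OF \<eta>] by blast
    have "norm (w n x - w m x) \<le> \<eta>" if "1 / real (Suc n) \<le> \<delta>" "1 / real (Suc m) \<le> \<delta>" "x \<in> {0..T}" for n m x
      using \<delta>[rule_format, OF that that(3)] \<open>0 < \<delta>\<close> by simp
    then show ?thesis using \<open>0 < \<delta>\<close> by blast
  qed
  have small: "\<forall>\<^sub>F n in sequentially. 1 / real (Suc n) \<le> \<delta>" if "0 < \<delta>" for \<delta> :: real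
    using order_tendstoD(2)[OF LIMSEQ_Suc[OF lim_1_over_n] that] by eventually_elim auto
  have "convergent (\<lambda>n. w n x)" if x: "x \<in> {0..T}" for x
  proof (rule Cauchy_convergent, rule CauchyI)
    fix e :: real assume "0 < e"
    then obtain \<delta> where \<delta>: "0 < \<delta>" "\<And>n m. 1 / real (Suc n) \<le> \<delta> \<Longrightarrow> 1 / real (Suc m) \<le> \<delta> \<Longrightarrow> norm (w n x - w m x) \<le> e / 2"
      using mod'[of "e / 2"] x half_gt_zero by metis
    obtain M where "\<And>n. n \<ge> M \<Longrightarrow> 1 / real (Suc n) \<le> \<delta>" using small[OF \<delta>(1)] by (auto simp: eventually_sequentially)
    then have "norm (w m x - w n x) < e" if "m \<ge> M" "n \<ge> M" for m n
      using \<delta>(2)[of m n] that \<open>0 < e\<close> by (smt (verit, best) field_sum_of_halves)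
    then show "\<exists>M. \<forall>m\<ge>M. \<forall>n\<ge>M. norm (w m x - w n x) < e" by blast
  qed
  then obtain W where W: "\<And>x. x \<in> {0..T} \<Longrightarrow> (\<lambda>n. w n x) \<longlonglongrightarrow> W x"
    unfolding convergent_def by metis
  have wW: "\<exists>\<delta>>0. \<forall>n x. 1 / real (Suc n) \<le> \<delta> \<longrightarrow> x \<in> {0..T} \<longrightarrow> norm (w n x - W x) \<le> \<eta>" if \<eta>: "0 < \<eta>" for \<eta>
  proof -
    obtain \<delta> where \<delta>: "0 < \<delta>" "\<And>n m x. 1 / real (Suc n) \<le> \<delta> \<Longrightarrow> 1 / real (Suc m) \<le> \<delta> \<Longrightarrow> x \<in> {0..T} \<Longrightarrow> norm (w n x - w m x) \<le> \<eta>"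
      using mod'[OF \<eta>] by metis
    have "norm (w n x - W x) \<le> \<eta>" if "1 / real (Suc n) \<le> \<delta>" "x \<in> {0..T}" for n x
    proof (rule tendsto_upperbound)
      show "(\<lambda>m. norm (w n x - w m x)) \<longlonglongrightarrow> norm (w n x - W x)" by (intro tendsto_intros W that)
      show "\<forall>\<^sub>F m in sequentially. norm (w n x - w m x) \<le> \<eta>"
        using small[OF \<delta>(1)] by eventually_elim (use \<delta>(2) that in blast)
    qed simp
    then show ?thesis using \<delta>(1) by blast
  qed
  \<comment> \<open>The step functions jump, but their common modulus holds for all large
    \<open>n\<close> at a fixed distance \<delta>, which suffices for the limit.\<close>
  have "continuous_on {0..T} W"
    unfolding continuous_on_iff
  proof (intro ballI allI impI)
    fix x e assume x: "x \<in> {0..T}" and e: "(0::real) < e"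
    obtain \<delta> where \<delta>: "0 < \<delta>" "\<And>n m x y. 1 / real (Suc n) \<le> \<delta> \<Longrightarrow> 1 / real (Suc m) \<le> \<delta> \<Longrightarrow> x \<in> {0..T} \<Longrightarrow> y \<in> {0..T} \<Longrightarrow>
        \<bar>x - y\<bar> \<le> \<delta> \<Longrightarrow> norm (w n x - w m y) \<le> e / 2"
      using mod[OF half_gt_zero[OF e]] by metis
    have "dist (W y) (W x) < e" if y: "y \<in> {0..T}" "dist y x < \<delta>" for y
    proof -
      have "norm (W y - W x) \<le> e / 2"
      proof (rule tendsto_upperbound)
        show "(\<lambda>m. norm (w m y - w m x)) \<longlonglongrightarrow> norm (W y - W x)" by (intro tendsto_intros W x y)
        show "\<forall>\<^sub>F m in sequentially. norm (w m y - w m x) \<le> e / 2"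
          using small[OF \<delta>(1)] by eventually_elim (rule \<delta>(2), use x y in \<open>auto simp: dist_real_def\<close>)
      qed simp
      then show ?thesis using e by (simp add: dist_norm)
    qed
    then show "\<exists>d>0. \<forall>y\<in>{0..T}. dist y x < d \<longrightarrow> dist (W y) (W x) < e" using \<delta>(1) by blast
  qed
  moreover have "W x \<in> X" if x: "x \<in> {0..T}" for x
    using closed_sequentially[OF X(2) wX[OF x] W[OF x]] .
  moreover have "W 0 = W0"
  proof -
    have "w n 0 = W0" for n using w[of n] Wd0[of n] by (simp add: step_interpolant_def)
    then show ?thesis using W[of 0] T by (simp add: LIMSEQ_const_iff)
  qed
  moreover have "\<exists>N t Fd Wd w. discretization A F W0 T \<epsilon> N t Fd Wd \<and>
      (\<forall>i\<in>{1..N}. Fd i \<in> X \<and> Wd i \<in> X) \<and> step_interpolant N t Wd w \<and>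
      (SUP s\<in>{0..T}. norm (W s - w s)) < \<epsilon>" if \<epsilon>: "0 < \<epsilon>" for \<epsilon>
  proof -
    obtain \<delta> where \<delta>: "0 < \<delta>" "\<And>n x. 1 / real (Suc n) \<le> \<delta> \<Longrightarrow> x \<in> {0..T} \<Longrightarrow> norm (w n x - W x) \<le> \<epsilon> / 2"
      using wW[OF half_gt_zero[OF \<epsilon>]] by metis
    obtain n where n: "1 / real (Suc n) \<le> min \<delta> \<epsilon>" using small[of "min \<delta> \<epsilon>"] \<delta>(1) \<epsilon> by (auto simp: eventually_sequentially)
    have "(SUP s\<in>{0..T}. norm (W s - w n s)) \<le> \<epsilon> / 2"
      using \<delta>(2)[of n] n T by (intro cSUP_least) (auto simp: norm_minus_commute)
    then have "(SUP s\<in>{0..T}. norm (W s - w n s)) < \<epsilon>" using \<epsilon> by linarith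
    moreover have "discretization A F W0 T \<epsilon> (N n) (t n) (Fd n) (Wd n)"
      using discretization_mono[OF d] n by auto
    ultimately show ?thesis using dX[of n] w[of n] by blast
  qed
  ultimately show ?thesis unfolding mild_solution_iff using F W0 by blast
qed

section \<open>Integration over a bounded open segment\<close>

text \<open>A finite measure of its own, so that dominated convergence and almost everywhere
  arguments run without indicator functions. For \<open>x \<le> l\<close>, integration over
  \<open>seg x\<close> also expresses the primitive at \<open>x\<close>; for \<open>x = 0\<close>
  the space is empty.\<close>

definition seg :: "real \<Rightarrow> real measure" where
  "seg l = restrict_space lborel {0<..<l}"

lemma space_seg [simp]: "space (seg l) = {0<..<l}"
  by (simp add: seg_def)

lemma seg_integrable_iff: "integrable (seg l) f \<longleftrightarrow> set_integrable lborel {0<..<l} (f :: real \<Rightarrow> real)"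
  unfolding seg_def set_integrable_def by (rule integrable_restrict_space) simp

lemma set_integral_seg: "(LBINT x:{0<..<l}. f x) = (LINT x|seg l. f x :: real)"
  unfolding seg_def set_lebesgue_integral_def by (rule integral_restrict_space[symmetric]) simp

lemma AE_seg_iff: "(AE x in seg l. P x) \<longleftrightarrow> (AE x in lborel. x \<in> {0<..<l} \<longrightarrow> P x)"
  unfolding seg_def by (rule AE_restrict_space_iff) simp

lemma seg_measurable_iff:
  "f \<in> borel_measurable (seg l) \<longleftrightarrow> set_borel_measurable lborel {0<..<l} (f :: real \<Rightarrow> real)"
  unfolding seg_def set_borel_measurable_def by (subst borel_measurable_restrict_space_iff) auto

lemma seg_measurableI: "f \<in> borel_measurable borel \<Longrightarrow> f \<in> borel_measurable (seg l)"
  unfolding seg_def by (rule measurable_restrict_space1) simp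

lemma seg_measurable_continuous:
  fixes f :: "real \<Rightarrow> real"
  assumes "continuous_on {0..l} f" shows "f \<in> borel_measurable (seg l)"
proof -
  have "continuous_on {0<..<l} f" by (rule continuous_on_subset[OF assms]) auto
  then show ?thesis
    using set_measurable_continuous_on[of "{0<..<l}" f]
    by (auto simp: seg_measurable_iff set_borel_measurable_def)
qed

lemma finite_measure_seg: "finite_measure (seg l)"
proof (rule finite_measureI)
  have "emeasure (seg l) (space (seg l)) = emeasure lborel {0<..<l}"
    unfolding seg_def by (subst emeasure_restrict_space) auto
  also have "\<dots> \<noteq> \<infinity>" by (cases "0 \<le> l") auto
  finally show "emeasure (seg l) (space (seg l)) \<noteq> \<infinity>" .
qed

lemma measure_seg: "0 \<le> l \<Longrightarrow> measure (seg l) {0<..<l} = l"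
  unfolding seg_def by (subst measure_restrict_space) auto

lemma seg_integrable_const [simp]: "integrable (seg l) (\<lambda>_. c :: real)"
  by (rule finite_measure.integrable_const[OF finite_measure_seg])

lemma seg_integrable_bounded:
  fixes f :: "real \<Rightarrow> real"
  assumes "f \<in> borel_measurable (seg l)" "\<And>x. 0 < x \<Longrightarrow> x < l \<Longrightarrow> \<bar>f x\<bar> \<le> B"
  shows "integrable (seg l) f"
  by (rule finite_measure.integrable_const_bound[OF finite_measure_seg _ assms(1), of B])
    (use assms(2) in \<open>auto intro!: AE_I2\<close>)

lemma seg_integrable_mult_bounded:
  fixes f g :: "real \<Rightarrow> real"
  assumes "integrable (seg l) f" "g \<in> borel_measurable (seg l)" "\<And>x. 0 < x \<Longrightarrow> x < l \<Longrightarrow> \<bar>g x\<bar> \<le> B"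
  shows "integrable (seg l) (\<lambda>x. f x * g x)"
proof (rule Bochner_Integration.integrable_bound[of _ "\<lambda>x. B * f x"])
  show "AE x in seg l. norm (f x * g x) \<le> norm (B * f x)"
  proof (rule AE_I2)
    fix x assume "x \<in> space (seg l)"
    then have "\<bar>g x\<bar> \<le> \<bar>B\<bar>" using assms(3)[of x] by auto
    then show "norm (f x * g x) \<le> norm (B * f x)"
      using mult_left_mono[of "\<bar>g x\<bar>" "\<bar>B\<bar>" "\<bar>f x\<bar>"] by (simp add: abs_mult mult.commute)
  qed
qed (use assms in auto)

lemma continuous_bounded_Icc:
  fixes f :: "real \<Rightarrow> real"
  assumes "continuous_on {0..l} f" obtains B where "0 \<le> B" "\<And>x. 0 \<le> x \<Longrightarrow> x \<le> l \<Longrightarrow> \<bar>f x\<bar> \<le> B"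
proof -
  have "bounded (f ` {0..l})" using assms by (intro compact_imp_bounded compact_continuous_image) auto
  then obtain B where "\<forall>y\<in>f ` {0..l}. norm y \<le> B" by (auto simp: bounded_iff)
  then show thesis by (intro that[of "\<bar>B\<bar>"]) force+
qed

lemma seg_integrable_continuous:
  fixes f :: "real \<Rightarrow> real"
  assumes "continuous_on {0..l} f" shows "integrable (seg l) f"
proof -
  obtain B where "0 \<le> B" "\<And>x. 0 \<le> x \<Longrightarrow> x \<le> l \<Longrightarrow> \<bar>f x\<bar> \<le> B" using continuous_bounded_Icc[OF assms] by blast
  then show ?thesis by (intro seg_integrable_bounded[of _ _ B] seg_measurable_continuous assms) auto
qed

lemma seg_integrable_mult_continuous:
  fixes f g :: "real \<Rightarrow> real"
  assumes "integrable (seg l) f" "continuous_on {0..l} g"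
  shows "integrable (seg l) (\<lambda>x. f x * g x)"
proof -
  obtain B where "0 \<le> B" "\<And>x. 0 \<le> x \<Longrightarrow> x \<le> l \<Longrightarrow> \<bar>g x\<bar> \<le> B" using continuous_bounded_Icc[OF assms(2)] by blast
  then show ?thesis using assms by (intro seg_integrable_mult_bounded[of _ _ _ B] seg_measurable_continuous) auto
qed

lemma seg_integral_eq_integral:
  assumes "integrable (seg l) f"
  shows "(LINT x|seg l. f x :: real) = integral {0..l} f" "f integrable_on {0..l}"
  using set_borel_integral_eq_integral[of "{0<..<l}" f] assms
  by (auto simp: seg_integrable_iff set_integral_seg integral_open_interval_real integrable_on_open_interval_real)

lemma seg_integral_FTC:
  assumes "0 \<le> l" "continuous_on {0..l} f"
    and "\<And>x. x \<in> {0..l} \<Longrightarrow> (F has_real_derivative f x) (at x within {0..l})"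
  shows "(LINT x|seg l. f x) = F l - F 0"
proof -
  have "(f has_integral F l - F 0) {0..l}"
    using assms by (intro fundamental_theorem_of_calculus) (auto simp: has_real_derivative_iff_has_vector_derivative)
  then show ?thesis
    using seg_integral_eq_integral(1)[OF seg_integrable_continuous[OF assms(2)]] by (simp add: integral_unique)
qed

lemma seg_integrable_subset:
  assumes "integrable (seg l) (f :: real \<Rightarrow> real)" "x \<le> l" shows "integrable (seg x) f"
  using assms unfolding seg_integrable_iff by (auto intro: set_integrable_subset)

lemma seg_integral_mono_length:
  assumes "integrable (seg l) (f :: real \<Rightarrow> real)" "x \<le> l" "\<And>y. 0 < y \<Longrightarrow> y < l \<Longrightarrow> 0 \<le> f y"
  shows "(LINT y|seg x. f y) \<le> (LINT y|seg l. f y)"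
  unfolding set_integral_seg[symmetric] set_lebesgue_integral_def
  using assms seg_integrable_subset[OF assms(1,2)]
  by (intro Bochner_Integration.integral_mono) (auto simp: seg_integrable_iff set_integrable_def indicator_def)

lemma seg_primitive_continuous:
  assumes "integrable (seg l) (f :: real \<Rightarrow> real)"
  shows "continuous_on {0..l} (\<lambda>x. LINT y|seg x. f y)"
proof (rule continuous_on_eq)
  show "continuous_on {0..l} (\<lambda>x. integral {0..x} f)"
    by (rule indefinite_integral_continuous_1[OF seg_integral_eq_integral(2)[OF assms]])
  show "integral {0..x} f = (LINT y|seg x. f y)" if "x \<in> {0..l}" for x
    using seg_integral_eq_integral(1)[OF seg_integrable_subset[OF assms, of x]] that by simp
qed

lemma seg_integral_Icc_eq:
  assumes f: "integrable (seg l) (f :: real \<Rightarrow> real)" and ab: "0 \<le> a" "a \<le> b" "b \<le> l"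
  shows "(LBINT y:{a..b}. f y) = (LINT y|seg b. f y) - (LINT y|seg a. f y)" "set_integrable lborel {a..b} f"
proof -
  have i: "set_integrable lborel {0..l} f"
    using f unfolding seg_integrable_iff
    by (subst set_integrable_discrete_difference[where X = "{0, l}" and B = "{0<..<l}"]) auto
  show j: "set_integrable lborel {a..b} f" by (rule set_integrable_subset[OF i]) (use ab in auto)
  have "integral {0..a} f + integral {a..b} f = integral {0..b} f"
    using ab seg_integral_eq_integral(2)[OF seg_integrable_subset[OF f ab(3)]]
    by (intro Henstock_Kurzweil_Integration.integral_combine)
  then show "(LBINT y:{a..b}. f y) = (LINT y|seg b. f y) - (LINT y|seg a. f y)"
    using set_borel_integral_eq_integral(2)[OF j] seg_integral_eq_integral(1)[OF seg_integrable_subset[OF f, of a]]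
      seg_integral_eq_integral(1)[OF seg_integrable_subset[OF f, of b]] ab by simp
qed

text \<open>The hypothesis makes the integral vanish over all intervals. The sets with this property
  are closed under complements and disjoint countable unions, so they include all Borel sets. This
  gives uniqueness of the weak derivative.\<close>

lemma seg_primitive_zero_imp_AE_zero:
  assumes g: "integrable (seg l) g" and zero: "\<And>x. 0 \<le> x \<Longrightarrow> x \<le> l \<Longrightarrow> (LINT y|seg x. g y :: real) = 0"
  shows "AE x in seg l. g x = 0"
proof (cases "0 \<le> l")
  case True
  define h where "h = (\<lambda>x. indicator {0<..<l} x * g x)"
  have h: "integrable lborel h" using g by (simp add: seg_integrable_iff set_integrable_def h_def)
  have hA: "set_integrable lborel A h" if "A \<in> sets borel" for A
    using h that by (simp add: set_integrable_def integrable_mult_indicator[of A lborel h, simplified])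
  have tot: "(LINT x|lborel. h x) = 0"
    using zero[OF True order_refl] by (simp add: set_integral_seg[symmetric] set_lebesgue_integral_def h_def)
  have int: "(LBINT x:{a..b}. h x) = 0" if "a \<le> b" for a b
  proof (cases "max a 0 \<le> min b l")
    case c: True
    have "(LBINT x:{a..b}. h x) = (LBINT x:{max a 0..min b l}. g x)"
      unfolding set_lebesgue_integral_def
      by (rule integral_discrete_difference[of "{0, l}"]) (auto simp: h_def indicator_def)
    also have "\<dots> = 0"
      using seg_integral_Icc_eq(1)[OF g _ c] zero c True by simp
    finally show ?thesis .
  next
    case False
    then have "indicator {a..b} x *\<^sub>R h x = 0" for x by (auto simp: h_def indicator_def)
    then show ?thesis by (simp only: set_lebesgue_integral_def) simp
  qed
  have "(LBINT x:A. h x) = 0" if "A \<in> sets borel" for A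
    using that
  proof (induction rule: borel_set_induct)
    case empty
    show ?case by (simp add: set_lebesgue_integral_def)
  next
    case (interval a b)
    then show ?case by (rule int)
  next
    case (compl A)
    have "(LBINT x:A \<union> - A. h x) = (LBINT x:A. h x) + (LBINT x:- A. h x)"
      using compl(1) by (intro set_integral_Un hA) auto
    then show ?case using compl(2) tot by (simp add: set_lebesgue_integral_def)
  next
    case (union F)
    have "(LBINT x:(\<Union>i. F i). h x) = (\<Sum>i. LBINT x:F i. h x)"
      using union(1,2) by (intro lebesgue_integral_countable_add hA) (auto simp: disjoint_family_on_def)
    then show ?case using union(3) by simp
  qed
  then have "AE x in lborel. h x = 0"
    by (intro density_unique_real[OF h]) (auto simp: set_lebesgue_integral_def)
  then show ?thesis unfolding AE_seg_iff by eventually_elim (auto simp: h_def)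
next
  case False
  then show ?thesis by (auto simp: AE_seg_iff)
qed

lemma seg_approx_continuous:
  assumes "integrable (seg l) (g :: real \<Rightarrow> real)" "0 < e"
  shows "\<exists>h. continuous_on UNIV h \<and> (LINT x|seg l. \<bar>g x - h x\<bar>) < e"
proof -
  define g0 where "g0 = (\<lambda>x. indicator {0<..<l} x * g x)"
  have g0: "integrable lborel g0" using assms(1) by (simp add: seg_integrable_iff set_integrable_def g0_def)
  then have "integrable lebesgue g0" using integrable_completion[of g0 lborel] by auto
  from lipschitz_dense[OF this assms(2), of 0 l] obtain h L where
    h: "0 \<le> L" "\<And>x y. norm (h x - h y) \<le> L * \<bar>x - y\<bar>" "(LINT s:{0..l}|lebesgue. norm (g0 s - h s)) < e" by blast
  have c: "continuous_on S h" for S by (rule lipschitz_imp_continuous[OF h(1,2)])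
  have g0s: "g0 x = g x" if "x \<in> {0<..<l}" for x using that by (simp add: g0_def)
  have "integrable (seg l) (\<lambda>x. \<bar>g x - h x\<bar>)" using assms(1) seg_integrable_continuous[OF c] by auto
  then have "(LINT x|seg l. \<bar>g x - h x\<bar>) = integral {0..l} (\<lambda>x. \<bar>g x - h x\<bar>)" by (rule seg_integral_eq_integral)
  also have "\<dots> = integral {0..l} (\<lambda>x. \<bar>g0 x - h x\<bar>)"
    unfolding integral_open_interval_real by (intro Henstock_Kurzweil_Integration.integral_cong) (simp add: g0s)
  also have "\<dots> = (LINT s:{0..l}|lebesgue. norm (g0 s - h s))"
  proof -
    have "set_integrable lebesgue {0..l} g0"
      using \<open>integrable lebesgue g0\<close> unfolding set_integrable_def by (intro integrable_mult_indicator) auto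
    then have "set_integrable lebesgue {0..l} (\<lambda>s. norm (g0 s - h s))"
      using continuous_imp_set_integrable_lebesgue[OF c] by (intro set_integrable_norm set_integral_diff(1))
    from set_lebesgue_integral_eq_integral(2)[OF this] show ?thesis by simp
  qed
  finally show ?thesis using h(3) c by (intro exI[of _ h]) auto
qed

section \<open>Calculus for primitives of integrable functions\<close>

lemma seg_integral_tendsto:
  fixes F :: "nat \<Rightarrow> real \<Rightarrow> real"
  assumes "\<And>n. integrable (seg l) (F n)" "integrable (seg l) G"
    and "\<And>n. (LINT x|seg l. \<bar>F n x - G x\<bar>) \<le> e n" "e \<longlonglongrightarrow> 0"
  shows "(\<lambda>n. LINT x|seg l. F n x) \<longlonglongrightarrow> (LINT x|seg l. G x)"
proof (rule LIM_zero_cancel, rule Lim_null_comparison[OF _ assms(4)], rule always_eventually, rule allI)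
  fix n
  have "norm ((LINT x|seg l. F n x) - (LINT x|seg l. G x)) = \<bar>LINT x|seg l. F n x - G x\<bar>"
    using assms(1,2) by simp
  also have "\<dots> \<le> (LINT x|seg l. \<bar>F n x - G x\<bar>)" by (rule integral_abs_bound)
  finally show "norm ((LINT x|seg l. F n x) - (LINT x|seg l. G x)) \<le> e n" using assms(3)[of n] by linarith
qed

text \<open>Continuous approximations in \<open>L^1\<close> have continuously differentiable
  primitives, which converge uniformly. Integration by parts and the chain rule are thus inherited
  from the fundamental theorem of calculus.\<close>

lemma seg_primitive_approx:
  assumes "integrable (seg l) (g :: real \<Rightarrow> real)"
  obtains h :: "nat \<Rightarrow> real \<Rightarrow> real" where "\<And>n. continuous_on UNIV (h n)" "\<And>n. integrable (seg l) (h n)"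
    "(\<lambda>n. LINT x|seg l. \<bar>g x - h n x\<bar>) \<longlonglongrightarrow> 0"
    "\<And>n x. 0 \<le> x \<Longrightarrow> x \<le> l \<Longrightarrow> \<bar>(LINT y|seg x. g y) - (LINT y|seg x. h n y)\<bar> \<le> (LINT y|seg l. \<bar>g y - h n y\<bar>)"
proof -
  have "\<forall>n. \<exists>h. continuous_on UNIV h \<and> (LINT x|seg l. \<bar>g x - h x\<bar>) < 1 / real (Suc n)"
    using seg_approx_continuous[OF assms] by simp
  then obtain h where h: "\<And>n. continuous_on UNIV (h n)" "\<And>n. (LINT x|seg l. \<bar>g x - h n x\<bar>) < 1 / real (Suc n)"
    by metis
  have hi: "integrable (seg l) (h n)" for n
    by (rule seg_integrable_continuous) (rule continuous_on_subset[OF h(1)], simp)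
  show thesis
  proof (rule that[OF h(1) hi])
    show "(\<lambda>n. LINT x|seg l. \<bar>g x - h n x\<bar>) \<longlonglongrightarrow> 0"
    proof (rule tendsto_sandwich[OF _ _ tendsto_const LIMSEQ_Suc[OF lim_1_over_n]])
      show "\<forall>\<^sub>F n in sequentially. (LINT x|seg l. \<bar>g x - h n x\<bar>) \<le> 1 / real (Suc n)"
        using h(2) by (intro always_eventually allI less_imp_le)
    qed simp
    fix n x assume x: "0 \<le> x" "x \<le> l"
    note sub = seg_integrable_subset[OF _ x(2)]
    have "\<bar>(LINT y|seg x. g y) - (LINT y|seg x. h n y)\<bar> = \<bar>LINT y|seg x. g y - h n y\<bar>"
      using sub[OF assms] sub[OF hi] by simp
    also have "\<dots> \<le> (LINT y|seg x. \<bar>g y - h n y\<bar>)" by (rule integral_abs_bound)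
    also have "\<dots> \<le> (LINT y|seg l. \<bar>g y - h n y\<bar>)"
      using assms hi x by (intro seg_integral_mono_length) auto
    finally show "\<bar>(LINT y|seg x. g y) - (LINT y|seg x. h n y)\<bar> \<le> (LINT y|seg l. \<bar>g y - h n y\<bar>)" .
  qed
qed

lemma seg_primitive_deriv:
  assumes "continuous_on UNIV (h :: real \<Rightarrow> real)" "x \<in> {0..l}"
  shows "((\<lambda>x. c + (LINT y|seg x. h y)) has_real_derivative h x) (at x within {0..l})"
proof -
  have "((\<lambda>x. integral {0..x} h) has_real_derivative h x) (at x within {0..l})"
    by (rule integral_has_real_derivative[OF continuous_on_subset[OF assms(1)] assms(2)]) simp
  then have "((\<lambda>x. c + integral {0..x} h) has_real_derivative 0 + h x) (at x within {0..l})"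
    by (intro DERIV_add) auto
  moreover have "c + integral {0..x} h = c + (LINT y|seg x. h y)" if "x \<in> {0..l}" for x
    using seg_integral_eq_integral(1)[OF seg_integrable_continuous, OF continuous_on_subset[OF assms(1)], of x] by simp
  ultimately show ?thesis
    using assms(2) by (auto intro: has_field_derivative_transform_within[of _ _ _ _ 1])
qed

lemma seg_integration_by_parts:
  assumes g: "integrable (seg l) g" and l: "0 \<le> l"
    and \<psi>: "\<And>x. x \<in> {0..l} \<Longrightarrow> (\<psi> has_real_derivative \<psi>' x) (at x within {0..l})" "continuous_on {0..l} \<psi>'"
    and U: "\<And>x. x \<in> {0..l} \<Longrightarrow> U x = c + (LINT y|seg x. g y)"
  shows "(LINT x|seg l. U x * \<psi>' x) + (LINT x|seg l. g x * \<psi> x) = U l * \<psi> l - U 0 * \<psi> 0"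
proof -
  obtain h where h: "\<And>n. continuous_on UNIV (h n)" "\<And>n. integrable (seg l) (h n)"
    "(\<lambda>n. LINT x|seg l. \<bar>g x - h n x\<bar>) \<longlonglongrightarrow> 0"
    "\<And>n x. 0 \<le> x \<Longrightarrow> x \<le> l \<Longrightarrow> \<bar>(LINT y|seg x. g y) - (LINT y|seg x. h n y)\<bar> \<le> (LINT y|seg l. \<bar>g y - h n y\<bar>)"
    using seg_primitive_approx[OF g] by blast
  define e where "e n = (LINT x|seg l. \<bar>g x - h n x\<bar>)" for n
  define V where "V n x = c + (LINT y|seg x. h n y)" for n x
  have \<psi>c: "continuous_on {0..l} \<psi>" using \<psi>(1) by (intro DERIV_continuous_on)
  have Vd: "(V n has_real_derivative h n x) (at x within {0..l})" if "x \<in> {0..l}" for n x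
    unfolding V_def by (rule seg_primitive_deriv[OF h(1) that])
  have Vc: "continuous_on {0..l} (V n)" for n using Vd by (intro DERIV_continuous_on)
  have hc: "continuous_on {0..l} (h n)" for n by (rule continuous_on_subset[OF h(1)]) simp
  have Uc: "continuous_on {0..l} U"
    by (rule continuous_on_eq[of _ "\<lambda>x. c + (LINT y|seg x. g y)"]) (auto intro!: continuous_intros seg_primitive_continuous g simp: U)
  have VU: "\<bar>V n x - U x\<bar> \<le> e n" if "x \<in> {0..l}" for n x
    using h(4)[of x n] that by (simp add: V_def U e_def abs_minus_commute)
  have V_lim: "(\<lambda>n. V n x) \<longlonglongrightarrow> U x" if "x \<in> {0..l}" for x
    by (rule LIM_zero_cancel, rule Lim_null_comparison[OF _ h(3)]) (use VU[OF that] in \<open>simp add: e_def\<close>)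
  have parts: "(LINT x|seg l. V n x * \<psi>' x) + (LINT x|seg l. h n x * \<psi> x) = V n l * \<psi> l - V n 0 * \<psi> 0" for n
  proof -
    have "(LINT x|seg l. V n x * \<psi>' x) + (LINT x|seg l. h n x * \<psi> x) = (LINT x|seg l. V n x * \<psi>' x + h n x * \<psi> x)"
      by (intro Bochner_Integration.integral_add[symmetric] seg_integrable_continuous continuous_intros Vc hc \<psi>c \<psi>(2))
    also have "\<dots> = V n l * \<psi> l - V n 0 * \<psi> 0"
      by (rule seg_integral_FTC[where F = "\<lambda>x. V n x * \<psi> x", OF l])
        (auto intro!: continuous_intros Vc hc \<psi>c \<psi>(2) derivative_eq_intros Vd \<psi>(1) simp: mult.commute)
    finally show ?thesis .
  qed
  obtain B where B: "0 \<le> B" "\<And>x. 0 \<le> x \<Longrightarrow> x \<le> l \<Longrightarrow> \<bar>\<psi> x\<bar> \<le> B" using continuous_bounded_Icc[OF \<psi>c] by blast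
  have "(\<lambda>n. LINT x|seg l. V n x * \<psi>' x) \<longlonglongrightarrow> (LINT x|seg l. U x * \<psi>' x)"
  proof (rule seg_integral_tendsto)
    show "integrable (seg l) (\<lambda>x. V n x * \<psi>' x)" for n
      by (intro seg_integrable_continuous continuous_intros Vc \<psi>(2))
    show "integrable (seg l) (\<lambda>x. U x * \<psi>' x)"
      by (intro seg_integrable_continuous continuous_intros Uc \<psi>(2))
    show "(LINT x|seg l. \<bar>V n x * \<psi>' x - U x * \<psi>' x\<bar>) \<le> e n * (LINT x|seg l. \<bar>\<psi>' x\<bar>)" for n
    proof -
      have "(LINT x|seg l. \<bar>V n x * \<psi>' x - U x * \<psi>' x\<bar>) \<le> (LINT x|seg l. e n * \<bar>\<psi>' x\<bar>)"
        using VU by (intro Bochner_Integration.integral_mono seg_integrable_continuous continuous_intros Vc Uc \<psi>(2))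
          (auto simp: left_diff_distrib[symmetric] abs_mult intro!: mult_right_mono)
      then show ?thesis by simp
    qed
    show "(\<lambda>n. e n * (LINT x|seg l. \<bar>\<psi>' x\<bar>)) \<longlonglongrightarrow> 0"
      unfolding e_def by (intro tendsto_mult_left_zero h(3))
  qed
  moreover have "(\<lambda>n. LINT x|seg l. h n x * \<psi> x) \<longlonglongrightarrow> (LINT x|seg l. g x * \<psi> x)"
  proof (rule seg_integral_tendsto)
    show "integrable (seg l) (\<lambda>x. h n x * \<psi> x)" for n
      by (rule seg_integrable_mult_continuous[OF h(2) \<psi>c])
    show "integrable (seg l) (\<lambda>x. g x * \<psi> x)"
      by (rule seg_integrable_mult_continuous[OF g \<psi>c])
    show "(LINT x|seg l. \<bar>h n x * \<psi> x - g x * \<psi> x\<bar>) \<le> e n * B" for n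
    proof -
      have "integrable (seg l) (\<lambda>x. \<bar>(h n x - g x) * \<psi> x\<bar>)"
        using h(2) g by (intro integrable_abs seg_integrable_mult_continuous \<psi>c) auto
      then have "(LINT x|seg l. \<bar>h n x * \<psi> x - g x * \<psi> x\<bar>) \<le> (LINT x|seg l. \<bar>g x - h n x\<bar> * B)"
        using B h(2) g by (intro Bochner_Integration.integral_mono)
          (auto simp: left_diff_distrib[symmetric] abs_mult abs_minus_commute intro!: mult_left_mono)
      then show ?thesis by (simp add: e_def)
    qed
    show "(\<lambda>n. e n * B) \<longlonglongrightarrow> 0"
      unfolding e_def by (intro tendsto_mult_left_zero h(3))
  qed
  ultimately have "(\<lambda>n. V n l * \<psi> l - V n 0 * \<psi> 0) \<longlonglongrightarrow> (LINT x|seg l. U x * \<psi>' x) + (LINT x|seg l. g x * \<psi> x)"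
    unfolding parts[symmetric] by (intro tendsto_add)
  moreover have "(\<lambda>n. V n l * \<psi> l - V n 0 * \<psi> 0) \<longlonglongrightarrow> U l * \<psi> l - U 0 * \<psi> 0"
    using l by (intro tendsto_intros V_lim) auto
  ultimately show ?thesis by (rule LIMSEQ_unique)
qed

text \<open>The bound \<open>B\<close> on \<open>H'\<close> is used twice: it controls the
  replacement of \<open>h n\<close> by \<open>g\<close> under the integral, and it provides the
  dominating function \<open>B |g|\<close> when \<open>H' (V n)\<close> converges to
  \<open>H' (U)\<close>.\<close>

lemma seg_chain_rule:
  assumes g: "integrable (seg l) g" and l: "0 \<le> l"
    and H: "\<And>r. (H has_real_derivative H' r) (at r)" "continuous_on UNIV H'" "\<And>r. \<bar>H' r\<bar> \<le> B"
    and U: "\<And>x. x \<in> {0..l} \<Longrightarrow> U x = c + (LINT y|seg x. g y)"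
  shows "H (U l) = H (U 0) + (LINT x|seg l. H' (U x) * g x)"
proof -
  obtain h where h: "\<And>n. continuous_on UNIV (h n)" "\<And>n. integrable (seg l) (h n)"
    "(\<lambda>n. LINT x|seg l. \<bar>g x - h n x\<bar>) \<longlonglongrightarrow> 0"
    "\<And>n x. 0 \<le> x \<Longrightarrow> x \<le> l \<Longrightarrow> \<bar>(LINT y|seg x. g y) - (LINT y|seg x. h n y)\<bar> \<le> (LINT y|seg l. \<bar>g y - h n y\<bar>)"
    using seg_primitive_approx[OF g] by blast
  define e where "e n = (LINT x|seg l. \<bar>g x - h n x\<bar>)" for n
  define V where "V n x = c + (LINT y|seg x. h n y)" for n x
  have B0: "0 \<le> B" using H(3)[of 0] by linarith
  have Vd: "(V n has_real_derivative h n x) (at x within {0..l})" if "x \<in> {0..l}" for n x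
    unfolding V_def by (rule seg_primitive_deriv[OF h(1) that])
  have Vc: "continuous_on {0..l} (V n)" for n using Vd by (intro DERIV_continuous_on)
  have hc: "continuous_on {0..l} (h n)" for n by (rule continuous_on_subset[OF h(1)]) simp
  have Uc: "continuous_on {0..l} U"
    by (rule continuous_on_eq[of _ "\<lambda>x. c + (LINT y|seg x. g y)"]) (auto intro!: continuous_intros seg_primitive_continuous g simp: U)
  have H'c: "continuous_on S (\<lambda>x. H' (f x))" if "continuous_on S f" for S and f :: "real \<Rightarrow> real"
    by (rule continuous_on_compose2[OF H(2) that]) simp
  have V_lim: "(\<lambda>n. V n x) \<longlonglongrightarrow> U x" if "x \<in> {0..l}" for x
  proof (rule LIM_zero_cancel, rule Lim_null_comparison[OF _ h(3)])
    show "\<forall>\<^sub>F n in sequentially. norm (V n x - U x) \<le> (LINT x|seg l. \<bar>g x - h n x\<bar>)"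
      using h(4)[of x] that by (simp add: V_def U abs_minus_commute)
  qed
  have FTC: "(LINT x|seg l. H' (V n x) * h n x) = H (V n l) - H (V n 0)" for n
  proof (rule seg_integral_FTC[where F = "\<lambda>x. H (V n x)", OF l])
    show "continuous_on {0..l} (\<lambda>x. H' (V n x) * h n x)"
      by (intro continuous_intros H'c Vc hc)
    show "((\<lambda>x. H (V n x)) has_real_derivative H' (V n x) * h n x) (at x within {0..l})" if "x \<in> {0..l}" for x
      by (rule DERIV_chain2[OF H(1) Vd[OF that]])
  qed
  have gH: "integrable (seg l) (\<lambda>x. H' (V n x) * g x)" for n
    using seg_integrable_mult_continuous[OF g H'c[OF Vc]] by (simp add: mult.commute)
  have "(\<lambda>n. (LINT x|seg l. H' (V n x) * h n x) - (LINT x|seg l. H' (V n x) * g x)) \<longlonglongrightarrow> 0"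
  proof (rule Lim_null_comparison[of _ "\<lambda>n. e n * B"], rule always_eventually, rule allI)
    fix n
    have i: "integrable (seg l) (\<lambda>x. H' (V n x) * h n x)"
      by (intro seg_integrable_continuous continuous_intros H'c Vc hc)
    have "norm ((LINT x|seg l. H' (V n x) * h n x) - (LINT x|seg l. H' (V n x) * g x))
       = \<bar>LINT x|seg l. H' (V n x) * h n x - H' (V n x) * g x\<bar>" using i gH by simp
    also have "\<dots> \<le> (LINT x|seg l. \<bar>H' (V n x) * h n x - H' (V n x) * g x\<bar>)" by (rule integral_abs_bound)
    also have "\<dots> \<le> (LINT x|seg l. \<bar>g x - h n x\<bar> * B)"
    proof (rule Bochner_Integration.integral_mono)
      show "integrable (seg l) (\<lambda>x. \<bar>H' (V n x) * h n x - H' (V n x) * g x\<bar>)" using i gH by auto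
      show "integrable (seg l) (\<lambda>x. \<bar>g x - h n x\<bar> * B)" using g h(2) by auto
      fix x show "\<bar>H' (V n x) * h n x - H' (V n x) * g x\<bar> \<le> \<bar>g x - h n x\<bar> * B"
      proof -
        have "H' (V n x) * h n x - H' (V n x) * g x = - ((g x - h n x) * H' (V n x))" by (simp add: algebra_simps)
        then show ?thesis
          using mult_left_mono[OF H(3)[of "V n x"], of "\<bar>g x - h n x\<bar>"] by (simp only: abs_minus abs_mult)
      qed
    qed
    finally show "norm ((LINT x|seg l. H' (V n x) * h n x) - (LINT x|seg l. H' (V n x) * g x)) \<le> e n * B"
      by (simp add: e_def)
  next
    show "(\<lambda>n. e n * B) \<longlonglongrightarrow> 0" unfolding e_def by (intro tendsto_mult_left_zero h(3))
  qed
  moreover have "(\<lambda>n. LINT x|seg l. H' (V n x) * g x) \<longlonglongrightarrow> (LINT x|seg l. H' (U x) * g x)"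
  proof (rule integral_dominated_convergence[where w = "\<lambda>x. B * \<bar>g x\<bar>"])
    show "AE x in seg l. (\<lambda>n. H' (V n x) * g x) \<longlonglongrightarrow> H' (U x) * g x"
    proof (rule AE_I2)
      fix x assume "x \<in> space (seg l)"
      then have "(\<lambda>n. V n x) \<longlonglongrightarrow> U x" by (intro V_lim) auto
      then have "(\<lambda>n. H' (V n x)) \<longlonglongrightarrow> H' (U x)"
        by (rule isCont_tendsto_compose[rotated]) (use H(2) in \<open>simp add: continuous_on_eq_continuous_at\<close>)
      then show "(\<lambda>n. H' (V n x) * g x) \<longlonglongrightarrow> H' (U x) * g x" by (intro tendsto_intros)
    qed
    show "AE x in seg l. norm (H' (V n x) * g x) \<le> B * \<bar>g x\<bar>" for n
      using H(3) by (auto simp: abs_mult intro!: mult_right_mono AE_I2)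
    show "(\<lambda>x. H' (U x) * g x) \<in> borel_measurable (seg l)"
      by (rule borel_measurable_times[OF seg_measurable_continuous[OF H'c[OF Uc]] borel_measurable_integrable[OF g]])
    show "(\<lambda>x. H' (V n x) * g x) \<in> borel_measurable (seg l)" for n using gH by auto
  qed (use g in auto)
  ultimately have "(\<lambda>n. ((LINT x|seg l. H' (V n x) * h n x) - (LINT x|seg l. H' (V n x) * g x)) + (LINT x|seg l. H' (V n x) * g x))
     \<longlonglongrightarrow> 0 + (LINT x|seg l. H' (U x) * g x)" by (rule tendsto_add)
  then have "(\<lambda>n. H (V n l) - H (V n 0)) \<longlonglongrightarrow> (LINT x|seg l. H' (U x) * g x)" by (simp add: FTC)
  moreover have "(\<lambda>n. H (V n l) - H (V n 0)) \<longlonglongrightarrow> H (U l) - H (U 0)"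
    using l by (intro tendsto_diff isCont_tendsto_compose[OF DERIV_isCont[OF H(1)]] V_lim) auto
  ultimately show ?thesis using LIMSEQ_unique by fastforce
qed

section \<open>Sobolev functions of one variable\<close>

lemma in_Lp_iff:
  "in_Lp p l u \<longleftrightarrow> u \<in> borel_measurable (seg l) \<and> integrable (seg l) (\<lambda>x. \<bar>u x\<bar> powr p)"
  by (simp add: in_Lp_def seg_measurable_iff seg_integrable_iff)

lemma abs_le_one_add_powr:
  fixes x p :: real assumes "1 \<le> p" shows "\<bar>x\<bar> \<le> 1 + \<bar>x\<bar> powr p"
proof (cases "\<bar>x\<bar> \<le> 1")
  case False
  then have "\<bar>x\<bar> powr 1 \<le> \<bar>x\<bar> powr p" using assms by (intro powr_mono) auto
  then show ?thesis using False by simp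
qed (simp add: add_increasing2)

lemma in_Lp_integrable:
  assumes "in_Lp p l u" "1 \<le> p" shows "integrable (seg l) u"
proof (rule Bochner_Integration.integrable_bound[of _ "\<lambda>x. 1 + \<bar>u x\<bar> powr p"])
  show "AE x in seg l. norm (u x) \<le> norm (1 + \<bar>u x\<bar> powr p)"
    using abs_le_one_add_powr[OF assms(2)] by (intro AE_I2) (auto intro: order_trans)
qed (use assms in \<open>auto simp: in_Lp_iff\<close>)

lemma in_Lp_bounded:
  assumes "u \<in> borel_measurable (seg l)" "0 \<le> p" "\<And>x. 0 < x \<Longrightarrow> x < l \<Longrightarrow> \<bar>u x\<bar> \<le> B"
  shows "in_Lp p l u"
  unfolding in_Lp_iff
  using assms by (auto intro!: seg_integrable_bounded[of _ _ "B powr p"] powr_mono2)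

lemma in_Lp_continuous:
  assumes "continuous_on {0..l} u" "0 \<le> p" shows "in_Lp p l u"
proof -
  obtain B where "0 \<le> B" "\<And>x. 0 \<le> x \<Longrightarrow> x \<le> l \<Longrightarrow> \<bar>u x\<bar> \<le> B" using continuous_bounded_Icc[OF assms(1)] by blast
  then show ?thesis using assms by (intro in_Lp_bounded[of _ _ _ B] seg_measurable_continuous) auto
qed

lemma powr_add_le:
  fixes x y p :: real assumes "0 \<le> p"
  shows "\<bar>x + y\<bar> powr p \<le> 2 powr p * (\<bar>x\<bar> powr p + \<bar>y\<bar> powr p)"
proof -
  have "\<bar>x + y\<bar> powr p \<le> (2 * max \<bar>x\<bar> \<bar>y\<bar>) powr p" using assms by (intro powr_mono2) auto
  also have "\<dots> = 2 powr p * (max \<bar>x\<bar> \<bar>y\<bar> powr p)" by (simp add: powr_mult)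
  also have "\<dots> \<le> 2 powr p * (\<bar>x\<bar> powr p + \<bar>y\<bar> powr p)" by (intro mult_left_mono) (auto simp: max_def)
  finally show ?thesis .
qed

lemma in_Lp_add:
  assumes "in_Lp p l u" "in_Lp p l v" "0 \<le> p" shows "in_Lp p l (\<lambda>x. u x + v x)"
  unfolding in_Lp_iff
proof
  show "integrable (seg l) (\<lambda>x. \<bar>u x + v x\<bar> powr p)"
    by (rule Bochner_Integration.integrable_bound[of _ "\<lambda>x. 2 powr p * (\<bar>u x\<bar> powr p + \<bar>v x\<bar> powr p)"])
      (use assms powr_add_le[OF assms(3)] in \<open>auto simp: in_Lp_iff intro!: AE_I2\<close>)
qed (use assms in \<open>auto simp: in_Lp_iff\<close>)

lemma in_Lp_cmult:
  assumes "in_Lp p l u" shows "in_Lp p l (\<lambda>x. c * u x)"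
  using assms unfolding in_Lp_iff by (auto simp: abs_mult powr_mult)

lemma in_Lp_mult_bounded:
  assumes "in_Lp p l u" "b \<in> borel_measurable (seg l)" "\<And>x. 0 < x \<Longrightarrow> x < l \<Longrightarrow> \<bar>b x\<bar> \<le> B" "0 \<le> p"
  shows "in_Lp p l (\<lambda>x. b x * u x)"
  unfolding in_Lp_iff
proof
  have "integrable (seg l) (\<lambda>x. \<bar>u x\<bar> powr p * \<bar>b x\<bar> powr p)"
    using assms by (intro seg_integrable_mult_bounded[of _ _ _ "B powr p"]) (auto simp: in_Lp_iff intro: powr_mono2)
  then show "integrable (seg l) (\<lambda>x. \<bar>b x * u x\<bar> powr p)" by (simp add: abs_mult powr_mult mult.commute)
qed (use assms in \<open>auto simp: in_Lp_iff\<close>)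

text \<open>Absolutely continuous functions with derivative in \<open>L^p\<close>, in integrated
  form. Working with the pair \<open>(u, g)\<close> avoids any reference to the particular
  representative that \<open>weak_deriv\<close> selects.\<close>

definition sobolev_rep :: "real \<Rightarrow> real \<Rightarrow> (real \<Rightarrow> real) \<Rightarrow> (real \<Rightarrow> real) \<Rightarrow> bool" where
  "sobolev_rep p l u g \<longleftrightarrow> in_Lp p l g \<and> (\<forall>x\<in>{0..l}. u x = u 0 + (LINT y|seg x. g y))"

lemma sobolev_repD:
  assumes "sobolev_rep p l u g"
  shows "in_Lp p l g" "x \<in> {0..l} \<Longrightarrow> u x = u 0 + (LINT y|seg x. g y)"
  using assms unfolding sobolev_rep_def by blast+

lemma sobolev_repI:
  assumes "in_Lp p l g" "\<And>x. x \<in> {0..l} \<Longrightarrow> u x = u 0 + (LINT y|seg x. g y)"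
  shows "sobolev_rep p l u g"
  using assms unfolding sobolev_rep_def by blast

text \<open>The lemma of du Bois-Reymond. The test function is a primitive of
  \<open>(w - c) \<kappa>\<close> with a continuous bump \<kappa>; pairing it with \<open>w\<close>
  gives a vanishing integral of \<open>(w - c)^2 \<kappa>\<close>. Since test functions need only be
  continuously differentiable, no smoothing is necessary.\<close>

lemma constant_if_weak_deriv_zero:
  assumes w: "continuous_on {0..l} w" and l: "0 < l"
    and weak: "\<And>\<psi>. test_function l \<psi> \<Longrightarrow> (LINT x|seg l. w x * deriv \<psi> x) = 0"
  shows "\<And>x. x \<in> {0..l} \<Longrightarrow> w x = w 0"
proof -
  have inner: "\<exists>c. \<forall>x\<in>{d<..<l - d}. w x = c" if d: "0 < d" "d < l / 2" for d
  proof -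
    \<comment> \<open>Test functions live on the whole line, so \<open>w\<close> is extended
      continuously by its endpoint values.\<close>
    define v where "v x = w (max 0 (min l x))" for x
    have vc: "continuous_on S v" for S
      unfolding v_def by (rule continuous_on_compose2[OF w]) (use l in \<open>auto intro!: continuous_intros\<close>)
    define \<kappa> where "\<kappa> x = max 0 ((x - d) * (l - d - x))" for x
    have \<kappa>c: "continuous_on S \<kappa>" for S unfolding \<kappa>_def by (intro continuous_intros)
    have \<kappa>0: "0 \<le> \<kappa> x" for x by (simp add: \<kappa>_def)
    have \<kappa>out: "\<kappa> x = 0" if "x \<le> d \<or> l - d \<le> x" for x
    proof -
      have "(x - d) * (l - d - x) \<le> 0"
        using that
      proof
        assume "x \<le> d" then show ?thesis using d by (intro mult_nonpos_nonneg) auto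
      next
        assume "l - d \<le> x" then show ?thesis using d by (intro mult_nonneg_nonpos) auto
      qed
      then show ?thesis by (simp add: \<kappa>_def)
    qed
    have \<kappa>in: "0 < \<kappa> x" if "x \<in> {d<..<l - d}" for x using that by (simp add: \<kappa>_def)
    have \<kappa>int: "0 < integral {0..l} \<kappa>"
    proof -
      have "integral {0..l} \<kappa> \<noteq> 0"
        using integral_eq_0_iff[OF \<kappa>c l \<kappa>0] \<kappa>in[of "l / 2"] d l by (auto intro!: bexI[of _ "l / 2"])
      moreover have "0 \<le> integral {0..l} \<kappa>" using \<kappa>0 by (intro Henstock_Kurzweil_Integration.integral_nonneg integrable_continuous_real \<kappa>c) auto
      ultimately show ?thesis by linarith
    qed
    \<comment> \<open>The mean of \<open>v\<close> weighted by \<kappa>: with it \<eta> has integral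
      0, and its primitive \<psi> vanishes to the right of the support as well as to the
      left.\<close>
    define c where "c = integral {0..l} (\<lambda>x. v x * \<kappa> x) / integral {0..l} \<kappa>"
    define \<eta> where "\<eta> x = (v x - c) * \<kappa> x" for x
    have \<eta>c: "continuous_on S \<eta>" for S unfolding \<eta>_def by (intro continuous_intros vc \<kappa>c)
    have \<eta>int: "integral {0..l} \<eta> = 0"
    proof -
      have "integral {0..l} \<eta> = integral {0..l} (\<lambda>x. v x * \<kappa> x - c * \<kappa> x)"
        by (intro Henstock_Kurzweil_Integration.integral_cong) (simp add: \<eta>_def algebra_simps)
      also have "\<dots> = integral {0..l} (\<lambda>x. v x * \<kappa> x) - c * integral {0..l} \<kappa>"
        by (subst Henstock_Kurzweil_Integration.integral_diff) (auto intro!: integrable_continuous_real continuous_intros vc \<kappa>c)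
      also have "\<dots> = 0" using \<kappa>int by (simp add: c_def)
      finally show ?thesis .
    qed
    have "\<exists>F. \<forall>x::real. - \<infinity> < ereal x \<longrightarrow> ereal x < \<infinity> \<longrightarrow> (F has_vector_derivative \<eta> x) (at x)"
      by (rule einterval_antiderivative) (use \<eta>c[of UNIV] in \<open>auto simp: continuous_on_eq_continuous_at\<close>)
    then obtain F where F: "\<And>x. (F has_real_derivative \<eta> x) (at x)"
      by (auto simp: has_real_derivative_iff_has_vector_derivative)
    define \<psi> where "\<psi> x = F x - F 0" for x
    have \<psi>d: "(\<psi> has_real_derivative \<eta> x) (at x)" for x unfolding \<psi>_def by (auto intro!: derivative_eq_intros F)
    have deriv\<psi>: "deriv \<psi> = \<eta>" using DERIV_imp_deriv[OF \<psi>d] by auto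
    have const: "\<psi> a = \<psi> b" if "a \<le> b" "\<And>x. a \<le> x \<Longrightarrow> x \<le> b \<Longrightarrow> \<eta> x = 0" for a b
    proof (cases "a = b")
      case False
      have "\<psi> b = \<psi> a"
      proof (rule DERIV_isconst_end[of a b \<psi>])
        show "continuous_on {a..b} \<psi>"
          by (intro continuous_at_imp_continuous_on ballI DERIV_isCont[OF \<psi>d])
        show "(\<psi> has_real_derivative 0) (at x)" if "a < x" "x < b" for x
          using \<psi>d[of x] \<open>\<And>x. a \<le> x \<Longrightarrow> x \<le> b \<Longrightarrow> \<eta> x = 0\<close>[of x] that by simp
      qed (use that False in simp)
      then show ?thesis by simp
    qed simp
    have \<psi>0: "\<psi> 0 = 0" by (simp add: \<psi>_def)
    have \<psi>l: "\<psi> l = 0"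
    proof -
      have "(\<eta> has_integral \<psi> l - \<psi> 0) {0..l}"
        using l by (intro fundamental_theorem_of_calculus) (auto simp: has_real_derivative_iff_has_vector_derivative[symmetric] intro: DERIV_subset[OF \<psi>d])
      then show ?thesis using \<eta>int \<psi>0 by (simp add: integral_unique)
    qed
    have \<psi>left: "\<psi> x = 0" if "x \<le> d" for x
    proof (cases "0 \<le> x")
      case True then show ?thesis using const[of 0 x] \<psi>0 that \<kappa>out by (simp add: \<eta>_def)
    next
      case False then show ?thesis using const[of x 0] \<psi>0 d \<kappa>out by (simp add: \<eta>_def)
    qed
    have \<psi>right: "\<psi> x = 0" if "l - d \<le> x" for x
    proof (cases "l \<le> x")
      case True then show ?thesis using const[of l x] \<psi>l d \<kappa>out by (simp add: \<eta>_def)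
    next
      case False then show ?thesis using const[of x l] \<psi>l that d \<kappa>out by (simp add: \<eta>_def)
    qed
    have "test_function l \<psi>"
      unfolding test_function_def deriv\<psi>
    proof (intro conjI allI \<eta>c)
      show "\<psi> differentiable at x" for x using \<psi>d[of x] by (auto simp: differentiable_def has_field_derivative_def)
      have "closure {x. \<psi> x \<noteq> 0} \<subseteq> {d..l - d}"
      proof (rule closure_minimal)
        show "{x. \<psi> x \<noteq> 0} \<subseteq> {d..l - d}"
        proof
          fix x assume "x \<in> {x. \<psi> x \<noteq> 0}"
          then have "\<not> x \<le> d" "\<not> l - d \<le> x" using \<psi>left[of x] \<psi>right[of x] by blast+
          then show "x \<in> {d..l - d}" by simp
        qed
      qed simp
      also have "{d..l - d} \<subseteq> {0<..<l}" using d by auto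
      finally show "closure {x. \<psi> x \<noteq> 0} \<subseteq> {0<..<l}" .
    qed
    then have "0 = (LINT x|seg l. w x * \<eta> x)" using weak[of \<psi>] by (simp add: deriv\<psi>)
    also have "\<dots> = integral {0..l} (\<lambda>x. w x * \<eta> x)"
      by (intro seg_integral_eq_integral(1) seg_integrable_continuous continuous_intros w \<eta>c)
    also have "\<dots> = integral {0..l} (\<lambda>x. (v x - c) * \<eta> x + c * \<eta> x)"
      by (intro Henstock_Kurzweil_Integration.integral_cong) (auto simp: v_def algebra_simps)
    also have "\<dots> = integral {0..l} (\<lambda>x. (v x - c) * \<eta> x) + c * integral {0..l} \<eta>"
      by (subst Henstock_Kurzweil_Integration.integral_add) (auto intro!: integrable_continuous_real continuous_intros vc \<eta>c)
    finally have zi: "integral {0..l} (\<lambda>x. (v x - c) * \<eta> x) = 0" using \<eta>int by simp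
    have nonneg: "0 \<le> (v x - c) * \<eta> x" for x
    proof -
      have "(v x - c) * \<eta> x = (v x - c)\<^sup>2 * \<kappa> x" by (simp add: \<eta>_def power2_eq_square)
      then show ?thesis using \<kappa>0[of x] by simp
    qed
    have "continuous_on {0..l} (\<lambda>x. (v x - c) * \<eta> x)" by (intro continuous_intros vc \<eta>c)
    from iffD1[OF integral_eq_0_iff[OF this l nonneg] zi]
    have z: "\<forall>x\<in>{0..l}. (v x - c) * \<eta> x = 0" .
    have "w x = c" if "x \<in> {d<..<l - d}" for x
    proof -
      have "(v x - c) * ((v x - c) * \<kappa> x) = 0" using bspec[OF z, of x] that d by (simp add: \<eta>_def)
      then have "v x = c" using \<kappa>in[OF that] by simp
      then show ?thesis using that d by (simp add: v_def max_def min_def split: if_splits)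
    qed
    then show ?thesis by blast
  qed
  have int: "w x = w (l / 2)" if "x \<in> {0<..<l}" for x
  proof -
    \<comment> \<open>The constant supplied by \<open>inner\<close> may depend on \<open>d\<close>.
      This \<open>d\<close> is small enough for the inner interval to contain both \<open>x\<close>
      and \<open>l / 2\<close>, so the midpoint serves as a common reference.\<close>
    define d where "d = min (min x (l - x)) (l / 2) / 2"
    have d: "0 < d" "d < l / 2" "d < x" "x < l - d" "l / 2 \<in> {d<..<l - d}"
      using that l by (auto simp: d_def min_def field_simps)
    from inner[OF d(1,2)] obtain c where "\<forall>x\<in>{d<..<l - d}. w x = c" by blast
    then show ?thesis using d by auto
  qed
  have all: "w x = w (l / 2)" if "x \<in> {0..l}" for x
  proof -
    have cl: "closure {0<..<l} = {0..l}" using l by simp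
    have "continuous_on (closure {0<..<l}) w" "x \<in> closure {0<..<l}" unfolding cl using w that by blast+
    then show ?thesis using continuous_constant_on_closure[of "{0<..<l}" w "w (l / 2)" x] int by blast
  qed
  have "w 0 = w (l / 2)" by (rule all) (use l in simp)
  then show "w x = w 0" if "x \<in> {0..l}" for x using all[OF that] by argo
qed

text \<open>By integration by parts the primitive of the weak derivative has the same weak
  derivative as \<open>u\<close>, so their difference is constant.\<close>

lemma W1p_imp_sobolev_rep:
  assumes "W1p p l u" "continuous_on {0..l} u" "1 \<le> p" "0 < l"
  shows "sobolev_rep p l u (weak_deriv p l u)"
proof -
  define g where "g = weak_deriv p l u"
  have wd: "has_weak_deriv p l u g"
    using assms(1) unfolding W1p_def g_def weak_deriv_def by (metis someI_ex)
  then have Lp: "in_Lp p l g" by (simp add: has_weak_deriv_def)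
  have g: "integrable (seg l) g" by (rule in_Lp_integrable[OF Lp assms(3)])
  have pc: "continuous_on {0..l} (\<lambda>x. LINT y|seg x. g y)" by (rule seg_primitive_continuous[OF g])
  have cst: "(u x - (LINT y|seg x. g y)) = (u 0 - (LINT y|seg 0. g y))" if "x \<in> {0..l}" for x
  proof (rule constant_if_weak_deriv_zero[where w = "\<lambda>x. u x - (LINT y|seg x. g y)" and l = l])
    show "continuous_on {0..l} (\<lambda>x. u x - (LINT y|seg x. g y))" by (intro continuous_intros assms(2) pc)
    fix \<psi> assume t: "test_function l \<psi>"
    have d: "(\<psi> has_real_derivative deriv \<psi> x) (at x)" for x
      using t by (simp add: test_function_def real_differentiable_def DERIV_deriv_iff_real_differentiable)
    have dc: "continuous_on {0..l} (deriv \<psi>)" using t by (auto simp: test_function_def intro: continuous_on_subset[of UNIV])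
    have z: "\<psi> x = 0" if "x \<notin> {0<..<l}" for x
      using t that closure_subset[of "{x. \<psi> x \<noteq> 0}"] by (auto simp: test_function_def)
    have "(LINT x|seg l. (LINT y|seg x. g y) * deriv \<psi> x) + (LINT x|seg l. g x * \<psi> x)
       = (LINT y|seg l. g y) * \<psi> l - (LINT y|seg 0. g y) * \<psi> 0"
      by (rule seg_integration_by_parts[where c = 0, OF g _ DERIV_subset[OF d] dc]) (use assms(4) in auto)
    then have "(LINT x|seg l. (LINT y|seg x. g y) * deriv \<psi> x) = - (LINT x|seg l. g x * \<psi> x)"
      using z by simp
    moreover have "(LINT x|seg l. u x * deriv \<psi> x) = - (LINT x|seg l. g x * \<psi> x)"
      using wd t by (simp add: has_weak_deriv_def set_integral_seg)
    moreover have "(LINT x|seg l. (u x - (LINT y|seg x. g y)) * deriv \<psi> x) =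
        (LINT x|seg l. u x * deriv \<psi> x) - (LINT x|seg l. (LINT y|seg x. g y) * deriv \<psi> x)"
      unfolding left_diff_distrib
      by (intro Bochner_Integration.integral_diff seg_integrable_continuous continuous_intros assms(2) pc dc)
    ultimately show "(LINT x|seg l. (u x - (LINT y|seg x. g y)) * deriv \<psi> x) = 0" by simp
  qed (use assms(4) that in auto)
  have z0: "(LINT y|seg 0. g y) = 0"
    by (simp add: set_integral_seg[symmetric] set_lebesgue_integral_def)
  have "u x = u 0 + (LINT y|seg x. g y)" if "x \<in> {0..l}" for x
    using cst[OF that] z0 by linarith
  then show ?thesis using Lp unfolding g_def by (intro sobolev_repI)
qed

lemma sobolev_rep_integrable: "sobolev_rep p l u g \<Longrightarrow> 1 \<le> p \<Longrightarrow> integrable (seg l) g"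
  by (rule in_Lp_integrable[OF sobolev_repD(1)])

lemma sobolev_rep_continuous:
  assumes "sobolev_rep p l u g" "1 \<le> p" shows "continuous_on {0..l} u"
proof (rule continuous_on_eq)
  show "continuous_on {0..l} (\<lambda>x. u 0 + (LINT y|seg x. g y))"
    by (intro continuous_intros seg_primitive_continuous sobolev_rep_integrable[OF assms])
qed (rule sobolev_repD(2)[OF assms(1), symmetric])

text \<open>Identifies the chosen weak derivative: it and \<open>g\<close> have the same primitive
  \<open>u x - u 0\<close> on every initial segment, hence agree almost everywhere.\<close>

lemma sobolev_rep_imp_W1p:
  assumes "sobolev_rep p l u g" "1 \<le> p" "0 < l"
  shows "W1p p l u" "AE x in seg l. weak_deriv p l u x = g x"
proof -
  have c: "continuous_on {0..l} u" and g: "integrable (seg l) g"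
    using sobolev_rep_continuous[OF assms(1,2)] sobolev_rep_integrable[OF assms(1,2)] by auto
  have u: "u x = u 0 + (LINT y|seg x. g y)" if "x \<in> {0..l}" for x by (rule sobolev_repD(2)[OF assms(1) that])
  have "has_weak_deriv p l u g"
    unfolding has_weak_deriv_def set_integral_seg
  proof (intro conjI allI impI)
    show "in_Lp p l g" by (rule sobolev_repD(1)[OF assms(1)])
    fix \<psi> assume t: "test_function l \<psi>"
    have d: "(\<psi> has_real_derivative deriv \<psi> x) (at x)" for x
      using t by (simp add: test_function_def real_differentiable_def DERIV_deriv_iff_real_differentiable)
    have dc: "continuous_on {0..l} (deriv \<psi>)" using t by (auto simp: test_function_def intro: continuous_on_subset[of UNIV])
    have z: "\<psi> x = 0" if "x \<notin> {0<..<l}" for x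
      using t that closure_subset[of "{x. \<psi> x \<noteq> 0}"] by (auto simp: test_function_def)
    have "(LINT x|seg l. u x * deriv \<psi> x) + (LINT x|seg l. g x * \<psi> x) = u l * \<psi> l - u 0 * \<psi> 0"
      by (rule seg_integration_by_parts[OF g _ DERIV_subset[OF d] dc u]) (use assms(3) in auto)
    then show "(LINT x|seg l. u x * deriv \<psi> x) = - (LINT x|seg l. g x * \<psi> x)" using z by simp
  qed
  then show W: "W1p p l u"
    unfolding W1p_def using in_Lp_continuous[OF c] assms(2) by auto
  have r: "sobolev_rep p l u (weak_deriv p l u)" by (rule W1p_imp_sobolev_rep[OF W c assms(2,3)])
  have w: "integrable (seg l) (weak_deriv p l u)" by (rule sobolev_rep_integrable[OF r assms(2)])
  have "AE x in seg l. weak_deriv p l u x - g x = 0"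
  proof (rule seg_primitive_zero_imp_AE_zero)
    fix x assume x: "0 \<le> x" "x \<le> l"
    then have xi: "x \<in> {0..l}" by simp
    have "(LINT y|seg x. weak_deriv p l u y) = u x - u 0" "(LINT y|seg x. g y) = u x - u 0"
      using sobolev_repD(2)[OF r xi] u[OF xi] by linarith+
    then show "(LINT y|seg x. weak_deriv p l u y - g y) = 0"
      using seg_integrable_subset[OF w x(2)] seg_integrable_subset[OF g x(2)] by simp
  qed (use w g in auto)
  then show "AE x in seg l. weak_deriv p l u x = g x" by simp
qed

lemma sobolev_rep_add:
  assumes u: "sobolev_rep p l u g" and v: "sobolev_rep p l v h" and p: "1 \<le> p"
  shows "sobolev_rep p l (\<lambda>x. u x + v x) (\<lambda>x. g x + h x)"
proof (rule sobolev_repI)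
  show "in_Lp p l (\<lambda>x. g x + h x)"
    using p by (intro in_Lp_add sobolev_repD(1)[OF u] sobolev_repD(1)[OF v]) simp
  fix x assume x: "x \<in> {0..l}"
  then have "integrable (seg x) g" "integrable (seg x) h"
    using seg_integrable_subset[OF sobolev_rep_integrable[OF u p], of x]
      seg_integrable_subset[OF sobolev_rep_integrable[OF v p], of x] by simp_all
  then show "u x + v x = u 0 + v 0 + (LINT y|seg x. g y + h y)"
    using sobolev_repD(2)[OF u x] sobolev_repD(2)[OF v x] Bochner_Integration.integral_add[of "seg x" g h] by linarith
qed

lemma sobolev_rep_cmult:
  assumes "sobolev_rep p l u g" shows "sobolev_rep p l (\<lambda>x. c * u x) (\<lambda>x. c * g x)"
proof (rule sobolev_repI)
  fix x assume "x \<in> {0..l}"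
  then have "u x = u 0 + (LINT y|seg x. g y)" by (rule sobolev_repD(2)[OF assms])
  then have "c * u x = c * (u 0 + (LINT y|seg x. g y))" by (rule arg_cong)
  then show "c * u x = c * u 0 + (LINT y|seg x. c * g y)" by (simp add: distrib_left)
qed (rule in_Lp_cmult[OF sobolev_repD(1)[OF assms]])

lemma sobolev_rep_compose:
  assumes u: "sobolev_rep p l u g" "1 \<le> p"
    and H: "\<And>r. (H has_real_derivative H' r) (at r)" "continuous_on UNIV H'" "\<And>r. \<bar>H' r\<bar> \<le> B"
  shows "sobolev_rep p l (\<lambda>x. H (u x)) (\<lambda>x. H' (u x) * g x)"
proof (rule sobolev_repI)
  have c: "continuous_on {0..l} u" by (rule sobolev_rep_continuous[OF u])
  have "continuous_on {0..l} (\<lambda>x. H' (u x))" by (rule continuous_on_compose2[OF H(2) c]) simp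
  then show "in_Lp p l (\<lambda>x. H' (u x) * g x)"
    using u(2) H(3) by (intro in_Lp_mult_bounded[of _ _ _ _ B] seg_measurable_continuous sobolev_repD(1)[OF u(1)]) auto
  fix x assume x: "x \<in> {0..l}"
  show "H (u x) = H (u 0) + (LINT y|seg x. H' (u y) * g y)"
    by (rule seg_chain_rule[OF _ _ H sobolev_repD(2)[OF u(1)]])
      (use x in \<open>auto intro: seg_integrable_subset[OF sobolev_rep_integrable[OF u]]\<close>)
qed

section \<open>The state space\<close>

lemma rep_plus_L1R: "AE x in lborel. rep_L1R (u + v) x = rep_L1R u x + rep_L1R v x"
proof -
  have "u + v = abs_L1R (\<lambda>x. rep_L1R u x + rep_L1R v x)"
    using plus_abs_L1R[of "rep_L1R u" "rep_L1R v"] by simp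
  then show ?thesis using rep_abs_L1R[of "\<lambda>x. rep_L1R u x + rep_L1R v x"] by simp
qed

lemma rep_minus_L1R: "AE x in lborel. rep_L1R (u - v) x = rep_L1R u x - rep_L1R v x"
proof -
  have "abs_L1R (rep_L1R u) - abs_L1R (rep_L1R v) = abs_L1R (\<lambda>x. rep_L1R u x - rep_L1R v x)"
    by (rule minus_L1R.abs_eq) auto
  then show ?thesis using rep_abs_L1R[of "\<lambda>x. rep_L1R u x - rep_L1R v x"] by simp
qed

lemma rep_scale_L1R: "AE x in lborel. rep_L1R (c *\<^sub>R u) x = c * rep_L1R u x"
proof -
  have "c *\<^sub>R abs_L1R (rep_L1R u) = abs_L1R (\<lambda>x. c * rep_L1R u x)"
    by (rule scaleR_L1R.abs_eq) auto
  then show ?thesis using rep_abs_L1R[of "\<lambda>x. c * rep_L1R u x"] by simp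
qed

lemma rep_zero_L1R: "AE x in lborel. rep_L1R 0 x = 0"
  unfolding zero_L1R_def by (rule rep_abs_L1R) simp

lemma AE_lborel_imp_seg: "(AE x in lborel. P x) \<Longrightarrow> (AE x in seg l. P x)"
  unfolding AE_seg_iff by (rule AE_mp) auto

lemma rep_measurable_seg [measurable]: "rep_L1R u \<in> borel_measurable (seg l)"
  using borel_measurable_integrable[OF integrable_rep_L1R[of u]] by (intro seg_measurableI) simp

lemma rep_integrable_seg [simp]: "integrable (seg l) (rep_L1R u)"
  using integrable_rep_L1R[of u] unfolding seg_integrable_iff set_integrable_def
  by (intro integrable_mult_indicator) auto

definition edge_dens :: "'v::finite state \<Rightarrow> 'v \<times> 'v \<Rightarrow> real \<Rightarrow> real" where
  "edge_dens W e = rep_L1R (component (l1_fst W) e)"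

definition vertex_mass :: "'v::finite state \<Rightarrow> 'v \<Rightarrow> real" where
  "vertex_mass W v = component (l1_snd W) v"

lemma edge_dens_integrable [simp]: "integrable (seg l) (edge_dens W e)"
  by (simp add: edge_dens_def)

lemma edge_dens_measurable [measurable]: "edge_dens W e \<in> borel_measurable (seg l)"
  by (simp add: edge_dens_def)

lemma edge_dens_diff: "AE x in seg l. edge_dens (W - V) e x = edge_dens W e x - edge_dens V e x"
  unfolding edge_dens_def minus_l1_prod_def
  by (rule AE_lborel_imp_seg) (simp add: l1_fst.rep_eq Parts_inverse minus_l1_family.rep_eq rep_minus_L1R minus_l1_prod.rep_eq flip: minus_l1_prod_def)

lemma edge_dens_add: "AE x in seg l. edge_dens (W + V) e x = edge_dens W e x + edge_dens V e x"
  unfolding edge_dens_def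
  by (rule AE_lborel_imp_seg) (simp add: l1_fst.rep_eq plus_l1_family.rep_eq rep_plus_L1R plus_l1_prod.rep_eq)

lemma edge_dens_scale: "AE x in seg l. edge_dens (c *\<^sub>R W) e x = c * edge_dens W e x"
  unfolding edge_dens_def
  by (rule AE_lborel_imp_seg) (simp add: l1_fst.rep_eq scaleR_l1_family.rep_eq rep_scale_L1R scaleR_l1_prod.rep_eq)

lemma vertex_mass_simps:
  "vertex_mass (W - V) v = vertex_mass W v - vertex_mass V v"
  "vertex_mass (W + V) v = vertex_mass W v + vertex_mass V v"
  "vertex_mass (c *\<^sub>R W) v = c * vertex_mass W v"
  unfolding vertex_mass_def
  by (simp_all add: l1_snd.rep_eq minus_l1_prod.rep_eq plus_l1_prod.rep_eq scaleR_l1_prod.rep_eq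
      minus_l1_family.rep_eq plus_l1_family.rep_eq scaleR_l1_family.rep_eq)

lemma norm_L1R_seg:
  assumes "AE x in lborel. x \<notin> {0<..<l} \<longrightarrow> rep_L1R u x = 0"
  shows "norm u = (LINT x|seg l. \<bar>rep_L1R u x\<bar>)"
proof -
  have [measurable]: "rep_L1R u \<in> borel_measurable borel"
    using borel_measurable_integrable[OF integrable_rep_L1R[of u]] by simp
  have "norm u = (LBINT x. \<bar>rep_L1R u x\<bar>)" by (rule norm_rep_L1R)
  also have "\<dots> = (LBINT x:{0<..<l}. \<bar>rep_L1R u x\<bar>)"
    unfolding set_lebesgue_integral_def
    by (rule integral_cong_AE) (use assms in \<open>auto simp: indicator_def elim!: eventually_mono\<close>)
  finally show ?thesis by (simp add: set_integral_seg)
qed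

lemma state_spaceD:
  assumes "W \<in> state_space G"
  shows "e \<notin> edges G \<Longrightarrow> component (l1_fst W) e = 0"
    and "e \<in> edges G \<Longrightarrow> AE x in lborel. x \<notin> {0<..<len G e} \<longrightarrow> rep_L1R (component (l1_fst W) e) x = 0"
  using assms unfolding state_space_def L1_edges_def by blast+

lemma state_spaceI:
  assumes "\<And>e. e \<notin> edges G \<Longrightarrow> component (l1_fst W) e = 0"
    and "\<And>e. e \<in> edges G \<Longrightarrow> AE x in lborel. x \<notin> {0<..<len G e} \<longrightarrow> rep_L1R (component (l1_fst W) e) x = 0"
  shows "W \<in> state_space G"
  using assms unfolding state_space_def L1_edges_def by blast

lemma norm_state:
  assumes "W \<in> state_space G"
  shows "norm W = (\<Sum>e\<in>edges G. LINT x|seg (len G e). \<bar>edge_dens W e x\<bar>) + (\<Sum>v\<in>UNIV. \<bar>vertex_mass W v\<bar>)"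
proof -
  have out: "component (l1_fst W) e = 0" if "e \<notin> edges G" for e
    by (rule state_spaceD(1)[OF assms that])
  have inn: "norm (component (l1_fst W) e) = (LINT x|seg (len G e). \<bar>edge_dens W e x\<bar>)" if "e \<in> edges G" for e
    unfolding edge_dens_def by (rule norm_L1R_seg[OF state_spaceD(2)[OF assms that]])
  have "norm W = norm (l1_fst W) + norm (l1_snd W)"
    by (simp add: norm_l1_prod.rep_eq l1_fst.rep_eq l1_snd.rep_eq)
  also have "norm (l1_fst W) = (\<Sum>e\<in>edges G. norm (component (l1_fst W) e))"
    unfolding norm_l1_family.rep_eq by (rule sum.mono_neutral_right) (use out in auto)
  also have "\<dots> = (\<Sum>e\<in>edges G. LINT x|seg (len G e). \<bar>edge_dens W e x\<bar>)"
    by (intro sum.cong inn) auto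
  also have "norm (l1_snd W) = (\<Sum>v\<in>UNIV. \<bar>vertex_mass W v\<bar>)"
    by (simp add: norm_l1_family.rep_eq vertex_mass_def)
  finally show ?thesis .
qed

lemma subspace_state_space: "subspace (state_space G)"
proof (rule subspaceI)
  have c0: "component (l1_fst 0) e = 0" for e :: "'a \<times> 'a"
    by (simp add: l1_fst.rep_eq zero_l1_prod.rep_eq zero_l1_family.rep_eq)
  show "0 \<in> state_space G"
  proof (rule state_spaceI, goal_cases)
    case (2 e)
    show ?case unfolding c0 using rep_zero_L1R by eventually_elim simp
  qed (rule c0)
next
  fix W V assume W: "W \<in> state_space G" and V: "V \<in> state_space G"
  have f: "component (l1_fst (W + V)) e = component (l1_fst W) e + component (l1_fst V) e" for e
    by (simp add: l1_fst.rep_eq plus_l1_family.rep_eq plus_l1_prod.rep_eq)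
  show "W + V \<in> state_space G"
  proof (rule state_spaceI)
    show "component (l1_fst (W + V)) e = 0" if "e \<notin> edges G" for e
      unfolding f state_spaceD(1)[OF W that] state_spaceD(1)[OF V that] by simp
    show "AE x in lborel. x \<notin> {0<..<len G e} \<longrightarrow> rep_L1R (component (l1_fst (W + V)) e) x = 0"
      if e: "e \<in> edges G" for e
      unfolding f using state_spaceD(2)[OF W e] state_spaceD(2)[OF V e]
        rep_plus_L1R[of "component (l1_fst W) e" "component (l1_fst V) e"] by eventually_elim auto
  qed
next
  fix c :: real and W assume W: "W \<in> state_space G"
  have f: "component (l1_fst (c *\<^sub>R W)) e = c *\<^sub>R component (l1_fst W) e" for e
    by (simp add: l1_fst.rep_eq scaleR_l1_family.rep_eq scaleR_l1_prod.rep_eq)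
  show "c *\<^sub>R W \<in> state_space G"
  proof (rule state_spaceI)
    show "component (l1_fst (c *\<^sub>R W)) e = 0" if "e \<notin> edges G" for e
      unfolding f state_spaceD(1)[OF W that] by simp
    show "AE x in lborel. x \<notin> {0<..<len G e} \<longrightarrow> rep_L1R (component (l1_fst (c *\<^sub>R W)) e) x = 0"
      if e: "e \<in> edges G" for e
      unfolding f using state_spaceD(2)[OF W e] rep_scale_L1R[of c "component (l1_fst W) e"]
      by eventually_elim auto
  qed
qed

lemma closed_state_space: "closed (state_space G)"
proof (rule closed_sequential_limits[THEN iffD2], intro allI impI, elim conjE)
  fix X :: "nat \<Rightarrow> 'a state" and W assume X: "\<forall>n. X n \<in> state_space G" "X \<longlonglongrightarrow> W"
  have fst_le: "dist (component (l1_fst U) e) (component (l1_fst V) e) \<le> dist U V" for U V :: "'a state" and e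
  proof -
    have "dist (component (l1_fst U) e) (component (l1_fst V) e) \<le> dist (l1_fst U) (l1_fst V)"
      unfolding dist_l1_family by (rule member_le_sum) auto
    then show ?thesis by (simp add: dist_l1_prod add_increasing2)
  qed
  have lim: "(\<lambda>n. component (l1_fst (X n)) e) \<longlonglongrightarrow> component (l1_fst W) e" for e
    using X(2) unfolding tendsto_dist_iff[of X] tendsto_dist_iff[of "\<lambda>n. component (l1_fst (X n)) e"]
    by (rule Lim_null_comparison[rotated]) (use fst_le in auto)
  show "W \<in> state_space G"
  proof (rule state_spaceI)
    fix e assume "e \<notin> edges G"
    then have "component (l1_fst (X n)) e = 0" for n by (rule state_spaceD(1)[OF X(1)[rule_format]])
    then show "component (l1_fst W) e = 0" using lim[of e] by (simp add: LIMSEQ_const_iff)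
  next
    fix e assume e: "e \<in> edges G"
    let ?S = "- {0<..<len G e}"
    let ?w = "component (l1_fst W) e"
    have [measurable]: "rep_L1R u \<in> borel_measurable borel" for u
      using borel_measurable_integrable[OF integrable_rep_L1R[of u]] by simp
    have int: "integrable lborel (\<lambda>x. indicator ?S x * \<bar>rep_L1R ?w x\<bar>)"
      using integrable_mult_indicator[of ?S lborel "\<lambda>x. \<bar>rep_L1R ?w x\<bar>"] by simp
    \<comment> \<open>\<open>X n\<close> vanishes outside the segment, so the mass of the limit
      there is at most its distance to \<open>X n\<close>.\<close>
    have bnd: "(LBINT x. indicator ?S x * \<bar>rep_L1R ?w x\<bar>) \<le> norm (component (l1_fst (X n)) e - ?w)" for n
      unfolding norm_rep_L1R
    proof (rule integral_mono_AE[OF int])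
      have "AE x in lborel. x \<notin> {0<..<len G e} \<longrightarrow> rep_L1R (component (l1_fst (X n)) e) x = 0"
        by (rule state_spaceD(2)[OF X(1)[rule_format] e])
      then show "AE x in lborel. indicator ?S x * \<bar>rep_L1R ?w x\<bar> \<le> \<bar>rep_L1R (component (l1_fst (X n)) e - ?w) x\<bar>"
        using rep_minus_L1R[of "component (l1_fst (X n)) e" ?w] by eventually_elim (auto simp: indicator_def)
    qed simp
    have "(\<lambda>n. norm (component (l1_fst (X n)) e - ?w)) \<longlonglongrightarrow> 0"
      using lim[of e] by (simp add: tendsto_dist_iff[of _ ?w] dist_norm)
    then have "(LBINT x. indicator ?S x * \<bar>rep_L1R ?w x\<bar>) \<le> 0"
      by (rule tendsto_lowerbound) (use bnd in auto)
    moreover have "0 \<le> (LBINT x. indicator ?S x * \<bar>rep_L1R ?w x\<bar>)" by (intro Bochner_Integration.integral_nonneg) auto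
    ultimately have "AE x in lborel. indicator ?S x * \<bar>rep_L1R ?w x\<bar> = 0"
      by (subst integral_nonneg_eq_0_iff_AE[symmetric, OF int]) auto
    then show "AE x in lborel. x \<notin> {0<..<len G e} \<longrightarrow> rep_L1R ?w x = 0"
      by eventually_elim (auto simp: indicator_def)
  qed
qed

section \<open>The flux\<close>

definition flux :: "real \<Rightarrow> real \<Rightarrow> real" where
  "flux p s = \<bar>s\<bar> powr (p - 2) * s"

text \<open>For \<open>p < 2\<close> the exponent \<open>p - 2\<close> is negative. The form with
  the positive exponent \<open>p - 1\<close> shows monotonicity and continuity at 0.\<close>

lemma flux_eq: "flux p s = sgn s * \<bar>s\<bar> powr (p - 1)"
proof (cases "s = 0")
  case False
  have "\<bar>s\<bar> powr (p - 1) = \<bar>s\<bar> powr (p - 2) * \<bar>s\<bar>"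
    using powr_add[of "\<bar>s\<bar>" "p - 2" 1] False by simp
  then show ?thesis by (simp add: flux_def sgn_if)
qed (simp add: flux_def)

lemma flux_mono: assumes "1 < p" "s \<le> t" shows "flux p s \<le> flux p t"
proof -
  consider "0 \<le> s" | "s < 0" "0 \<le> t" | "t < 0" by linarith
  then show ?thesis
  proof cases
    case 1
    then have "\<bar>s\<bar> powr (p - 1) \<le> \<bar>t\<bar> powr (p - 1)" using assms by (intro powr_mono2) auto
    then show ?thesis using 1 assms by (auto simp: flux_eq sgn_if)
  next
    case 2
    have "flux p s \<le> 0" "0 \<le> flux p t" using 2 by (simp_all add: flux_def mult_nonneg_nonpos)
    then show ?thesis by simp
  next
    case 3
    then have "\<bar>t\<bar> powr (p - 1) \<le> \<bar>s\<bar> powr (p - 1)" using assms by (intro powr_mono2) auto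
    then show ?thesis using 3 assms by (auto simp: flux_eq sgn_if)
  qed
qed

lemma flux_diff_mult_nonneg: "1 < p \<Longrightarrow> 0 \<le> (flux p s - flux p t) * (s - t)"
  using flux_mono[of p s t] flux_mono[of p t s]
  by (cases "s \<le> t") (auto intro: mult_nonpos_nonpos mult_nonneg_nonneg)

text \<open>A crude substitute for Hoelder's inequality, from replacing \<open>|s|\<close> and
  \<open>|t|\<close> by their maximum; it suffices for integrability and domination.\<close>

lemma abs_flux_mult_le:
  assumes "1 < p" shows "\<bar>flux p s * t\<bar> \<le> \<bar>s\<bar> powr p + \<bar>t\<bar> powr p"
proof -
  let ?m = "max \<bar>s\<bar> \<bar>t\<bar>"
  have "\<bar>flux p s * t\<bar> \<le> \<bar>s\<bar> powr (p - 1) * \<bar>t\<bar>" by (auto simp: flux_eq abs_mult sgn_if)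
  also have "\<dots> \<le> ?m powr (p - 1) * ?m" using assms by (intro mult_mono powr_mono2) auto
  also have "\<dots> = ?m powr p"
  proof (cases "?m = 0")
    case False
    then show ?thesis using powr_add[of ?m "p - 1" 1] by simp
  next
    case True
    then have "s = 0" "t = 0" by auto
    then show ?thesis by simp
  qed
  also have "\<dots> \<le> \<bar>s\<bar> powr p + \<bar>t\<bar> powr p" by (auto simp: max_def)
  finally show ?thesis .
qed

lemma flux_measurable [measurable (raw)]:
  "f \<in> borel_measurable M \<Longrightarrow> (\<lambda>x. flux p (f x)) \<in> borel_measurable M"
  unfolding flux_def by measurable

lemma flux_mult_integrable:
  assumes "in_Lp p l g" "in_Lp p l h" "1 < p"
  shows "integrable (seg l) (\<lambda>x. flux p (g x) * h x)"
proof (rule Bochner_Integration.integrable_bound[of _ "\<lambda>x. \<bar>g x\<bar> powr p + \<bar>h x\<bar> powr p"])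
  show "AE x in seg l. norm (flux p (g x) * h x) \<le> norm (\<bar>g x\<bar> powr p + \<bar>h x\<bar> powr p)"
    using abs_flux_mult_le[OF assms(3)] by (intro AE_I2) (simp add: add_nonneg_nonneg)
qed (use assms in \<open>auto simp: in_Lp_iff\<close>)

section \<open>Sobolev functions on the graph\<close>

lemma arctan_scaled_deriv:
  "((\<lambda>r. arctan (k * r)) has_real_derivative (k / (1 + (k * r)\<^sup>2))) (at r)"
  by (auto intro!: derivative_eq_intros simp: field_simps)

lemma arctan_scaled_tendsto: "(\<lambda>n. arctan (real n * r)) \<longlonglongrightarrow> pi / 2 * sgn r"
proof -
  consider "r = 0" | "0 < r" | "r < 0" by linarith
  then show ?thesis
  proof cases
    case 2
    have "filterlim (\<lambda>n. r * real n) at_top sequentially"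
      using 2 filterlim_real_sequentially by (intro filterlim_tendsto_pos_mult_at_top[OF tendsto_const])
    then have "(\<lambda>n. arctan (r * real n)) \<longlonglongrightarrow> pi / 2" by (rule filterlim_compose[OF tendsto_arctan_at_top])
    then show ?thesis using 2 by (simp add: mult.commute)
  next
    case 3
    have "filterlim (\<lambda>n. - r * real n) at_top sequentially"
      using 3 filterlim_real_sequentially by (intro filterlim_tendsto_pos_mult_at_top[OF tendsto_const]) auto
    then have "(\<lambda>n. arctan (- r * real n)) \<longlonglongrightarrow> pi / 2" by (rule filterlim_compose[OF tendsto_arctan_at_top])
    then have "(\<lambda>n. - arctan (- r * real n)) \<longlonglongrightarrow> - (pi / 2)" by (rule tendsto_minus)
    then show ?thesis using 3 by (simp add: mult.commute arctan_minus)
  qed simp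
qed

lemma has_vertex_value_map2:
  "has_vertex_value G u v c \<Longrightarrow> has_vertex_value G w v d \<Longrightarrow>
    has_vertex_value G (\<lambda>e x. F (u e x) (w e x)) v (F c d)"
  unfolding has_vertex_value_def by auto

lemma vertex_value_eq:
  assumes "has_vertex_value G u v c" "\<exists>e\<in>edges G. fst e = v \<or> snd e = v"
  shows "vertex_value G u v = c"
proof -
  have "(THE c. has_vertex_value G u v c) = c"
    using assms by (intro the_equality) (auto simp: has_vertex_value_def)
  then show ?thesis using assms(2) unfolding vertex_value_def by simp
qed

text \<open>The condition \<open>F 0 0 = 0\<close> matches the convention that a vertex without
  incident edges has value 0.\<close>

lemma vertex_value_map2:
  assumes "\<exists>c. has_vertex_value G u v c" "\<exists>c. has_vertex_value G w v c" "F 0 0 = 0"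
  shows "vertex_value G (\<lambda>e x. F (u e x) (w e x)) v = F (vertex_value G u v) (vertex_value G w v)"
proof (cases "\<exists>e\<in>edges G. fst e = v \<or> snd e = v")
  case True
  obtain c d where cd: "has_vertex_value G u v c" "has_vertex_value G w v d" using assms by blast
  show ?thesis
    unfolding vertex_value_eq[OF cd(1) True] vertex_value_eq[OF cd(2) True]
    by (rule vertex_value_eq[OF has_vertex_value_map2[OF cd] True])
next
  case False
  then show ?thesis unfolding vertex_value_def if_not_P[OF False] using assms(3) by simp
qed

locale graph_problem =
  fixes G :: "'v::finite metric_graph"
    and p :: "'v \<times> 'v \<Rightarrow> real"
    and \<gamma> :: "'v \<times> 'v \<Rightarrow> real \<Rightarrow> real"
  assumes compact_G: "compact_metric_graph G" and connected_G: "connected_graph G"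
    and p_gt_1: "\<And>e. e \<in> edges G \<Longrightarrow> 1 < p e"
    and \<gamma>: "\<And>e. e \<in> edges G \<Longrightarrow>
      continuous_on UNIV (\<gamma> e) \<and> strict_mono (\<gamma> e) \<and> range (\<gamma> e) = UNIV \<and> \<gamma> e 0 = 0"
begin

abbreviation E where "E \<equiv> edges G"
abbreviation \<W> where "\<W> \<equiv> W1p_graph G p"
abbreviation wd where "wd u e \<equiv> weak_deriv (p e) (len G e) (u e)"
abbreviation seg_of where "seg_of e \<equiv> seg (len G e)"
abbreviation vv where "vv \<equiv> vertex_value G"

lemma len_pos: "e \<in> E \<Longrightarrow> 0 < len G e"
  using compact_G by (simp add: compact_metric_graph_def)

lemma p_ge_1: "e \<in> E \<Longrightarrow> 1 \<le> p e" using p_gt_1[of e] by simp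

lemma graphD:
  assumes "u \<in> \<W>"
  shows "e \<in> E \<Longrightarrow> sobolev_rep (p e) (len G e) (u e) (wd u e)" "\<exists>c. has_vertex_value G u v c"
proof -
  show "\<exists>c. has_vertex_value G u v c" using assms unfolding W1p_graph_def by blast
  show "sobolev_rep (p e) (len G e) (u e) (wd u e)" if e: "e \<in> E"
  proof (rule W1p_imp_sobolev_rep)
    show "W1p (p e) (len G e) (u e)" "continuous_on {0..len G e} (u e)"
      using assms e unfolding W1p_graph_def by blast+
  qed (use e p_ge_1 len_pos in auto)
qed

text \<open>Together with \<open>graphD\<close> the interface to weak derivatives on the graph: any
  integral representation gives membership and determines the chosen weak derivative almost
  everywhere.\<close>

lemma graphI:
  assumes "\<And>e. e \<in> E \<Longrightarrow> sobolev_rep (p e) (len G e) (u e) (g e)" "\<And>v. \<exists>c. has_vertex_value G u v c"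
  shows "u \<in> \<W>" "e \<in> E \<Longrightarrow> AE x in seg_of e. wd u e x = g e x"
proof -
  show "u \<in> \<W>"
    unfolding W1p_graph_def
  proof (intro CollectI conjI ballI allI assms(2))
    fix e assume e: "e \<in> E"
    show "W1p (p e) (len G e) (u e)" "continuous_on {0..len G e} (u e)"
      using sobolev_rep_imp_W1p(1)[OF assms(1)[OF e] p_ge_1[OF e] len_pos[OF e]]
        sobolev_rep_continuous[OF assms(1)[OF e] p_ge_1[OF e]] by blast+
  qed
  show "AE x in seg_of e. wd u e x = g e x" if e: "e \<in> E"
    by (rule sobolev_rep_imp_W1p(2)[OF assms(1)[OF e] p_ge_1[OF e] len_pos[OF e]])
qed

lemma graph_continuous: "u \<in> \<W> \<Longrightarrow> e \<in> E \<Longrightarrow> continuous_on {0..len G e} (u e)"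
  using sobolev_rep_continuous[OF graphD(1) p_ge_1] by blast

lemma graph_measurable: "u \<in> \<W> \<Longrightarrow> e \<in> E \<Longrightarrow> u e \<in> borel_measurable (seg_of e)"
  by (rule seg_measurable_continuous[OF graph_continuous])

lemma graph_integrable: "u \<in> \<W> \<Longrightarrow> e \<in> E \<Longrightarrow> integrable (seg_of e) (u e)"
  by (rule seg_integrable_continuous[OF graph_continuous])

lemma wd_in_Lp: "u \<in> \<W> \<Longrightarrow> e \<in> E \<Longrightarrow> in_Lp (p e) (len G e) (wd u e)"
  by (rule sobolev_repD(1)[OF graphD(1)])

lemma wd_measurable: "u \<in> \<W> \<Longrightarrow> e \<in> E \<Longrightarrow> wd u e \<in> borel_measurable (seg_of e)"
  using wd_in_Lp by (simp add: in_Lp_iff)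

lemma wd_integrable: "u \<in> \<W> \<Longrightarrow> e \<in> E \<Longrightarrow> integrable (seg_of e) (wd u e)"
  by (rule in_Lp_integrable[OF wd_in_Lp p_ge_1])

lemma graph_endpoints:
  assumes "u \<in> \<W>" "e \<in> E"
  shows "u e 0 = vv u (fst e)" "u e (len G e) = vv u (snd e)"
proof -
  obtain c d where "has_vertex_value G u (fst e) c" "has_vertex_value G u (snd e) d"
    using graphD(2)[OF assms(1)] by metis
  moreover from this have "vv u (fst e) = c" "vv u (snd e) = d"
    using assms(2) by (auto intro!: vertex_value_eq)
  ultimately show "u e 0 = vv u (fst e)" "u e (len G e) = vv u (snd e)"
    using assms(2) by (auto simp: has_vertex_value_def)
qed

lemma graph_lincomb:
  assumes u: "u \<in> \<W>" and w: "w \<in> \<W>"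
  shows "(\<lambda>e x. a * u e x + t * w e x) \<in> \<W>"
    "e \<in> E \<Longrightarrow> AE x in seg_of e. wd (\<lambda>e x. a * u e x + t * w e x) e x = a * wd u e x + t * wd w e x"
    "vv (\<lambda>e x. a * u e x + t * w e x) v = a * vv u v + t * vv w v"
proof -
  have r: "sobolev_rep (p e) (len G e) ((\<lambda>e x. a * u e x + t * w e x) e) ((\<lambda>e x. a * wd u e x + t * wd w e x) e)"
    if "e \<in> E" for e
    using that by (intro sobolev_rep_add sobolev_rep_cmult graphD(1) u w p_ge_1)
  have v: "\<exists>c. has_vertex_value G (\<lambda>e x. a * u e x + t * w e x) v c" for v
    using has_vertex_value_map2[of G u v _ w _ "\<lambda>y z. a * y + t * z"] graphD(2)[OF u, of v] graphD(2)[OF w, of v] by blast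
  note I = graphI[OF r v]
  show "(\<lambda>e x. a * u e x + t * w e x) \<in> \<W>" by (rule I(1))
  show "AE x in seg_of e. wd (\<lambda>e x. a * u e x + t * w e x) e x = a * wd u e x + t * wd w e x" if "e \<in> E"
    using graphI(2)[OF r v that] by simp
  show "vv (\<lambda>e x. a * u e x + t * w e x) v = a * vv u v + t * vv w v"
    by (rule vertex_value_map2[where F = "\<lambda>y z. a * y + t * z", OF graphD(2)[OF u] graphD(2)[OF w]]) simp
qed

lemma graph_compose:
  assumes u: "u \<in> \<W>"
    and H: "\<And>r. (H has_real_derivative H' r) (at r)" "continuous_on UNIV H'" "\<And>r. \<bar>H' r\<bar> \<le> B" "H 0 = 0"
  shows "(\<lambda>e x. H (u e x)) \<in> \<W>"
    "e \<in> E \<Longrightarrow> AE x in seg_of e. wd (\<lambda>e x. H (u e x)) e x = H' (u e x) * wd u e x"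
    "vv (\<lambda>e x. H (u e x)) v = H (vv u v)"
proof -
  have r: "sobolev_rep (p e) (len G e) ((\<lambda>e x. H (u e x)) e) ((\<lambda>e x. H' (u e x) * wd u e x) e)"
    if "e \<in> E" for e
    by (rule sobolev_rep_compose[OF graphD(1)[OF u that] p_ge_1[OF that] H(1-3)])
  have v: "\<exists>c. has_vertex_value G (\<lambda>e x. H (u e x)) v c" for v
    using has_vertex_value_map2[of G u v _ u _ "\<lambda>y z. H y"] graphD(2)[OF u, of v] by blast
  note I = graphI[OF r v]
  show "(\<lambda>e x. H (u e x)) \<in> \<W>" by (rule I(1))
  show "AE x in seg_of e. wd (\<lambda>e x. H (u e x)) e x = H' (u e x) * wd u e x" if "e \<in> E"
    using graphI(2)[OF r v that] by simp
  show "vv (\<lambda>e x. H (u e x)) v = H (vv u v)"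
    by (rule vertex_value_map2[where F = "\<lambda>y z. H y", OF graphD(2)[OF u] graphD(2)[OF u] H(4)])
qed

section \<open>Weak formulation and accretivity of the graph operator\<close>

definition energy_form :: "('v \<times> 'v \<Rightarrow> real \<Rightarrow> real) \<Rightarrow> ('v \<times> 'v \<Rightarrow> real \<Rightarrow> real) \<Rightarrow> real" where
  "energy_form u \<phi> = (\<Sum>e\<in>E. LINT x|seg_of e. flux (p e) (wd u e x) * wd \<phi> e x)"

definition load :: "'v state \<Rightarrow> ('v \<times> 'v \<Rightarrow> real \<Rightarrow> real) \<Rightarrow> real" where
  "load Z \<phi> = (\<Sum>e\<in>E. LINT x|seg_of e. edge_dens Z e x * \<phi> e x) + (\<Sum>v\<in>UNIV. vertex_mass Z v * vv \<phi> v)"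

lemma graph_operator_iff:
  "(V, Z) \<in> graph_operator G p \<gamma> \<longleftrightarrow> V \<in> state_space G \<and> Z \<in> state_space G \<and> l1_snd V = 0 \<and>
    (\<exists>u\<in>\<W>. (\<forall>e\<in>E. AE x in seg_of e. edge_dens V e x = \<gamma> e (u e x)) \<and>
      (\<forall>\<phi>\<in>\<W>. energy_form u \<phi> = load Z \<phi>))"
  unfolding graph_operator_def mem_Collect_eq prod.case energy_form_def load_def flux_def
    AE_seg_iff edge_dens_def vertex_mass_def set_integral_seg ..

lemma energy_integrable:
  "u \<in> \<W> \<Longrightarrow> \<phi> \<in> \<W> \<Longrightarrow> e \<in> E \<Longrightarrow> integrable (seg_of e) (\<lambda>x. flux (p e) (wd u e x) * wd \<phi> e x)"
  by (rule flux_mult_integrable[OF wd_in_Lp wd_in_Lp p_gt_1])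

lemma dens_mult_integrable:
  "\<phi> \<in> \<W> \<Longrightarrow> e \<in> E \<Longrightarrow> integrable (seg_of e) (\<lambda>x. edge_dens Z e x * \<phi> e x)"
  by (rule seg_integrable_mult_continuous[OF edge_dens_integrable graph_continuous])

lemma \<gamma>_comp_continuous: "u \<in> \<W> \<Longrightarrow> e \<in> E \<Longrightarrow> continuous_on {0..len G e} (\<lambda>x. \<gamma> e (u e x))"
  using \<gamma>[of e] continuous_on_compose2[of UNIV "\<gamma> e" "{0..len G e}" "u e"] graph_continuous by auto

text \<open>The sign of \<open>w = u1 - u2\<close> may jump and so fail to be a test function. A
  smooth increasing function of \<open>w\<close> multiplies the derivative of \<open>w\<close> by a
  nonnegative factor, so monotonicity of the flux makes the difference of the energies nonnegative;
  the arctangents are bounded by \<open>pi / 2\<close>, which permits the limit, and the factor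
  \<open>pi / 2\<close> is divided out.\<close>

lemma load_sgn_nonneg:
  assumes u: "u1 \<in> \<W>" "u2 \<in> \<W>"
    and eq: "\<And>\<phi>. \<phi> \<in> \<W> \<Longrightarrow> energy_form u1 \<phi> = load Z1 \<phi>" "\<And>\<phi>. \<phi> \<in> \<W> \<Longrightarrow> energy_form u2 \<phi> = load Z2 \<phi>"
  shows "0 \<le> (\<Sum>e\<in>E. LINT x|seg_of e. (edge_dens Z1 e x - edge_dens Z2 e x) * sgn (u1 e x - u2 e x))
    + (\<Sum>v\<in>UNIV. (vertex_mass Z1 v - vertex_mass Z2 v) * sgn (vv u1 v - vv u2 v))"
proof -
  define w where "w = (\<lambda>e x. 1 * u1 e x + (- 1) * u2 e x)"
  have w: "w \<in> \<W>" and wwd: "\<And>e. e \<in> E \<Longrightarrow> AE x in seg_of e. wd w e x = wd u1 e x - wd u2 e x"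
    and wv: "\<And>v. vv w v = vv u1 v - vv u2 v"
    using graph_lincomb[OF u, where a = 1 and t = "- 1"] unfolding w_def by auto
  have wx: "w e x = u1 e x - u2 e x" for e x by (simp add: w_def)
  define \<phi> where "\<phi> n = (\<lambda>e x. arctan (real n * w e x))" for n
  have bound: "\<bar>real n / (1 + (real n * r)\<^sup>2)\<bar> \<le> real n" for n r
    by (simp add: divide_le_eq mult_le_cancel_left1)
      (smt (verit) mult_right_mono of_nat_0_le_iff zero_le_power2 mult_le_cancel_left1)
  have cont: "continuous_on UNIV (\<lambda>r. real n / (1 + (real n * r)\<^sup>2))" for n
    by (intro continuous_intros) (metis add_pos_nonneg less_irrefl zero_le_power2 zero_less_one)
  have comp: "\<phi> n \<in> \<W>" "e \<in> E \<Longrightarrow> AE x in seg_of e. wd (\<phi> n) e x = real n / (1 + (real n * w e x)\<^sup>2) * wd w e x"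
    "vv (\<phi> n) v = arctan (real n * vv w v)" for n e v
    using graph_compose[OF w arctan_scaled_deriv cont bound] unfolding \<phi>_def by auto
  have energy: "0 \<le> energy_form u1 (\<phi> n) - energy_form u2 (\<phi> n)" for n
  proof -
    have "0 \<le> (LINT x|seg_of e. flux (p e) (wd u1 e x) * wd (\<phi> n) e x) - (LINT x|seg_of e. flux (p e) (wd u2 e x) * wd (\<phi> n) e x)"
      if e: "e \<in> E" for e
    proof -
      have "AE x in seg_of e. 0 \<le> flux (p e) (wd u1 e x) * wd (\<phi> n) e x - flux (p e) (wd u2 e x) * wd (\<phi> n) e x"
        using comp(2)[OF e, of n] wwd[OF e]
      proof eventually_elim
        case (elim x)
        define k where "k = real n / (1 + (real n * w e x)\<^sup>2)"
        have k: "0 \<le> k" unfolding k_def by (intro divide_nonneg_nonneg add_nonneg_nonneg) auto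
        have "flux (p e) (wd u1 e x) * wd (\<phi> n) e x - flux (p e) (wd u2 e x) * wd (\<phi> n) e x
           = k * ((flux (p e) (wd u1 e x) - flux (p e) (wd u2 e x)) * (wd u1 e x - wd u2 e x))"
          unfolding elim k_def[symmetric] by (simp add: algebra_simps)
        then show ?case using k flux_diff_mult_nonneg[OF p_gt_1[OF e]] by simp
      qed
      then have "0 \<le> (LINT x|seg_of e. flux (p e) (wd u1 e x) * wd (\<phi> n) e x - flux (p e) (wd u2 e x) * wd (\<phi> n) e x)"
        by (rule integral_nonneg_AE)
      then show ?thesis using energy_integrable[OF u(1) comp(1) e] energy_integrable[OF u(2) comp(1) e] by simp
    qed
    then show ?thesis unfolding energy_form_def sum_subtractf[symmetric] by (intro sum_nonneg)
  qed
  let ?d = "\<lambda>e x. edge_dens Z1 e x - edge_dens Z2 e x"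
  let ?m = "\<lambda>v. vertex_mass Z1 v - vertex_mass Z2 v"
  have load: "load Z1 (\<phi> n) - load Z2 (\<phi> n) =
      (\<Sum>e\<in>E. LINT x|seg_of e. ?d e x * arctan (real n * w e x)) + (\<Sum>v\<in>UNIV. ?m v * arctan (real n * vv w v))" for n
  proof -
    have "(LINT x|seg_of e. edge_dens Z1 e x * \<phi> n e x) - (LINT x|seg_of e. edge_dens Z2 e x * \<phi> n e x)
        = (LINT x|seg_of e. ?d e x * arctan (real n * w e x))" if "e \<in> E" for e
      using dens_mult_integrable[OF comp(1) that, of Z1] dens_mult_integrable[OF comp(1) that, of Z2]
      by (subst Bochner_Integration.integral_diff[symmetric]) (auto simp: \<phi>_def left_diff_distrib)
    then show ?thesis
      unfolding load_def comp(3)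
      by (simp add: sum_subtractf[symmetric] left_diff_distrib add_diff_add)
  qed
  have "(\<lambda>n. (\<Sum>e\<in>E. LINT x|seg_of e. ?d e x * arctan (real n * w e x)) + (\<Sum>v\<in>UNIV. ?m v * arctan (real n * vv w v)))
    \<longlonglongrightarrow> (\<Sum>e\<in>E. LINT x|seg_of e. ?d e x * (pi / 2 * sgn (w e x))) + (\<Sum>v\<in>UNIV. ?m v * (pi / 2 * sgn (vv w v)))"
  proof (intro tendsto_add tendsto_sum tendsto_mult tendsto_const arctan_scaled_tendsto)
    fix e assume e: "e \<in> E"
    note [measurable] = graph_measurable[OF w e]
    show "(\<lambda>n. LINT x|seg_of e. ?d e x * arctan (real n * w e x)) \<longlonglongrightarrow> (LINT x|seg_of e. ?d e x * (pi / 2 * sgn (w e x)))"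
    proof (rule integral_dominated_convergence[where w = "\<lambda>x. \<bar>?d e x\<bar> * (pi / 2)"])
      show "AE x in seg_of e. (\<lambda>n. ?d e x * arctan (real n * w e x)) \<longlonglongrightarrow> ?d e x * (pi / 2 * sgn (w e x))"
        by (intro AE_I2 tendsto_mult tendsto_const arctan_scaled_tendsto)
      show "AE x in seg_of e. norm (?d e x * arctan (real n * w e x)) \<le> \<bar>?d e x\<bar> * (pi / 2)" for n
      proof (rule AE_I2)
        fix x
        have "\<bar>arctan (real n * w e x)\<bar> \<le> pi / 2"
          using arctan_lbound[of "real n * w e x"] arctan_ubound[of "real n * w e x"] by simp
        then show "norm (?d e x * arctan (real n * w e x)) \<le> \<bar>?d e x\<bar> * (pi / 2)"
          unfolding real_norm_def abs_mult by (rule mult_left_mono) simp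
      qed
    qed (auto intro: borel_measurable_arctan)
  qed
  then have "0 \<le> (\<Sum>e\<in>E. LINT x|seg_of e. ?d e x * (pi / 2 * sgn (w e x))) + (\<Sum>v\<in>UNIV. ?m v * (pi / 2 * sgn (vv w v)))"
    by (rule tendsto_lowerbound) (use energy load comp(1) eq in auto)
  also have "\<dots> = pi / 2 * ((\<Sum>e\<in>E. LINT x|seg_of e. ?d e x * sgn (w e x)) + (\<Sum>v\<in>UNIV. ?m v * sgn (vv w v)))"
    by (simp add: sum_distrib_left distrib_left mult.left_commute)
  finally show ?thesis using pi_gt_zero by (auto simp: wx wv zero_le_mult_iff)
qed

text \<open>On an edge, strict monotonicity of \<gamma> gives the difference of the densities the
  sign of \<open>u1 - u2\<close>, and where the two agree both vanish. Hence adding \<open>r\<close>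
  times the signed difference of the images never exceeds the modulus of the combined density. At a
  vertex the domain contributes nothing, and the sign has modulus at most 1.\<close>

lemma accretive_graph_operator: "accretive (graph_operator G p \<gamma>)"
  unfolding accretive_def
proof (intro allI impI)
  fix W1 Z1 W2 Z2 and r :: real
  assume 1: "(W1, Z1) \<in> graph_operator G p \<gamma>" and 2: "(W2, Z2) \<in> graph_operator G p \<gamma>" and r: "0 < r"
  obtain u1 where u1: "u1 \<in> \<W>" "\<And>e. e \<in> E \<Longrightarrow> AE x in seg_of e. edge_dens W1 e x = \<gamma> e (u1 e x)"
    "\<And>\<phi>. \<phi> \<in> \<W> \<Longrightarrow> energy_form u1 \<phi> = load Z1 \<phi>" using 1 unfolding graph_operator_iff by blast
  obtain u2 where u2: "u2 \<in> \<W>" "\<And>e. e \<in> E \<Longrightarrow> AE x in seg_of e. edge_dens W2 e x = \<gamma> e (u2 e x)"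
    "\<And>\<phi>. \<phi> \<in> \<W> \<Longrightarrow> energy_form u2 \<phi> = load Z2 \<phi>" using 2 unfolding graph_operator_iff by blast
  have S: "W1 \<in> state_space G" "W2 \<in> state_space G" "Z1 \<in> state_space G" "Z2 \<in> state_space G"
    and zero: "l1_snd W1 = 0" "l1_snd W2 = 0"
    using 1 2 unfolding graph_operator_iff by blast+
  define Q where "Q = W1 - W2 + r *\<^sub>R (Z1 - Z2)"
  have QS: "Q \<in> state_space G" and DS: "W1 - W2 \<in> state_space G"
    unfolding Q_def using S subspace_state_space by (auto intro: subspace_add subspace_diff subspace_scale)
  let ?d = "\<lambda>e x. edge_dens Z1 e x - edge_dens Z2 e x"
  let ?m = "\<lambda>v. vertex_mass Z1 v - vertex_mass Z2 v"
  let ?s = "\<lambda>e x. sgn (u1 e x - u2 e x)"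
  let ?t = "\<lambda>v. sgn (vv u1 v - vv u2 v)"
  have mW: "vertex_mass (W1 - W2) v = 0" for v
    using zero by (simp add: vertex_mass_simps) (simp add: vertex_mass_def)
  have mQ: "vertex_mass Q v = r * ?m v" for v
    using mW[of v] by (simp add: Q_def vertex_mass_simps)
  have edge: "(LINT x|seg_of e. \<bar>edge_dens (W1 - W2) e x\<bar>) + r * (LINT x|seg_of e. ?d e x * ?s e x)
      \<le> (LINT x|seg_of e. \<bar>edge_dens Q e x\<bar>)" if e: "e \<in> E" for e
  proof -
    note [measurable] = graph_measurable[OF u1(1) e] graph_measurable[OF u2(1) e]
    have i: "integrable (seg_of e) (\<lambda>x. ?d e x * ?s e x)"
      by (rule seg_integrable_mult_bounded[where B = 1]) (auto simp: sgn_if)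
    have "(LINT x|seg_of e. \<bar>edge_dens (W1 - W2) e x\<bar>) + r * (LINT x|seg_of e. ?d e x * ?s e x)
       = (LINT x|seg_of e. \<bar>edge_dens (W1 - W2) e x\<bar> + r * (?d e x * ?s e x))"
      using i by simp
    also have "\<dots> \<le> (LINT x|seg_of e. \<bar>edge_dens Q e x\<bar>)"
    proof (rule integral_mono_AE)
      show "integrable (seg_of e) (\<lambda>x. \<bar>edge_dens (W1 - W2) e x\<bar> + r * (?d e x * ?s e x))" using i by simp
      show "AE x in seg_of e. \<bar>edge_dens (W1 - W2) e x\<bar> + r * (?d e x * ?s e x) \<le> \<bar>edge_dens Q e x\<bar>"
        using u1(2)[OF e] u2(2)[OF e] edge_dens_diff[of W1 W2 e] edge_dens_diff[of Z1 Z2 e] edge_dens_scale[of r "Z1 - Z2" e]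
          edge_dens_add[of "W1 - W2" "r *\<^sub>R (Z1 - Z2)" e]
      proof eventually_elim
        case (elim x)
        have sm: "strict_mono (\<gamma> e)" using \<gamma>[OF e] by blast
        have Q: "edge_dens Q e x = (\<gamma> e (u1 e x) - \<gamma> e (u2 e x)) + r * ?d e x"
          unfolding Q_def using elim by simp
        consider "u1 e x = u2 e x" | "u1 e x < u2 e x" | "u2 e x < u1 e x" by linarith
        then show ?case
        proof cases
          case 1 then show ?thesis using elim by simp
        next
          case 2
          then have "\<gamma> e (u1 e x) < \<gamma> e (u2 e x)" using sm by (simp add: strict_mono_less)
          then have "\<bar>edge_dens (W1 - W2) e x\<bar> + r * (?d e x * ?s e x) = - edge_dens Q e x"
            unfolding Q using 2 elim by (simp add: algebra_simps)
          then show ?thesis by simp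
        next
          case 3
          then have "\<gamma> e (u2 e x) < \<gamma> e (u1 e x)" using sm by (simp add: strict_mono_less)
          then have "\<bar>edge_dens (W1 - W2) e x\<bar> + r * (?d e x * ?s e x) = edge_dens Q e x"
            unfolding Q using 3 elim by (simp add: algebra_simps)
          then show ?thesis by simp
        qed
      qed
    qed simp
    finally show ?thesis .
  qed
  have vert: "r * (?m v * ?t v) \<le> \<bar>vertex_mass Q v\<bar>" for v
    using r unfolding mQ by (auto simp: sgn_if abs_mult)
  have "norm (W1 - W2) \<le> norm (W1 - W2) + r * ((\<Sum>e\<in>E. LINT x|seg_of e. ?d e x * ?s e x) + (\<Sum>v\<in>UNIV. ?m v * ?t v))"
    using load_sgn_nonneg[OF u1(1) u2(1) u1(3) u2(3)] r by simp
  also have "\<dots> = (\<Sum>e\<in>E. (LINT x|seg_of e. \<bar>edge_dens (W1 - W2) e x\<bar>) + r * (LINT x|seg_of e. ?d e x * ?s e x))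
      + (\<Sum>v\<in>UNIV. r * (?m v * ?t v))"
    unfolding norm_state[OF DS] by (simp add: mW sum.distrib sum_distrib_left distrib_left)
  also have "\<dots> \<le> (\<Sum>e\<in>E. LINT x|seg_of e. \<bar>edge_dens Q e x\<bar>) + (\<Sum>v\<in>UNIV. \<bar>vertex_mass Q v\<bar>)"
    by (intro add_mono sum_mono edge vert)
  also have "\<dots> = norm Q" by (rule norm_state[OF QS, symmetric])
  finally show "norm (W1 - W2) \<le> norm (W1 - W2 + r *\<^sub>R (Z1 - Z2))" by (simp add: Q_def)
qed

end

section \<open>Convex primitives\<close>

text \<open>The subgradient inequality replaces \<open>P' = d\<close>, so that \<open>\<bar>s\<bar> powr p\<close> need not be differentiated at 0.\<close>

definition tangent :: "(real \<Rightarrow> real) \<Rightarrow> (real \<Rightarrow> real) \<Rightarrow> bool" where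
  "tangent P d \<longleftrightarrow> (\<forall>s t. P s - P t \<le> d s * (s - t))"

lemma tangentD: "tangent P d \<Longrightarrow> P s - P t \<le> d s * (s - t)"
  unfolding tangent_def by blast

lemma tangent_midpoint:
  assumes "tangent P d" shows "P ((a + b) / 2) \<le> (P a + P b) / 2"
proof -
  define m where "m = (a + b) / 2"
  have "P m - P a + (P m - P b) \<le> d m * (m - a) + d m * (m - b)"
    by (intro add_mono tangentD[OF assms])
  also have "\<dots> = d m * (2 * m - a - b)" by (simp add: algebra_simps)
  also have "2 * m - a - b = 0"
  proof -
    have "2 * m = a + b" by (simp add: m_def)
    then show ?thesis by simp
  qed
  finally show ?thesis by (simp add: m_def)
qed

text \<open>The subgradient at the midpoint alone yields only the weak inequality. Passing through
  the quarter points \<open>?n\<close> and \<open>?k\<close> leaves the term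
  \<open>(d ?n - d ?k) (a - b) / 4\<close>, which is positive.\<close>

lemma tangent_strict_midpoint:
  assumes P: "tangent P d" and d: "strict_mono d" and "a \<noteq> b"
  shows "P ((a + b) / 2) < (P a + P b) / 2"
proof -
  have main: "P ((a + b) / 2) < (P a + P b) / 2" if "b < a" for a b
  proof -
    let ?m = "(a + b) / 2" and ?n = "(3 * a + b) / 4" and ?k = "(a + 3 * b) / 4"
    have "P ?n - P a + (P ?k - P b) + (P ?m - P ?n) + (P ?m - P ?k)
        \<le> d ?n * (?n - a) + d ?k * (?k - b) + d ?m * (?m - ?n) + d ?m * (?m - ?k)"
      by (intro add_mono tangentD[OF P])
    also have "\<dots> = - ((d ?n - d ?k) * (a - b) / 4)" by (simp add: field_simps)
    also have "\<dots> < 0"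
      using strict_monoD[OF d, of ?k ?n] that by simp
    finally show ?thesis by simp
  qed
  then show ?thesis using main[of b a] main[of a b] \<open>a \<noteq> b\<close> by (cases "b < a") (auto simp: add.commute)
qed

text \<open>As \<open>d\<close> is onto, the slopes \<open>B\<close> and \<open>- B\<close> are
  attained, and \<open>P\<close> lies above the two corresponding supporting lines. Coercivity draws
  on this instead of a growth condition.\<close>

lemma tangent_superlinear:
  assumes P: "tangent P d" "\<And>s. 0 \<le> P s" and d: "surj d"
  shows "\<exists>C\<ge>0. \<forall>s. B * \<bar>s\<bar> \<le> P s + C"
proof -
  obtain s0 s1 where s: "d s0 = B" "d s1 = - B" using d by (metis surjD)
  have "B * \<bar>s\<bar> \<le> P s + (\<bar>B * s0\<bar> + \<bar>B * s1\<bar>)" for s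
  proof -
    have "P s0 - P s \<le> B * (s0 - s)" "P s1 - P s \<le> - B * (s1 - s)"
      using tangentD[OF P(1), of s0 s] tangentD[OF P(1), of s1 s] by (simp_all only: s)
    moreover have "B * s0 \<le> \<bar>B * s0\<bar>" "- (B * s1) \<le> \<bar>B * s1\<bar>" by simp_all
    ultimately show ?thesis
      using P(2)[of s0] P(2)[of s1] by (cases "0 \<le> s") (simp_all add: algebra_simps)
  qed
  then show ?thesis by (intro exI[of _ "\<bar>B * s0\<bar> + \<bar>B * s1\<bar>"]) auto
qed

lemma tangent_primitive:
  assumes d: "continuous_on UNIV d" "mono d" "d 0 = (0::real)"
  obtains P where "tangent P d" "P 0 = 0" "\<And>s. 0 \<le> P s" "continuous_on UNIV P"
proof -
  have "\<exists>F. \<forall>x::real. - \<infinity> < ereal x \<longrightarrow> ereal x < \<infinity> \<longrightarrow> (F has_vector_derivative d x) (at x)"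
    by (rule einterval_antiderivative) (use d(1) in \<open>auto simp: continuous_on_eq_continuous_at\<close>)
  then obtain F where F: "\<And>x. (F has_real_derivative d x) (at x)"
    by (auto simp: has_real_derivative_iff_has_vector_derivative)
  define P where "P x = F x - F 0" for x
  have D: "(P has_real_derivative d x) (at x)" for x unfolding P_def by (auto intro!: derivative_eq_intros F)
  have T: "tangent P d"
    unfolding tangent_def
  proof (intro allI)
    fix s t :: real
    consider "s = t" | "s < t" | "t < s" by linarith
    then show "P s - P t \<le> d s * (s - t)"
    proof cases
      case 2
      obtain z where z: "s < z" "z < t" "P t - P s = (t - s) * d z" using MVT2[OF 2, of P d] D by blast
      have "(t - s) * d s \<le> (t - s) * d z" using z(1) 2 monoD[OF d(2), of s z] by (intro mult_left_mono) auto
      then show ?thesis using z(3) by (simp add: algebra_simps)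
    next
      case 3
      obtain z where z: "t < z" "z < s" "P s - P t = (s - t) * d z" using MVT2[OF 3, of P d] D by blast
      have "(s - t) * d z \<le> (s - t) * d s" using z(2) 3 monoD[OF d(2), of z s] by (intro mult_left_mono) auto
      then show ?thesis using z(3) by (simp add: algebra_simps)
    qed simp
  qed
  have "0 \<le> P s" for s using tangentD[OF T, of 0 s] d(3) by (simp add: P_def)
  moreover have "continuous_on UNIV P" using D by (intro continuous_at_imp_continuous_on) (auto intro: DERIV_isCont)
  ultimately show thesis using T that[of P] by (simp add: P_def)
qed

section \<open>The p-energy, its flux and its convexity gap\<close>

definition p_energy :: "real \<Rightarrow> real \<Rightarrow> real" where
  "p_energy p s = \<bar>s\<bar> powr p / p"

lemma flux_mult_self: "flux p s * s = \<bar>s\<bar> powr p"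
proof (cases "s = 0")
  case False
  have "flux p s * s = \<bar>s\<bar> powr (p - 1) * \<bar>s\<bar>" by (auto simp: flux_eq sgn_if)
  also have "\<dots> = \<bar>s\<bar> powr p" using powr_add[of "\<bar>s\<bar>" "p - 1" 1] False by simp
  finally show ?thesis .
qed (simp add: flux_def)

text \<open>This is Young's inequality for \<open>t\<close> and \<open>|s| powr (p - 1)\<close> with
  the conjugate exponent \<open>q\<close>, for which \<open>(p - 1) q = p\<close>.\<close>

lemma tangent_p_energy:
  assumes p: "1 < p" shows "tangent (p_energy p) (flux p)"
  unfolding tangent_def
proof (intro allI)
  fix s t :: real
  define q where "q = p / (p - 1)"
  have q: "1 < q" "1 / p + 1 / q = 1" "(p - 1) * q = p" using p by (auto simp: q_def field_simps)
  have "flux p s * t \<le> \<bar>t\<bar> * \<bar>s\<bar> powr (p - 1)"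
    by (rule order_trans[OF abs_ge_self]) (auto simp: flux_eq abs_mult sgn_if)
  also have "\<dots> \<le> \<bar>t\<bar> powr p / p + (\<bar>s\<bar> powr (p - 1)) powr q / q"
    using p q by (intro Youngs_inequality) auto
  also have "(\<bar>s\<bar> powr (p - 1)) powr q = \<bar>s\<bar> powr p" by (simp add: powr_powr q)
  also have "\<bar>s\<bar> powr p / q = \<bar>s\<bar> powr p - \<bar>s\<bar> powr p / p"
  proof -
    have "1 / q = 1 - 1 / p" using q(2) by simp
    then have "\<bar>s\<bar> powr p * (1 / q) = \<bar>s\<bar> powr p * (1 - 1 / p)" by simp
    then show ?thesis by (simp add: right_diff_distrib)
  qed
  finally show "p_energy p s - p_energy p t \<le> flux p s * (s - t)"
    by (simp add: p_energy_def right_diff_distrib flux_mult_self)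
qed

lemma strict_mono_flux: assumes "1 < p" shows "strict_mono (flux p)"
proof (rule strict_monoI)
  fix s t :: real assume "s < t"
  have "flux p s \<noteq> flux p t"
  proof
    assume eq: "flux p s = flux p t"
    then have "\<bar>s\<bar> powr (p - 1) = \<bar>t\<bar> powr (p - 1)" and sg: "sgn s = sgn t"
    proof -
      have a: "\<bar>flux p x\<bar> = \<bar>x\<bar> powr (p - 1)" for x by (auto simp: flux_eq abs_mult sgn_if)
      have b: "sgn (flux p x) = sgn x" for x by (auto simp: flux_eq sgn_if)
      show "\<bar>s\<bar> powr (p - 1) = \<bar>t\<bar> powr (p - 1)" "sgn s = sgn t" using a[of s] a[of t] b[of s] b[of t] eq by simp_all
    qed
    then have "\<bar>s\<bar> = \<bar>t\<bar>" using assms by (metis abs_ge_zero diff_gt_0_iff_gt less_irrefl linorder_neqE_linordered_idom powr_less_mono2)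
    then show False using sg \<open>s < t\<close> by (auto simp: sgn_if split: if_splits)
  qed
  then show "flux p s < flux p t" using flux_mono[OF assms, of s t] \<open>s < t\<close> by simp
qed

lemma surj_flux: assumes "1 < p" shows "surj (flux p)"
proof (rule surjI)
  fix y :: real
  show "flux p (sgn y * \<bar>y\<bar> powr (1 / (p - 1))) = y"
    using assms by (cases "y = 0") (auto simp: flux_eq abs_mult sgn_mult powr_powr sgn_if)
qed

text \<open>The sign is discontinuous at 0, but there the power with exponent
  \<open>p - 1 > 0\<close> already tends to 0.\<close>

lemma flux_tendsto:
  assumes p: "1 < p" and s: "s \<longlonglongrightarrow> t" shows "(\<lambda>n. flux p (s n)) \<longlonglongrightarrow> flux p t"
proof -
  have pw: "(\<lambda>n. \<bar>s n\<bar> powr (p - 1)) \<longlonglongrightarrow> \<bar>t\<bar> powr (p - 1)"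
    using p by (intro tendsto_powr' tendsto_rabs s tendsto_const) auto
  show ?thesis
  proof (cases "t = 0")
    case True
    show ?thesis unfolding True
    proof (rule Lim_null_comparison[of _ "\<lambda>n. \<bar>s n\<bar> powr (p - 1)", THEN tendsto_eq_rhs])
      show "\<forall>\<^sub>F n in sequentially. norm (flux p (s n)) \<le> \<bar>s n\<bar> powr (p - 1)"
        by (intro always_eventually) (auto simp: flux_eq abs_mult sgn_if)
      show "(\<lambda>n. \<bar>s n\<bar> powr (p - 1)) \<longlonglongrightarrow> 0" using pw True by simp
    qed (simp add: flux_def)
  next
    case False
    then show ?thesis unfolding flux_eq by (intro tendsto_mult tendsto_sgn s pw)
  qed
qed

lemma p_energy_nonneg: "1 < p \<Longrightarrow> 0 \<le> p_energy p s" by (simp add: p_energy_def)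

lemma p_energy_continuous: "1 < p \<Longrightarrow> continuous_on S (p_energy p)"
  unfolding p_energy_def by (intro continuous_intros continuous_on_powr') auto

lemma p_energy_integrable: "in_Lp p l g \<Longrightarrow> integrable (seg l) (\<lambda>x. p_energy p (g x))"
  by (auto simp: in_Lp_iff p_energy_def)

text \<open>The defect in midpoint convexity; for \<open>p = 2\<close> it is
  \<open>(a - b)^2 / 8\<close>. It takes the place of Clarkson's inequalities and treats all
  \<open>p > 1\<close> alike.\<close>

definition convexity_gap :: "real \<Rightarrow> real \<Rightarrow> real \<Rightarrow> real" where
  "convexity_gap p a b = (p_energy p a + p_energy p b) / 2 - p_energy p ((a + b) / 2)"

lemma convexity_gap_nonneg: "1 < p \<Longrightarrow> 0 \<le> convexity_gap p a b"
  using tangent_midpoint[OF tangent_p_energy, of p a b] by (simp add: convexity_gap_def)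

text \<open>The gap is continuous and, by strict convexity, positive on the compact set of pairs in
  the square with distance at least \<open>e\<close>, so it attains a positive minimum. For
  \<open>e > 2 K\<close> the set is empty and any constant does.\<close>

lemma convexity_gap_lower_bound:
  assumes p: "1 < p" and K: "0 < K" and e: "0 < e"
  shows "\<exists>c>0. \<forall>a b. \<bar>a\<bar> \<le> K \<longrightarrow> \<bar>b\<bar> \<le> K \<longrightarrow> e \<le> \<bar>a - b\<bar> \<longrightarrow> c \<le> convexity_gap p a b"
proof -
  define S where "S = {z \<in> {-K..K} \<times> {-K..K}. e \<le> \<bar>fst z - snd z\<bar>}"
  have "closed {z :: real \<times> real. e \<le> \<bar>fst z - snd z\<bar>}"
    by (intro closed_Collect_le continuous_intros)
  then have cS: "compact S"
    unfolding S_def Collect_conj_eq Collect_mem_eq by (intro compact_Int_closed compact_Times) auto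
  have cont: "continuous_on S (\<lambda>z. convexity_gap p (fst z) (snd z))"
    unfolding convexity_gap_def
    by (intro continuous_intros continuous_on_compose2[OF p_energy_continuous[OF p, of UNIV]]) auto
  show ?thesis
  proof (cases "S = {}")
    case True
    then have "\<not> (\<bar>a\<bar> \<le> K \<and> \<bar>b\<bar> \<le> K \<and> e \<le> \<bar>a - b\<bar>)" for a b
      by (auto simp: S_def abs_le_iff)
    then show ?thesis by (intro exI[of _ 1]) auto
  next
    case False
    obtain z where z: "z \<in> S" "\<And>y. y \<in> S \<Longrightarrow> convexity_gap p (fst z) (snd z) \<le> convexity_gap p (fst y) (snd y)"
      using continuous_attains_inf[OF cS False cont] by blast
    have "fst z \<noteq> snd z" using z(1) e by (auto simp: S_def)
    then have "0 < convexity_gap p (fst z) (snd z)"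
      using tangent_strict_midpoint[OF tangent_p_energy[OF p] strict_mono_flux[OF p]] by (simp add: convexity_gap_def)
    moreover have "convexity_gap p (fst z) (snd z) \<le> convexity_gap p a b" if "\<bar>a\<bar> \<le> K" "\<bar>b\<bar> \<le> K" "e \<le> \<bar>a - b\<bar>" for a b
      using z(2)[of "(a, b)"] that by (auto simp: S_def abs_le_iff)
    ultimately show ?thesis by blast
  qed
qed

text \<open>Three regimes: close arguments cost \<open>e\<close>; separated arguments bounded by
  \<open>K\<close> have a gap bounded below, while their distance is at most \<open>2 K\<close>; if
  one exceeds \<open>K\<close>, the larger modulus \<open>m\<close> satisfies
  \<open>m \<le> m powr p / K powr (p - 1)\<close>.\<close>

lemma abs_diff_le_gap:
  assumes p: "1 < p" and K: "0 < K" and e: "0 < e"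
  shows "\<exists>c>0. \<forall>a b. \<bar>a - b\<bar> \<le> e + c * convexity_gap p a b + 2 / K powr (p - 1) * (\<bar>a\<bar> powr p + \<bar>b\<bar> powr p)"
proof -
  obtain c where c: "0 < c" "\<And>a b. \<bar>a\<bar> \<le> K \<Longrightarrow> \<bar>b\<bar> \<le> K \<Longrightarrow> e \<le> \<bar>a - b\<bar> \<Longrightarrow> c \<le> convexity_gap p a b"
    using convexity_gap_lower_bound[OF p K e] by blast
  have "\<bar>a - b\<bar> \<le> e + 2 * K / c * convexity_gap p a b + 2 / K powr (p - 1) * (\<bar>a\<bar> powr p + \<bar>b\<bar> powr p)" for a b
  proof -
    have g: "0 \<le> 2 * K / c * convexity_gap p a b" using c(1) K convexity_gap_nonneg[OF p] by simp
    have t: "0 \<le> 2 / K powr (p - 1) * (\<bar>a\<bar> powr p + \<bar>b\<bar> powr p)" by simp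
    consider "\<bar>a - b\<bar> \<le> e" | "e \<le> \<bar>a - b\<bar>" "\<bar>a\<bar> \<le> K" "\<bar>b\<bar> \<le> K" | "K < max \<bar>a\<bar> \<bar>b\<bar>" by linarith
    then show ?thesis
    proof cases
      case 1 then show ?thesis using g t by linarith
    next
      case 2
      have "\<bar>a - b\<bar> \<le> 2 * K" using 2 by linarith
      also have "2 * K \<le> 2 * K / c * convexity_gap p a b"
        using mult_left_mono[OF c(2)[OF 2(2,3,1)], of "2 * K / c"] c(1) K by simp
      finally show ?thesis using e t by linarith
    next
      case 3
      define m where "m = max \<bar>a\<bar> \<bar>b\<bar>"
      have m: "0 < m" "K < m" using 3 K unfolding m_def by linarith+
      have "m * K powr (p - 1) \<le> m * m powr (p - 1)" using m K p by (intro mult_left_mono powr_mono2) auto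
      also have "\<dots> = m powr p" using powr_add[of m "p - 1" 1] m by simp
      also have "\<dots> \<le> \<bar>a\<bar> powr p + \<bar>b\<bar> powr p" by (auto simp: m_def max_def)
      finally have "m \<le> (\<bar>a\<bar> powr p + \<bar>b\<bar> powr p) / K powr (p - 1)"
        using K by (intro mult_imp_le_div_pos) auto
      moreover have "\<bar>a - b\<bar> \<le> 2 * m" unfolding m_def by linarith
      moreover have "2 / K powr (p - 1) * (\<bar>a\<bar> powr p + \<bar>b\<bar> powr p) = 2 * ((\<bar>a\<bar> powr p + \<bar>b\<bar> powr p) / K powr (p - 1))"
        by simp
      ultimately have "\<bar>a - b\<bar> \<le> 2 / K powr (p - 1) * (\<bar>a\<bar> powr p + \<bar>b\<bar> powr p)" by linarith
      then show ?thesis using g e by linarith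
    qed
  qed
  then show ?thesis using c(1) K by (intro exI[of _ "2 * K / c"]) auto
qed

text \<open>Integrating the preceding bound, the uniform bound on the p-th powers makes the tail
  small for large \<open>K\<close>, and then the gap term is small by assumption. The limit is
  obtained in \<open>L^1\<close> only; membership in \<open>L^p\<close> comes later from Fatou's
  lemma.\<close>

lemma convexity_gap_L1_limit:
  fixes g :: "nat \<Rightarrow> real \<Rightarrow> real"
  assumes p: "1 < p" and l: "0 < l" and g: "\<And>n. in_Lp p l (g n)"
    and R: "\<And>n. (LINT x|seg l. \<bar>g n x\<bar> powr p) \<le> R"
    and gap: "\<And>e. 0 < e \<Longrightarrow> \<exists>M. \<forall>n\<ge>M. \<forall>k\<ge>M. (LINT x|seg l. convexity_gap p (g n x) (g k x)) < e"
  shows "\<exists>h. integrable (seg l) h \<and> (\<lambda>n. LINT x|seg l. \<bar>g n x - h x\<bar>) \<longlonglongrightarrow> 0"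
proof -
  have gi: "integrable (seg l) (g n)" for n using in_Lp_integrable[OF g] p by simp
  have gm: "g n \<in> borel_measurable (seg l)" and gp: "integrable (seg l) (\<lambda>x. \<bar>g n x\<bar> powr p)" for n
    using g by (simp_all add: in_Lp_iff)
  have half: "in_Lp p l (\<lambda>x. (g n x + g k x) / 2)" for n k
    using in_Lp_cmult[OF in_Lp_add[OF g g], of "1 / 2" n k] p by simp
  have gapi: "integrable (seg l) (\<lambda>x. convexity_gap p (g n x) (g k x))" for n k
    unfolding convexity_gap_def using p_energy_integrable[OF g] p_energy_integrable[OF half] by simp
  have R0: "0 \<le> R" using order_trans[OF Bochner_Integration.integral_nonneg R] by simp
  have cau: "\<exists>M. \<forall>n\<ge>M. \<forall>k\<ge>M. (LINT x|seg l. \<bar>g n x - g k x\<bar>) < e" if e: "0 < e" for e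
  proof -
    \<comment> \<open>Makes \<open>K powr (p - 1) = 16 R / e + 1\<close>, so that the tail
      \<open>4 R / K powr (p - 1)\<close> is at most \<open>e / 4\<close>; the other two
      contributions are also at most \<open>e / 4\<close> each.\<close>
    define K where "K = (16 * R / e + 1) powr (1 / (p - 1))"
    have Kp: "K powr (p - 1) = 16 * R / e + 1" using p R0 e by (simp add: K_def powr_powr)
    have pos: "0 < 16 * R / e + 1" using R0 e by (simp add: add_nonneg_pos)
    then have K: "0 < K" by (simp add: K_def)
    have tail: "2 / K powr (p - 1) * (2 * R) \<le> e / 4"
      unfolding Kp using R0 e pos by (simp add: divide_le_eq field_simps)
    obtain c where c: "0 < c"
      "\<And>a b. \<bar>a - b\<bar> \<le> e / (4 * l) + c * convexity_gap p a b + 2 / K powr (p - 1) * (\<bar>a\<bar> powr p + \<bar>b\<bar> powr p)"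
      using abs_diff_le_gap[OF p K, of "e / (4 * l)"] e l by auto
    obtain M where M: "\<And>n k. n \<ge> M \<Longrightarrow> k \<ge> M \<Longrightarrow> (LINT x|seg l. convexity_gap p (g n x) (g k x)) < e / (4 * c)"
      using gap[of "e / (4 * c)"] e c(1) by auto
    have "(LINT x|seg l. \<bar>g n x - g k x\<bar>) < e" if "n \<ge> M" "k \<ge> M" for n k
    proof -
      have "(LINT x|seg l. \<bar>g n x - g k x\<bar>) \<le>
        (LINT x|seg l. e / (4 * l) + c * convexity_gap p (g n x) (g k x) + 2 / K powr (p - 1) * (\<bar>g n x\<bar> powr p + \<bar>g k x\<bar> powr p))"
        using c(2) gi gapi gp by (intro Bochner_Integration.integral_mono) auto
      also have "\<dots> = e / 4 + c * (LINT x|seg l. convexity_gap p (g n x) (g k x))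
          + 2 / K powr (p - 1) * ((LINT x|seg l. \<bar>g n x\<bar> powr p) + (LINT x|seg l. \<bar>g k x\<bar> powr p))"
        using gapi gp l measure_seg[of l] by (simp add: field_simps)
      also have "2 / K powr (p - 1) * ((LINT x|seg l. \<bar>g n x\<bar> powr p) + (LINT x|seg l. \<bar>g k x\<bar> powr p)) \<le> 2 / K powr (p - 1) * (2 * R)"
        using R[of n] R[of k] by (intro mult_left_mono) auto
      also have "c * (LINT x|seg l. convexity_gap p (g n x) (g k x)) \<le> e / 4"
        using M[OF that] c(1) by (simp add: field_simps)
      finally show ?thesis using tail e by linarith
    qed
    then show ?thesis by blast
  qed
  \<comment> \<open>Extension by zero moves the sequence to \<open>L1R\<close>, whose completeness
    supplies the limit.\<close>
  define f where "f n = (\<lambda>x. indicator {0<..<l} x * g n x)" for n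
  have f: "integrable lborel (f n)" for n using gi[of n] by (simp add: seg_integrable_iff set_integrable_def f_def)
  have seg_f: "(LINT x|lborel. \<bar>f n x - indicator {0<..<l} x * h x\<bar>) = (LINT x|seg l. \<bar>g n x - h x\<bar>)" for n h
    unfolding set_integral_seg[symmetric] set_lebesgue_integral_def f_def
    by (intro Bochner_Integration.integral_cong) (auto simp: indicator_def)
  have "Cauchy (\<lambda>n. abs_L1R (f n))"
  proof (rule metric_CauchyI)
    fix e :: real assume "0 < e"
    then obtain M where "\<And>n k. n \<ge> M \<Longrightarrow> k \<ge> M \<Longrightarrow> (LINT x|seg l. \<bar>g n x - g k x\<bar>) < e" using cau by blast
    moreover have "dist (abs_L1R (f m)) (abs_L1R (f n)) = (LINT x|seg l. \<bar>g m x - g n x\<bar>)" for m n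
      using dist_abs_L1R[OF f f] seg_f[of m "g n"] by (simp add: f_def)
    ultimately show "\<exists>M. \<forall>m\<ge>M. \<forall>n\<ge>M. dist (abs_L1R (f m)) (abs_L1R (f n)) < e"
      by (intro exI[of _ M]) auto
  qed
  then obtain H where H: "(\<lambda>n. abs_L1R (f n)) \<longlonglongrightarrow> H" using Cauchy_convergent convergent_def by blast
  have "(\<lambda>n. LINT x|seg l. \<bar>g n x - rep_L1R H x\<bar>) \<longlonglongrightarrow> 0"
  proof (rule Lim_null_comparison)
    show "(\<lambda>n. dist (abs_L1R (f n)) H) \<longlonglongrightarrow> 0" using H by (simp add: tendsto_dist_iff[symmetric])
    have "(LINT x|seg l. \<bar>g n x - rep_L1R H x\<bar>) \<le> dist (abs_L1R (f n)) H" for n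
    proof -
      have i: "integrable lborel (\<lambda>x. \<bar>f n x - rep_L1R H x\<bar>)" using f by simp
      have "(LINT x|seg l. \<bar>g n x - rep_L1R H x\<bar>) = (LINT x|lborel. indicator {0<..<l} x * \<bar>f n x - rep_L1R H x\<bar>)"
        unfolding set_integral_seg[symmetric] set_lebesgue_integral_def f_def
        by (intro Bochner_Integration.integral_cong) (auto simp: indicator_def)
      also have "\<dots> \<le> (LINT x|lborel. \<bar>f n x - rep_L1R H x\<bar>)"
        using integrable_mult_indicator[of "{0<..<l}", OF _ i] i
        by (intro Bochner_Integration.integral_mono) (auto simp: indicator_def)
      also have "\<dots> = dist (abs_L1R (f n)) (abs_L1R (rep_L1R H))"
        using dist_abs_L1R[OF f integrable_rep_L1R] by simp
      finally show ?thesis by simp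
    qed
    then show "\<forall>\<^sub>F n in sequentially. norm (LINT x|seg l. \<bar>g n x - rep_L1R H x\<bar>) \<le> dist (abs_L1R (f n)) H"
      by (intro always_eventually) (simp add: Bochner_Integration.integral_nonneg)
  qed
  then show ?thesis by (intro exI[of _ "rep_L1R H"]) simp
qed

text \<open>Supplies both the finiteness of the p-energy of an almost everywhere limit and its lower
  semicontinuity along a sequence with convergent energies.\<close>

lemma Fatou_limit:
  fixes f :: "nat \<Rightarrow> real \<Rightarrow> real"
  assumes f: "\<And>n. integrable M (f n)" "\<And>n x. 0 \<le> f n x" and h: "h \<in> borel_measurable M" "\<And>x. 0 \<le> h x"
    and AE: "AE x in M. (\<lambda>n. f n x) \<longlonglongrightarrow> h x" and lim: "(\<lambda>n. LINT x|M. f n x) \<longlonglongrightarrow> \<tau>"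
  shows "integrable M h" "(LINT x|M. h x) \<le> \<tau>"
proof -
  have t0: "0 \<le> \<tau>" by (rule tendsto_lowerbound[OF lim]) (use f(2) in \<open>auto intro: Bochner_Integration.integral_nonneg\<close>)
  have "(\<integral>\<^sup>+x. ennreal (h x) \<partial>M) = (\<integral>\<^sup>+x. liminf (\<lambda>n. ennreal (f n x)) \<partial>M)"
    by (rule nn_integral_cong_AE, use AE in eventually_elim)
      (auto intro!: lim_imp_Liminf[symmetric] tendsto_ennrealI)
  also have "\<dots> \<le> liminf (\<lambda>n. \<integral>\<^sup>+x. ennreal (f n x) \<partial>M)"
    using f(1) by (intro nn_integral_liminf) (auto dest: borel_measurable_integrable)
  also have "\<dots> = liminf (\<lambda>n. ennreal (LINT x|M. f n x))"
    using f by (simp add: nn_integral_eq_integral)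
  also have "\<dots> = ennreal \<tau>"
    by (intro lim_imp_Liminf tendsto_ennrealI lim) simp
  finally have *: "(\<integral>\<^sup>+x. ennreal (h x) \<partial>M) \<le> ennreal \<tau>" .
  then show i: "integrable M h"
    using h by (intro integrableI_nonneg) (auto simp: order_le_less_trans)
  show "(LINT x|M. h x) \<le> \<tau>"
    using * t0 h i by (simp add: nn_integral_eq_integral ennreal_le_iff)
qed

text \<open>One extraction per index; a property inherited by subsequences survives the later
  extractions. It is applied to the edges and then to the vertices.\<close>

lemma common_subsequence:
  assumes "finite I"
    and sub: "\<And>i s r. Q i s \<Longrightarrow> strict_mono r \<Longrightarrow> Q i (s \<circ> r)"
    and ex: "\<And>i s. i \<in> I \<Longrightarrow> strict_mono s \<Longrightarrow> \<exists>r. strict_mono (r :: nat \<Rightarrow> nat) \<and> Q i (s \<circ> r)"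
    and "strict_mono (s0 :: nat \<Rightarrow> nat)"
  shows "\<exists>r. strict_mono (r :: nat \<Rightarrow> nat) \<and> (\<forall>i\<in>I. Q i (s0 \<circ> r))"
  using assms(1,3)
proof (induction I rule: finite_induct)
  case empty
  show ?case by (intro exI[of _ id]) (simp add: strict_mono_def)
next
  case (insert i I)
  then obtain r where r: "strict_mono r" "\<And>j. j \<in> I \<Longrightarrow> Q j (s0 \<circ> r)" by blast
  obtain r' where r': "strict_mono r'" "Q i (s0 \<circ> r \<circ> r')"
    using insert.prems[OF insertI1 strict_mono_o[OF \<open>strict_mono s0\<close> r(1)]] by blast
  show ?case
    using r'(2) sub[OF r(2) r'(1)] strict_mono_o[OF r(1) r'(1)]
    by (intro exI[of _ "r \<circ> r'"]) (auto simp only: o_assoc insert_iff)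
qed

section \<open>The stationary problem\<close>

context graph_problem
begin

definition potential :: "'v \<times> 'v \<Rightarrow> real \<Rightarrow> real" where
  "potential e = (SOME P. tangent P (\<gamma> e) \<and> P 0 = 0 \<and> (\<forall>s. 0 \<le> P s) \<and> continuous_on UNIV P)"

lemma potential:
  assumes "e \<in> E"
  shows "tangent (potential e) (\<gamma> e)" "potential e 0 = 0" "0 \<le> potential e s" "continuous_on UNIV (potential e)"
proof -
  have "\<exists>P. tangent P (\<gamma> e) \<and> P 0 = 0 \<and> (\<forall>s. 0 \<le> P s) \<and> continuous_on UNIV P"
    using tangent_primitive[of "\<gamma> e"] \<gamma>[OF assms] strict_mono_mono by metis
  from someI_ex[OF this] show "tangent (potential e) (\<gamma> e)" "potential e 0 = 0" "0 \<le> potential e s" "continuous_on UNIV (potential e)"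
    unfolding potential_def by blast+
qed

section \<open>A priori bounds from the variation\<close>

definition variation :: "('v \<times> 'v \<Rightarrow> real \<Rightarrow> real) \<Rightarrow> real" where
  "variation u = (\<Sum>e\<in>E. LINT x|seg_of e. \<bar>wd u e x\<bar>)"

lemma variation_ge: "e \<in> E \<Longrightarrow> (LINT x|seg_of e. \<bar>wd u e x\<bar>) \<le> variation u"
  unfolding variation_def by (rule member_le_sum) auto

lemma variation_nonneg: "0 \<le> variation u"
  unfolding variation_def by (intro sum_nonneg) simp

lemma edge_oscillation:
  assumes u: "u \<in> \<W>" and e: "e \<in> E" and x: "x \<in> {0..len G e}"
  shows "\<bar>u e x - vv u (fst e)\<bar> \<le> variation u"
proof -
  have "u e x - vv u (fst e) = (LINT y|seg x. wd u e y)"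
    using sobolev_repD(2)[OF graphD(1)[OF u e] x] graph_endpoints(1)[OF u e] by linarith
  then have "\<bar>u e x - vv u (fst e)\<bar> \<le> (LINT y|seg x. \<bar>wd u e y\<bar>)"
    using integral_abs_bound[of "seg x" "wd u e"] by simp
  also have "\<dots> \<le> (LINT y|seg_of e. \<bar>wd u e y\<bar>)"
    using wd_integrable[OF u e] x by (intro seg_integral_mono_length) auto
  finally show ?thesis using variation_ge[OF e, of u] by linarith
qed

text \<open>Connectedness enters here: \<open>k\<close> counts the edges of a path from
  \<open>a\<close> to \<open>b\<close>, each of which costs at most one variation.\<close>

lemma path_oscillation: "\<exists>k\<ge>0. \<forall>u\<in>\<W>. \<bar>vv u a - vv u b\<bar> \<le> k * variation u"
proof -
  have "(a, b) \<in> (edges G \<union> (edges G)\<inverse>)\<^sup>*" using connected_G by (simp add: connected_graph_def)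
  then show ?thesis
  proof (induction rule: rtrancl_induct)
    case base
    show ?case by (intro exI[of _ 0]) simp
  next
    case (step y z)
    from step.IH obtain k where k: "0 \<le> k" "\<forall>u\<in>\<W>. \<bar>vv u a - vv u y\<bar> \<le> k * variation u" by blast
    have "\<bar>vv u a - vv u z\<bar> \<le> (k + 1) * variation u" if u: "u \<in> \<W>" for u
    proof -
      have edge: "\<bar>vv u (snd e) - vv u (fst e)\<bar> \<le> variation u" if e: "e \<in> E" for e
        using edge_oscillation[OF u e, of "len G e"] graph_endpoints(2)[OF u e] len_pos[OF e] by simp
      have "\<bar>vv u y - vv u z\<bar> \<le> variation u"
        using step.hyps(2) edge[of "(y, z)"] edge[of "(z, y)"] by (auto simp: abs_minus_commute)
      moreover have "\<bar>vv u a - vv u y\<bar> \<le> k * variation u" using k u by blast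
      ultimately show ?thesis by (simp add: distrib_right)
    qed
    then show ?case using k by (intro exI[of _ "k + 1"]) auto
  qed
qed

text \<open>A Poincare inequality. Derivatives do not see constants, so the mean of
  \<open>|u|\<close> over a single edge is added, and connectedness transports the bound to the rest
  of the graph.\<close>

lemma sup_bound:
  assumes e0: "e0 \<in> E"
  shows "\<exists>K\<ge>0. \<forall>u\<in>\<W>. (\<forall>e\<in>E. \<forall>x\<in>{0..len G e}. \<bar>u e x\<bar> \<le> (LINT y|seg_of e0. \<bar>u e0 y\<bar>) / len G e0 + K * variation u)
    \<and> (\<forall>v. \<bar>vv u v\<bar> \<le> (LINT y|seg_of e0. \<bar>u e0 y\<bar>) / len G e0 + K * variation u)"
proof -
  from path_oscillation have "\<forall>a. \<exists>k\<ge>0. \<forall>u\<in>\<W>. \<bar>vv u a - vv u (fst e0)\<bar> \<le> k * variation u" by blast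
  then obtain k where k: "\<And>a. 0 \<le> k a" "\<And>a u. u \<in> \<W> \<Longrightarrow> \<bar>vv u a - vv u (fst e0)\<bar> \<le> k a * variation u" by metis
  \<comment> \<open>The sum dominates every path constant. One of the two extra units leads from a
    point of \<open>e0\<close> to its initial vertex, the other from a vertex into the edge
    \<open>e\<close>.\<close>
  define K where "K = (\<Sum>a\<in>UNIV. k a) + 2"
  have kK: "k a \<le> K - 2" for a unfolding K_def using k(1) by (simp add: member_le_sum)
  have K0: "0 \<le> K" using kK[of "fst e0"] k(1)[of "fst e0"] by linarith
  have l: "0 < len G e0" by (rule len_pos[OF e0])
  have avg: "c \<le> (LINT y|seg_of e0. \<bar>u e0 y\<bar>) / len G e0 + B" if u: "u \<in> \<W>" and "\<And>y. y \<in> {0..len G e0} \<Longrightarrow> c \<le> \<bar>u e0 y\<bar> + B" for c u B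
  proof -
    have "(LINT y|seg_of e0. c - B) \<le> (LINT y|seg_of e0. \<bar>u e0 y\<bar>)"
    proof (rule integral_mono_AE)
      show "AE y in seg_of e0. c - B \<le> \<bar>u e0 y\<bar>"
      proof (rule AE_I2)
        fix y assume "y \<in> space (seg_of e0)"
        then show "c - B \<le> \<bar>u e0 y\<bar>" using that(2)[of y] by simp
      qed
    qed (use graph_integrable[OF u e0] in auto)
    moreover have "(LINT y|seg_of e0. c - B) = (c - B) * len G e0" using l measure_seg[of "len G e0"] by simp
    ultimately have "c - B \<le> (LINT y|seg_of e0. \<bar>u e0 y\<bar>) / len G e0" using l by (simp only: pos_le_divide_eq)
    then show ?thesis by linarith
  qed
  have vb: "\<bar>vv u v\<bar> \<le> (LINT y|seg_of e0. \<bar>u e0 y\<bar>) / len G e0 + (K - 1) * variation u" if u: "u \<in> \<W>" for u v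
  proof (rule avg[OF u])
    fix y assume "y \<in> {0..len G e0}"
    then have "\<bar>u e0 y - vv u (fst e0)\<bar> \<le> variation u" by (rule edge_oscillation[OF u e0])
    moreover have "\<bar>vv u v - vv u (fst e0)\<bar> \<le> (K - 2) * variation u"
      using k(2)[OF u, of v] mult_right_mono[OF kK[of v] variation_nonneg[of u]] by linarith
    ultimately show "\<bar>vv u v\<bar> \<le> \<bar>u e0 y\<bar> + (K - 1) * variation u" by (simp add: algebra_simps)
  qed
  show ?thesis
  proof (intro exI[of _ K] conjI ballI allI K0)
    fix u v assume u: "u \<in> \<W>"
    show "\<bar>vv u v\<bar> \<le> (LINT y|seg_of e0. \<bar>u e0 y\<bar>) / len G e0 + K * variation u"
      using vb[OF u, of v] variation_nonneg[of u] by (simp add: algebra_simps)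
  next
    fix u e x assume u: "u \<in> \<W>" and "e \<in> E" "x \<in> {0..len G e}"
    then have "\<bar>u e x - vv u (fst e)\<bar> \<le> variation u" by (intro edge_oscillation)
    then show "\<bar>u e x\<bar> \<le> (LINT y|seg_of e0. \<bar>u e0 y\<bar>) / len G e0 + K * variation u"
      using vb[OF u, of "fst e"] by (simp add: algebra_simps)
  qed
qed

text \<open>Its Euler-Lagrange equation is the weak form of \<open>W + r Z = X\<close> with
  \<open>W\<close> given by the densities \<open>\<gamma> e (u e x)\<close> and with
  \<open>Z\<close> in the image of \<open>W\<close>.\<close>

definition objective :: "real \<Rightarrow> 'v state \<Rightarrow> ('v \<times> 'v \<Rightarrow> real \<Rightarrow> real) \<Rightarrow> real" where
  "objective r X u = r * (\<Sum>e\<in>E. LINT x|seg_of e. p_energy (p e) (wd u e x))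
    + (\<Sum>e\<in>E. LINT x|seg_of e. potential e (u e x)) - load X u"

lemma potential_integrable: "u \<in> \<W> \<Longrightarrow> e \<in> E \<Longrightarrow> integrable (seg_of e) (\<lambda>x. potential e (u e x))"
  by (intro seg_integrable_continuous continuous_on_compose2[OF potential(4) graph_continuous]) auto

lemma p_energy_wd_integrable: "u \<in> \<W> \<Longrightarrow> e \<in> E \<Longrightarrow> integrable (seg_of e) (\<lambda>x. p_energy (p e) (wd u e x))"
  by (rule p_energy_integrable[OF wd_in_Lp])

definition load_bound :: "'v state \<Rightarrow> real" where
  "load_bound X = (\<Sum>e\<in>E. LINT x|seg_of e. \<bar>edge_dens X e x\<bar>) + (\<Sum>v\<in>UNIV. \<bar>vertex_mass X v\<bar>)"

lemma load_bound_nonneg: "0 \<le> load_bound X"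
  unfolding load_bound_def by (intro add_nonneg_nonneg sum_nonneg) auto

lemma load_le:
  assumes u: "u \<in> \<W>" and N: "\<And>e x. e \<in> E \<Longrightarrow> x \<in> {0..len G e} \<Longrightarrow> \<bar>u e x\<bar> \<le> N" "\<And>v. \<bar>vv u v\<bar> \<le> N"
  shows "load X u \<le> load_bound X * N"
proof -
  have "(LINT x|seg_of e. edge_dens X e x * u e x) \<le> (LINT x|seg_of e. \<bar>edge_dens X e x\<bar>) * N" if e: "e \<in> E" for e
  proof -
    have "(LINT x|seg_of e. edge_dens X e x * u e x) \<le> (LINT x|seg_of e. \<bar>edge_dens X e x\<bar> * N)"
    proof (rule integral_mono_AE)
      show "AE x in seg_of e. edge_dens X e x * u e x \<le> \<bar>edge_dens X e x\<bar> * N"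
      proof (rule AE_I2)
        fix x assume "x \<in> space (seg_of e)"
        then have "\<bar>edge_dens X e x\<bar> * \<bar>u e x\<bar> \<le> \<bar>edge_dens X e x\<bar> * N" using N(1)[OF e, of x] by (intro mult_left_mono) auto
        then show "edge_dens X e x * u e x \<le> \<bar>edge_dens X e x\<bar> * N"
          using abs_ge_self[of "edge_dens X e x * u e x"] by (simp add: abs_mult)
      qed
    qed (use dens_mult_integrable[OF u e] in auto)
    then show ?thesis by simp
  qed
  moreover have "vertex_mass X v * vv u v \<le> \<bar>vertex_mass X v\<bar> * N" for v
    using mult_left_mono[OF N(2)[of v], of "\<bar>vertex_mass X v\<bar>"] abs_ge_self[of "vertex_mass X v * vv u v"]
    by (simp add: abs_mult)
  ultimately show ?thesis
    unfolding load_def load_bound_def distrib_right sum_distrib_right by (intro add_mono sum_mono)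
qed

text \<open>The load is at most linear in the uniform bound \<open>N u\<close>, whereas p-energy and
  potential are superlinear and hence outgrow any prescribed multiple of \<open>N u\<close>.\<close>

lemma objective_coercive:
  assumes e0: "e0 \<in> E" and r: "0 < r"
  shows "\<exists>N C. \<forall>u\<in>\<W>. (\<forall>e\<in>E. \<forall>x\<in>{0..len G e}. \<bar>u e x\<bar> \<le> N u) \<and> (\<forall>v. \<bar>vv u v\<bar> \<le> N u) \<and> N u \<le> objective r X u + C"
proof -
  obtain K where K: "0 \<le> K"
    "\<And>u e x. u \<in> \<W> \<Longrightarrow> e \<in> E \<Longrightarrow> x \<in> {0..len G e} \<Longrightarrow> \<bar>u e x\<bar> \<le> (LINT y|seg_of e0. \<bar>u e0 y\<bar>) / len G e0 + K * variation u"
    "\<And>u v. u \<in> \<W> \<Longrightarrow> \<bar>vv u v\<bar> \<le> (LINT y|seg_of e0. \<bar>u e0 y\<bar>) / len G e0 + K * variation u"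
    using sup_bound[OF e0] by blast
  define N where "N u = (LINT y|seg_of e0. \<bar>u e0 y\<bar>) / len G e0 + K * variation u" for u
  \<comment> \<open>One more than the load can consume. \<open>B1\<close> and \<open>B2\<close> are
    the slopes for which \<open>r B1\<close> times the variation plus \<open>B2\<close> times the
    integral over \<open>e0\<close> equals \<open>M * N u\<close>; after subtraction of the load one
    \<open>N u\<close> is left.\<close>
  define M where "M = load_bound X + 1"
  have M: "0 < M" using load_bound_nonneg[of X] by (simp add: M_def)
  define B1 where "B1 = M * K / r"
  define B2 where "B2 = M / len G e0"
  have B: "0 \<le> B1" "0 \<le> B2" using M K(1) r len_pos[OF e0] by (auto simp: B1_def B2_def)
  have "\<forall>e\<in>E. \<exists>C\<ge>0. \<forall>s. B1 * \<bar>s\<bar> \<le> p_energy (p e) s + C"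
    using tangent_superlinear[OF tangent_p_energy p_energy_nonneg surj_flux] p_gt_1 by blast
  then obtain C1 where C1: "\<And>e s. e \<in> E \<Longrightarrow> B1 * \<bar>s\<bar> \<le> p_energy (p e) s + C1 e" by metis
  have "\<forall>e\<in>E. \<exists>C\<ge>0. \<forall>s. B2 * \<bar>s\<bar> \<le> potential e s + C"
    using tangent_superlinear[OF potential(1,3)] \<gamma> by blast
  then obtain C2 where C2: "\<And>e s. e \<in> E \<Longrightarrow> B2 * \<bar>s\<bar> \<le> potential e s + C2 e" by metis
  define C where "C = r * (\<Sum>e\<in>E. C1 e * len G e) + (\<Sum>e\<in>E. C2 e * len G e)"
  have "N u \<le> objective r X u + C" if u: "u \<in> \<W>" for u
  proof -
    have 1: "B1 * (LINT x|seg_of e. \<bar>wd u e x\<bar>) \<le> (LINT x|seg_of e. p_energy (p e) (wd u e x)) + C1 e * len G e" if e: "e \<in> E" for e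
    proof -
      have "(LINT x|seg_of e. B1 * \<bar>wd u e x\<bar>) \<le> (LINT x|seg_of e. p_energy (p e) (wd u e x) + C1 e)"
        using wd_integrable[OF u e] p_energy_wd_integrable[OF u e] C1[OF e] by (intro Bochner_Integration.integral_mono) auto
      then show ?thesis using p_energy_wd_integrable[OF u e] measure_seg[of "len G e"] len_pos[OF e] by (simp add: mult.commute)
    qed
    have 2: "B2 * (LINT x|seg_of e. \<bar>u e x\<bar>) \<le> (LINT x|seg_of e. potential e (u e x)) + C2 e * len G e" if e: "e \<in> E" for e
    proof -
      have "(LINT x|seg_of e. B2 * \<bar>u e x\<bar>) \<le> (LINT x|seg_of e. potential e (u e x) + C2 e)"
        using graph_integrable[OF u e] potential_integrable[OF u e] C2[OF e] by (intro Bochner_Integration.integral_mono) auto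
      then show ?thesis using potential_integrable[OF u e] measure_seg[of "len G e"] len_pos[OF e] by (simp add: mult.commute)
    qed
    have "(\<Sum>e\<in>E. B1 * (LINT x|seg_of e. \<bar>wd u e x\<bar>)) \<le> (\<Sum>e\<in>E. (LINT x|seg_of e. p_energy (p e) (wd u e x)) + C1 e * len G e)"
      by (intro sum_mono 1)
    then have "B1 * variation u \<le> (\<Sum>e\<in>E. LINT x|seg_of e. p_energy (p e) (wd u e x)) + (\<Sum>e\<in>E. C1 e * len G e)"
      by (simp only: variation_def sum_distrib_left sum.distrib)
    then have a: "r * (B1 * variation u) \<le> r * ((\<Sum>e\<in>E. LINT x|seg_of e. p_energy (p e) (wd u e x)) + (\<Sum>e\<in>E. C1 e * len G e))"
      using r by (intro mult_left_mono) auto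
    have "B2 * (LINT x|seg_of e0. \<bar>u e0 x\<bar>) \<le> (\<Sum>e\<in>E. B2 * (LINT x|seg_of e. \<bar>u e x\<bar>))"
      by (rule member_le_sum[OF e0]) (use B in auto)
    also have "\<dots> \<le> (\<Sum>e\<in>E. (LINT x|seg_of e. potential e (u e x)) + C2 e * len G e)"
      by (intro sum_mono 2)
    finally have b: "B2 * (LINT x|seg_of e0. \<bar>u e0 x\<bar>) \<le> (\<Sum>e\<in>E. LINT x|seg_of e. potential e (u e x)) + (\<Sum>e\<in>E. C2 e * len G e)"
      by (simp add: sum.distrib)
    have c: "load X u \<le> load_bound X * N u"
      by (rule load_le[OF u]) (use K(2,3) u in \<open>auto simp: N_def\<close>)
    have "M * N u = r * (B1 * variation u) + B2 * (LINT x|seg_of e0. \<bar>u e0 x\<bar>)"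
      using r len_pos[OF e0] by (simp add: N_def B1_def B2_def field_simps)
    then have "N u + load_bound X * N u = r * (B1 * variation u) + B2 * (LINT x|seg_of e0. \<bar>u e0 x\<bar>)"
      by (simp add: M_def algebra_simps)
    then show ?thesis using a b c by (simp add: objective_def C_def distrib_left)
  qed
  then show ?thesis using K(2,3) by (intro exI[of _ N] exI[of _ C]) (auto simp: N_def)
qed

lemma load_lincomb:
  assumes "u \<in> \<W>" "w \<in> \<W>"
  shows "load X (\<lambda>e x. a * u e x + t * w e x) = a * load X u + t * load X w"
proof -
  have "(LINT x|seg_of e. edge_dens X e x * (a * u e x + t * w e x)) =
     a * (LINT x|seg_of e. edge_dens X e x * u e x) + t * (LINT x|seg_of e. edge_dens X e x * w e x)" if e: "e \<in> E" for e
  proof -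
    have "(LINT x|seg_of e. edge_dens X e x * (a * u e x + t * w e x)) =
       (LINT x|seg_of e. a * (edge_dens X e x * u e x) + t * (edge_dens X e x * w e x))"
      by (intro Bochner_Integration.integral_cong) (auto simp: algebra_simps)
    then show ?thesis using dens_mult_integrable[OF assms(1) e, of X] dens_mult_integrable[OF assms(2) e, of X] by simp
  qed
  then show ?thesis
    unfolding load_def graph_lincomb(3)[OF assms]
    by (simp add: sum.distrib sum_distrib_left algebra_simps)
qed

text \<open>The potential is convex and the load linear, so only the gap of the p-energy survives on
  the left. For two nearly minimizing functions the right-hand side is at most their mean excess
  over the infimum.\<close>

lemma objective_midpoint:
  assumes u: "u \<in> \<W>" and w: "w \<in> \<W>" and r: "0 < r"
  defines "z \<equiv> \<lambda>e x. (1/2) * u e x + (1/2) * w e x"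
  shows "z \<in> \<W>" "e \<in> E \<Longrightarrow> r * (LINT x|seg_of e. convexity_gap (p e) (wd u e x) (wd w e x))
    \<le> (objective r X u + objective r X w) / 2 - objective r X z"
proof -
  show zW: "z \<in> \<W>" unfolding z_def by (rule graph_lincomb(1)[OF u w])
  have z: "AE x in seg_of e. wd z e x = (wd u e x + wd w e x) / 2" if e: "e \<in> E" for e
    using graph_lincomb(2)[OF u w e, where a = "1/2" and t = "1/2"] unfolding z_def by (simp add: add_divide_distrib)
  have gap: "(LINT x|seg_of e. convexity_gap (p e) (wd u e x) (wd w e x)) =
      ((LINT x|seg_of e. p_energy (p e) (wd u e x)) + (LINT x|seg_of e. p_energy (p e) (wd w e x))) / 2
      - (LINT x|seg_of e. p_energy (p e) (wd z e x))" (is "_ = ?R") if e: "e \<in> E" for e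
  proof -
    have m: "(\<lambda>x. convexity_gap (p e) (wd u e x) (wd w e x)) \<in> borel_measurable (seg_of e)"
      using wd_measurable[OF u e] wd_measurable[OF w e] unfolding convexity_gap_def p_energy_def by measurable
    have "(LINT x|seg_of e. convexity_gap (p e) (wd u e x) (wd w e x)) =
      (LINT x|seg_of e. (p_energy (p e) (wd u e x) + p_energy (p e) (wd w e x)) / 2 - p_energy (p e) (wd z e x))"
    proof (rule integral_cong_AE[OF m])
      show "(\<lambda>x. (p_energy (p e) (wd u e x) + p_energy (p e) (wd w e x)) / 2 - p_energy (p e) (wd z e x)) \<in> borel_measurable (seg_of e)"
        using wd_measurable[OF u e] wd_measurable[OF w e] wd_measurable[OF zW e] unfolding p_energy_def by measurable
      show "AE x in seg_of e. convexity_gap (p e) (wd u e x) (wd w e x) =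
          (p_energy (p e) (wd u e x) + p_energy (p e) (wd w e x)) / 2 - p_energy (p e) (wd z e x)"
        using z[OF e] by eventually_elim (simp only: convexity_gap_def)
    qed
    also have "\<dots> = ?R"
      using p_energy_wd_integrable[OF u e] p_energy_wd_integrable[OF w e] p_energy_wd_integrable[OF zW e] by simp
    finally show ?thesis .
  qed
  have pot: "(LINT x|seg_of e. potential e (z e x)) \<le> ((LINT x|seg_of e. potential e (u e x)) + (LINT x|seg_of e. potential e (w e x))) / 2"
    if e: "e \<in> E" for e
  proof -
    have "(LINT x|seg_of e. potential e (z e x)) \<le> (LINT x|seg_of e. (potential e (u e x) + potential e (w e x)) / 2)"
      using potential_integrable[OF u e] potential_integrable[OF w e] potential_integrable[OF zW e]
        tangent_midpoint[OF potential(1)[OF e]]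
      by (intro Bochner_Integration.integral_mono) (auto simp: z_def add_divide_distrib)
    then show ?thesis using potential_integrable[OF u e] potential_integrable[OF w e] by simp
  qed
  have gap0: "0 \<le> (LINT x|seg_of e. convexity_gap (p e) (wd u e x) (wd w e x))" if "e \<in> E" for e
    using convexity_gap_nonneg[OF p_gt_1[OF that]] by (intro Bochner_Integration.integral_nonneg) auto
  show "r * (LINT x|seg_of e. convexity_gap (p e) (wd u e x) (wd w e x))
    \<le> (objective r X u + objective r X w) / 2 - objective r X z" if e: "e \<in> E"
  proof -
    have "(LINT x|seg_of e. convexity_gap (p e) (wd u e x) (wd w e x)) \<le> (\<Sum>e\<in>E. LINT x|seg_of e. convexity_gap (p e) (wd u e x) (wd w e x))"
      by (rule member_le_sum[OF e]) (use gap0 in auto)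
    also have "\<dots> = (\<Sum>e\<in>E. ((LINT x|seg_of e. p_energy (p e) (wd u e x)) + (LINT x|seg_of e. p_energy (p e) (wd w e x))) / 2
      - (LINT x|seg_of e. p_energy (p e) (wd z e x)))" by (intro sum.cong gap) auto
    also have "\<dots> = ((\<Sum>e\<in>E. LINT x|seg_of e. p_energy (p e) (wd u e x)) + (\<Sum>e\<in>E. LINT x|seg_of e. p_energy (p e) (wd w e x))) / 2
      - (\<Sum>e\<in>E. LINT x|seg_of e. p_energy (p e) (wd z e x))"
      by (simp add: sum_subtractf sum.distrib sum_divide_distrib[symmetric])
    finally have 1: "r * (LINT x|seg_of e. convexity_gap (p e) (wd u e x) (wd w e x)) \<le> r * \<dots>"
      using r by (intro mult_left_mono) auto
    have "(\<Sum>e\<in>E. LINT x|seg_of e. potential e (z e x)) \<le>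
      (\<Sum>e\<in>E. ((LINT x|seg_of e. potential e (u e x)) + (LINT x|seg_of e. potential e (w e x))) / 2)"
      by (intro sum_mono pot)
    also have "\<dots> = ((\<Sum>e\<in>E. LINT x|seg_of e. potential e (u e x)) + (\<Sum>e\<in>E. LINT x|seg_of e. potential e (w e x))) / 2"
      by (simp add: sum.distrib sum_divide_distrib[symmetric])
    finally have 2: "(\<Sum>e\<in>E. LINT x|seg_of e. potential e (z e x)) \<le> \<dots>" .
    have 3: "load X z = (load X u + load X w) / 2"
      unfolding z_def load_lincomb[OF u w] by simp
    show ?thesis using 1 2 3 unfolding objective_def by (simp add: algebra_simps add_divide_distrib diff_divide_distrib)
  qed
qed

section \<open>Existence of minimizers by the direct method\<close>

lemma zero_in_graph: "(\<lambda>e x. 0) \<in> \<W>"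
proof (rule graphI(1))
  show "sobolev_rep (p e) (len G e) ((\<lambda>e x. 0) e) ((\<lambda>e x. 0) e)" if e: "e \<in> E" for e
    by (rule sobolev_repI) (use p_ge_1[OF e] in \<open>auto intro!: in_Lp_bounded[of _ _ _ 0]\<close>)
  show "\<exists>c. has_vertex_value G (\<lambda>e x. 0) v c" for v
    by (intro exI[of _ 0]) (simp add: has_vertex_value_def)
qed

lemma no_edges_vertex_value: "E = {} \<Longrightarrow> vv u v = 0"
  by (simp add: vertex_value_def)

lemma potential_tendsto:
  assumes e: "e \<in> E" and w: "\<And>n. w n \<in> \<W>" and u: "u \<in> \<W>"
    and R: "\<And>n x. x \<in> {0..len G e} \<Longrightarrow> \<bar>w n e x\<bar> \<le> R"
    and lim: "\<And>x. x \<in> {0..len G e} \<Longrightarrow> (\<lambda>n. w n e x) \<longlonglongrightarrow> u e x"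
  shows "(\<lambda>n. LINT x|seg_of e. potential e (w n e x)) \<longlonglongrightarrow> (LINT x|seg_of e. potential e (u e x))"
proof -
  have "bounded (potential e ` {-R..R})"
    using potential(4)[OF e] by (intro compact_imp_bounded compact_continuous_image) (auto intro: continuous_on_subset)
  then obtain B where "\<forall>y\<in>potential e ` {-R..R}. norm y \<le> B" unfolding bounded_iff by blast
  then have B: "\<And>s. s \<in> {-R..R} \<Longrightarrow> \<bar>potential e s\<bar> \<le> B" by (metis imageI real_norm_def)
  show ?thesis
  proof (rule integral_dominated_convergence[where w = "\<lambda>_. B"])
    show "(\<lambda>x. potential e (u e x)) \<in> borel_measurable (seg_of e)"
      using potential_integrable[OF u e] by auto
    show "(\<lambda>x. potential e (w n e x)) \<in> borel_measurable (seg_of e)" for n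
      using potential_integrable[OF w e] by auto
    show "AE x in seg_of e. (\<lambda>n. potential e (w n e x)) \<longlonglongrightarrow> potential e (u e x)"
    proof (rule AE_I2)
      fix x assume "x \<in> space (seg_of e)"
      then show "(\<lambda>n. potential e (w n e x)) \<longlonglongrightarrow> potential e (u e x)"
        using potential(4)[OF e] lim[of x]
        by (intro isCont_tendsto_compose[of _ "potential e"]) (auto simp: continuous_on_eq_continuous_at)
    qed
    show "AE x in seg_of e. norm (potential e (w n e x)) \<le> B" for n
    proof (rule AE_I2)
      fix x assume "x \<in> space (seg_of e)"
      then have "w n e x \<in> {-R..R}" using R[of x n] by (auto simp: abs_le_iff)
      then show "norm (potential e (w n e x)) \<le> B" using B by simp
    qed
  qed simp
qed

lemma load_tendsto:
  assumes w: "\<And>n. w n \<in> \<W>" and u: "u \<in> \<W>"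
    and R: "\<And>n e x. e \<in> E \<Longrightarrow> x \<in> {0..len G e} \<Longrightarrow> \<bar>w n e x\<bar> \<le> R"
    and lim: "\<And>e x. e \<in> E \<Longrightarrow> x \<in> {0..len G e} \<Longrightarrow> (\<lambda>n. w n e x) \<longlonglongrightarrow> u e x"
    and vlim: "\<And>v. (\<lambda>n. vv (w n) v) \<longlonglongrightarrow> vv u v"
  shows "(\<lambda>n. load X (w n)) \<longlonglongrightarrow> load X u"
  unfolding load_def
proof (intro tendsto_add tendsto_sum tendsto_mult tendsto_const vlim)
  fix e assume e: "e \<in> E"
  show "(\<lambda>n. LINT x|seg_of e. edge_dens X e x * w n e x) \<longlonglongrightarrow> (LINT x|seg_of e. edge_dens X e x * u e x)"
  proof (rule integral_dominated_convergence[where w = "\<lambda>x. \<bar>edge_dens X e x\<bar> * R"])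
    show "(\<lambda>x. edge_dens X e x * u e x) \<in> borel_measurable (seg_of e)"
      using dens_mult_integrable[OF u e] by auto
    show "(\<lambda>x. edge_dens X e x * w n e x) \<in> borel_measurable (seg_of e)" for n
      using dens_mult_integrable[OF w e] by auto
    show "AE x in seg_of e. (\<lambda>n. edge_dens X e x * w n e x) \<longlonglongrightarrow> edge_dens X e x * u e x"
      by (intro AE_I2 tendsto_mult tendsto_const lim e) auto
    show "AE x in seg_of e. norm (edge_dens X e x * w n e x) \<le> \<bar>edge_dens X e x\<bar> * R" for n
      using R[OF e] by (intro AE_I2) (auto simp: abs_mult intro!: mult_left_mono)
  qed simp
qed

lemma minimizer_exists:
  assumes r: "0 < r"
  shows "\<exists>u\<in>\<W>. \<forall>w\<in>\<W>. objective r X u \<le> objective r X w"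
proof (cases "E = {}")
  \<comment> \<open>Without edges every term vanishes, the vertex values by convention, and any
    function is a minimizer.\<close>
  case True
  then have "objective r X u = 0" for u
    by (simp add: objective_def load_def no_edges_vertex_value)
  then show ?thesis using zero_in_graph by auto
next
  case False
  then obtain e0 where e0: "e0 \<in> E" by blast
  obtain N C where NC: "\<And>u e x. u \<in> \<W> \<Longrightarrow> e \<in> E \<Longrightarrow> x \<in> {0..len G e} \<Longrightarrow> \<bar>u e x\<bar> \<le> N u"
    "\<And>u v. u \<in> \<W> \<Longrightarrow> \<bar>vv u v\<bar> \<le> N u" "\<And>u. u \<in> \<W> \<Longrightarrow> N u \<le> objective r X u + C"
    using objective_coercive[OF e0 r, of X] by blast
  have N0: "0 \<le> N u" if "u \<in> \<W>" for u using NC(2)[OF that, of "fst e0"] abs_ge_zero[of "vv u (fst e0)"] by linarith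
  define m where "m = (INF u\<in>\<W>. objective r X u)"
  have bdd: "bdd_below (objective r X ` \<W>)"
    using N0 NC(3) by (intro bdd_belowI2[of _ "- C"]) force
  have m: "m \<le> objective r X u" if "u \<in> \<W>" for u unfolding m_def by (rule cINF_lower[OF bdd that])
  have "\<exists>u\<in>\<W>. objective r X u < m + 1 / real (Suc n)" for n
    using cINF_less_iff[of \<W> "objective r X" "m + 1 / real (Suc n)"] bdd zero_in_graph by (auto simp: m_def)
  then obtain u where u: "\<And>n. u n \<in> \<W>" "\<And>n. objective r X (u n) < m + 1 / real (Suc n)" by metis
  have u1: "objective r X (u n) < m + 1" for n
    using u(2)[of n] by (rule less_le_trans) simp
  define R where "R = m + 1 + C"
  have NR: "N (u n) \<le> R" for n using NC(3)[OF u(1), of n] u1[of n] by (simp add: R_def)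
  have ub: "\<bar>u n e x\<bar> \<le> R" if "e \<in> E" "x \<in> {0..len G e}" for n e x using NC(1)[OF u(1) that, of n] NR[of n] by linarith
  have vb: "\<bar>vv (u n) v\<bar> \<le> R" for n v using NC(2)[OF u(1), of n v] NR[of n] by linarith
  \<comment> \<open>Discarding the nonnegative potential term and bounding the load by the uniform
    bound \<open>R\<close> leaves this bound for the p-energy on each edge.\<close>
  define S where "S = (m + 1 + load_bound X * R) / r"
  have energy: "(LINT x|seg_of e. p_energy (p e) (wd (u n) e x)) \<le> S" and energy0: "0 \<le> (LINT x|seg_of e. p_energy (p e) (wd (u n) e x))"
    if e: "e \<in> E" for e n
  proof -
    have nn: "0 \<le> (LINT x|seg_of e. p_energy (p e) (wd (u n) e x))" if "e \<in> E" for e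
      using p_energy_nonneg[OF p_gt_1[OF that]] by (intro Bochner_Integration.integral_nonneg) auto
    then show "0 \<le> (LINT x|seg_of e. p_energy (p e) (wd (u n) e x))" using e .
    have "(LINT x|seg_of e. p_energy (p e) (wd (u n) e x)) \<le> (\<Sum>e\<in>E. LINT x|seg_of e. p_energy (p e) (wd (u n) e x))"
      by (rule member_le_sum[OF e]) (use nn in auto)
    then have "r * (LINT x|seg_of e. p_energy (p e) (wd (u n) e x)) \<le> r * (\<Sum>e\<in>E. LINT x|seg_of e. p_energy (p e) (wd (u n) e x))"
      using r by (intro mult_left_mono) auto
    also have "\<dots> \<le> objective r X (u n) + load X (u n)"
      using potential(3) unfolding objective_def by (auto intro!: sum_nonneg Bochner_Integration.integral_nonneg)
    also have "\<dots> \<le> m + 1 + load_bound X * R"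
      using u1[of n] load_le[OF u(1)[of n] ub vb, where X = X] by simp
    finally show "(LINT x|seg_of e. p_energy (p e) (wd (u n) e x)) \<le> S"
      using r by (simp add: S_def pos_le_divide_eq mult.commute)
  qed
  have inv: "(\<lambda>n. 1 / real (Suc n)) \<longlonglongrightarrow> 0" by (rule LIMSEQ_Suc[OF lim_1_over_n])
  \<comment> \<open>The midpoint of two members of the sequence is admissible, so its objective is
    at least \<open>m\<close>, and their convexity gap is at most the mean excess divided by
    \<open>r\<close>.\<close>
  have "\<exists>h. integrable (seg_of e) h \<and> (\<lambda>n. LINT x|seg_of e. \<bar>wd (u n) e x - h x\<bar>) \<longlonglongrightarrow> 0" if e: "e \<in> E" for e
  proof (rule convexity_gap_L1_limit[OF p_gt_1[OF e] len_pos[OF e] wd_in_Lp[OF u(1) e]])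
    show "(LINT x|seg_of e. \<bar>wd (u n) e x\<bar> powr p e) \<le> p e * S" for n
    proof -
      have "(LINT x|seg_of e. \<bar>wd (u n) e x\<bar> powr p e) = p e * (LINT x|seg_of e. p_energy (p e) (wd (u n) e x))"
        using p_gt_1[OF e] by (simp add: p_energy_def)
      then show ?thesis using energy[OF e, of n] p_gt_1[OF e] by simp
    qed
    fix \<epsilon> :: real assume "0 < \<epsilon>"
    then have "0 < r * \<epsilon>" using r by simp
    from order_tendstoD(2)[OF inv this] obtain M where M: "\<And>n. n \<ge> M \<Longrightarrow> 1 / real (Suc n) < r * \<epsilon>"
      by (auto simp: eventually_sequentially)
    have "(LINT x|seg_of e. convexity_gap (p e) (wd (u n) e x) (wd (u k) e x)) < \<epsilon>" if "n \<ge> M" "k \<ge> M" for n k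
    proof -
      have "r * (LINT x|seg_of e. convexity_gap (p e) (wd (u n) e x) (wd (u k) e x)) \<le>
          (objective r X (u n) + objective r X (u k)) / 2 - m"
        using objective_midpoint(2)[OF u(1)[of n] u(1)[of k] r e, where X = X]
          m[OF objective_midpoint(1)[OF u(1)[of n] u(1)[of k] r]] by linarith
      also have "\<dots> < r * \<epsilon>" using u(2)[of n] u(2)[of k] M[OF that(1)] M[OF that(2)] by argo
      finally show ?thesis using r by simp
    qed
    then show "\<exists>M. \<forall>n\<ge>M. \<forall>k\<ge>M. (LINT x|seg_of e. convexity_gap (p e) (wd (u n) e x) (wd (u k) e x)) < \<epsilon>" by blast
  qed
  then have "\<forall>e\<in>E. \<exists>h. integrable (seg_of e) h \<and> (\<lambda>n. LINT x|seg_of e. \<bar>wd (u n) e x - h x\<bar>) \<longlonglongrightarrow> 0" by blast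
  from bchoice[OF this] obtain h where h: "\<And>e. e \<in> E \<Longrightarrow> integrable (seg_of e) (h e)"
    "\<And>e. e \<in> E \<Longrightarrow> (\<lambda>n. LINT x|seg_of e. \<bar>wd (u n) e x - h e x\<bar>) \<longlonglongrightarrow> 0" by blast
  \<comment> \<open>The two ingredients for Fatou's lemma, in a form inherited by subsequences. The
    limit of the energies may exceed the energy of \<open>h\<close>.\<close>
  define Q where "Q e s \<longleftrightarrow> (AE x in seg_of e. (\<lambda>n. wd (u (s n)) e x) \<longlonglongrightarrow> h e x) \<and>
    convergent (\<lambda>n. LINT x|seg_of e. p_energy (p e) (wd (u (s n)) e x))" for e and s :: "nat \<Rightarrow> nat"
  have Qsub: "Q e (s \<circ> t)" if Q: "Q e s" and t: "strict_mono t" for e s t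
  proof -
    have "AE x in seg_of e. (\<lambda>n. wd (u (s n)) e x) \<longlonglongrightarrow> h e x" using Q by (simp add: Q_def)
    then have "AE x in seg_of e. (\<lambda>n. wd (u ((s \<circ> t) n)) e x) \<longlonglongrightarrow> h e x"
    proof eventually_elim
      case (elim x)
      from LIMSEQ_subseq_LIMSEQ[OF elim t] show ?case by (simp add: o_def)
    qed
    moreover have "convergent (\<lambda>n. LINT x|seg_of e. p_energy (p e) (wd (u (s n)) e x))" using Q by (simp add: Q_def)
    from convergent_subseq_convergent[OF this t]
    have "convergent (\<lambda>n. LINT x|seg_of e. p_energy (p e) (wd (u ((s \<circ> t) n)) e x))" by (simp add: o_def)
    ultimately show ?thesis unfolding Q_def by blast
  qed
  have Qex: "\<exists>t. strict_mono t \<and> Q e (s \<circ> t)" if e: "e \<in> E" and s: "strict_mono s" for e and s :: "nat \<Rightarrow> nat"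
  proof -
    have "(\<lambda>n. LINT x|seg_of e. norm (wd (u (s n)) e x - h e x)) \<longlonglongrightarrow> 0"
      using LIMSEQ_subseq_LIMSEQ[OF h(2)[OF e] s] by (simp add: o_def)
    from tendsto_L1_AE_subseq[OF _ this] obtain t1 where t1: "strict_mono t1"
      "AE x in seg_of e. (\<lambda>n. wd (u (s (t1 n))) e x - h e x) \<longlonglongrightarrow> 0"
      using wd_integrable[OF u(1) e] h(1)[OF e] by auto
    have "bounded (range (\<lambda>n. LINT x|seg_of e. p_energy (p e) (wd (u (s (t1 n))) e x)))"
      using energy[OF e] energy0[OF e] by (intro boundedI[of _ S]) auto
    from bounded_imp_convergent_subsequence[OF this] obtain \<tau> t2 where t2: "strict_mono t2"
      "((\<lambda>n. LINT x|seg_of e. p_energy (p e) (wd (u (s (t1 n))) e x)) \<circ> t2) \<longlonglongrightarrow> \<tau>" by blast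
    have "AE x in seg_of e. (\<lambda>n. wd (u ((s \<circ> (t1 \<circ> t2)) n)) e x) \<longlonglongrightarrow> h e x"
      using t1(2)
    proof eventually_elim
      case (elim x)
      then have "(\<lambda>n. wd (u (s (t1 n))) e x) \<longlonglongrightarrow> h e x" by (rule LIM_zero_cancel)
      from LIMSEQ_subseq_LIMSEQ[OF this t2(1)] show ?case by (simp add: o_def)
    qed
    moreover have "convergent (\<lambda>n. LINT x|seg_of e. p_energy (p e) (wd (u ((s \<circ> (t1 \<circ> t2)) n)) e x))"
      using t2(2) by (auto simp: convergent_def o_def)
    ultimately have "Q e (s \<circ> (t1 \<circ> t2))" unfolding Q_def by blast
    then show ?thesis using strict_mono_o[OF t1(1) t2(1)] by blast
  qed
  have idm: "strict_mono (id :: nat \<Rightarrow> nat)" by (simp add: strict_mono_def)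
  have "\<exists>t. strict_mono t \<and> (\<forall>e\<in>E. Q e (id \<circ> t))"
    by (rule common_subsequence[OF _ Qsub Qex idm]) simp_all
  then obtain t where t: "strict_mono t" "\<And>e. e \<in> E \<Longrightarrow> Q e t" by auto
  have "\<exists>t'. strict_mono t' \<and> (\<forall>v\<in>UNIV. convergent (\<lambda>n. vv (u ((t \<circ> t') n)) v))"
  proof (rule common_subsequence[OF _ _ _ t(1), where Q = "\<lambda>v s. convergent (\<lambda>n. vv (u (s n)) v)"])
    show "convergent (\<lambda>n. vv (u ((s \<circ> t) n)) v)" if "convergent (\<lambda>n. vv (u (s n)) v)" "strict_mono t" for v and s t :: "nat \<Rightarrow> nat"
      using convergent_subseq_convergent[OF that] by (simp add: o_def)
    show "\<exists>t. strict_mono t \<and> convergent (\<lambda>n. vv (u ((s \<circ> t) n)) v)" for v and s :: "nat \<Rightarrow> nat"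
    proof -
      have "bounded (range (\<lambda>n. vv (u (s n)) v))" using vb by (intro boundedI[of _ R]) auto
      from bounded_imp_convergent_subsequence[OF this] show ?thesis by (auto simp: convergent_def o_def)
    qed
  qed simp
  then obtain t' where t': "strict_mono t'" "\<And>v. convergent (\<lambda>n. vv (u ((t \<circ> t') n)) v)" by auto
  define s where "s = t \<circ> t'"
  have s: "strict_mono s" unfolding s_def by (rule strict_mono_o[OF t(1) t'(1)])
  have Qs: "Q e s" if "e \<in> E" for e unfolding s_def by (rule Qsub[OF t(2)[OF that] t'(1)])
  define w where "w n = u (s n)" for n
  have w: "w n \<in> \<W>" for n using u(1) by (simp add: w_def)
  have "\<forall>e\<in>E. \<exists>\<tau>. (\<lambda>n. LINT x|seg_of e. p_energy (p e) (wd (w n) e x)) \<longlonglongrightarrow> \<tau>"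
    using Qs unfolding Q_def convergent_def w_def by blast
  from bchoice[OF this] obtain \<tau> where
    \<tau>: "\<And>e. e \<in> E \<Longrightarrow> (\<lambda>n. LINT x|seg_of e. p_energy (p e) (wd (w n) e x)) \<longlonglongrightarrow> \<tau> e" by blast
  have hAE: "AE x in seg_of e. (\<lambda>n. wd (w n) e x) \<longlonglongrightarrow> h e x" if "e \<in> E" for e
    using Qs[OF that] unfolding Q_def w_def by blast
  have hL1: "(\<lambda>n. LINT x|seg_of e. \<bar>wd (w n) e x - h e x\<bar>) \<longlonglongrightarrow> 0" if "e \<in> E" for e
    using LIMSEQ_subseq_LIMSEQ[OF h(2)[OF that] s] by (simp add: o_def w_def)
  have "\<forall>v. \<exists>c. (\<lambda>n. vv (w n) v) \<longlonglongrightarrow> c"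
    using t'(2) unfolding convergent_def w_def s_def by blast
  from choice[OF this] obtain c where c: "\<And>v. (\<lambda>n. vv (w n) v) \<longlonglongrightarrow> c v" by blast
  \<comment> \<open>The limit is rebuilt from the limits of the vertex values and of the
    derivatives, so its integral representation holds by construction.\<close>
  define z where "z e x = c (fst e) + (LINT y|seg x. h e y)" for e x
  have z0: "z e 0 = c (fst e)" for e
    by (simp add: z_def set_integral_seg[symmetric] set_lebesgue_integral_def)
  have lim: "(\<lambda>n. w n e x) \<longlonglongrightarrow> z e x" if e: "e \<in> E" and x: "x \<in> {0..len G e}" for e x
  proof -
    have xl: "x \<le> len G e" using x by simp
    have "(\<lambda>n. (LINT y|seg x. wd (w n) e y) - (LINT y|seg x. h e y)) \<longlonglongrightarrow> 0"
    proof (rule Lim_null_comparison[OF _ hL1[OF e]], rule always_eventually, rule allI)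
      fix n
      have i: "integrable (seg x) (wd (w n) e)" "integrable (seg x) (h e)"
        using seg_integrable_subset[OF wd_integrable[OF w e] xl] seg_integrable_subset[OF h(1)[OF e] xl] by auto
      have "norm ((LINT y|seg x. wd (w n) e y) - (LINT y|seg x. h e y)) = \<bar>LINT y|seg x. wd (w n) e y - h e y\<bar>"
        using i by simp
      also have "\<dots> \<le> (LINT y|seg x. \<bar>wd (w n) e y - h e y\<bar>)" by (rule integral_abs_bound)
      also have "\<dots> \<le> (LINT y|seg_of e. \<bar>wd (w n) e y - h e y\<bar>)"
        using wd_integrable[OF w e] h(1)[OF e] xl by (intro seg_integral_mono_length) auto
      finally show "norm ((LINT y|seg x. wd (w n) e y) - (LINT y|seg x. h e y)) \<le> (LINT y|seg_of e. \<bar>wd (w n) e y - h e y\<bar>)" .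
    qed
    then have "(\<lambda>n. LINT y|seg x. wd (w n) e y) \<longlonglongrightarrow> (LINT y|seg x. h e y)" by (rule LIM_zero_cancel)
    then have "(\<lambda>n. vv (w n) (fst e) + (LINT y|seg x. wd (w n) e y)) \<longlonglongrightarrow> z e x"
      unfolding z_def by (intro tendsto_add c)
    moreover have "w n e x = vv (w n) (fst e) + (LINT y|seg x. wd (w n) e y)" for n
      using sobolev_repD(2)[OF graphD(1)[OF w e] x] graph_endpoints(1)[OF w e] by metis
    ultimately show ?thesis by presburger
  qed
  have fatou: "integrable (seg_of e) (\<lambda>x. p_energy (p e) (h e x))" "(LINT x|seg_of e. p_energy (p e) (h e x)) \<le> \<tau> e" if e: "e \<in> E" for e
  proof -
    have "AE x in seg_of e. (\<lambda>n. p_energy (p e) (wd (w n) e x)) \<longlonglongrightarrow> p_energy (p e) (h e x)"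
      using hAE[OF e]
    proof eventually_elim
      case (elim x)
      then show ?case
        using p_energy_continuous[OF p_gt_1[OF e], of UNIV]
        by (intro isCont_tendsto_compose[of _ "p_energy (p e)"]) (auto simp: continuous_on_eq_continuous_at)
    qed
    moreover have "(\<lambda>x. p_energy (p e) (h e x)) \<in> borel_measurable (seg_of e)"
      using borel_measurable_integrable[OF h(1)[OF e]] unfolding p_energy_def by measurable
    ultimately show "integrable (seg_of e) (\<lambda>x. p_energy (p e) (h e x))" "(LINT x|seg_of e. p_energy (p e) (h e x)) \<le> \<tau> e"
      using Fatou_limit[of "seg_of e" "\<lambda>n x. p_energy (p e) (wd (w n) e x)" "\<lambda>x. p_energy (p e) (h e x)" "\<tau> e"]
        p_energy_wd_integrable[OF w e] p_energy_nonneg[OF p_gt_1[OF e]] \<tau>[OF e] by blast+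
  qed
  have rep: "sobolev_rep (p e) (len G e) (z e) (h e)" if e: "e \<in> E" for e
  proof (rule sobolev_repI)
    have "integrable (seg_of e) (\<lambda>x. p e * p_energy (p e) (h e x))" using fatou(1)[OF e] by simp
    then show "in_Lp (p e) (len G e) (h e)"
      using h(1)[OF e] p_gt_1[OF e] by (simp add: in_Lp_iff p_energy_def borel_measurable_integrable)
    show "z e x = z e 0 + (LINT y|seg x. h e y)" for x unfolding z0 by (simp add: z_def)
  qed
  \<comment> \<open>At an initial vertex this holds by definition of \<open>z\<close>. At a terminal
    vertex \<open>z\<close> is the limit of \<open>w n\<close>, whose value there is the vertex
    value and tends to \<open>c v\<close>.\<close>
  have vertex: "has_vertex_value G z v (c v)" for v
    unfolding has_vertex_value_def
  proof (intro ballI conjI impI)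
    fix e assume e: "e \<in> E"
    show "z e 0 = c v" if "fst e = v" using that z0 by simp
    show "z e (len G e) = c v" if v: "snd e = v"
    proof -
      have "(\<lambda>n. w n e (len G e)) \<longlonglongrightarrow> z e (len G e)" by (rule lim[OF e]) (use len_pos[OF e] in simp)
      then have "(\<lambda>n. vv (w n) v) \<longlonglongrightarrow> z e (len G e)" using graph_endpoints(2)[OF w e] v by simp
      then show ?thesis using c[of v] by (rule LIMSEQ_unique)
    qed
  qed
  have zW: "z \<in> \<W>" by (rule graphI(1)[OF rep]) (use vertex in auto)
  have zwd: "AE x in seg_of e. wd z e x = h e x" if "e \<in> E" for e
    by (rule graphI(2)[OF rep _ that]) (use vertex in auto)
  have zv: "vv z v = c v" for v
  proof (cases "\<exists>e\<in>E. fst e = v \<or> snd e = v")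
    case True
    then show ?thesis by (rule vertex_value_eq[OF vertex])
  next
    case False
    have "vv q v = 0" for q unfolding vertex_value_def by (rule if_not_P[OF False])
    then show ?thesis using c[of v] by (simp add: LIMSEQ_const_iff)
  qed
  have wb: "\<bar>w n e x\<bar> \<le> R" if "e \<in> E" "x \<in> {0..len G e}" for n e x using ub[OF that] by (simp add: w_def)
  have "(\<lambda>n. objective r X (w n)) \<longlonglongrightarrow> r * (\<Sum>e\<in>E. \<tau> e) + (\<Sum>e\<in>E. LINT x|seg_of e. potential e (z e x)) - load X z"
    unfolding objective_def
    by (intro tendsto_diff tendsto_add tendsto_mult tendsto_const tendsto_sum \<tau> potential_tendsto[OF _ w zW wb lim]
        load_tendsto[OF w zW wb lim]) (use c zv in auto)
  moreover have "(\<lambda>n. objective r X (w n)) \<longlonglongrightarrow> m"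
  proof (rule tendsto_sandwich[of "\<lambda>_. m" _ _ "\<lambda>n. m + 1 / real (Suc (s n))"])
    show "(\<lambda>n. m + 1 / real (Suc (s n))) \<longlonglongrightarrow> m"
      using tendsto_add[OF tendsto_const LIMSEQ_subseq_LIMSEQ[OF inv s], of m] by (simp add: o_def)
    show "\<forall>\<^sub>F n in sequentially. objective r X (w n) \<le> m + 1 / real (Suc (s n))"
      using u(2) by (intro always_eventually allI less_imp_le) (simp add: w_def)
  qed (use m[OF w] in auto)
  ultimately have "r * (\<Sum>e\<in>E. \<tau> e) + (\<Sum>e\<in>E. LINT x|seg_of e. potential e (z e x)) - load X z = m"
    by (rule LIMSEQ_unique)
  moreover have "(\<Sum>e\<in>E. LINT x|seg_of e. p_energy (p e) (wd z e x)) \<le> (\<Sum>e\<in>E. \<tau> e)"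
  proof (rule sum_mono)
    fix e assume e: "e \<in> E"
    have "(LINT x|seg_of e. p_energy (p e) (wd z e x)) = (LINT x|seg_of e. p_energy (p e) (h e x))"
    proof (rule integral_cong_AE)
      show "(\<lambda>x. p_energy (p e) (wd z e x)) \<in> borel_measurable (seg_of e)" using p_energy_wd_integrable[OF zW e] by auto
      show "(\<lambda>x. p_energy (p e) (h e x)) \<in> borel_measurable (seg_of e)" using fatou(1)[OF e] by auto
      show "AE x in seg_of e. p_energy (p e) (wd z e x) = p_energy (p e) (h e x)"
        using zwd[OF e] by eventually_elim simp
    qed
    then show "(LINT x|seg_of e. p_energy (p e) (wd z e x)) \<le> \<tau> e" using fatou(2)[OF e] by simp
  qed
  then have "r * (\<Sum>e\<in>E. LINT x|seg_of e. p_energy (p e) (wd z e x)) \<le> r * (\<Sum>e\<in>E. \<tau> e)" using r by (intro mult_left_mono) auto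
  ultimately have "objective r X z \<le> m" unfolding objective_def by linarith
  then show ?thesis using zW m by (intro bexI[of _ z]) (auto intro: order_trans)
qed

section \<open>First variation and the Euler-Lagrange equation\<close>

lemma flux_line_tendsto:
  assumes u: "u \<in> \<W>" and \<phi>: "\<phi> \<in> \<W>" and e: "e \<in> E" and t: "t \<longlonglongrightarrow> 0" "\<And>n. \<bar>t n\<bar> \<le> 1"
  shows "(\<lambda>n. LINT x|seg_of e. flux (p e) (wd u e x + t n * wd \<phi> e x) * wd \<phi> e x)
    \<longlonglongrightarrow> (LINT x|seg_of e. flux (p e) (wd u e x) * wd \<phi> e x)"
proof (rule integral_dominated_convergence[where w = "\<lambda>x. 2 powr p e * (\<bar>wd u e x\<bar> powr p e + \<bar>wd \<phi> e x\<bar> powr p e) + \<bar>wd \<phi> e x\<bar> powr p e"])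
  have p: "1 < p e" by (rule p_gt_1[OF e])
  note [measurable] = wd_measurable[OF u e] wd_measurable[OF \<phi> e]
  show "(\<lambda>x. flux (p e) (wd u e x) * wd \<phi> e x) \<in> borel_measurable (seg_of e)" by measurable
  show "(\<lambda>x. flux (p e) (wd u e x + t n * wd \<phi> e x) * wd \<phi> e x) \<in> borel_measurable (seg_of e)" for n by measurable
  show "integrable (seg_of e) (\<lambda>x. 2 powr p e * (\<bar>wd u e x\<bar> powr p e + \<bar>wd \<phi> e x\<bar> powr p e) + \<bar>wd \<phi> e x\<bar> powr p e)"
    using wd_in_Lp[OF u e] wd_in_Lp[OF \<phi> e] by (simp add: in_Lp_iff)
  show "AE x in seg_of e. (\<lambda>n. flux (p e) (wd u e x + t n * wd \<phi> e x) * wd \<phi> e x) \<longlonglongrightarrow> flux (p e) (wd u e x) * wd \<phi> e x"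
  proof (rule AE_I2)
    fix x
    have "(\<lambda>n. wd u e x + t n * wd \<phi> e x) \<longlonglongrightarrow> wd u e x + 0 * wd \<phi> e x" by (intro tendsto_intros t)
    then show "(\<lambda>n. flux (p e) (wd u e x + t n * wd \<phi> e x) * wd \<phi> e x) \<longlonglongrightarrow> flux (p e) (wd u e x) * wd \<phi> e x"
      by (intro tendsto_mult tendsto_const flux_tendsto[OF p]) simp
  qed
  show "AE x in seg_of e. norm (flux (p e) (wd u e x + t n * wd \<phi> e x) * wd \<phi> e x)
     \<le> 2 powr p e * (\<bar>wd u e x\<bar> powr p e + \<bar>wd \<phi> e x\<bar> powr p e) + \<bar>wd \<phi> e x\<bar> powr p e" for n
  proof (rule AE_I2)
    fix x
    have "\<bar>flux (p e) (wd u e x + t n * wd \<phi> e x) * wd \<phi> e x\<bar> \<le> \<bar>wd u e x + t n * wd \<phi> e x\<bar> powr p e + \<bar>wd \<phi> e x\<bar> powr p e"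
      by (rule abs_flux_mult_le[OF p])
    moreover have "\<bar>wd u e x + t n * wd \<phi> e x\<bar> powr p e \<le> 2 powr p e * (\<bar>wd u e x\<bar> powr p e + \<bar>t n * wd \<phi> e x\<bar> powr p e)"
      by (rule powr_add_le) (use p in simp)
    moreover have "\<bar>t n * wd \<phi> e x\<bar> powr p e \<le> \<bar>wd \<phi> e x\<bar> powr p e"
      using p t(2)[of n] by (intro powr_mono2) (auto simp: abs_mult mult_left_le_one_le)
    then have "2 powr p e * (\<bar>wd u e x\<bar> powr p e + \<bar>t n * wd \<phi> e x\<bar> powr p e) \<le> 2 powr p e * (\<bar>wd u e x\<bar> powr p e + \<bar>wd \<phi> e x\<bar> powr p e)"
      by (intro mult_left_mono add_left_mono) auto
    ultimately show "norm (flux (p e) (wd u e x + t n * wd \<phi> e x) * wd \<phi> e x)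
     \<le> 2 powr p e * (\<bar>wd u e x\<bar> powr p e + \<bar>wd \<phi> e x\<bar> powr p e) + \<bar>wd \<phi> e x\<bar> powr p e"
      unfolding real_norm_def by linarith
  qed
qed

lemma \<gamma>_line_tendsto:
  assumes u: "u \<in> \<W>" and \<phi>: "\<phi> \<in> \<W>" and e: "e \<in> E" and t: "t \<longlonglongrightarrow> 0" "\<And>n. \<bar>t n\<bar> \<le> 1"
  shows "(\<lambda>n. LINT x|seg_of e. \<gamma> e (u e x + t n * \<phi> e x) * \<phi> e x) \<longlonglongrightarrow> (LINT x|seg_of e. \<gamma> e (u e x) * \<phi> e x)"
proof -
  have g: "continuous_on UNIV (\<gamma> e)" "strict_mono (\<gamma> e)" using \<gamma>[OF e] by auto
  obtain B1 where B1: "0 \<le> B1" "\<And>x. 0 \<le> x \<Longrightarrow> x \<le> len G e \<Longrightarrow> \<bar>u e x\<bar> \<le> B1"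
    using continuous_bounded_Icc[OF graph_continuous[OF u e]] by blast
  obtain B2 where B2: "0 \<le> B2" "\<And>x. 0 \<le> x \<Longrightarrow> x \<le> len G e \<Longrightarrow> \<bar>\<phi> e x\<bar> \<le> B2"
    using continuous_bounded_Icc[OF graph_continuous[OF \<phi> e]] by blast
  \<comment> \<open>A monotone function is bounded on an interval by its values at the two ends;
    this provides a constant dominating function.\<close>
  define M where "M = \<bar>\<gamma> e (B1 + B2)\<bar> + \<bar>\<gamma> e (- (B1 + B2))\<bar>"
  have cont: "continuous_on {0..len G e} (\<lambda>x. \<gamma> e (u e x + c * \<phi> e x) * \<phi> e x)" for c
    by (intro continuous_intros continuous_on_compose2[OF g(1)] graph_continuous u \<phi> e) auto
  show ?thesis
  proof (rule integral_dominated_convergence[where w = "\<lambda>_. M * B2"])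
    show "(\<lambda>x. \<gamma> e (u e x + t n * \<phi> e x) * \<phi> e x) \<in> borel_measurable (seg_of e)" for n
      by (rule seg_measurable_continuous[OF cont])
    show "(\<lambda>x. \<gamma> e (u e x) * \<phi> e x) \<in> borel_measurable (seg_of e)"
      using seg_measurable_continuous[OF cont[of 0]] by simp
    show "AE x in seg_of e. (\<lambda>n. \<gamma> e (u e x + t n * \<phi> e x) * \<phi> e x) \<longlonglongrightarrow> \<gamma> e (u e x) * \<phi> e x"
    proof (rule AE_I2)
      fix x
      have "(\<lambda>n. u e x + t n * \<phi> e x) \<longlonglongrightarrow> u e x + 0 * \<phi> e x" by (intro tendsto_intros t)
      then have "(\<lambda>n. \<gamma> e (u e x + t n * \<phi> e x)) \<longlonglongrightarrow> \<gamma> e (u e x)"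
        using g(1) by (intro isCont_tendsto_compose[of _ "\<gamma> e"]) (auto simp: continuous_on_eq_continuous_at)
      then show "(\<lambda>n. \<gamma> e (u e x + t n * \<phi> e x) * \<phi> e x) \<longlonglongrightarrow> \<gamma> e (u e x) * \<phi> e x" by (intro tendsto_intros)
    qed
    show "AE x in seg_of e. norm (\<gamma> e (u e x + t n * \<phi> e x) * \<phi> e x) \<le> M * B2" for n
    proof (rule AE_I2)
      fix x assume "x \<in> space (seg_of e)"
      then have x: "0 \<le> x" "x \<le> len G e" by auto
      have "\<bar>t n * \<phi> e x\<bar> \<le> \<bar>\<phi> e x\<bar>" using t(2)[of n] by (simp add: abs_mult mult_left_le_one_le)
      then have "u e x + t n * \<phi> e x \<le> B1 + B2" "- (B1 + B2) \<le> u e x + t n * \<phi> e x"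
        using B1(2)[OF x] B2(2)[OF x] by linarith+
      then have "\<gamma> e (u e x + t n * \<phi> e x) \<le> \<gamma> e (B1 + B2)" "\<gamma> e (- (B1 + B2)) \<le> \<gamma> e (u e x + t n * \<phi> e x)"
        using strict_mono_less_eq[OF g(2)] by auto
      then have "\<bar>\<gamma> e (u e x + t n * \<phi> e x)\<bar> \<le> M" unfolding M_def by linarith
      then show "norm (\<gamma> e (u e x + t n * \<phi> e x) * \<phi> e x) \<le> M * B2"
        using B2(2)[OF x] B2(1) unfolding real_norm_def abs_mult by (intro mult_mono) auto
    qed
  qed simp
qed

text \<open>The formal derivative of the objective along the line \<open>u + t \<phi>\<close>,
  evaluated at \<open>t\<close> and not at 0.\<close>

definition first_variation ::
  "real \<Rightarrow> 'v state \<Rightarrow> ('v \<times> 'v \<Rightarrow> real \<Rightarrow> real) \<Rightarrow> real \<Rightarrow> ('v \<times> 'v \<Rightarrow> real \<Rightarrow> real) \<Rightarrow> real" where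
  "first_variation r X u t \<phi> = r * (\<Sum>e\<in>E. LINT x|seg_of e. flux (p e) (wd u e x + t * wd \<phi> e x) * wd \<phi> e x)
    + (\<Sum>e\<in>E. LINT x|seg_of e. \<gamma> e (u e x + t * \<phi> e x) * \<phi> e x) - load X \<phi>"

lemma objective_increment_le:
  assumes u: "u \<in> \<W>" and \<phi>: "\<phi> \<in> \<W>" and r: "0 < r"
  shows "objective r X (\<lambda>e x. 1 * u e x + t * \<phi> e x) - objective r X u \<le> t * first_variation r X u t \<phi>"
proof -
  define z where "z = (\<lambda>e x. 1 * u e x + t * \<phi> e x)"
  have zW: "z \<in> \<W>" unfolding z_def by (rule graph_lincomb(1)[OF u \<phi>])
  have zwd: "AE x in seg_of e. wd z e x = wd u e x + t * wd \<phi> e x" if "e \<in> E" for e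
    using graph_lincomb(2)[OF u \<phi> that, where a = 1 and t = t] unfolding z_def by simp
  have ze: "z e x = u e x + t * \<phi> e x" for e x by (simp add: z_def)
  have lz: "load X z = load X u + t * load X \<phi>" unfolding z_def load_lincomb[OF u \<phi>] by simp
  have 1: "(LINT x|seg_of e. p_energy (p e) (wd z e x)) - (LINT x|seg_of e. p_energy (p e) (wd u e x)) \<le>
     t * (LINT x|seg_of e. flux (p e) (wd u e x + t * wd \<phi> e x) * wd \<phi> e x)" if e: "e \<in> E" for e
  proof -
    have Lp: "in_Lp (p e) (len G e) (\<lambda>x. wd u e x + t * wd \<phi> e x)"
      using p_gt_1[OF e] by (intro in_Lp_add in_Lp_cmult wd_in_Lp u \<phi> e) simp
    have i: "integrable (seg_of e) (\<lambda>x. flux (p e) (wd u e x + t * wd \<phi> e x) * wd \<phi> e x)"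
      by (rule flux_mult_integrable[OF Lp wd_in_Lp[OF \<phi> e] p_gt_1[OF e]])
    have "(LINT x|seg_of e. p_energy (p e) (wd z e x)) - (LINT x|seg_of e. p_energy (p e) (wd u e x))
       = (LINT x|seg_of e. p_energy (p e) (wd z e x) - p_energy (p e) (wd u e x))"
      using p_energy_wd_integrable[OF zW e] p_energy_wd_integrable[OF u e] by simp
    also have "\<dots> \<le> (LINT x|seg_of e. t * (flux (p e) (wd u e x + t * wd \<phi> e x) * wd \<phi> e x))"
    proof (rule integral_mono_AE)
      show "AE x in seg_of e. p_energy (p e) (wd z e x) - p_energy (p e) (wd u e x) \<le> t * (flux (p e) (wd u e x + t * wd \<phi> e x) * wd \<phi> e x)"
        using zwd[OF e]
      proof eventually_elim
        case (elim x)
        show ?case unfolding elim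
          using tangentD[OF tangent_p_energy[OF p_gt_1[OF e]], of "wd u e x + t * wd \<phi> e x" "wd u e x"]
          by (simp add: mult.left_commute mult.assoc)
      qed
    qed (use p_energy_wd_integrable[OF zW e] p_energy_wd_integrable[OF u e] i in auto)
    finally show ?thesis by simp
  qed
  have 2: "(LINT x|seg_of e. potential e (z e x)) - (LINT x|seg_of e. potential e (u e x)) \<le>
     t * (LINT x|seg_of e. \<gamma> e (u e x + t * \<phi> e x) * \<phi> e x)" if e: "e \<in> E" for e
  proof -
    have i: "integrable (seg_of e) (\<lambda>x. \<gamma> e (u e x + t * \<phi> e x) * \<phi> e x)"
      using seg_integrable_continuous[OF continuous_on_mult[OF \<gamma>_comp_continuous[OF zW e] graph_continuous[OF \<phi> e]]]
      by (simp add: ze)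
    have "(LINT x|seg_of e. potential e (z e x)) - (LINT x|seg_of e. potential e (u e x))
       = (LINT x|seg_of e. potential e (z e x) - potential e (u e x))"
      using potential_integrable[OF zW e] potential_integrable[OF u e] by simp
    also have "\<dots> \<le> (LINT x|seg_of e. t * (\<gamma> e (u e x + t * \<phi> e x) * \<phi> e x))"
    proof (rule Bochner_Integration.integral_mono)
      show "potential e (z e x) - potential e (u e x) \<le> t * (\<gamma> e (u e x + t * \<phi> e x) * \<phi> e x)" for x
        using tangentD[OF potential(1)[OF e], of "u e x + t * \<phi> e x" "u e x"]
        by (simp add: ze mult.left_commute mult.assoc)
    qed (use potential_integrable[OF zW e] potential_integrable[OF u e] i in auto)
    finally show ?thesis by simp
  qed
  have "r * ((\<Sum>e\<in>E. LINT x|seg_of e. p_energy (p e) (wd z e x)) - (\<Sum>e\<in>E. LINT x|seg_of e. p_energy (p e) (wd u e x)))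
     \<le> r * (t * (\<Sum>e\<in>E. LINT x|seg_of e. flux (p e) (wd u e x + t * wd \<phi> e x) * wd \<phi> e x))"
    unfolding sum_subtractf[symmetric] sum_distrib_left[of t] using r by (intro mult_left_mono sum_mono 1) auto
  moreover have "(\<Sum>e\<in>E. LINT x|seg_of e. potential e (z e x)) - (\<Sum>e\<in>E. LINT x|seg_of e. potential e (u e x))
     \<le> t * (\<Sum>e\<in>E. LINT x|seg_of e. \<gamma> e (u e x + t * \<phi> e x) * \<phi> e x)"
    unfolding sum_subtractf[symmetric] sum_distrib_left by (intro sum_mono 2)
  ultimately have "objective r X z - objective r X u \<le> t * first_variation r X u t \<phi>"
    unfolding objective_def first_variation_def lz by (simp add: algebra_simps)
  then show ?thesis by (simp only: z_def)
qed

text \<open>By minimality \<open>t\<close> times the first variation at \<open>t\<close> is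
  nonnegative. Letting \<open>t\<close> tend to 0 from either side gives both signs of the limit,
  and dominated convergence identifies that limit with \<open>D\<close>.\<close>

lemma euler_lagrange:
  assumes u: "u \<in> \<W>" and min: "\<And>w. w \<in> \<W> \<Longrightarrow> objective r X u \<le> objective r X w" and \<phi>: "\<phi> \<in> \<W>" and r: "0 < r"
  shows "r * energy_form u \<phi> + (\<Sum>e\<in>E. LINT x|seg_of e. \<gamma> e (u e x) * \<phi> e x) = load X \<phi>"
proof -
  define D where "D = r * energy_form u \<phi> + (\<Sum>e\<in>E. LINT x|seg_of e. \<gamma> e (u e x) * \<phi> e x) - load X \<phi>"
  have inv: "(\<lambda>n. 1 / real (Suc n)) \<longlonglongrightarrow> 0" by (rule LIMSEQ_Suc[OF lim_1_over_n])
  have "0 \<le> \<sigma> * D" if \<sigma>: "\<sigma> = 1 \<or> \<sigma> = -1" for \<sigma> :: real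
  proof -
    define t where "t n = \<sigma> * (1 / real (Suc n))" for n
    have t: "t \<longlonglongrightarrow> 0" "\<bar>t n\<bar> \<le> 1" for n
      using tendsto_mult_right_zero[OF inv, of \<sigma>] \<sigma> by (auto simp: t_def[abs_def] abs_mult)
    have "(\<lambda>n. first_variation r X u (t n) \<phi>) \<longlonglongrightarrow> D"
      unfolding first_variation_def D_def energy_form_def
      by (intro tendsto_diff tendsto_add tendsto_mult tendsto_const tendsto_sum flux_line_tendsto \<gamma>_line_tendsto u \<phi> t)
    then have "(\<lambda>n. \<sigma> * first_variation r X u (t n) \<phi>) \<longlonglongrightarrow> \<sigma> * D" by (intro tendsto_mult tendsto_const)
    then show ?thesis
    proof (rule tendsto_lowerbound, intro always_eventually allI)
      fix n
      have "0 \<le> t n * first_variation r X u (t n) \<phi>"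
        using objective_increment_le[OF u \<phi> r, of X "t n"] min[OF graph_lincomb(1)[OF u \<phi>], of 1 "t n"] by linarith
      then have "0 \<le> 1 / real (Suc n) * (\<sigma> * first_variation r X u (t n) \<phi>)" by (simp add: t_def)
      then show "0 \<le> \<sigma> * first_variation r X u (t n) \<phi>" by (simp add: zero_le_divide_iff)
    qed simp
  qed
  from this[of 1] this[of "-1"] have "D = 0" by simp
  then show ?thesis by (simp add: D_def)
qed

section \<open>Resolvents of the graph operator\<close>

definition state_of_dens :: "('v \<times> 'v \<Rightarrow> real \<Rightarrow> real) \<Rightarrow> 'v state" where
  "state_of_dens g = l1_Pair (Family (\<lambda>e. if e \<in> E then abs_L1R (\<lambda>x. indicator {0<..<len G e} x * g e x) else 0)) 0"

lemma state_of_dens: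
  assumes "\<And>e. e \<in> E \<Longrightarrow> integrable (seg_of e) (g e)"
  shows "state_of_dens g \<in> state_space G" "l1_snd (state_of_dens g) = 0"
    "e \<in> E \<Longrightarrow> AE x in seg_of e. edge_dens (state_of_dens g) e x = g e x"
proof -
  have rep: "AE x in lborel. rep_L1R (component (l1_fst (state_of_dens g)) e) x = indicator {0<..<len G e} x * g e x"
    if e: "e \<in> E" for e
  proof -
    have "integrable lborel (\<lambda>x. indicator {0<..<len G e} x * g e x)"
      using assms[OF e] by (simp add: seg_integrable_iff set_integrable_def)
    then show ?thesis using e rep_abs_L1R by (simp add: state_of_dens_def)
  qed
  show "state_of_dens g \<in> state_space G"
  proof (rule state_spaceI)
    show "component (l1_fst (state_of_dens g)) e = 0" if "e \<notin> E" for e using that by (simp add: state_of_dens_def)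
    show "AE x in lborel. x \<notin> {0<..<len G e} \<longrightarrow> rep_L1R (component (l1_fst (state_of_dens g)) e) x = 0" if "e \<in> E" for e
      using rep[OF that] by eventually_elim auto
  qed
  show "l1_snd (state_of_dens g) = 0" by (simp add: state_of_dens_def)
  show "AE x in seg_of e. edge_dens (state_of_dens g) e x = g e x" if e: "e \<in> E"
    unfolding edge_dens_def AE_seg_iff using rep[OF e] by eventually_elim auto
qed

text \<open>The Euler-Lagrange equation is kept next to membership in the operator, since the
  density argument tests it with a difference of functions.\<close>

lemma resolvent_solution:
  assumes X: "X \<in> state_space G" and r: "0 < r"
  shows "\<exists>u\<in>\<W>. (state_of_dens (\<lambda>e x. \<gamma> e (u e x)), (1 / r) *\<^sub>R (X - state_of_dens (\<lambda>e x. \<gamma> e (u e x)))) \<in> graph_operator G p \<gamma> \<and>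
    (\<forall>\<phi>\<in>\<W>. r * energy_form u \<phi> + (\<Sum>e\<in>E. LINT x|seg_of e. \<gamma> e (u e x) * \<phi> e x) = load X \<phi>)"
proof -
  obtain u where u: "u \<in> \<W>" and "\<And>w. w \<in> \<W> \<Longrightarrow> objective r X u \<le> objective r X w"
    using minimizer_exists[OF r] by blast
  then have EL: "r * energy_form u \<phi> + (\<Sum>e\<in>E. LINT x|seg_of e. \<gamma> e (u e x) * \<phi> e x) = load X \<phi>" if "\<phi> \<in> \<W>" for \<phi>
    using euler_lagrange[OF u _ that r] by blast
  define V where "V = state_of_dens (\<lambda>e x. \<gamma> e (u e x))"
  have int: "integrable (seg_of e) (\<lambda>x. \<gamma> e (u e x))" if "e \<in> E" for e
    by (rule seg_integrable_continuous[OF \<gamma>_comp_continuous[OF u that]])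
  have VS: "V \<in> state_space G" and V0: "l1_snd V = 0"
    unfolding V_def by (rule state_of_dens(1,2)[OF int]; assumption)+
  have Vd: "AE x in seg_of e. edge_dens V e x = \<gamma> e (u e x)" if "e \<in> E" for e
    unfolding V_def by (rule state_of_dens(3)[OF int that])
  \<comment> \<open>\<open>Z\<close> is forced by \<open>V + r Z = X\<close>. As \<open>V\<close>
    has no vertex part, that of \<open>Z\<close> is the vertex part of \<open>X\<close> divided by
    \<open>r\<close>, which is what the load at the vertices requires.\<close>
  define Z where "Z = (1 / r) *\<^sub>R (X - V)"
  have ZS: "Z \<in> state_space G" unfolding Z_def
    using X VS subspace_state_space by (intro subspace_scale subspace_diff)
  have "energy_form u \<phi> = load Z \<phi>" if \<phi>: "\<phi> \<in> \<W>" for \<phi>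
  proof -
    have m: "vertex_mass Z v = (1 / r) * vertex_mass X v" for v
      unfolding Z_def vertex_mass_simps using V0 by (simp add: vertex_mass_def zero_l1_family.rep_eq)
    have d: "(LINT x|seg_of e. edge_dens Z e x * \<phi> e x) = (1 / r) * ((LINT x|seg_of e. edge_dens X e x * \<phi> e x) - (LINT x|seg_of e. \<gamma> e (u e x) * \<phi> e x))"
      if e: "e \<in> E" for e
    proof -
      have i: "integrable (seg_of e) (\<lambda>x. \<gamma> e (u e x) * \<phi> e x)"
        by (rule seg_integrable_continuous[OF continuous_on_mult[OF \<gamma>_comp_continuous[OF u e] graph_continuous[OF \<phi> e]]])
      have "(LINT x|seg_of e. edge_dens Z e x * \<phi> e x) = (LINT x|seg_of e. (1 / r) * (edge_dens X e x * \<phi> e x - \<gamma> e (u e x) * \<phi> e x))"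
      proof (rule integral_cong_AE)
        show "(\<lambda>x. edge_dens Z e x * \<phi> e x) \<in> borel_measurable (seg_of e)"
          using dens_mult_integrable[OF \<phi> e] by auto
        show "(\<lambda>x. (1 / r) * (edge_dens X e x * \<phi> e x - \<gamma> e (u e x) * \<phi> e x)) \<in> borel_measurable (seg_of e)"
          using dens_mult_integrable[OF \<phi> e, of X] i by auto
        show "AE x in seg_of e. edge_dens Z e x * \<phi> e x = (1 / r) * (edge_dens X e x * \<phi> e x - \<gamma> e (u e x) * \<phi> e x)"
          using Vd[OF e] edge_dens_diff[of X V e "len G e"] edge_dens_scale[of "1 / r" "X - V" e "len G e"]
          unfolding Z_def[symmetric] by eventually_elim (simp add: left_diff_distrib)
      qed
      also have "\<dots> = (1 / r) * ((LINT x|seg_of e. edge_dens X e x * \<phi> e x) - (LINT x|seg_of e. \<gamma> e (u e x) * \<phi> e x))"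
        using dens_mult_integrable[OF \<phi> e, of X] i by simp
      finally show ?thesis .
    qed
    have "load Z \<phi> = (\<Sum>e\<in>E. (1 / r) * ((LINT x|seg_of e. edge_dens X e x * \<phi> e x) - (LINT x|seg_of e. \<gamma> e (u e x) * \<phi> e x)))
       + (\<Sum>v\<in>UNIV. (1 / r) * (vertex_mass X v * vv \<phi> v))"
      unfolding load_def by (intro arg_cong2[where f = "(+)"] sum.cong) (auto simp: d m)
    also have "\<dots> = (1 / r) * (load X \<phi> - (\<Sum>e\<in>E. LINT x|seg_of e. \<gamma> e (u e x) * \<phi> e x))"
      unfolding sum_distrib_left[symmetric] load_def sum_subtractf by (simp only: distrib_left right_diff_distrib)
    also have "\<dots> = energy_form u \<phi>" using EL[OF \<phi>] r by (simp add: field_simps)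
    finally show ?thesis by simp
  qed
  then have "(V, Z) \<in> graph_operator G p \<gamma>"
    unfolding graph_operator_iff using u VS V0 Vd ZS by blast
  then show ?thesis using u EL unfolding Z_def V_def by blast
qed

lemma range_condition:
  assumes "X \<in> state_space G" "0 < r"
  shows "\<exists>W Z. (W, Z) \<in> graph_operator G p \<gamma> \<and> W + r *\<^sub>R Z = X"
proof -
  obtain u where "(state_of_dens (\<lambda>e x. \<gamma> e (u e x)), (1 / r) *\<^sub>R (X - state_of_dens (\<lambda>e x. \<gamma> e (u e x)))) \<in> graph_operator G p \<gamma>"
    using resolvent_solution[OF assms] by blast
  then show ?thesis using assms(2)
    by (intro exI[of _ "state_of_dens (\<lambda>e x. \<gamma> e (u e x))"] exI[of _ "(1 / r) *\<^sub>R (X - state_of_dens (\<lambda>e x. \<gamma> e (u e x)))"]) simp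
qed

end

section \<open>Density of the domain\<close>

text \<open>Uniform continuity handles arguments at distance below \<open>r\<close>; beyond that,
  monotonicity makes \<open>|\<gamma> a - \<gamma> b|\<close> at most the product divided by
  \<open>r\<close>. Only \<open>b\<close> has to be bounded, which matters because no uniform bound
  on the resolvents is at hand.\<close>

lemma abs_diff_le_monotone_gap:
  fixes \<gamma> :: "real \<Rightarrow> real"
  assumes c: "continuous_on UNIV \<gamma>" and m: "mono \<gamma>" and e: "0 < e"
  shows "\<exists>k\<ge>0. \<forall>a b. \<bar>b\<bar> \<le> M \<longrightarrow> \<bar>\<gamma> a - \<gamma> b\<bar> \<le> e + k * ((\<gamma> a - \<gamma> b) * (a - b))"
proof -
  have "uniformly_continuous_on {- (M + 1)..M + 1} \<gamma>"
    by (intro compact_uniformly_continuous continuous_on_subset[OF c]) auto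
  then have "\<exists>d>0. \<forall>x\<in>{- (M + 1)..M + 1}. \<forall>y\<in>{- (M + 1)..M + 1}. dist y x < d \<longrightarrow> dist (\<gamma> y) (\<gamma> x) < e"
    unfolding uniformly_continuous_on_def using e by blast
  then obtain d where d: "0 < d" "\<And>x y. x \<in> {- (M + 1)..M + 1} \<Longrightarrow> y \<in> {- (M + 1)..M + 1} \<Longrightarrow> dist y x < d \<Longrightarrow> dist (\<gamma> y) (\<gamma> x) < e"
    by blast
  \<comment> \<open>Since \<open>r \<le> 1\<close>, a point \<open>a\<close> at distance below
    \<open>r\<close> from \<open>b\<close> stays in the interval enlarged by 1, on which \<gamma> is
    uniformly continuous.\<close>
  define r where "r = min d 1"
  have r: "0 < r" "r \<le> d" "r \<le> 1" using d(1) by (auto simp: r_def)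
  have prod: "(\<gamma> a - \<gamma> b) * (a - b) = \<bar>\<gamma> a - \<gamma> b\<bar> * \<bar>a - b\<bar>" for a b
  proof -
    have "0 \<le> (\<gamma> a - \<gamma> b) * (a - b)"
    proof (cases "a \<le> b")
      case True
      then show ?thesis using monoD[OF m True] by (intro mult_nonpos_nonpos) auto
    next
      case False
      then show ?thesis using monoD[OF m, of b a] by (intro mult_nonneg_nonneg) auto
    qed
    then show ?thesis unfolding abs_mult[symmetric] by (rule abs_of_nonneg[symmetric])
  qed
  have "\<bar>\<gamma> a - \<gamma> b\<bar> \<le> e + 1 / r * ((\<gamma> a - \<gamma> b) * (a - b))" if b: "\<bar>b\<bar> \<le> M" for a b
  proof (cases "\<bar>a - b\<bar> < r")
    case True
    then have "dist (\<gamma> a) (\<gamma> b) < e" using b r by (intro d(2)) (auto simp: dist_real_def)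
    moreover have "0 \<le> 1 / r * ((\<gamma> a - \<gamma> b) * (a - b))" unfolding prod using r by simp
    ultimately show ?thesis by (simp add: dist_real_def)
  next
    case False
    then have "\<bar>\<gamma> a - \<gamma> b\<bar> * r \<le> \<bar>\<gamma> a - \<gamma> b\<bar> * \<bar>a - b\<bar>" by (intro mult_left_mono) auto
    then have "\<bar>\<gamma> a - \<gamma> b\<bar> \<le> 1 / r * ((\<gamma> a - \<gamma> b) * (a - b))"
      unfolding prod using r by (simp add: pos_le_divide_eq)
    then show ?thesis using e by linarith
  qed
  then show ?thesis using r(1) by (intro exI[of _ "1 / r"]) auto
qed

lemma continuous_inv_strict_mono:
  fixes \<gamma> :: "real \<Rightarrow> real"
  assumes "continuous_on UNIV \<gamma>" "strict_mono \<gamma>" "surj \<gamma>"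
  shows "continuous_on UNIV (inv \<gamma>)"
proof -
  have inj: "inj \<gamma>" by (rule strict_mono_imp_inj_on[OF assms(2)])
  have "isCont (inv \<gamma>) y" for y
  proof -
    have "isCont (inv \<gamma>) (\<gamma> (inv \<gamma> y))"
      using assms(1) inj by (intro isCont_inverse_function[where d = 1 and f = \<gamma> and x = "inv \<gamma> y"]) (auto simp: continuous_on_eq_continuous_at)
    then show ?thesis using assms(3) by (simp add: surj_f_inv_f)
  qed
  then show ?thesis by (simp add: continuous_on_eq_continuous_at)
qed

lemma sobolev_rep_C1:
  assumes d: "\<And>x. (q has_real_derivative q' x) (at x)" and c: "continuous_on UNIV q'" and p: "0 \<le> p"
  shows "sobolev_rep p l q q'"
proof (rule sobolev_repI)
  show "in_Lp p l q'" by (rule in_Lp_continuous[OF continuous_on_subset[OF c] p]) simp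
  fix x assume "x \<in> {0..l}"
  then have "(LINT y|seg x. q' y) = q x - q 0"
    by (intro seg_integral_FTC DERIV_subset[OF d] continuous_on_subset[OF c]) auto
  then show "q x = q 0 + (LINT y|seg x. q' y)" by simp
qed

text \<open>The cutoff factor \<open>1 - (1 - 4 x (l - x) / l\<^sup>2)\<^sup>n\<close> makes a polynomial vanish at both ends of the segment
  and tends to 1 inside.\<close>

lemma monotone_image_polynomial_dense:
  fixes \<gamma> :: "real \<Rightarrow> real"
  assumes \<gamma>: "continuous_on UNIV \<gamma>" "strict_mono \<gamma>" "surj \<gamma>" and f: "integrable (seg l) f" and l: "0 < l" and e: "0 < e"
  shows "\<exists>q. real_polynomial_function q \<and> q 0 = 0 \<and> q l = 0 \<and> (LINT x|seg l. \<bar>f x - \<gamma> (q x)\<bar>) < e"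
proof -
  obtain h where h: "continuous_on UNIV h" "(LINT x|seg l. \<bar>f x - h x\<bar>) < e / 2"
    using seg_approx_continuous[OF f, of "e / 2"] e by auto
  \<comment> \<open>The continuous approximation of \<open>f\<close> is pulled back through
    \<gamma>. Polynomials near \<open>k\<close>, cut off at the ends, are uniformly bounded, so
    their images under \<gamma> converge to \<open>h\<close> in \<open>L^1\<close> by dominated
    convergence.\<close>
  define k where "k x = inv \<gamma> (h x)" for x
  have \<gamma>k: "\<gamma> (k x) = h x" for x using \<gamma>(3) by (simp add: k_def surj_f_inv_f)
  have kc: "continuous_on {0..l} k"
    unfolding k_def by (rule continuous_on_compose2[OF continuous_inv_strict_mono[OF \<gamma>] continuous_on_subset[OF h(1)]]) auto
  have hc: "continuous_on {0..l} h" by (rule continuous_on_subset[OF h(1)]) simp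
  have "\<forall>n. \<exists>P. real_polynomial_function P \<and> (\<forall>x\<in>{0..l}. \<bar>k x - P x\<bar> < 1 / real (Suc n))"
  proof
    fix n :: nat
    obtain P where "real_polynomial_function P" "\<And>x. x \<in> {0..l} \<Longrightarrow> \<bar>k x - P x\<bar> < 1 / real (Suc n)"
      by (rule Stone_Weierstrass_real_polynomial_function[OF compact_Icc kc, of "1 / real (Suc n)"]) auto
    then show "\<exists>P. real_polynomial_function P \<and> (\<forall>x\<in>{0..l}. \<bar>k x - P x\<bar> < 1 / real (Suc n))" by blast
  qed
  then obtain P where P: "\<And>n. real_polynomial_function (P n)" "\<And>n x. x \<in> {0..l} \<Longrightarrow> \<bar>k x - P n x\<bar> < 1 / real (Suc n)"
    by metis
  define b where "b x = 1 + (- (4 / l\<^sup>2)) * (x * (l + (-1) * x))" for x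
  have b_eq: "b x = ((l - 2 * x) / l)\<^sup>2" for x using l by (simp add: b_def power2_eq_square field_simps)
  have b01: "0 \<le> b x" for x unfolding b_eq by simp
  have b1: "b x < 1" if "x \<in> {0<..<l}" for x
    using that l by (simp add: b_def)
  define q where "q n x = P n x * (1 + (-1) * b x ^ n)" for n x
  have id_poly: "real_polynomial_function (\<lambda>x::real. x)" by (rule real_polynomial_function.intros(1)) (rule bounded_linear_ident)
  have b_poly: "real_polynomial_function b"
    unfolding b_def[abs_def]
    by (intro real_polynomial_function.intros(2-4) id_poly)
  have q_poly: "real_polynomial_function (q n)" for n
    unfolding q_def[abs_def]
    by (intro real_polynomial_function.intros(2-4)
        real_polynomial_function_power b_poly P)
  have q0: "q n 0 = 0" "q n l = 0" for n using l by (simp_all add: q_def b_def)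
  have qc: "continuous_on S (q n)" for S n
    using q_poly[of n] by (intro continuous_on_polymonial_function) (simp add: real_polynomial_function_eq)
  have inv: "(\<lambda>n. 1 / real (Suc n)) \<longlonglongrightarrow> 0" by (rule LIMSEQ_Suc[OF lim_1_over_n])
  have q_lim: "(\<lambda>n. q n x) \<longlonglongrightarrow> k x" if x: "x \<in> {0<..<l}" for x
  proof -
    have "(\<lambda>n. P n x) \<longlonglongrightarrow> k x"
    proof (rule LIM_zero_cancel, rule Lim_null_comparison[OF _ inv], rule always_eventually, rule allI)
      show "norm (P n x - k x) \<le> 1 / real (Suc n)" for n
        using P(2)[of x n] x by (simp add: abs_minus_commute)
    qed
    moreover have "(\<lambda>n. b x ^ n) \<longlonglongrightarrow> 0" using b01[of x] b1[OF x] by (intro LIMSEQ_realpow_zero)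
    ultimately have "(\<lambda>n. P n x * (1 + (-1) * b x ^ n)) \<longlonglongrightarrow> k x * (1 + (-1) * 0)"
      by (intro tendsto_mult tendsto_add tendsto_const)
    then show ?thesis by (simp add: q_def)
  qed
  obtain B where B: "0 \<le> B" "\<And>x. 0 \<le> x \<Longrightarrow> x \<le> l \<Longrightarrow> \<bar>k x\<bar> \<le> B" using continuous_bounded_Icc[OF kc] by blast
  have q_bound: "\<bar>q n x\<bar> \<le> B + 1" if x: "x \<in> {0<..<l}" for n x
  proof -
    have xx: "x \<in> {0..l}" "0 \<le> x" "x \<le> l" using x by auto
    have "1 / real (Suc n) \<le> 1" by simp
    then have "\<bar>P n x\<bar> \<le> B + 1" using P(2)[OF xx(1), of n] B(2)[OF xx(2,3)] by linarith
    moreover have "0 \<le> b x ^ n" "b x ^ n \<le> 1" using b01[of x] b1[OF x] by (auto intro: power_le_one)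
    then have "\<bar>1 + (-1) * b x ^ n\<bar> \<le> 1" by simp
    ultimately have "\<bar>P n x\<bar> * \<bar>1 + (-1) * b x ^ n\<bar> \<le> (B + 1) * 1" using B(1) by (intro mult_mono) auto
    then show ?thesis by (simp add: q_def abs_mult)
  qed
  define M where "M = \<bar>\<gamma> (B + 1)\<bar> + \<bar>\<gamma> (- (B + 1))\<bar>"
  have \<gamma>qc: "continuous_on {0..l} (\<lambda>x. \<gamma> (q n x))" for n
    by (rule continuous_on_compose2[OF \<gamma>(1) qc]) simp
  have "(\<lambda>n. LINT x|seg l. \<bar>h x - \<gamma> (q n x)\<bar>) \<longlonglongrightarrow> (LINT x|seg l. 0)"
  proof (rule integral_dominated_convergence[where w = "\<lambda>x. \<bar>h x\<bar> + M"])
    show "(\<lambda>x. \<bar>h x - \<gamma> (q n x)\<bar>) \<in> borel_measurable (seg l)" for n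
      by (intro seg_measurable_continuous continuous_intros hc \<gamma>qc)
    show "integrable (seg l) (\<lambda>x. \<bar>h x\<bar> + M)" by (intro seg_integrable_continuous continuous_intros hc)
    show "AE x in seg l. (\<lambda>n. \<bar>h x - \<gamma> (q n x)\<bar>) \<longlonglongrightarrow> 0"
    proof (rule AE_I2)
      fix x assume "x \<in> space (seg l)"
      then have "(\<lambda>n. \<gamma> (q n x)) \<longlonglongrightarrow> \<gamma> (k x)"
        using \<gamma>(1) q_lim[of x] by (intro isCont_tendsto_compose[of _ \<gamma>]) (auto simp: continuous_on_eq_continuous_at)
      then have "(\<lambda>n. \<bar>h x - \<gamma> (q n x)\<bar>) \<longlonglongrightarrow> \<bar>h x - h x\<bar>" unfolding \<gamma>k by (intro tendsto_intros)
      then show "(\<lambda>n. \<bar>h x - \<gamma> (q n x)\<bar>) \<longlonglongrightarrow> 0" by simp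
    qed
    show "AE x in seg l. norm \<bar>h x - \<gamma> (q n x)\<bar> \<le> \<bar>h x\<bar> + M" for n
    proof (rule AE_I2)
      fix x assume "x \<in> space (seg l)"
      then have "\<bar>q n x\<bar> \<le> B + 1" by (intro q_bound) simp
      then have "\<gamma> (q n x) \<le> \<gamma> (B + 1)" "\<gamma> (- (B + 1)) \<le> \<gamma> (q n x)"
        using strict_mono_less_eq[OF \<gamma>(2)] by auto
      then have "\<bar>\<gamma> (q n x)\<bar> \<le> M" unfolding M_def by linarith
      then show "norm \<bar>h x - \<gamma> (q n x)\<bar> \<le> \<bar>h x\<bar> + M" by simp
    qed
  qed simp
  then have "(\<lambda>n. LINT x|seg l. \<bar>h x - \<gamma> (q n x)\<bar>) \<longlonglongrightarrow> 0" by simp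
  then obtain n where n: "(LINT x|seg l. \<bar>h x - \<gamma> (q n x)\<bar>) < e / 2"
    using order_tendstoD(2)[of _ 0 sequentially "e / 2"] e by (auto simp: eventually_sequentially)
  note i = f seg_integrable_continuous[OF hc] seg_integrable_continuous[OF \<gamma>qc[of n]]
  have "(LINT x|seg l. \<bar>f x - \<gamma> (q n x)\<bar>) \<le> (LINT x|seg l. \<bar>f x - h x\<bar> + \<bar>h x - \<gamma> (q n x)\<bar>)"
    using i by (intro Bochner_Integration.integral_mono) auto
  also have "\<dots> = (LINT x|seg l. \<bar>f x - h x\<bar>) + (LINT x|seg l. \<bar>h x - \<gamma> (q n x)\<bar>)" using i by simp
  also have "\<dots> < e" using h(2) n by simp
  finally show ?thesis using q_poly q0 by blast
qed

context graph_problem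
begin

text \<open>Testing the resolvent equation for the datum \<open>\<gamma> w\<close> with
  \<open>u - w\<close> bounds the integrated product of \<open>\<gamma> u - \<gamma> w\<close> and
  \<open>u - w\<close> by \<open>r P\<close>, where \<open>P\<close> is the p-energy of
  \<open>w\<close> and independent of \<open>r\<close>. This product controls the \<open>L^1\<close>
  distance of \<open>\<gamma> u\<close> and \<open>\<gamma> w\<close> up to the error
  \<eta>.\<close>

lemma resolvent_approximation:
  assumes w: "w \<in> \<W>" "\<And>v. vv w v = 0" and e: "0 < \<epsilon>"
  shows "\<exists>W\<in>Domain (graph_operator G p \<gamma>). norm (W - state_of_dens (\<lambda>e x. \<gamma> e (w e x))) < \<epsilon>"
proof -
  define X where "X = state_of_dens (\<lambda>e x. \<gamma> e (w e x))"
  have int: "integrable (seg_of e) (\<lambda>x. \<gamma> e (u e x))" if "u \<in> \<W>" "e \<in> E" for u e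
    by (rule seg_integrable_continuous[OF \<gamma>_comp_continuous[OF that]])
  have XS: "X \<in> state_space G" and X0: "l1_snd X = 0"
    unfolding X_def by (rule state_of_dens(1,2)[OF int[OF w(1)]]; assumption)+
  have Xd: "AE x in seg_of e. edge_dens X e x = \<gamma> e (w e x)" if "e \<in> E" for e
    unfolding X_def by (rule state_of_dens(3)[OF int[OF w(1)] that])
  \<comment> \<open>Half of \<epsilon> is spread over the edges in proportion to their lengths; the
    added 1 keeps the denominator positive also without edges.\<close>
  define \<eta> where "\<eta> = \<epsilon> / (2 * ((\<Sum>e\<in>E. len G e) + 1))"
  have L: "0 \<le> (\<Sum>e\<in>E. len G e)" using len_pos by (intro sum_nonneg) (simp add: less_imp_le)
  have \<eta>: "0 < \<eta>" "\<eta> * (\<Sum>e\<in>E. len G e) < \<epsilon> / 2"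
    using e L by (auto simp: \<eta>_def field_simps)
  have "\<exists>k\<ge>0. \<forall>a x. x \<in> {0..len G e} \<longrightarrow> \<bar>\<gamma> e a - \<gamma> e (w e x)\<bar> \<le> \<eta> + k * ((\<gamma> e a - \<gamma> e (w e x)) * (a - w e x))"
    if e: "e \<in> E" for e
  proof -
    obtain M where M: "0 \<le> M" "\<And>x. 0 \<le> x \<Longrightarrow> x \<le> len G e \<Longrightarrow> \<bar>w e x\<bar> \<le> M"
      using continuous_bounded_Icc[OF graph_continuous[OF w(1) e]] by blast
    have "continuous_on UNIV (\<gamma> e)" "mono (\<gamma> e)" using \<gamma>[OF e] by (auto intro: strict_mono_mono)
    from abs_diff_le_monotone_gap[OF this \<eta>(1), of M] obtain k where
      k: "0 \<le> k" "\<And>a b. \<bar>b\<bar> \<le> M \<Longrightarrow> \<bar>\<gamma> e a - \<gamma> e b\<bar> \<le> \<eta> + k * ((\<gamma> e a - \<gamma> e b) * (a - b))" by blast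
    have "\<bar>\<gamma> e a - \<gamma> e (w e x)\<bar> \<le> \<eta> + k * ((\<gamma> e a - \<gamma> e (w e x)) * (a - w e x))" if "x \<in> {0..len G e}" for a x
      using that by (intro k(2) M(2)) auto
    then show ?thesis using k(1) by blast
  qed
  then have "\<forall>e\<in>E. \<exists>k\<ge>0. \<forall>a x. x \<in> {0..len G e} \<longrightarrow> \<bar>\<gamma> e a - \<gamma> e (w e x)\<bar> \<le> \<eta> + k * ((\<gamma> e a - \<gamma> e (w e x)) * (a - w e x))" by blast
  from bchoice[OF this] obtain k where k0: "\<And>e. e \<in> E \<Longrightarrow> 0 \<le> k e" and
    k: "\<And>e a x. e \<in> E \<Longrightarrow> x \<in> {0..len G e} \<Longrightarrow> \<bar>\<gamma> e a - \<gamma> e (w e x)\<bar> \<le> \<eta> + k e * ((\<gamma> e a - \<gamma> e (w e x)) * (a - w e x))"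
    by blast
  define k' where "k' = (\<Sum>e\<in>E. k e)"
  have k': "k e \<le> k'" if "e \<in> E" for e unfolding k'_def by (rule member_le_sum[OF that]) (use k0 in auto)
  have k'0: "0 \<le> k'" unfolding k'_def by (intro sum_nonneg k0)
  define P where "P = (\<Sum>e\<in>E. LINT x|seg_of e. p_energy (p e) (wd w e x))"
  have P0: "0 \<le> P" unfolding P_def
    using p_energy_nonneg[OF p_gt_1] by (intro sum_nonneg Bochner_Integration.integral_nonneg) auto
  \<comment> \<open>Chosen last, so that the other half of \<epsilon> covers \<open>k' r P\<close>;
    the constants \<open>k'\<close> and \<open>P\<close> depend only on \<open>w\<close>, \<gamma>,
    \<open>p\<close> and \<eta>.\<close>
  define r where "r = \<epsilon> / (2 * (k' * P + 1))"
  have kP: "0 \<le> k' * P" using k'0 P0 by simp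
  have r: "0 < r" "k' * (r * P) < \<epsilon> / 2" using e kP by (auto simp: r_def field_simps)
  obtain u where u: "u \<in> \<W>" "state_of_dens (\<lambda>e x. \<gamma> e (u e x)) \<in> Domain (graph_operator G p \<gamma>)"
    "\<And>\<phi>. \<phi> \<in> \<W> \<Longrightarrow> r * energy_form u \<phi> + (\<Sum>e\<in>E. LINT x|seg_of e. \<gamma> e (u e x) * \<phi> e x) = load X \<phi>"
    using resolvent_solution[OF XS r(1)] by blast
  define V where "V = state_of_dens (\<lambda>e x. \<gamma> e (u e x))"
  have VS: "V \<in> state_space G" and V0: "l1_snd V = 0"
    unfolding V_def by (rule state_of_dens(1,2)[OF int[OF u(1)]]; assumption)+
  have Vd: "AE x in seg_of e. edge_dens V e x = \<gamma> e (u e x)" if "e \<in> E" for e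
    unfolding V_def by (rule state_of_dens(3)[OF int[OF u(1)] that])
  define \<phi> where "\<phi> = (\<lambda>e x. 1 * u e x + (- 1) * w e x)"
  have \<phi>W: "\<phi> \<in> \<W>" unfolding \<phi>_def by (rule graph_lincomb(1)[OF u(1) w(1)])
  have \<phi>wd: "AE x in seg_of e. wd \<phi> e x = wd u e x - wd w e x" if "e \<in> E" for e
    using graph_lincomb(2)[OF u(1) w(1) that, where a = 1 and t = "- 1"] unfolding \<phi>_def by simp
  have \<phi>x: "\<phi> e x = u e x - w e x" for e x by (simp add: \<phi>_def)
  have gi: "integrable (seg_of e) (\<lambda>x. \<gamma> e (z e x) * \<phi> e x)" if "z \<in> \<W>" "e \<in> E" for z e
    by (rule seg_integrable_continuous[OF continuous_on_mult[OF \<gamma>_comp_continuous[OF that] graph_continuous[OF \<phi>W that(2)]]])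
  have load: "load X \<phi> = (\<Sum>e\<in>E. LINT x|seg_of e. \<gamma> e (w e x) * \<phi> e x)"
  proof -
    have "(LINT x|seg_of e. edge_dens X e x * \<phi> e x) = (LINT x|seg_of e. \<gamma> e (w e x) * \<phi> e x)" if e: "e \<in> E" for e
    proof (rule integral_cong_AE)
      show "(\<lambda>x. edge_dens X e x * \<phi> e x) \<in> borel_measurable (seg_of e)" using dens_mult_integrable[OF \<phi>W e] by auto
      show "(\<lambda>x. \<gamma> e (w e x) * \<phi> e x) \<in> borel_measurable (seg_of e)" using gi[OF w(1) e] by auto
      show "AE x in seg_of e. edge_dens X e x * \<phi> e x = \<gamma> e (w e x) * \<phi> e x" using Xd[OF e] by eventually_elim simp
    qed
    moreover have "vertex_mass X v = 0" for v using X0 by (simp add: vertex_mass_def zero_l1_family.rep_eq)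
    ultimately show ?thesis unfolding load_def by simp
  qed
  define g where "g e = (LINT x|seg_of e. (\<gamma> e (u e x) - \<gamma> e (w e x)) * (u e x - w e x))" for e
  have "(\<Sum>e\<in>E. g e) = - (r * energy_form u \<phi>)"
  proof -
    have "g e = (LINT x|seg_of e. \<gamma> e (u e x) * \<phi> e x) - (LINT x|seg_of e. \<gamma> e (w e x) * \<phi> e x)" if "e \<in> E" for e
      unfolding g_def \<phi>x[symmetric] left_diff_distrib using gi[OF u(1) that] gi[OF w(1) that] by simp
    then have "(\<Sum>e\<in>E. g e) = (\<Sum>e\<in>E. LINT x|seg_of e. \<gamma> e (u e x) * \<phi> e x) - load X \<phi>"
      unfolding load by (simp add: sum_subtractf)
    then show ?thesis using u(3)[OF \<phi>W] by linarith
  qed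
  also have "\<dots> \<le> r * P"
  proof -
    \<comment> \<open>The subgradient inequality at the derivative of \<open>u\<close> bounds the
      flux term below by the p-energy of \<open>u\<close> minus that of \<open>w\<close>, and the
      former is nonnegative.\<close>
    have "- P \<le> energy_form u \<phi>"
      unfolding P_def energy_form_def sum_negf[symmetric]
    proof (rule sum_mono)
      fix e assume e: "e \<in> E"
      have "(LINT x|seg_of e. - p_energy (p e) (wd w e x)) \<le> (LINT x|seg_of e. flux (p e) (wd u e x) * wd \<phi> e x)"
      proof (rule integral_mono_AE)
        show "AE x in seg_of e. - p_energy (p e) (wd w e x) \<le> flux (p e) (wd u e x) * wd \<phi> e x"
          using \<phi>wd[OF e]
        proof eventually_elim
          case (elim x)
          show ?case unfolding elim
            using tangentD[OF tangent_p_energy[OF p_gt_1[OF e]], of "wd u e x" "wd w e x"]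
              p_energy_nonneg[OF p_gt_1[OF e], of "wd u e x"] by linarith
        qed
      qed (use p_energy_wd_integrable[OF w(1) e] energy_integrable[OF u(1) \<phi>W e] in auto)
      then show "- (LINT x|seg_of e. p_energy (p e) (wd w e x)) \<le> (LINT x|seg_of e. flux (p e) (wd u e x) * wd \<phi> e x)" by simp
    qed
    then have "r * (- P) \<le> r * energy_form u \<phi>" using r(1) by (intro mult_left_mono) auto
    then show ?thesis by simp
  qed
  finally have g_sum: "(\<Sum>e\<in>E. g e) \<le> r * P" .
  have g0: "0 \<le> g e" if e: "e \<in> E" for e
    unfolding g_def
  proof (rule Bochner_Integration.integral_nonneg)
    have "mono (\<gamma> e)" using \<gamma>[OF e] by (auto intro: strict_mono_mono)
    then show "0 \<le> (\<gamma> e (u e x) - \<gamma> e (w e x)) * (u e x - w e x)" for x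
      using monoD[of "\<gamma> e" "u e x" "w e x"] monoD[of "\<gamma> e" "w e x" "u e x"]
      by (cases "u e x \<le> w e x") (auto intro: mult_nonpos_nonpos mult_nonneg_nonneg)
  qed
  have edge: "(LINT x|seg_of e. \<bar>edge_dens (V - X) e x\<bar>) \<le> \<eta> * len G e + k' * g e" if e: "e \<in> E" for e
  proof -
    have i: "integrable (seg_of e) (\<lambda>x. (\<gamma> e (u e x) - \<gamma> e (w e x)) * (u e x - w e x))"
      using gi[OF u(1) e] gi[OF w(1) e] unfolding \<phi>x[symmetric] left_diff_distrib by simp
    have "(LINT x|seg_of e. \<bar>edge_dens (V - X) e x\<bar>) \<le> (LINT x|seg_of e. \<eta> + k e * ((\<gamma> e (u e x) - \<gamma> e (w e x)) * (u e x - w e x)))"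
    proof (rule integral_mono_AE)
      show "AE x in seg_of e. \<bar>edge_dens (V - X) e x\<bar> \<le> \<eta> + k e * ((\<gamma> e (u e x) - \<gamma> e (w e x)) * (u e x - w e x))"
        using edge_dens_diff[of V X e "len G e"] Vd[OF e] Xd[OF e] AE_space
      proof eventually_elim
        case (elim x)
        then show ?case using k[OF e, of x "u e x"] by simp
      qed
    qed (use i in auto)
    also have "\<dots> = \<eta> * len G e + k e * g e"
      using i measure_seg[of "len G e"] len_pos[OF e] by (simp add: g_def)
    also have "k e * g e \<le> k' * g e" using k'[OF e] g0[OF e] by (intro mult_right_mono)
    finally show ?thesis by simp
  qed
  have DS: "V - X \<in> state_space G" using VS XS subspace_state_space by (intro subspace_diff)
  have "vertex_mass (V - X) v = 0" for v
    unfolding vertex_mass_simps using V0 X0 by (simp add: vertex_mass_def)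
  then have "norm (V - X) = (\<Sum>e\<in>E. LINT x|seg_of e. \<bar>edge_dens (V - X) e x\<bar>)"
    unfolding norm_state[OF DS] by simp
  also have "\<dots> \<le> (\<Sum>e\<in>E. \<eta> * len G e + k' * g e)" by (intro sum_mono edge)
  also have "\<dots> = \<eta> * (\<Sum>e\<in>E. len G e) + k' * (\<Sum>e\<in>E. g e)" by (simp add: sum.distrib sum_distrib_left)
  also have "k' * (\<Sum>e\<in>E. g e) \<le> k' * (r * P)" using g_sum k'0 by (intro mult_left_mono)
  finally have "norm (V - X) < \<epsilon>" using \<eta>(2) r(2) by linarith
  then show ?thesis using u(2) unfolding V_def X_def by blast
qed

text \<open>Approximants that vanish at both ends of every edge can be chosen edge by edge, because
  continuity at the vertices then holds automatically.\<close>

lemma domain_dense: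
  assumes X: "X \<in> state_space G" "l1_snd X = 0"
  shows "X \<in> closure (Domain (graph_operator G p \<gamma>))"
  unfolding closure_approachable
proof (intro allI impI)
  fix \<epsilon> :: real assume \<epsilon>: "0 < \<epsilon>"
  define \<delta> where "\<delta> = \<epsilon> / (2 * (real (card E) + 1))"
  have \<delta>: "0 < \<delta>" "real (card E) * \<delta> < \<epsilon> / 2"
    using \<epsilon> by (auto simp: \<delta>_def field_simps)
  have "\<forall>e\<in>E. \<exists>q. real_polynomial_function q \<and> q 0 = 0 \<and> q (len G e) = 0 \<and>
      (LINT x|seg_of e. \<bar>edge_dens X e x - \<gamma> e (q x)\<bar>) < \<delta>"
  proof
    fix e assume e: "e \<in> E"
    show "\<exists>q. real_polynomial_function q \<and> q 0 = 0 \<and> q (len G e) = 0 \<and>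
      (LINT x|seg_of e. \<bar>edge_dens X e x - \<gamma> e (q x)\<bar>) < \<delta>"
      by (rule monotone_image_polynomial_dense[OF _ _ _ edge_dens_integrable len_pos[OF e] \<delta>(1)])
        (use \<gamma>[OF e] in blast)+
  qed
  from bchoice[OF this] obtain q where q: "\<And>e. e \<in> E \<Longrightarrow> real_polynomial_function (q e)"
    "\<And>e. e \<in> E \<Longrightarrow> q e 0 = 0" "\<And>e. e \<in> E \<Longrightarrow> q e (len G e) = 0"
    "\<And>e. e \<in> E \<Longrightarrow> (LINT x|seg_of e. \<bar>edge_dens X e x - \<gamma> e (q e x)\<bar>) < \<delta>" by blast
  have "\<forall>e\<in>E. \<exists>q'. real_polynomial_function q' \<and> (\<forall>x. (q e has_real_derivative q' x) (at x))"
    using has_real_derivative_polynomial_function[OF q(1)] by blast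
  from bchoice[OF this] obtain q' where q': "\<And>e. e \<in> E \<Longrightarrow> real_polynomial_function (q' e)"
    "\<And>e x. e \<in> E \<Longrightarrow> (q e has_real_derivative q' e x) (at x)" by blast
  have rep: "sobolev_rep (p e) (len G e) (q e) (q' e)" if e: "e \<in> E" for e
  proof (rule sobolev_rep_C1)
    show "(q e has_real_derivative q' e x) (at x)" for x by (rule q'(2)[OF e])
    show "continuous_on UNIV (q' e)"
      using q'(1)[OF e] by (intro continuous_on_polymonial_function) (simp add: real_polynomial_function_eq)
  qed (use p_gt_1[OF e] in simp)
  have vertex: "has_vertex_value G q v 0" for v
    unfolding has_vertex_value_def using q(2,3) by blast
  have qW: "q \<in> \<W>" by (rule graphI(1)[OF rep]) (use vertex in auto)
  have qv: "vv q v = 0" for v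
    using vertex_value_eq[OF vertex, of v] unfolding vertex_value_def by presburger
  define Y where "Y = state_of_dens (\<lambda>e x. \<gamma> e (q e x))"
  have int: "integrable (seg_of e) (\<lambda>x. \<gamma> e (q e x))" if "e \<in> E" for e
    by (rule seg_integrable_continuous[OF \<gamma>_comp_continuous[OF qW that]])
  have YS: "Y \<in> state_space G" and Y0: "l1_snd Y = 0"
    unfolding Y_def by (rule state_of_dens(1,2)[OF int]; assumption)+
  have Yd: "AE x in seg_of e. edge_dens Y e x = \<gamma> e (q e x)" if "e \<in> E" for e
    unfolding Y_def by (rule state_of_dens(3)[OF int that])
  obtain W where W: "W \<in> Domain (graph_operator G p \<gamma>)" "norm (W - Y) < \<epsilon> / 2"
    using resolvent_approximation[OF qW qv, of "\<epsilon> / 2"] \<epsilon> unfolding Y_def by auto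
  have edge: "(LINT x|seg_of e. \<bar>edge_dens (Y - X) e x\<bar>) \<le> \<delta>" if e: "e \<in> E" for e
  proof -
    have "(LINT x|seg_of e. \<bar>edge_dens (Y - X) e x\<bar>) = (LINT x|seg_of e. \<bar>edge_dens X e x - \<gamma> e (q e x)\<bar>)"
    proof (rule integral_cong_AE)
      show "(\<lambda>x. \<bar>edge_dens (Y - X) e x\<bar>) \<in> borel_measurable (seg_of e)" by measurable
      show "(\<lambda>x. \<bar>edge_dens X e x - \<gamma> e (q e x)\<bar>) \<in> borel_measurable (seg_of e)" using int[OF e] by auto
      show "AE x in seg_of e. \<bar>edge_dens (Y - X) e x\<bar> = \<bar>edge_dens X e x - \<gamma> e (q e x)\<bar>"
        using edge_dens_diff[of Y X e "len G e"] Yd[OF e] by eventually_elim (simp add: abs_minus_commute)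
    qed
    then show ?thesis using q(4)[OF e] by simp
  qed
  have DS: "Y - X \<in> state_space G" using YS X(1) subspace_state_space by (intro subspace_diff)
  have "vertex_mass (Y - X) v = 0" for v
    unfolding vertex_mass_simps using Y0 X(2) by (simp add: vertex_mass_def)
  then have "norm (Y - X) = (\<Sum>e\<in>E. LINT x|seg_of e. \<bar>edge_dens (Y - X) e x\<bar>)"
    unfolding norm_state[OF DS] by simp
  also have "\<dots> \<le> (\<Sum>e\<in>E. \<delta>)" by (intro sum_mono edge)
  also have "\<dots> < \<epsilon> / 2" using \<delta>(2) by simp
  finally have "norm (Y - X) < \<epsilon> / 2" .
  then have "dist W X < \<epsilon>"
    using W(2) norm_triangle_ineq[of "W - Y" "Y - X"] by (simp add: dist_norm)
  then show "\<exists>y\<in>Domain (graph_operator G p \<gamma>). dist y X < \<epsilon>" using W(1) by blast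
qed

lemma graph_operator_subset: "graph_operator G p \<gamma> \<subseteq> state_space G \<times> state_space G"
  using graph_operator_iff by auto

end

section \<open>Well-posedness\<close>

lemma bounded_linear_l1_Pair_left: "bounded_linear (\<lambda>a :: 'a::real_normed_vector. l1_Pair a (0 :: 'b::real_normed_vector))"
  by (rule bounded_linear_intro[where K = 1])
    (transfer, auto simp: l1_Pair.rep_eq norm_l1_prod.rep_eq)+

lemma bounded_linear_l1_Pair_right: "bounded_linear (\<lambda>b :: 'b::real_normed_vector. l1_Pair (0 :: 'a::real_normed_vector) b)"
  by (rule bounded_linear_intro[where K = 1])
    (transfer, auto simp: l1_Pair.rep_eq norm_l1_prod.rep_eq)+

text \<open>The pair is the sum of the two coordinate embeddings, each bounded and linear for the
  added norms, so Bochner integrability passes to it.\<close>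

lemma set_integrable_l1_Pair:
  assumes "set_integrable M A f" "set_integrable M A g"
  shows "set_integrable M A (\<lambda>t. l1_Pair (f t) (g t))"
proof -
  have "integrable M (\<lambda>t. l1_Pair (indicator A t *\<^sub>R f t) 0 + l1_Pair 0 (indicator A t *\<^sub>R g t))"
    using assms unfolding set_integrable_def
    by (intro Bochner_Integration.integrable_add integrable_bounded_linear[OF bounded_linear_l1_Pair_left]
        integrable_bounded_linear[OF bounded_linear_l1_Pair_right])
  also have "(\<lambda>t. l1_Pair (indicator A t *\<^sub>R f t) 0 + l1_Pair 0 (indicator A t *\<^sub>R g t)) =
      (\<lambda>t. indicator A t *\<^sub>R l1_Pair (f t) (g t))"
    by (rule ext, transfer) simp
  finally show ?thesis by (simp add: set_integrable_def)
qed

theorem theorem3p21: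
  fixes G :: "'v::finite metric_graph"
    and p :: "'v \<times> 'v \<Rightarrow> real"
    and \<gamma> :: "'v \<times> 'v \<Rightarrow> real \<Rightarrow> real"
    and f :: "real \<Rightarrow> 'v edge_fun"
    and \<omega> :: "real \<Rightarrow> 'v vertex_fun"
    and v0 :: "'v edge_fun"
    and T :: real
  assumes "compact_metric_graph G" and "connected_graph G"
    and "\<And>e. e \<in> edges G \<Longrightarrow> 1 < p e"
    and "\<And>e. e \<in> edges G \<Longrightarrow>
      continuous_on UNIV (\<gamma> e) \<and> strict_mono (\<gamma> e) \<and> range (\<gamma> e) = UNIV \<and> \<gamma> e 0 = 0"
    and "L1_loc (L1_edges G) f" and "L1_loc UNIV \<omega>"
    and "v0 \<in> L1_edges G" and "0 < T"
  shows "(\<exists>W. mild_solution (state_space G) (graph_operator G p \<gamma>)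
            (\<lambda>t. l1_Pair (f t) (\<omega> t)) (l1_Pair v0 0) T W) \<and>
    (\<forall>W W'. mild_solution (state_space G) (graph_operator G p \<gamma>)
            (\<lambda>t. l1_Pair (f t) (\<omega> t)) (l1_Pair v0 0) T W \<longrightarrow>
        mild_solution (state_space G) (graph_operator G p \<gamma>)
            (\<lambda>t. l1_Pair (f t) (\<omega> t)) (l1_Pair v0 0) T W' \<longrightarrow>
        (\<forall>t\<in>{0..T}. W t = W' t))"
proof -
  interpret graph_problem G p \<gamma>
    by unfold_locales (use assms in auto)
  have W0: "l1_Pair v0 0 \<in> state_space G" using assms(7) by (simp add: state_space_def)
  have F: "L1_on T (state_space G) (\<lambda>t. l1_Pair (f t) (\<omega> t))"
    using assms(5,6,8) by (auto simp: L1_loc_def L1_on_def state_space_def intro: set_integrable_l1_Pair)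
  have "\<exists>W. mild_solution (state_space G) (graph_operator G p \<gamma>) (\<lambda>t. l1_Pair (f t) (\<omega> t)) (l1_Pair v0 0) T W"
    by (rule mild_solution_exists[OF subspace_state_space closed_state_space accretive_graph_operator
          graph_operator_subset range_condition F W0 domain_dense[OF W0] assms(8)]) auto
  then show ?thesis
    using mild_solution_unique[OF accretive_graph_operator assms(8)] by blast
qed

end
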